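(* Let $G=GL_n$ over $R$. 1) There exists an open set $G^{**}$ of $G$ and a lift of Frobenius $\phi_{G^{**}}$ on $\widehat{G^{**}}$ such that $G^{**}$ is invariant under conjugation by $N$, $G^{**}\cap T=T^*$, $\phi_{G^{**}}$ is $\mathcal P$-horizontal with respect to $\phi_{\mathbb A^n,0}$, and $\phi_{G^{**}}$ is a $T$-deformation of $\phi_{G,0}$. 2) For any $G^{**}$ as in 1), $\phi_{G^{**}}$ is the unique lift of Frobenius on $\widehat{G^{**}}$ that is $\mathcal P$-horizontal with respect to $\phi_{\mathbb A^n,0}$ and is a $T$-deformation of $\phi_{G,0}$, and $\phi_{G^{**}}$ is $\mathcal C$-compatible with $N$. 3) For any matrix $\alpha(x)$ with coefficients in $\mathcal O(G^{**})^\wedge$ the lift of Frobenius $\phi^{(\alpha)}_{G^{**}}$ on $\widehat{G^{**}}$ defined by $\phi^{(\alpha)}_{G^{**}}(x)=\epsilon(x)\cdot\phi_{G^{**}}(x)\cdot\epsilon(x)^{-1}$, $\epsilon(x):=1+p\alpha(x)$, is $\mathcal P$-horizontal with respect to $\phi_{\mathbb A^n,0}$. So if $\delta^{(\alpha)}_{G^{**}}$ is the $p$-derivation on $\mathcal O(G^{**})^\wedge$ attached to $\phi^{(\alpha)}_{G^{**}}$ then $\delta^{(\alpha)}_{G^{**}}\mathcal P_i=0$ for $i=1,\dots,n$.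
   Context: Fix an odd prime $p$. $R$ is the unique complete discrete valuation ring with maximal ideal $pR$ and residue field an algebraic closure of $\mathbb F_p$; $\phi:R\to R$ is the unique ring homomorphism lifting Frobenius. A hat denotes $p$-adic completion. A lift of Frobenius on $\widehat X$ ($X$ smooth of finite type over $R$) is a morphism of formal schemes $\widehat X\to\widehat X$ reducing mod $p$ to the $p$-power Frobenius and compatible with $\phi$ on $R$ (for $X$ affine, a ring endomorphism of $\mathcal O(X)^\wedge$). The $p$-derivation attached to $\phi_X$ is $f\mapsto(\phi_X(f)-f^p)/p$. $G=GL_n=\mathrm{Spec}\,R[x,\det(x)^{-1}]$, $x^{(p)}=(x_{ij}^p)$, $\phi_{G,0}(x)=x^{(p)}$. $T$ is the diagonal torus, $N$ its normalizer in $G$; $\phi_{N,0}$ is the lift of Frobenius on $\widehat N$ induced by $\phi_{G,0}$. Write $\det(s\cdot1_n-x)=\sum_{i=0}^n(-1)^i\mathcal P_i(x)s^{n-i}$; $T^*\subset T$ is the open subset where the discriminant of this polynomial is invertible (diagonal matrices with entries distinct mod $p$). $\mathcal P:G\to\mathbb A^n=\mathrm{Spec}\,R[z_1,\dots,z_n]$ is $\mathcal P(a)=(\mathcal P_1(a),\dots,\mathcal P_n(a))$, and $\phi_{\mathbb A^n,0}(z_i)=z_i^p$. For $G^{**}\subset G$ open: $\phi_{G^{**}}$ is $\mathcal P$-horizontal with respect to $\phi_{\mathbb A^n,0}$ if $\mathcal P\circ\phi_{G^{**}}=\phi_{\mathbb A^n,0}\circ\mathcal P$ on $\widehat{G^{**}}$;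 $\phi_{G^{**}}$ is a $T$-deformation of $\phi_{G,0}$ if $\mathcal Q\circ(\phi_{G^{**},0}\times\phi_{G^{**}}):\widehat{G^{**}}\to\widehat G$ factors through $\widehat T$, where $\mathcal Q(x,y)=x^{-1}y$, $\phi_{G^{**},0}$ is the restriction of $\phi_{G,0}$ and $f_1\times f_2$ has components $f_1,f_2$. If $G^{**}$ is invariant under conjugation by $N$, with $\mathcal C(a,b)=b^{-1}ab$, $\phi_{G^{**}}$ is $\mathcal C$-compatible with $N$ if $\mathcal C\circ(\phi_{G^{**}}\times\phi_{N,0})=\phi_{G^{**}}\circ\mathcal C$ on $\widehat{G^{**}}\times\widehat N$. *)

theory Defs
  imports
    "HOL-Analysis.Determinants"
    "HOL-Algebra.Algebraic_Closure_Type"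
    "HOL-Library.Poly_Mapping"
    "Subresultants.Resultant_Prelim"
begin

section \<open>The base ring\<close>

abbreviation typ_ring :: "'a::comm_ring_1 ring" where
  "typ_ring \<equiv> ring_of_type_algebra"

text \<open>
  The ring of the type \<open>'r\<close> is a complete discrete valuation ring with maximal ideal \<open>p R\<close>
  whose residue field is an algebraic closure of (the image of) the prime field.  A discrete
  valuation ring is a principal ideal domain with exactly one maximal ideal that is not a field.
\<close>

definition complete_dvr_Fp_closure :: "'r::idom itself \<Rightarrow> nat \<Rightarrow> bool" where
  "complete_dvr_Fp_closure _ p \<longleftrightarrow>
     (let R = (typ_ring :: 'r ring); M = PIdl\<^bsub>R\<^esub> (of_nat p) in
        principal_domain R \<and> \<not> Ring.field R
        \<and> {I. maximalideal I R} = {M}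
        \<and> (\<forall>f :: nat \<Rightarrow> 'r. (\<forall>m. of_nat p ^ m dvd f (Suc m) - f m)
              \<longrightarrow> (\<exists>l. \<forall>m. of_nat p ^ m dvd l - f m))
        \<and> algebraic_closure (R Quot M) (range (\<lambda>k. M +>\<^bsub>R\<^esub> of_nat k)))"

definition frobenius_lift_base :: "nat \<Rightarrow> ('r::idom \<Rightarrow> 'r) \<Rightarrow> bool" where
  "frobenius_lift_base p \<phi> \<longleftrightarrow>
     \<phi> \<in> Ring.ring_hom typ_ring typ_ring \<and> (\<forall>a. of_nat p dvd \<phi> a - a ^ p)"

section \<open>Polynomial rings in arbitrary sets of variables\<close>

type_synonym ('v, 'r) mpoly = "('v \<Rightarrow>\<^sub>0 nat) \<Rightarrow>\<^sub>0 'r"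

definition Const :: "'r::comm_ring_1 \<Rightarrow> ('v, 'r) mpoly" where
  "Const c = Poly_Mapping.single 0 c"

definition Var :: "'v \<Rightarrow> ('v, 'r::comm_ring_1) mpoly" where
  "Var v = Poly_Mapping.single (Poly_Mapping.single v 1) 1"

definition subst :: "('v \<Rightarrow> ('w, 'r) mpoly) \<Rightarrow> ('v, 'r::comm_ring_1) mpoly \<Rightarrow> ('w, 'r) mpoly" where
  "subst h f = (\<Sum>m \<in> Poly_Mapping.keys f. Const (Poly_Mapping.lookup f m) *
       (\<Prod>v \<in> Poly_Mapping.keys m. h v ^ Poly_Mapping.lookup m v))"

section \<open>Affine schemes and their formal completions\<close>

text \<open>
  All schemes below are locally closed in some \<open>Spec A\<close>, with \<open>A\<close> the ring of a type: a set of
  primes together with an ideal \<open>I\<close> contained in all of them.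
\<close>

definition Spec :: "'a::comm_ring_1 set set" where
  "Spec = {P. primeideal P typ_ring}"

definition zariski_open :: "'a::comm_ring_1 set set \<Rightarrow> bool" where
  "zariski_open V \<longleftrightarrow> (\<exists>S. V = {P \<in> Spec. \<not> S \<subseteq> P})"

definition opens :: "'a::comm_ring_1 set set \<Rightarrow> 'a set set set" where
  "opens Z = {V \<inter> Z | V. zariski_open V}"

text \<open>The fraction \<open>a/s\<close> in the localization of \<open>A/I\<close> at \<open>P\<close>, where \<open>I \<subseteq> P\<close> and \<open>s \<notin> P\<close>, as an
  equivalence class of pairs (numerator, denominator).\<close>

definition frac :: "'a::comm_ring_1 set \<Rightarrow> 'a set \<Rightarrow> 'a \<Rightarrow> 'a \<Rightarrow> ('a \<times> 'a) set" where
  "frac I P a s = {(b, t). t \<notin> P \<and> (\<exists>u. u \<notin> P \<and> u * (a * t - b * s) \<in> I)}"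

definition stalk :: "'a::comm_ring_1 set \<Rightarrow> 'a set \<Rightarrow> ('a \<times> 'a) set ring" where
  "stalk I P =
     \<lparr> carrier = {frac I P a s | a s. s \<notin> P},
       mult = (\<lambda>\<sigma> \<tau>. \<Union>(a, s) \<in> \<sigma>. \<Union>(b, t) \<in> \<tau>. frac I P (a * b) (s * t)),
       one = frac I P 1 1,
       zero = frac I P 0 1,
       add = (\<lambda>\<sigma> \<tau>. \<Union>(a, s) \<in> \<sigma>. \<Union>(b, t) \<in> \<tau>. frac I P (a * t + b * s) (s * t)) \<rparr>"

text \<open>The ideal of the infinitesimal neighbourhood \<open>X\<^sub>m = Spec (A/(I + p\<^sup>m\<^sup>+\<^sup>1 A))\<close>; in particular
  level \<open>0\<close> is reduction mod \<open>p\<close>.\<close>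

definition thick :: "nat \<Rightarrow> 'a::comm_ring_1 set \<Rightarrow> nat \<Rightarrow> 'a set" where
  "thick p I m = genideal typ_ring (insert (of_nat p ^ Suc m) I)"

text \<open>The topological space of the \<open>p\<close>-adic completion of a scheme is its special fibre.\<close>

definition special_fibre :: "nat \<Rightarrow> 'a::comm_ring_1 set set \<Rightarrow> 'a set set" where
  "special_fibre p Z = {P \<in> Z. of_nat p \<in> P}"

text \<open>
  The ring of sections over \<open>W\<close> of the structure sheaf of the formal completion, that is, of the
  inverse limit over \<open>m\<close> of the structure sheaves of the schemes \<open>X\<^sub>m\<close> given by the
  ideals \<open>J m\<close>.  The \<open>m\<close>-th component of a section is a family of germs that is locally a
  fraction.  A class of fractions mod \<open>J (Suc m)\<close> maps to the class mod \<open>J m\<close> that contains it, so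
  compatibility of the components is an inclusion.  For affine \<open>X\<close> and \<open>W\<close> its whole special fibre
  this is the \<open>p\<close>-adic completion of the coordinate ring of \<open>X\<close>.
\<close>

type_synonym 'a sect = "nat \<Rightarrow> 'a set \<Rightarrow> ('a \<times> 'a) set"

definition sections :: "(nat \<Rightarrow> 'a::comm_ring_1 set) \<Rightarrow> 'a set set \<Rightarrow> 'a sect ring" where
  "sections J W =
     \<lparr> carrier = {\<sigma>. (\<forall>m P. P \<notin> W \<longrightarrow> \<sigma> m P = {})
          \<and> (\<forall>m. \<forall>P\<in>W. \<sigma> (Suc m) P \<subseteq> \<sigma> m P)
          \<and> (\<forall>m. \<forall>P\<in>W. \<exists>V a s. zariski_open V \<and> P \<in> V
                 \<and> (\<forall>Q \<in> V \<inter> W. s \<notin> Q \<and> \<sigma> m Q = frac (J m) Q a s))},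
       mult = (\<lambda>\<sigma> \<tau> m P. if P \<in> W then \<sigma> m P \<otimes>\<^bsub>stalk (J m) P\<^esub> \<tau> m P else {}),
       one = (\<lambda>m P. if P \<in> W then \<one>\<^bsub>stalk (J m) P\<^esub> else {}),
       zero = (\<lambda>m P. if P \<in> W then \<zero>\<^bsub>stalk (J m) P\<^esub> else {}),
       add = (\<lambda>\<sigma> \<tau> m P. if P \<in> W then \<sigma> m P \<oplus>\<^bsub>stalk (J m) P\<^esub> \<tau> m P else {}) \<rparr>"

definition restrict_sect :: "'a set set \<Rightarrow> 'a sect \<Rightarrow> 'a sect" where
  "restrict_sect W \<sigma> = (\<lambda>m P. if P \<in> W then \<sigma> m P else {})"

definition sect_of :: "(nat \<Rightarrow> 'a::comm_ring_1 set) \<Rightarrow> 'a set set \<Rightarrow> 'a \<Rightarrow> 'a sect" where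
  "sect_of J W a = (\<lambda>m P. if P \<in> W then frac (J m) P a 1 else {})"

text \<open>Pullback to \<open>Y\<close> of a section along the morphism of spectra given by a ring homomorphism
  \<open>h\<close>, on germs \<open>a/s \<mapsto> h a / h s\<close>; the points of \<open>Y\<close> are to be mapped to the domain of the section.\<close>

definition pullback ::
    "('a::comm_ring_1 \<Rightarrow> 'b::comm_ring_1) \<Rightarrow> (nat \<Rightarrow> 'b set) \<Rightarrow> 'b set set \<Rightarrow> 'a sect \<Rightarrow> 'b sect" where
  "pullback h J Y \<sigma> =
     (\<lambda>m Q. if Q \<in> Y then \<Union>(a, s) \<in> \<sigma> m (h -` Q). frac (J m) Q (h a) (h s) else {})"

section \<open>Lifts of Frobenius\<close>

text \<open>
  The Frobenius of the special fibre is the identity on points, so a morphism of formal schemes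
  from the completion to itself that reduces to it is an endomorphism of the structure sheaf on
  the topological space \<open>Z\<close>; its locality on stalks follows from the congruence with the \<open>p\<close>-th power.
\<close>

definition frobenius_lift ::
    "nat \<Rightarrow> ('r::comm_ring_1 \<Rightarrow> 'r) \<Rightarrow> (nat \<Rightarrow> ('v, 'r) mpoly set) \<Rightarrow> ('v, 'r) mpoly set set
      \<Rightarrow> (('v, 'r) mpoly set set \<Rightarrow> ('v, 'r) mpoly sect \<Rightarrow> ('v, 'r) mpoly sect) \<Rightarrow> bool" where
  "frobenius_lift p \<phi> J Z \<Phi> \<longleftrightarrow>
     (\<forall>W \<in> opens Z. \<Phi> W \<in> Ring.ring_hom (sections J W) (sections J W))
     \<and> (\<forall>W \<in> opens Z. \<forall>W' \<in> opens Z. W' \<subseteq> W \<longrightarrow> (\<forall>\<sigma> \<in> carrier (sections J W).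
           restrict_sect W' (\<Phi> W \<sigma>) = \<Phi> W' (restrict_sect W' \<sigma>)))
     \<and> (\<forall>W \<in> opens Z. \<forall>\<sigma> \<in> carrier (sections J W). \<forall>P \<in> W.
           \<Phi> W \<sigma> 0 P = \<sigma> 0 P [^]\<^bsub>stalk (J 0) P\<^esub> p)
     \<and> (\<forall>W \<in> opens Z. \<forall>c. \<Phi> W (sect_of J W (Const c)) = sect_of J W (Const (\<phi> c)))"

text \<open>Equality of two morphisms given by families as above: values outside the carriers of the
  rings of sections are irrelevant.\<close>

definition same_morphism ::
    "(nat \<Rightarrow> 'a::comm_ring_1 set) \<Rightarrow> 'a set set
      \<Rightarrow> ('a set set \<Rightarrow> 'a sect \<Rightarrow> 'a sect) \<Rightarrow> ('a set set \<Rightarrow> 'a sect \<Rightarrow> 'a sect) \<Rightarrow> bool" where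
  "same_morphism J Z \<Phi> \<Psi> \<longleftrightarrow> (\<forall>W \<in> opens Z. \<forall>\<sigma> \<in> carrier (sections J W). \<Phi> W \<sigma> = \<Psi> W \<sigma>)"

definition p_derivation :: "'s ring \<Rightarrow> nat \<Rightarrow> ('s \<Rightarrow> 's) \<Rightarrow> 's \<Rightarrow> 's" where
  "p_derivation S p \<psi> f =
     (THE g. g \<in> carrier S \<and> [p] \<cdot>\<^bsub>S\<^esub> g = \<psi> f \<ominus>\<^bsub>S\<^esub> (f [^]\<^bsub>S\<^esub> p))"

section \<open>Matrices over a ring given by a carrier\<close>

type_synonym ('n, 's) fmat = "'n \<Rightarrow> 'n \<Rightarrow> 's"

definition mat_carrier :: "'s ring \<Rightarrow> ('n, 's) fmat set" where
  "mat_carrier S = {A. \<forall>i j. A i j \<in> carrier S}"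

definition mat_one :: "'s ring \<Rightarrow> ('n, 's) fmat" where
  "mat_one S = (\<lambda>i j. if i = j then \<one>\<^bsub>S\<^esub> else \<zero>\<^bsub>S\<^esub>)"

definition mat_mult :: "'s ring \<Rightarrow> ('n::finite, 's) fmat \<Rightarrow> ('n, 's) fmat \<Rightarrow> ('n, 's) fmat" where
  "mat_mult S A B = (\<lambda>i k. finsum S (\<lambda>j. A i j \<otimes>\<^bsub>S\<^esub> B j k) UNIV)"

definition mat_inverse :: "'s ring \<Rightarrow> ('n::finite, 's) fmat \<Rightarrow> ('n, 's) fmat" where
  "mat_inverse S A =
     (THE B. B \<in> mat_carrier S \<and> mat_mult S A B = mat_one S \<and> mat_mult S B A = mat_one S)"

section \<open>The general linear group\<close>

text \<open>\<open>GL\<^sub>n\<close>, \<open>n = CARD('n)\<close>, is the principal open subscheme of \<open>Spec R[x]\<close> where \<open>det x\<close> is invertible.\<close>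

type_synonym ('n, 'r) GL_fun = "('n \<times> 'n, 'r) mpoly"

definition det_fun :: "('n::finite, 'r::comm_ring_1) GL_fun" where
  "det_fun = Determinants.det (\<chi> i j. Var (i, j))"

definition char_pol :: "('n::finite, 'r::comm_ring_1) GL_fun poly" where
  "char_pol = Determinants.det (\<chi> i j. (if i = j then [:0, 1:] else 0) - [:Var (i, j):])"

definition P_fun :: "nat \<Rightarrow> ('n::finite, 'r::comm_ring_1) GL_fun" where
  "P_fun i = (-1) ^ i * Polynomial.coeff char_pol (CARD('n) - i)"

definition formal_deriv :: "'a::comm_ring_1 poly \<Rightarrow> 'a poly" where
  "formal_deriv f = (\<Sum>k \<le> Polynomial.degree f.
      Polynomial.monom (of_nat k * Polynomial.coeff f k) (k - 1))"

definition discriminant :: "'a::comm_ring_1 poly \<Rightarrow> 'a" \<comment> \<open>for monic polynomials\<close> where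
  "discriminant f =
     (-1) ^ (Polynomial.degree f * (Polynomial.degree f - 1) div 2) * resultant f (formal_deriv f)"

definition GL :: "('n::finite, 'r::comm_ring_1) GL_fun set set" where
  "GL = {P \<in> Spec. det_fun \<notin> P}"

definition torus :: "('n::finite, 'r::comm_ring_1) GL_fun set set" where
  "torus = {P \<in> GL. \<forall>i j. i \<noteq> j \<longrightarrow> Var (i, j) \<in> P}"

definition torus_star :: "('n::finite, 'r::comm_ring_1) GL_fun set set" where
  "torus_star = {P \<in> torus. discriminant char_pol \<notin> P}"

subsection \<open>The normalizer of the torus and conjugation\<close>

text \<open>
  Coordinates on \<open>GL\<^sub>n \<times> GL\<^sub>n\<close>: \<open>XV\<close> for \<open>x\<close> in the first factor, \<open>BV\<close> for \<open>b\<close> in the second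
  factor, \<open>CV\<close> for \<open>c = b\<inverse>\<close>; so \<open>R[b, det(b)\<inverse>]\<close> is \<open>R[b, c]\<close> modulo \<open>b c = c b = 1\<close>.
\<close>

datatype 'n conj_var = XV 'n 'n | BV 'n 'n | CV 'n 'n

type_synonym ('n, 'r) conj_fun = "('n conj_var, 'r) mpoly"

text \<open>
  The normalizer \<open>N\<close> is the closed subscheme of those \<open>b\<close> with \<open>b T b\<inverse> \<subseteq> T\<close> and
  \<open>b\<inverse> T b \<subseteq> T\<close>.  The entries of \<open>b diag(t) b\<inverse>\<close> are \<open>\<Sum>\<^sub>j b\<^sub>i\<^sub>j t\<^sub>j c\<^sub>j\<^sub>k\<close>, so the off-diagonal ones
  vanish for the universal \<open>t\<close> iff all \<open>b\<^sub>i\<^sub>j c\<^sub>j\<^sub>k\<close> with \<open>i \<noteq> k\<close> do, and likewise for \<open>b\<inverse> diag(t) b\<close>.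
\<close>

definition normalizer_ideal :: "('n::finite, 'r::comm_ring_1) conj_fun set" where
  "normalizer_ideal = genideal typ_ring
     ({(\<Sum>j\<in>UNIV. Var (BV i j) * Var (CV j k)) - (if i = k then 1 else 0) | i k. True}
      \<union> {(\<Sum>j\<in>UNIV. Var (CV i j) * Var (BV j k)) - (if i = k then 1 else 0) | i k. True}
      \<union> {Var (BV i j) * Var (CV j k) | i j k. i \<noteq> k}
      \<union> {Var (CV i j) * Var (BV j k) | i j k. i \<noteq> k})"

definition proj_G :: "('n::finite, 'r::comm_ring_1) GL_fun \<Rightarrow> ('n, 'r) conj_fun" where
  "proj_G = subst (\<lambda>(i, j). Var (XV i j))"

definition conj_map :: "('n::finite, 'r::comm_ring_1) GL_fun \<Rightarrow> ('n, 'r) conj_fun" where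
  "conj_map = subst (\<lambda>(i, j). \<Sum>k\<in>UNIV. \<Sum>l\<in>UNIV. Var (CV i k) * Var (XV k l) * Var (BV l j))"

text \<open>The points of \<open>U \<times> N\<close>.\<close>

definition times_N :: "('n::finite, 'r::comm_ring_1) GL_fun set set \<Rightarrow> ('n, 'r) conj_fun set set" where
  "times_N U = {Q \<in> Spec. normalizer_ideal \<subseteq> Q \<and> proj_G -` Q \<in> U}"

definition N_invariant :: "('n::finite, 'r::comm_ring_1) GL_fun set set \<Rightarrow> bool" where
  "N_invariant U \<longleftrightarrow> (\<forall>Q \<in> times_N U. conj_map -` Q \<in> U)"

subsection \<open>Lifts of Frobenius on completed open subschemes\<close>

text \<open>
  A morphism to the completion of an affine space, or of an open subscheme of it, is given by the
  images of the coordinate functions in the ring of global sections (and by its effect on \<open>R\<close>,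
  which is the same on both sides of all equations of morphisms below).
\<close>

abbreviation JG :: "nat \<Rightarrow> nat \<Rightarrow> ('n::finite, 'r::comm_ring_1) GL_fun set" where
  "JG p \<equiv> thick p {0}"

abbreviation O_hat :: "nat \<Rightarrow> ('n::finite, 'r::comm_ring_1) GL_fun set set
    \<Rightarrow> ('n, 'r) GL_fun sect ring" where
  "O_hat p U \<equiv> sections (JG p) (special_fibre p U)"

abbreviation glob :: "nat \<Rightarrow> ('n::finite, 'r::comm_ring_1) GL_fun set set
    \<Rightarrow> ('n, 'r) GL_fun \<Rightarrow> ('n, 'r) GL_fun sect" where
  "glob p U \<equiv> sect_of (JG p) (special_fibre p U)"

type_synonym ('n, 'r) G_mor =
  "('n, 'r) GL_fun set set \<Rightarrow> ('n, 'r) GL_fun sect \<Rightarrow> ('n, 'r) GL_fun sect"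

abbreviation G_frobenius_lift ::
    "nat \<Rightarrow> ('r::comm_ring_1 \<Rightarrow> 'r) \<Rightarrow> ('n::finite, 'r) GL_fun set set \<Rightarrow> ('n, 'r) G_mor \<Rightarrow> bool" where
  "G_frobenius_lift p \<phi> U \<equiv> frobenius_lift p \<phi> (JG p) (special_fibre p U)"

abbreviation G_same ::
    "nat \<Rightarrow> ('n::finite, 'r::comm_ring_1) GL_fun set set \<Rightarrow> ('n, 'r) G_mor \<Rightarrow> ('n, 'r) G_mor \<Rightarrow> bool" where
  "G_same p U \<equiv> same_morphism (JG p) (special_fibre p U)"

text \<open>The matrix \<open>\<phi>(x)\<close>.\<close>

definition at_x :: "nat \<Rightarrow> ('n::finite, 'r::comm_ring_1) GL_fun set set \<Rightarrow> ('n, 'r) G_mor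
    \<Rightarrow> ('n, ('n, 'r) GL_fun sect) fmat" where
  "at_x p U \<Phi> = (\<lambda>i j. \<Phi> (special_fibre p U) (glob p U (Var (i, j))))"

text \<open>The matrix \<open>\<phi>\<^sub>G\<^sub>,\<^sub>0(x) = x\<^sup>(\<^sup>p\<^sup>)\<close>.\<close>

definition frob0_at_x :: "nat \<Rightarrow> ('n::finite, 'r::comm_ring_1) GL_fun set set
    \<Rightarrow> ('n, ('n, 'r) GL_fun sect) fmat" where
  "frob0_at_x p U = (\<lambda>i j. glob p U (Var (i, j) ^ p))"

text \<open>Both sides are the images of the coordinates \<open>z\<^sub>i\<close> of the affine space.\<close>

definition P_horizontal :: "nat \<Rightarrow> ('n::finite, 'r::comm_ring_1) GL_fun set set
    \<Rightarrow> ('n, 'r) G_mor \<Rightarrow> bool" where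
  "P_horizontal p U \<Phi> \<longleftrightarrow>
     (\<forall>i \<in> {1..CARD('n)}. \<Phi> (special_fibre p U) (glob p U (P_fun i)) = glob p U (P_fun i ^ p))"

definition T_deformation :: "nat \<Rightarrow> ('n::finite, 'r::comm_ring_1) GL_fun set set
    \<Rightarrow> ('n, 'r) G_mor \<Rightarrow> bool" where
  "T_deformation p U \<Phi> \<longleftrightarrow>
     (\<forall>i j. i \<noteq> j \<longrightarrow>
        mat_mult (O_hat p U) (mat_inverse (O_hat p U) (frob0_at_x p U)) (at_x p U \<Phi>) i j
          = \<zero>\<^bsub>O_hat p U\<^esub>)"

text \<open>
  The coordinates of the two morphisms from the completion of \<open>U \<times> N\<close>: on the left those of
  \<open>C \<circ> (\<Phi> \<times> \<phi>\<^sub>N\<^sub>,\<^sub>0)\<close>, i.e. \<open>\<phi>\<^sub>N\<^sub>,\<^sub>0(b)\<inverse> \<Phi>(x) \<phi>\<^sub>N\<^sub>,\<^sub>0(b)\<close> with \<open>\<phi>\<^sub>N\<^sub>,\<^sub>0(b) = b\<^sup>(\<^sup>p\<^sup>)\<close>, on the right those of \<open>\<Phi> \<circ> C\<close>.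
\<close>

definition C_compatible :: "nat \<Rightarrow> ('n::finite, 'r::comm_ring_1) GL_fun set set
    \<Rightarrow> ('n, 'r) G_mor \<Rightarrow> bool" where
  "C_compatible p U \<Phi> \<longleftrightarrow>
     (let J = thick p normalizer_ideal;
          Y = special_fibre p (times_N U);
          S = sections J Y;
          b = (\<lambda>i j. sect_of J Y (Var (BV i j) ^ p))
      in mat_mult S (mat_mult S (mat_inverse S b) (\<lambda>i j. pullback proj_G J Y (at_x p U \<Phi> i j))) b
         = (\<lambda>i j. pullback conj_map J Y (at_x p U \<Phi> i j)))"

definition good_pair :: "nat \<Rightarrow> ('r::comm_ring_1 \<Rightarrow> 'r) \<Rightarrow> ('n::finite, 'r) GL_fun set set
    \<Rightarrow> ('n, 'r) G_mor \<Rightarrow> bool" where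
  "good_pair p \<phi> U \<Phi> \<longleftrightarrow>
     zariski_open U \<and> U \<subseteq> GL \<and> G_frobenius_lift p \<phi> U \<Phi>
     \<and> N_invariant U \<and> U \<inter> torus = torus_star
     \<and> P_horizontal p U \<Phi> \<and> T_deformation p U \<Phi>"

text \<open>The matrix \<open>\<epsilon> \<Phi>(x) \<epsilon>\<inverse>\<close> with \<open>\<epsilon> = 1 + p \<alpha>\<close>.\<close>

definition twist_at_x :: "nat \<Rightarrow> ('n::finite, 'r::comm_ring_1) GL_fun set set \<Rightarrow> ('n, 'r) G_mor
    \<Rightarrow> ('n, ('n, 'r) GL_fun sect) fmat \<Rightarrow> ('n, ('n, 'r) GL_fun sect) fmat" where
  "twist_at_x p U \<Phi> \<alpha> =
     (let S = O_hat p U; \<epsilon> = (\<lambda>i j. mat_one S i j \<oplus>\<^bsub>S\<^esub> ([p] \<cdot>\<^bsub>S\<^esub> \<alpha> i j))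
      in mat_mult S (mat_mult S \<epsilon> (at_x p U \<Phi>)) (mat_inverse S \<epsilon>))"

end

theory Submission
  imports Defs
begin

text \<open>The entries of \<open>\<phi>(x)\<close> have to be \<open>x\<^sub>i\<^sub>j\<^sup>p s\<^sub>j\<close> with \<open>s\<^sub>j\<close> congruent to \<open>1\<close> mod \<open>p\<close>, and
  horizontality prescribes the coefficients of the characteristic polynomial of this matrix.  Let \<open>jac\<close>
  be the Jacobian of these coefficients in the directions of \<open>s\<close>.  At \<open>x\<^sup>(\<^sup>p\<^sup>)\<close> it is congruent to
  \<open>jac(x)\<^sup>p\<close>, and on the diagonal it is a unit times a Vandermonde determinant.  Hence Hensel's lemma gives
  \<open>s\<close> on the open set where \<open>jac\<close> is invertible, which meets \<open>T\<close> in \<open>T\<^sup>*\<close>.  On any open set \<open>jac(x\<^sup>(\<^sup>p\<^sup>))\<close>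
  is regular mod \<open>p\<close>, so \<open>s\<close> is unique.

  For \<open>b\<close> in \<open>N\<close> every product of two distinct entries in a row or a column vanishes, so
  \<open>(b\<inverse> x b)\<^sup>(\<^sup>p\<^sup>)\<close> is the conjugate of \<open>x\<^sup>(\<^sup>p\<^sup>)\<close> by \<open>b\<^sup>(\<^sup>p\<^sup>)\<close>.  Both sides of the compatibility are therefore
  diagonal multiples of the same matrix with the same characteristic polynomial; they agree because
  \<open>jac\<close> of that matrix is \<open>jac(x\<^sup>(\<^sup>p\<^sup>))\<close> up to a unit and stays regular mod \<open>p\<close> on the product with
  \<open>N\<close>, which is locally a torus over \<open>GL\<^sub>n\<close>.  Conjugation by \<open>1 + p\<alpha>\<close> preserves characteristic
  polynomials.  A lift of Frobenius is the same as its values on the coordinates, since sections are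
  local fractions in each \<open>p\<close>-adic level.\<close>

text \<open>The Hensel argument is linear algebra with determinants and adjugates over the ring of a
  type, whereas a completed ring of functions is a ring of sections given by a carrier. Hence all
  linear algebra is done in a commutative ring modulo an ideal, and the ring of sections enters as
  the quotient of a polynomial ring, with one variable for every section, by the ideal
  \<open>relations\<close>. Hensel's lemma sees the geometry only through properties of this
  quotient: it is p-torsion free, p-adically separated and complete. As the open set may fail to be
  affine, these are proved on germs, level by level. Regularity of jac(x^(p)) mod p holds because p
  is a prime element of R[x] that does not divide jac(x^(p)), as diagonal matrices of indeterminates
  show. On the product with N the role of R[x] is taken, near each point, by Laurent polynomials, in
  which p is still prime.\<close>

no_notation vec_index (infixl "$" 100)
no_notation fps_nth (infixl "$" 75)

section \<open>Linear algebra over commutative rings, modulo an ideal\<close>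

section \<open>Ring relations and ideals\<close>

text \<open>One notion covers congruence modulo an ideal, the graph of a ring homomorphism, and the
  relation g = f^p mod p. Whatever is built from entries by ring operations with integer
  coefficients (determinants, characteristic coefficients, \<open>jac\<close>) is transported along
  all of them by the same lemmas.\<close>

locale ring_rel =
  fixes R :: "'a::comm_ring_1 \<Rightarrow> 'b::comm_ring_1 \<Rightarrow> bool"
  assumes zero: "R 0 0" and one: "R 1 1"
    and add: "R a b \<Longrightarrow> R c d \<Longrightarrow> R (a + c) (b + d)"
    and uminus: "R a b \<Longrightarrow> R (- a) (- b)"
    and mult: "R a b \<Longrightarrow> R c d \<Longrightarrow> R (a * c) (b * d)"
begin

lemma diff: "R a b \<Longrightarrow> R c d \<Longrightarrow> R (a - c) (b - d)"
  using add[OF _ uminus] by force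

lemma sum: "(\<And>x. x \<in> A \<Longrightarrow> R (f x) (g x)) \<Longrightarrow> R (sum f A) (sum g A)"
  by (induction A rule: infinite_finite_induct) (auto intro: zero add)

lemma prod: "(\<And>x. x \<in> A \<Longrightarrow> R (f x) (g x)) \<Longrightarrow> R (prod f A) (prod g A)"
  by (induction A rule: infinite_finite_induct) (auto intro: one mult)

lemma power: "R a b \<Longrightarrow> R (a ^ n) (b ^ n)"
  by (induction n) (auto intro: one mult)

lemma of_int_sign: "R (of_int (sign \<pi>)) (of_int (sign \<pi>))"
  by (auto simp: sign_def intro: one uminus)

lemma det: "(\<And>i j. R (A $ i $ j) (B $ i $ j)) \<Longrightarrow> R (Determinants.det A) (Determinants.det B)"
  unfolding Determinants.det_def by (intro sum mult of_int_sign prod)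

text \<open>Lifting the relation to coefficients makes the determinant of the polynomial matrix s -
  y accessible to \<open>det\<close>.\<close>

lemma poly: "ring_rel (\<lambda>f g. \<forall>n. R (Polynomial.coeff f n) (Polynomial.coeff g n))"
proof
  show "\<forall>n. R (Polynomial.coeff (a * c) n) (Polynomial.coeff (b * d) n)"
    if "\<forall>n. R (Polynomial.coeff a n) (Polynomial.coeff b n)"
      "\<forall>n. R (Polynomial.coeff c n) (Polynomial.coeff d n)" for a b c d
    using that by (auto simp: coeff_mult intro!: sum mult)
qed (auto intro: zero one add uminus simp: coeff_1)

end

definition is_ideal :: "'a::comm_ring_1 set \<Rightarrow> bool" where
  "is_ideal I \<longleftrightarrow> 0 \<in> I \<and> (\<forall>a\<in>I. \<forall>b\<in>I. a + b \<in> I) \<and> (\<forall>a\<in>I. \<forall>r. r * a \<in> I)"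

lemma is_idealD:
  assumes "is_ideal I"
  shows "0 \<in> I" "a \<in> I \<Longrightarrow> b \<in> I \<Longrightarrow> a + b \<in> I" "a \<in> I \<Longrightarrow> r * a \<in> I" "a \<in> I \<Longrightarrow> a * r \<in> I"
    "a \<in> I \<Longrightarrow> - a \<in> I" "a \<in> I \<Longrightarrow> b \<in> I \<Longrightarrow> a - b \<in> I"
proof -
  show m: "r * a \<in> I" if "a \<in> I" for r a using assms that by (auto simp: is_ideal_def)
  show "a * r \<in> I" if "a \<in> I" for r a using m[OF that, of r] by (simp add: mult.commute)
  show u: "- a \<in> I" if "a \<in> I" for a using m[OF that, of "-1"] by simp
  show a: "a + b \<in> I" if "a \<in> I" "b \<in> I" for a b using assms that by (auto simp: is_ideal_def)
  show "a - b \<in> I" if "a \<in> I" "b \<in> I" for a b using a[OF that(1) u[OF that(2)]] by simp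
qed (use assms in \<open>auto simp: is_ideal_def\<close>)

lemma is_ideal_sum: "is_ideal I \<Longrightarrow> (\<And>x. x \<in> A \<Longrightarrow> f x \<in> I) \<Longrightarrow> sum f A \<in> I"
  by (induction A rule: infinite_finite_induct) (auto intro: is_idealD)

definition ideal_add :: "'a::comm_ring_1 set \<Rightarrow> 'a \<Rightarrow> 'a set" where
  "ideal_add I q = {i + q * a | i a. i \<in> I}"

lemma ideal_addI: "i \<in> I \<Longrightarrow> i + q * a \<in> ideal_add I q"
  by (auto simp: ideal_add_def)

lemma ideal_addE:
  assumes "x \<in> ideal_add I q"
  obtains i a where "i \<in> I" "x = i + q * a"
  using assms by (auto simp: ideal_add_def)

lemma ideal_add_iff: "x \<in> ideal_add I q \<longleftrightarrow> (\<exists>a. x - q * a \<in> I)"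
proof
  show "\<exists>a. x - q * a \<in> I" if "x \<in> ideal_add I q"
    using that by (elim ideal_addE) (metis add_diff_cancel_right')
  show "x \<in> ideal_add I q" if "\<exists>a. x - q * a \<in> I"
    using that ideal_addI[of "x - q * _" I q] by (metis diff_add_cancel)
qed

lemma is_ideal_add: "is_ideal I \<Longrightarrow> is_ideal (ideal_add I q)"
  unfolding is_ideal_def[of "ideal_add I q"]
proof (intro conjI ballI allI)
  assume I: "is_ideal I"
  note D = is_idealD[OF I]
  show "0 \<in> ideal_add I q" using ideal_addI[OF D(1), of q 0] by simp
  show "a + b \<in> ideal_add I q" if "a \<in> ideal_add I q" "b \<in> ideal_add I q" for a b
  proof -
    obtain i j c d where "i \<in> I" "j \<in> I" "a = i + q * c" "b = j + q * d"
      using \<open>a \<in> _\<close> \<open>b \<in> _\<close> by (auto elim!: ideal_addE)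
    then show ?thesis using ideal_addI[OF D(2), of i j q "c + d"] by (simp add: algebra_simps)
  qed
  show "r * a \<in> ideal_add I q" if "a \<in> ideal_add I q" for a r
  proof -
    obtain i c where "i \<in> I" "a = i + q * c" using \<open>a \<in> _\<close> by (auto elim!: ideal_addE)
    then show ?thesis using ideal_addI[OF D(3)[of i r], of q "r * c"] by (simp add: algebra_simps)
  qed
qed

lemma ideal_add_mono: "is_ideal I \<Longrightarrow> I \<subseteq> ideal_add I q"
  using ideal_addI[of _ I q 0] by auto

lemma is_ideal_0: "is_ideal {0}"
  by (auto simp: is_ideal_def)

definition cong_mod :: "'a::comm_ring_1 set \<Rightarrow> 'a \<Rightarrow> 'a \<Rightarrow> bool" where
  "cong_mod I a b \<longleftrightarrow> a - b \<in> I"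

lemma ring_rel_cong_mod:
  assumes "is_ideal I"
  shows "ring_rel (cong_mod I)"
proof
  note D = is_idealD[OF assms]
  show "cong_mod I (a * c) (b * d)" if "cong_mod I a b" "cong_mod I c d" for a b c d
  proof -
    have "a * c - b * d = (a - b) * c + b * (c - d)" by (simp add: algebra_simps)
    then show ?thesis using that unfolding cong_mod_def by (metis D(2) D(3) D(4))
  qed
  show "cong_mod I (a + c) (b + d)" if "cong_mod I a b" "cong_mod I c d" for a b c d
    using that D(2)[of "a - b" "c - d"] by (simp add: cong_mod_def algebra_simps)
  show "cong_mod I (- a) (- b)" if "cong_mod I a b" for a b
    using that D(5)[of "a - b"] by (simp add: cong_mod_def algebra_simps)
qed (simp_all add: cong_mod_def is_idealD(1)[OF assms])

lemma cong_mod_refl: "is_ideal I \<Longrightarrow> cong_mod I a a"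
  by (simp add: cong_mod_def is_idealD)

lemma cong_mod_sym: "is_ideal I \<Longrightarrow> cong_mod I a b \<Longrightarrow> cong_mod I b a"
  using is_idealD(5)[of I "a - b"] by (simp add: cong_mod_def)

lemma cong_mod_trans: "is_ideal I \<Longrightarrow> cong_mod I a b \<Longrightarrow> cong_mod I b c \<Longrightarrow> cong_mod I a c"
  using is_idealD(2)[of I "a - b" "b - c"] by (simp add: cong_mod_def)

lemma cong_mod_mono: "I \<subseteq> I' \<Longrightarrow> cong_mod I a b \<Longrightarrow> cong_mod I' a b"
  by (auto simp: cong_mod_def)

lemma cong_mod_mem: "is_ideal I \<Longrightarrow> cong_mod I a b \<Longrightarrow> a \<in> I \<longleftrightarrow> b \<in> I"
  using is_idealD(2)[of I "a - b" b] is_idealD(6)[of I a "a - b"] by (auto simp: cong_mod_def)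

lemma cong_mod_0_iff: "cong_mod I a 0 \<longleftrightarrow> a \<in> I"
  by (simp add: cong_mod_def)

definition pcong :: "'a::comm_ring_1 set \<Rightarrow> 'a poly \<Rightarrow> 'a poly \<Rightarrow> bool" where
  "pcong I f g \<longleftrightarrow> (\<forall>n. cong_mod I (Polynomial.coeff f n) (Polynomial.coeff g n))"

lemma ring_rel_pcong: "is_ideal I \<Longrightarrow> ring_rel (pcong I)"
  using ring_rel.poly[OF ring_rel_cong_mod[of I]] unfolding pcong_def[abs_def] .

lemma pcongD: "pcong I f g \<Longrightarrow> cong_mod I (Polynomial.coeff f n) (Polynomial.coeff g n)"
  by (simp add: pcong_def)

lemma pcong_refl: "is_ideal I \<Longrightarrow> pcong I f f"
  by (simp add: pcong_def cong_mod_refl)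

lemma pcong_trans: "is_ideal I \<Longrightarrow> pcong I f g \<Longrightarrow> pcong I g h \<Longrightarrow> pcong I f h"
  unfolding pcong_def using cong_mod_trans by blast

lemma matrix_eqI: "(\<And>i j. A $ i $ j = B $ i $ j) \<Longrightarrow> A = B"
  by (simp add: Finite_Cartesian_Product.vec_eq_iff)

lemma matrix_diff_distrib_left: "A ** (B - C) = A ** B - A ** C"
  for A :: "'a::comm_ring_1^'n^'m"
  by (rule matrix_eqI) (simp add: matrix_matrix_mult_def algebra_simps sum_subtractf)

lemma matrix_diff_distrib_right: "(B - C) ** A = B ** A - C ** A"
  for A :: "'a::comm_ring_1^'n^'m"
  by (rule matrix_eqI) (simp add: matrix_matrix_mult_def algebra_simps sum_subtractf)

section \<open>Adjugates\<close>

lemma det_replace_row_sum: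
  fixes A :: "'a::comm_ring_1^'n^'n"
  shows "Determinants.det (\<chi> i. if i = k then \<Sum>l\<in>UNIV. c l *s B l else A $ i)
       = (\<Sum>l\<in>(UNIV :: 'n set). c l * Determinants.det (\<chi> i. if i = k then B l else A $ i))"
  using det_linear_row_sum[of UNIV k "\<lambda>_ l. c l *s B l" "\<lambda>i. A $ i"]
  by (simp add: det_row_mul cong: if_cong)

definition adjugate :: "'a::comm_ring_1^'n^'n \<Rightarrow> 'a^'n^'n" where
  "adjugate A = (\<chi> j i. Determinants.det (\<chi> k. if k = i then axis j 1 else A $ k))"

text \<open>By linearity in row i, the (l, i) entry of the product is the determinant of A with row
  i replaced by row l. For l = i this is det A, otherwise two rows agree.\<close>

lemma mult_adjugate: "A ** adjugate A = Finite_Cartesian_Product.mat (Determinants.det A)"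
proof -
  have "(\<Sum>j\<in>UNIV. A $ l $ j * adjugate A $ j $ i) = (if l = i then Determinants.det A else 0)" for l i
  proof -
    have "(\<Sum>j\<in>UNIV. A $ l $ j * adjugate A $ j $ i)
        = Determinants.det (\<chi> k. if k = i then \<Sum>j\<in>UNIV. A $ l $ j *s axis j 1 else A $ k)"
      unfolding det_replace_row_sum by (simp add: adjugate_def)
    also have "(\<Sum>j\<in>UNIV. A $ l $ j *s axis j 1) = A $ l"
    proof (rule iffD2[OF Finite_Cartesian_Product.vec_eq_iff], rule allI)
      show "(\<Sum>j\<in>UNIV. A $ l $ j *s axis j 1) $ m = A $ l $ m" for m
        by (simp add: axis_def if_distrib[of "\<lambda>x. _ * x"] cong: if_cong)
    qed
    also have "Determinants.det (\<chi> k. if k = i then A $ l else A $ k)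
        = (if l = i then Determinants.det A else 0)"
    proof (cases "l = i")
      case True
      then show ?thesis by (auto intro!: arg_cong[where f = Determinants.det] simp: Finite_Cartesian_Product.vec_eq_iff)
    next
      case False
      then show ?thesis
        by (auto intro!: Determinants.det_identical_rows[of l i] simp: Finite_Cartesian_Product.row_def Finite_Cartesian_Product.vec_eq_iff)
    qed
    finally show ?thesis .
  qed
  then show ?thesis by (simp add: Finite_Cartesian_Product.vec_eq_iff matrix_matrix_mult_def Finite_Cartesian_Product.mat_def)
qed

lemma ex_adjugate_left: "\<exists>B. B ** A = Finite_Cartesian_Product.mat (Determinants.det A)" for A :: "'a::comm_ring_1^'n^'n"
proof
  have "transpose (transpose A ** adjugate (transpose A)) = Finite_Cartesian_Product.mat (Determinants.det A)"
    by (simp add: mult_adjugate Finite_Cartesian_Product.transpose_mat)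
  then show "transpose (adjugate (transpose A)) ** A = Finite_Cartesian_Product.mat (Determinants.det A)"
    by (simp add: matrix_transpose_mul transpose_transpose)
qed

section \<open>Directional derivatives of determinants\<close>

text \<open>The derivative of the determinant at C in direction E, that is the coefficient of t in
  det(C + tE). Leibniz' formula is differentiated by hand so that the result is visibly an integer
  polynomial in the entries.\<close>

definition ddet :: "'a::comm_ring_1^'n^'n \<Rightarrow> 'a^'n^'n \<Rightarrow> 'a" where
  "ddet C E = (\<Sum>\<pi> | \<pi> permutes UNIV. of_int (sign \<pi>) *
     (\<Sum>k\<in>UNIV. E $ k $ \<pi> k * (\<Prod>l\<in>UNIV - {k}. C $ l $ \<pi> l)))"

definition pencil :: "'a::comm_ring_1^'n^'n \<Rightarrow> 'a^'n^'n \<Rightarrow> 'a poly^'n^'n" where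
  "pencil C E = (\<chi> i j. [:C $ i $ j, E $ i $ j:])"

lemma coeff_0_prod: "Polynomial.coeff (\<Prod>l\<in>A. f l) 0 = (\<Prod>l\<in>A. Polynomial.coeff (f l) 0)"
  by (induction A rule: infinite_finite_induct) (auto simp: coeff_mult)

lemma coeff_1_prod:
  assumes "finite A"
  shows "Polynomial.coeff (\<Prod>l\<in>A. f l) 1
    = (\<Sum>k\<in>A. Polynomial.coeff (f k) 1 * (\<Prod>l\<in>A - {k}. Polynomial.coeff (f l) 0))"
  using assms
proof (induction A)
  case (insert x A)
  have e: "(\<Prod>l\<in>insert x A - {k}. Polynomial.coeff (f l) 0)
      = Polynomial.coeff (f x) 0 * (\<Prod>l\<in>A - {k}. Polynomial.coeff (f l) 0)" if "k \<in> A" for k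
  proof -
    have "insert x A - {k} = insert x (A - {k})" using insert that by auto
    then show ?thesis using insert by simp
  qed
  have "(\<Sum>k\<in>A. Polynomial.coeff (f k) 1 * (\<Prod>l\<in>insert x A - {k}. Polynomial.coeff (f l) 0))
      = (\<Sum>k\<in>A. Polynomial.coeff (f x) 0 * (Polynomial.coeff (f k) 1 * (\<Prod>l\<in>A - {k}. Polynomial.coeff (f l) 0)))"
    by (rule sum.cong) (simp_all add: e mult_ac del: insert_Diff_single)
  then show ?case using insert
    by (simp add: coeff_mult coeff_0_prod sum_distrib_left[symmetric] add.commute)
qed auto

lemma of_int_sign_poly: "of_int (sign \<pi>) = ([:of_int (sign \<pi>):] :: 'a::comm_ring_1 poly)"
  by (auto simp: sign_def one_pCons)

lemma coeff_0_det: "Polynomial.coeff (Determinants.det A) 0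
    = Determinants.det (\<chi> i j. Polynomial.coeff (A $ i $ j) 0)"
  by (simp add: Determinants.det_def coeff_sum of_int_sign_poly coeff_0_prod)

lemma coeff_0_det_pencil: "Polynomial.coeff (Determinants.det (pencil C E)) 0 = Determinants.det C"
  by (simp add: coeff_0_det pencil_def)

lemma coeff_1_det_pencil: "Polynomial.coeff (Determinants.det (pencil C E)) 1 = ddet C E"
proof -
  have "Polynomial.coeff (Determinants.det (pencil C E)) 1
      = (\<Sum>\<pi> | \<pi> permutes (UNIV :: 'b set). of_int (sign \<pi>) *
          Polynomial.coeff (\<Prod>i\<in>UNIV. [:C $ i $ \<pi> i, E $ i $ \<pi> i:]) 1)"
    by (simp add: Determinants.det_def coeff_sum of_int_sign_poly pencil_def)
  then show ?thesis unfolding coeff_1_prod[OF finite] by (simp add: ddet_def)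
qed

lemma poly_det: "Polynomial.poly (Determinants.det A) q
    = Determinants.det (\<chi> i j. Polynomial.poly (A $ i $ j) q)"
  by (simp add: Determinants.det_def poly_sum of_int_sign_poly poly_prod)

lemma poly_second_order: "\<exists>r. Polynomial.poly f q
    = Polynomial.coeff f 0 + q * Polynomial.coeff f 1 + q\<^sup>2 * r" for q :: "'a::comm_ring_1"
proof -
  obtain a g where f: "f = pCons a g" by (cases f)
  obtain b h where g: "g = pCons b h" by (cases g)
  show ?thesis
    by (intro exI[of _ "Polynomial.poly h q"]) (simp add: f g algebra_simps power2_eq_square)
qed

lemma det_perturb: "\<exists>r. Determinants.det (\<chi> i j. C $ i $ j + q * E $ i $ j)
    = Determinants.det C + q * ddet C E + q\<^sup>2 * r"
proof -
  have "Determinants.det (\<chi> i j. C $ i $ j + q * E $ i $ j) = Polynomial.poly (Determinants.det (pencil C E)) q"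
    by (simp add: poly_det pencil_def)
  then show ?thesis
    using poly_second_order[of "Determinants.det (pencil C E)" q]
    by (simp only: coeff_0_det_pencil coeff_1_det_pencil)
qed

text \<open>Compares the coefficients of t in det(A (C + tE) B) = det A det(C + tE) det B.\<close>

lemma ddet_mult: "ddet (A ** C ** B) (A ** E ** B)
    = Determinants.det A * Determinants.det B * ddet C E"
proof -
  have "pencil (A ** C ** B) (A ** E ** B) = pencil A 0 ** pencil C E ** pencil B 0"
  proof -
    have s: "(\<Sum>x\<in>Q. [:f x, g x:]) = [:\<Sum>x\<in>Q. f x, \<Sum>x\<in>Q. g x:]" for Q and f g :: "'b \<Rightarrow> 'a"
      by (induction Q rule: infinite_finite_induct) auto
    show ?thesis by (simp add: Finite_Cartesian_Product.vec_eq_iff pencil_def matrix_matrix_mult_def s sum_distrib_left sum_distrib_right mult_ac)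
  qed
  then have "Determinants.det (pencil (A ** C ** B) (A ** E ** B))
      = Determinants.det (pencil A 0) * Determinants.det (pencil C E) * Determinants.det (pencil B 0)"
    by (simp add: det_mul)
  moreover have "Determinants.det (pencil A 0) = [:Determinants.det A:]" for A :: "'a^'b^'b"
  proof -
    have "(\<Prod>x\<in>Q. [:f x:]) = [:\<Prod>x\<in>Q. f x:]" "(\<Sum>x\<in>Y. [:g x:]) = [:\<Sum>x\<in>Y. g x:]"
      for Q and f :: "'b \<Rightarrow> 'a" and Y and g :: "('b \<Rightarrow> 'b) \<Rightarrow> 'a"
      by (induction Q rule: infinite_finite_induct, auto simp: one_pCons)
         (induction Y rule: infinite_finite_induct, auto)
    then show ?thesis by (simp add: Determinants.det_def pencil_def of_int_sign_poly mult.commute)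
  qed
  ultimately have "Polynomial.coeff (Determinants.det (pencil (A ** C ** B) (A ** E ** B))) 1
      = Polynomial.coeff ([:Determinants.det A:] * Determinants.det (pencil C E) * [:Determinants.det B:]) 1"
    by simp
  then show ?thesis by (simp add: coeff_1_det_pencil mult_ac del: One_nat_def)
qed

lemma ddet_sum: "ddet C (\<chi> i j. \<Sum>a\<in>L. u a * E a $ i $ j) = (\<Sum>a\<in>L. u a * ddet C (E a))"
proof -
  have "ddet C (\<chi> i j. \<Sum>a\<in>L. u a * E a $ i $ j) = (\<Sum>\<pi> | \<pi> permutes UNIV. \<Sum>a\<in>L. u a * (of_int (sign \<pi>) *
     (\<Sum>k\<in>UNIV. E a $ k $ \<pi> k * (\<Prod>l\<in>UNIV - {k}. C $ l $ \<pi> l))))"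
    unfolding ddet_def
  proof (rule sum.cong[OF refl])
    fix \<pi> :: "'b \<Rightarrow> 'b"
    have "(\<Sum>k\<in>UNIV. (\<Sum>a\<in>L. u a * E a $ k $ \<pi> k) * (\<Prod>l\<in>UNIV - {k}. C $ l $ \<pi> l))
        = (\<Sum>a\<in>L. u a * (\<Sum>k\<in>UNIV. E a $ k $ \<pi> k * (\<Prod>l\<in>UNIV - {k}. C $ l $ \<pi> l)))"
      unfolding sum_distrib_right sum_distrib_left
      by (subst sum.swap) (simp add: mult_ac)
    then show "of_int (sign \<pi>) * (\<Sum>k\<in>UNIV. (\<chi> i j. \<Sum>a\<in>L. u a * E a $ i $ j) $ k $ \<pi> k * (\<Prod>l\<in>UNIV - {k}. C $ l $ \<pi> l))
        = (\<Sum>a\<in>L. u a * (of_int (sign \<pi>) * (\<Sum>k\<in>UNIV. E a $ k $ \<pi> k * (\<Prod>l\<in>UNIV - {k}. C $ l $ \<pi> l))))"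
      by (simp add: sum_distrib_left mult_ac)
  qed
  then show ?thesis unfolding ddet_def
    by (subst (asm) sum.swap) (simp add: sum_distrib_left)
qed

lemma (in ring_rel) ddet: "(\<And>i j. R (C $ i $ j) (C' $ i $ j)) \<Longrightarrow> (\<And>i j. R (E $ i $ j) (E' $ i $ j))
    \<Longrightarrow> R (ddet C E) (ddet C' E')"
  unfolding ddet_def by (intro sum mult of_int_sign prod)


section \<open>Coefficients of characteristic polynomials\<close>

definition cmat :: "'a::comm_ring_1^'n^'n \<Rightarrow> 'a poly^'n^'n" where
  "cmat y = (\<chi> i j. [:y $ i $ j:])"

definition charmat :: "'a::comm_ring_1^'n^'n \<Rightarrow> 'a poly^'n^'n" where
  "charmat y = (\<chi> i j. (if i = j then [:0, 1:] else 0) - [:y $ i $ j:])"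

definition cp :: "nat \<Rightarrow> 'a::comm_ring_1^'n^'n \<Rightarrow> 'a" where
  "cp i y = (-1) ^ i * Polynomial.coeff (Determinants.det (charmat y)) (CARD('n) - i)"

text \<open>The derivative of \<open>cp i\<close> at y in direction z. The sign comes from s - y,
  whose derivative in direction z is -z.\<close>

definition dcp :: "nat \<Rightarrow> 'a::comm_ring_1^'n^'n \<Rightarrow> 'a^'n^'n \<Rightarrow> 'a" where
  "dcp i y z = (-1) ^ i * Polynomial.coeff (ddet (charmat y) (cmat (- z))) (CARD('n) - i)"

lemma cp_add: "\<exists>r. cp i (\<chi> a b. y $ a $ b + q * z $ a $ b) = cp i y + q * dcp i y z + q\<^sup>2 * r"
proof -
  have e: "charmat (\<chi> a b. y $ a $ b + q * z $ a $ b)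
      = (\<chi> a b. charmat y $ a $ b + [:q:] * cmat (- z) $ a $ b)"
    by (rule matrix_eqI) (simp add: charmat_def cmat_def mult.commute)
  obtain r where r: "Determinants.det (charmat (\<chi> a b. y $ a $ b + q * z $ a $ b))
     = Determinants.det (charmat y) + [:q:] * ddet (charmat y) (cmat (- z)) + [:q:]\<^sup>2 * r"
    unfolding e using det_perturb by blast
  show ?thesis
    by (intro exI[of _ "(-1) ^ i * Polynomial.coeff r (CARD('b) - i)"])
      (simp add: cp_def dcp_def r power2_eq_square algebra_simps)
qed

lemma dcp_sum: "dcp i y (\<chi> a b. \<Sum>l\<in>L. u l * z l $ a $ b) = (\<Sum>l\<in>L. u l * dcp i y (z l))"
proof -
  have s: "(\<Sum>x\<in>L. [:f x:]) = [:\<Sum>x\<in>L. f x:]" for f :: "'c \<Rightarrow> 'a"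
    by (induction L rule: infinite_finite_induct) auto
  have e: "cmat (- (\<chi> a b. \<Sum>l\<in>L. u l * z l $ a $ b))
      = (\<chi> a b. \<Sum>l\<in>L. [:u l:] * cmat (- z l) $ a $ b)"
    by (rule matrix_eqI) (simp add: cmat_def s sum_negf mult.commute)
  show ?thesis unfolding dcp_def e ddet_sum
    by (simp add: coeff_sum sum_distrib_left mult_ac)
qed

context ring_rel
begin

lemma matrix_mult:
  "(\<And>i j. R (A $ i $ j) (A' $ i $ j)) \<Longrightarrow> (\<And>i j. R (B $ i $ j) (B' $ i $ j))
    \<Longrightarrow> R ((A ** B) $ i $ j) ((A' ** B') $ i $ j)"
  by (auto simp: matrix_matrix_mult_def intro!: sum mult)

lemma cmat: "R (y $ i $ j) (y' $ i $ j) \<Longrightarrow>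
    R (Polynomial.coeff (cmat y $ i $ j) n) (Polynomial.coeff (cmat y' $ i $ j) n)"
  by (auto simp: cmat_def coeff_pCons split: nat.split intro: zero)

lemma charmat: "R (y $ i $ j) (y' $ i $ j) \<Longrightarrow>
    R (Polynomial.coeff (charmat y $ i $ j) n) (Polynomial.coeff (charmat y' $ i $ j) n)"
  by (auto simp: charmat_def coeff_pCons split: nat.split intro!: zero one diff uminus)

lemma cp:
  fixes y :: "'a^'n^'n"
  assumes "\<And>i j. R (y $ i $ j) (y' $ i $ j)"
  shows "R (cp i y) (cp i y')"
proof -
  interpret P: ring_rel "\<lambda>f g. \<forall>n. R (Polynomial.coeff f n) (Polynomial.coeff g n)" by (rule poly)
  have "\<forall>n. R (Polynomial.coeff (Determinants.det (charmat y)) n) (Polynomial.coeff (Determinants.det (charmat y')) n)"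
    by (rule P.det) (use charmat assms in blast)
  then show ?thesis unfolding cp_def by (intro mult power uminus one) auto
qed

lemma dcp:
  fixes y :: "'a^'n^'n"
  assumes "\<And>i j. R (y $ i $ j) (y' $ i $ j)" "\<And>i j. R (z $ i $ j) (z' $ i $ j)"
  shows "R (dcp i y z) (dcp i y' z')"
proof -
  interpret P: ring_rel "\<lambda>f g. \<forall>n. R (Polynomial.coeff f n) (Polynomial.coeff g n)" by (rule poly)
  have z: "R ((- z) $ i $ j) ((- z') $ i $ j)" for i j using uminus[OF assms(2)] by simp
  have "\<forall>n. R (Polynomial.coeff (ddet (charmat y) (cmat (- z))) n)
     (Polynomial.coeff (ddet (charmat y') (cmat (- z'))) n)"
  proof (rule P.ddet)
    show "\<forall>n. R (Polynomial.coeff (charmat y $ i $ j) n) (Polynomial.coeff (charmat y' $ i $ j) n)" for i j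
      using charmat assms(1) by blast
    show "\<forall>n. R (Polynomial.coeff (cmat (- z) $ i $ j) n) (Polynomial.coeff (cmat (- z') $ i $ j) n)" for i j
      using cmat[OF z] by blast
  qed
  then show ?thesis unfolding dcp_def by (intro mult power uminus one) auto
qed

end

lemma const_sum: "(\<Sum>x\<in>Q. [:f x:]) = [:\<Sum>x\<in>Q. f x:]"
  by (induction Q rule: infinite_finite_induct) auto

lemma cmat_mult: "cmat (A ** B) = cmat A ** cmat B"
  by (rule matrix_eqI) (simp add: cmat_def matrix_matrix_mult_def const_sum mult.commute)

text \<open>This is e (s - y) f = s e f - e y f. The product e f is left as it stands because later
  it is the identity only modulo an ideal.\<close>

lemma charmat_conj:
  "cmat e ** charmat y ** cmat f = (\<chi> i j. monom ((e ** f) $ i $ j) 1) - cmat (e ** y ** f)"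
proof -
  have m: "Polynomial.monom (1::'a) (Suc 0) = [:0, 1:]" by (simp add: monom_altdef)
  have c: "charmat y = (\<chi> i j. if i = j then monom 1 1 else 0) - cmat y"
    by (rule matrix_eqI) (simp add: charmat_def cmat_def m)
  have "cmat e ** (\<chi> i j. if i = j then monom 1 1 else 0) ** cmat f = (\<chi> i j. monom ((e ** f) $ i $ j) 1)"
  proof -
    have "cmat e ** (\<chi> i j. if i = j then monom 1 1 else 0) = (\<chi> i j. monom (e $ i $ j) 1)"
      by (intro matrix_eqI) (simp add: matrix_matrix_mult_def cmat_def if_distrib[of "\<lambda>x. _ * x"]
          smult_monom cong: if_cong)
    moreover have "(\<Sum>k\<in>UNIV. monom (e $ i $ k) 1 * [:f $ k $ j:]) = monom (\<Sum>k\<in>UNIV. e $ i $ k * f $ k $ j) 1" for i j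
    proof -
      have "monom (\<Sum>k\<in>Q. e $ i $ k * f $ k $ j) 1 = (\<Sum>k\<in>Q. monom (e $ i $ k * f $ k $ j) 1)" for Q
        by (induction Q rule: infinite_finite_induct) (auto simp: add_monom[symmetric])
      then show ?thesis by (simp add: smult_monom mult.commute)
    qed
    ultimately show ?thesis
      by (intro matrix_eqI) (simp add: matrix_matrix_mult_def cmat_def)
  qed
  then show ?thesis
    by (simp add: c matrix_diff_distrib_left matrix_diff_distrib_right cmat_mult)
qed

context
  fixes I :: "'a::comm_ring_1 set" and e f :: "'a^'n^'n"
  assumes I: "is_ideal I"
    and ef: "\<And>i j. cong_mod I ((e ** f) $ i $ j) (Finite_Cartesian_Product.mat 1 $ i $ j)"
begin

interpretation R: ring_rel "cong_mod I" by (rule ring_rel_cong_mod[OF I])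
interpretation P: ring_rel "pcong I" by (rule ring_rel_pcong[OF I])

lemma charmat_conj_cong: "pcong I (charmat (e ** y ** f) $ i $ j) ((cmat e ** charmat y ** cmat f) $ i $ j)"
proof -
  have "pcong I (if i = j then [:0, 1:] else 0) (Polynomial.monom ((e ** f) $ i $ j) 1)"
    using cong_mod_sym[OF I ef[of i j]] cong_mod_refl[OF I]
    by (cases "i = j") (simp_all add: pcong_def coeff_pCons Finite_Cartesian_Product.mat_def split: nat.split)
  then show ?thesis unfolding charmat_conj
    by (simp add: charmat_def cmat_def P.diff pcong_refl[OF I])
qed

lemma det_cmat_conj: "pcong I (Determinants.det (cmat e) * Determinants.det (cmat f) * g) g"
proof -
  have "pcong I (Determinants.det (cmat (e ** f))) (Determinants.det (cmat (Finite_Cartesian_Product.mat 1 :: 'a^'n^'n)))"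
    unfolding pcong_def[of I "cmat _ $ _ $ _"] by (rule P.det) (simp add: pcong_def R.cmat ef)
  moreover have "cmat (Finite_Cartesian_Product.mat 1 :: 'a^'n^'n) = Finite_Cartesian_Product.mat 1"
    by (rule matrix_eqI) (simp add: cmat_def Finite_Cartesian_Product.mat_def one_pCons)
  ultimately have "pcong I (Determinants.det (cmat e) * Determinants.det (cmat f)) 1"
    by (simp add: cmat_mult det_mul)
  from P.mult[OF this pcong_refl[OF I]] show ?thesis by simp
qed

text \<open>Modulo I the matrix s - e y f may be replaced by e (s - y) f, and det e det f = det(e f)
  is 1 modulo I.\<close>

lemma cp_conj: "cong_mod I (cp i (e ** y ** f)) (cp i y)"
proof -
  have "pcong I (Determinants.det (charmat (e ** y ** f))) (Determinants.det (cmat e ** charmat y ** cmat f))"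
    by (rule P.det) (rule charmat_conj_cong)
  moreover have "pcong I (Determinants.det (cmat e ** charmat y ** cmat f)) (Determinants.det (charmat y))"
    using det_cmat_conj[of "Determinants.det (charmat y)"] by (simp add: det_mul mult_ac)
  ultimately have "pcong I (Determinants.det (charmat (e ** y ** f))) (Determinants.det (charmat y))"
    by (rule pcong_trans[OF I])
  then show ?thesis unfolding cp_def by (rule R.mult[OF cong_mod_refl[OF I] pcongD])
qed

lemma dcp_conj: "cong_mod I (dcp i (e ** y ** f) (e ** z ** f)) (dcp i y z)"
proof -
  have m: "cmat (- (e ** z ** f)) = cmat e ** cmat (- z) ** cmat f"
  proof -
    have "- (e ** z ** f) = e ** (- z) ** f"
      by (rule matrix_eqI) (simp add: matrix_matrix_mult_def sum_negf)
    then show ?thesis by (simp add: cmat_mult)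
  qed
  have "pcong I (ddet (charmat (e ** y ** f)) (cmat (- (e ** z ** f))))
     (ddet (cmat e ** charmat y ** cmat f) (cmat (- (e ** z ** f))))"
    by (rule P.ddet) (rule charmat_conj_cong, rule pcong_refl[OF I])
  moreover have "pcong I (ddet (cmat e ** charmat y ** cmat f) (cmat (- (e ** z ** f))))
     (ddet (charmat y) (cmat (- z)))"
    unfolding m ddet_mult by (rule det_cmat_conj)
  ultimately have "pcong I (ddet (charmat (e ** y ** f)) (cmat (- (e ** z ** f)))) (ddet (charmat y) (cmat (- z)))"
    by (rule pcong_trans[OF I])
  then show ?thesis unfolding dcp_def by (rule R.mult[OF cong_mod_refl[OF I] pcongD])
qed

end

section \<open>The Jacobian of the characteristic coefficients along the torus, and Hensel's
  lemma\<close>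

section \<open>The Jacobian in the torus directions\<close>

text \<open>Coefficients are numbered by 1, ..., n and columns by the index type. Identifying the
  two turns the Jacobian into a square matrix over a single type.\<close>

definition idx :: "'n::finite \<Rightarrow> nat" where
  "idx = (SOME f. bij_betw f UNIV {1..CARD('n)})"

lemma bij_idx: "bij_betw (idx :: 'n::finite \<Rightarrow> nat) UNIV {1..CARD('n)}"
proof -
  have "\<exists>f. bij_betw f (UNIV :: 'n set) {1..CARD('n)}" by (rule finite_same_card_bij) auto
  from someI_ex[OF this] show ?thesis by (simp add: idx_def)
qed

lemma idx_mem: "idx (i :: 'n::finite) \<in> {1..CARD('n)}"
  using bij_idx by (auto simp: bij_betw_def)

lemma ball_idx: "(\<forall>i\<in>{1..CARD('n::finite)}. Q i) \<longleftrightarrow> (\<forall>i :: 'n. Q (idx i))"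
proof -
  have "{1..CARD('n)} = range (idx :: 'n \<Rightarrow> nat)" using bij_idx[where 'n = 'n] by (simp add: bij_betw_def)
  then show ?thesis by simp
qed

text \<open>The tangent vector at s = 1 of y diag(s) in the direction of s_j. So
  \<open>jacm y\<close> below is the Jacobian matrix at s = 1 of the map sending s to the
  characteristic coefficients of y diag(s).\<close>

definition colm :: "'a::comm_ring_1^'n^'n \<Rightarrow> 'n \<Rightarrow> 'a^'n^'n" where
  "colm y j = (\<chi> a b. if b = j then y $ a $ b else 0)"

definition jacm :: "'a::comm_ring_1^'n^'n \<Rightarrow> 'a^'n^'n" where
  "jacm y = (\<chi> i j. dcp (idx i) y (colm y j))"

definition jac :: "'a::comm_ring_1^'n^'n \<Rightarrow> 'a" where
  "jac y = Determinants.det (jacm y)"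

lemma (in ring_rel) jac:
  assumes "\<And>i j. R (y $ i $ j) (y' $ i $ j)"
  shows "R (jac y) (jac y')"
  unfolding jac_def
proof (rule det)
  fix i j
  show "R (jacm y $ i $ j) (jacm y' $ i $ j)"
    using assms by (auto simp: jacm_def colm_def intro!: dcp zero)
qed

text \<open>Scaling column j of c x b is the direction c x B_j, where B_j is b with all columns but
  the j-th erased. Inserting c b = 1 on the right, it is the conjugate of x (B_j c), and B_j c is
  diagonal modulo I with entries b_lj c_jl. By invariance of the coefficients under conjugation the
  Jacobian matrix is thus multiplied on the right by the matrix of these entries.\<close>

lemma jac_conj:
  fixes b c x :: "'a::comm_ring_1^'n^'n"
  assumes I: "is_ideal I"
    and cb: "\<And>i j. cong_mod I ((c ** b) $ i $ j) (Finite_Cartesian_Product.mat 1 $ i $ j)"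
    and bc0: "\<And>i j k. i \<noteq> k \<Longrightarrow> b $ i $ j * c $ j $ k \<in> I"
  shows "cong_mod I (jac (c ** x ** b)) (jac x * Determinants.det (\<chi> l j. b $ l $ j * c $ j $ l))"
proof -
  interpret R: ring_rel "cong_mod I" by (rule ring_rel_cong_mod[OF I])
  note rf = cong_mod_refl[OF I]
  define M where "M = (\<chi> l j. b $ l $ j * c $ j $ l)"
  have "cong_mod I (jacm (c ** x ** b) $ i $ j) ((jacm x ** M) $ i $ j)" for i j
  proof -
    have 1: "cong_mod I (colm (c ** x ** b) j $ s $ t) ((c ** (x ** (colm b j ** c)) ** b) $ s $ t)" for s t
    proof -
      have "colm (c ** x ** b) j = c ** x ** colm b j ** Finite_Cartesian_Product.mat 1"
        unfolding matrix_mul_rid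
        by (intro matrix_eqI) (simp add: colm_def matrix_matrix_mult_def if_distrib[of "\<lambda>x. _ * x"] cong: if_cong)
      moreover have "cong_mod I ((c ** x ** colm b j ** Finite_Cartesian_Product.mat 1) $ s $ t)
          ((c ** x ** colm b j ** (c ** b)) $ s $ t)"
        by (rule R.matrix_mult) (auto intro: rf cong_mod_sym[OF I cb])
      ultimately show ?thesis by (simp add: matrix_mul_assoc)
    qed
    have t1: "cong_mod I (jacm (c ** x ** b) $ i $ j)
        (dcp (idx i) (c ** x ** b) (c ** (x ** (colm b j ** c)) ** b))"
      by (simp add: jacm_def) (intro R.dcp rf 1)
    have t2: "cong_mod I (dcp (idx i) (c ** x ** b) (c ** (x ** (colm b j ** c)) ** b))
        (dcp (idx i) x (x ** (colm b j ** c)))"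
      by (rule dcp_conj[OF I cb])
    have t3: "cong_mod I (dcp (idx i) x (x ** (colm b j ** c)))
        (dcp (idx i) x (\<chi> s t. \<Sum>l\<in>UNIV. M $ l $ j * colm x l $ s $ t))"
    proof (rule R.dcp[OF rf])
      fix s t
      have "(x ** (colm b j ** c)) $ s $ t = (\<Sum>k\<in>UNIV. x $ s $ k * (b $ k $ j * c $ j $ t))"
        by (simp add: matrix_matrix_mult_def colm_def if_distrib[of "\<lambda>x. x * _"] cong: if_cong)
      moreover have "cong_mod I \<dots> (\<Sum>k\<in>UNIV. if k = t then x $ s $ k * (b $ k $ j * c $ j $ t) else 0)"
        by (rule R.sum) (use bc0 in \<open>auto simp: rf cong_mod_0_iff is_idealD(3)[OF I]\<close>)
      ultimately show "cong_mod I ((x ** (colm b j ** c)) $ s $ t)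
          ((\<chi> s t. \<Sum>l\<in>UNIV. M $ l $ j * colm x l $ s $ t) $ s $ t)"
        by (simp add: colm_def M_def mult_ac if_distrib[of "\<lambda>x. _ * x"] cong: if_cong)
    qed
    have t4: "dcp (idx i) x (\<chi> s t. \<Sum>l\<in>UNIV. M $ l $ j * colm x l $ s $ t) = (jacm x ** M) $ i $ j"
      by (simp add: dcp_sum matrix_matrix_mult_def jacm_def mult_ac)
    show ?thesis
      using cong_mod_trans[OF I t1 cong_mod_trans[OF I t2 t3]] by (simp only: t4)
  qed
  then have "cong_mod I (jac (c ** x ** b)) (Determinants.det (jacm x ** M))"
    unfolding jac_def by (rule R.det)
  then show ?thesis by (simp add: det_mul jac_def M_def)
qed

text \<open>First-order expansion with two errors: the derivative is taken at y instead of Y, which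
  agrees with y mod q, and the quadratic term carries q^(2k+2). Both are divisible by q once q^(k+1)
  is split off; this is why the exponent starts at 1.\<close>

lemma cp_perturb:
  fixes y :: "'a::comm_ring_1^'n^'n"
  assumes K: "is_ideal K" and Y: "\<And>a b. Y $ a $ b - y $ a $ b \<in> ideal_add K q"
  shows "\<exists>e\<in>ideal_add K q. cp i (\<chi> a b. Y $ a $ b + q ^ Suc k * (y $ a $ b * u b))
    = cp i Y + q ^ Suc k * (\<Sum>j\<in>UNIV. u j * dcp i y (colm y j)) + q ^ Suc k * e"
proof -
  note D = is_idealD[OF is_ideal_add[OF K, of q]]
  define z where "z = (\<chi> a b. y $ a $ b * u b)"
  obtain r where r: "cp i (\<chi> a b. Y $ a $ b + q ^ Suc k * z $ a $ b)
      = cp i Y + q ^ Suc k * dcp i Y z + (q ^ Suc k)\<^sup>2 * r" using cp_add by blast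
  interpret R: ring_rel "cong_mod (ideal_add K q)" by (rule ring_rel_cong_mod[OF is_ideal_add[OF K]])
  have "z = (\<chi> a b. \<Sum>j\<in>UNIV. u j * colm y j $ a $ b)"
    by (rule matrix_eqI) (simp add: z_def colm_def if_distrib[of "\<lambda>x. _ * x"] mult.commute cong: if_cong)
  then have z: "dcp i y z = (\<Sum>j\<in>UNIV. u j * dcp i y (colm y j))" by (simp add: dcp_sum)
  have "cong_mod (ideal_add K q) (dcp i Y z) (dcp i y z)"
    by (rule R.dcp) (use Y in \<open>auto simp: cong_mod_def D\<close>)
  then have 1: "dcp i Y z - dcp i y z \<in> ideal_add K q" by (simp add: cong_mod_def)
  have 2: "q ^ Suc k * r \<in> ideal_add K q"
    using ideal_addI[of 0 K q "q ^ k * r"] is_idealD(1)[OF K] by (simp add: mult_ac)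
  show ?thesis
    by (rule bexI[OF _ D(2)[OF 1 2]])
      (use r z in \<open>simp add: z_def algebra_simps power2_eq_square\<close>)
qed

lemma ideal_add_power_mono:
  assumes K: "is_ideal K" and "m \<le> k" and "a \<in> ideal_add K (q ^ k)"
  shows "a \<in> ideal_add K (q ^ m)"
proof -
  obtain i c where "i \<in> K" "a = i + q ^ k * c" using assms by (auto elim: ideal_addE)
  moreover have "q ^ k = q ^ m * q ^ (k - m)" using \<open>m \<le> k\<close> by (simp flip: power_add)
  ultimately show ?thesis using ideal_addI[of i K "q ^ m" "q ^ (k - m) * c"] by (simp add: mult_ac)
qed

lemma ideal_add_step:
  assumes K: "is_ideal K" and a: "a - q ^ k * b \<in> K" and "b \<in> ideal_add K q"
  shows "a \<in> ideal_add K (q ^ Suc k)"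
proof -
  obtain i c where i: "i \<in> K" "b = i + q * c" using assms by (auto elim: ideal_addE)
  have "a = (a - q ^ k * b + q ^ k * i) + q ^ Suc k * c" using i by (simp add: algebra_simps)
  moreover have "a - q ^ k * b + q ^ k * i \<in> K" using is_idealD[OF K] a i by blast
  ultimately show ?thesis using ideal_addI by metis
qed

text \<open>If s - t = q^(k+1) u, equality of the characteristic coefficients gives q^(k+1) (J u +
  e) = 0 with J the Jacobian matrix and e divisible by q. Flatness cancels the power of q, so J u
  vanishes mod q, and regularity of det J forces u to vanish mod q. Hence s - t is divisible by
  every power of q.\<close>

lemma torus_factor_unique:
  fixes y :: "'a::comm_ring_1^'n^'n"
  assumes K: "is_ideal K"
    and flat: "\<And>a. q * a \<in> K \<Longrightarrow> a \<in> K"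
    and sep: "\<And>a. (\<And>k. a \<in> ideal_add K (q ^ k)) \<Longrightarrow> a \<in> K"
    and reg: "\<And>a. jac y * a \<in> ideal_add K q \<Longrightarrow> a \<in> ideal_add K q"
    and s: "\<And>j. s j - 1 \<in> ideal_add K q" and t: "\<And>j. t j - 1 \<in> ideal_add K q"
    and eq: "\<And>i. i \<in> {1..CARD('n)} \<Longrightarrow>
      cp i (\<chi> a b. y $ a $ b * s b) - cp i (\<chi> a b. y $ a $ b * t b) \<in> K"
  shows "s j - t j \<in> K"
proof -
  interpret R: ring_rel "cong_mod K" by (rule ring_rel_cong_mod[OF K])
  note DK = is_idealD[OF K] and DQ = is_idealD[OF is_ideal_add[OF K, of q]]
  have flatk: "a \<in> K" if "q ^ k * a \<in> K" for k a
    using that by (induction k) (auto simp: mult.assoc intro: flat)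
  have "\<forall>j. s j - t j \<in> ideal_add K (q ^ Suc k)" for k
  proof (induction k)
    case 0
    then show ?case using DQ(6)[OF s t] by simp
  next
    case (Suc k)
    then obtain u where u: "\<And>j. s j - t j - q ^ Suc k * u j \<in> K"
      unfolding ideal_add_iff by metis
    define Y where "Y = (\<chi> a b. y $ a $ b * t b)"
    have Y: "Y $ a $ b - y $ a $ b \<in> ideal_add K q" for a b
      using DQ(3)[OF t[of b], of "y $ a $ b"] by (simp add: Y_def algebra_simps)
    have J: "(\<Sum>j\<in>UNIV. jacm y $ i $ j * u j) \<in> ideal_add K q" for i
    proof -
      obtain e where e: "e \<in> ideal_add K q"
        "cp (idx i) (\<chi> a b. Y $ a $ b + q ^ Suc k * (y $ a $ b * u b))
          = cp (idx i) Y + q ^ Suc k * (\<Sum>j\<in>UNIV. u j * dcp (idx i) y (colm y j)) + q ^ Suc k * e"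
        using cp_perturb[OF K Y] by blast
      have c: "cong_mod K (cp (idx i) (\<chi> a b. y $ a $ b * s b))
          (cp (idx i) (\<chi> a b. Y $ a $ b + q ^ Suc k * (y $ a $ b * u b)))"
      proof (rule R.cp)
        fix a b
        show "cong_mod K ((\<chi> a b. y $ a $ b * s b) $ a $ b)
          ((\<chi> a b. Y $ a $ b + q ^ Suc k * (y $ a $ b * u b)) $ a $ b)"
          using DK(3)[OF u[of b], of "y $ a $ b"] by (simp add: cong_mod_def Y_def algebra_simps)
      qed
      have "cp (idx i) Y + q ^ Suc k * (\<Sum>j\<in>UNIV. u j * dcp (idx i) y (colm y j)) + q ^ Suc k * e
          - cp (idx i) (\<chi> a b. y $ a $ b * s b) \<in> K"
        using cong_mod_sym[OF K c] by (simp only: cong_mod_def e(2))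
      from DK(2)[OF this eq[OF idx_mem[of i]]]
      have "q ^ Suc k * ((\<Sum>j\<in>UNIV. u j * dcp (idx i) y (colm y j)) + e) \<in> K"
        by (simp add: Y_def algebra_simps)
      from flatk[OF this] have "(\<Sum>j\<in>UNIV. u j * dcp (idx i) y (colm y j)) + e \<in> ideal_add K q"
        using ideal_add_mono[OF K] by blast
      from DQ(6)[OF this e(1)] show ?thesis by (simp add: jacm_def mult.commute)
    qed
    \<comment> \<open>A left adjugate is needed here: it turns the vanishing of J u into that of det
      J times each single u_j.\<close>
    obtain B where B: "B ** jacm y = Finite_Cartesian_Product.mat (jac y)"
      unfolding jac_def using ex_adjugate_left by blast
    have "u j \<in> ideal_add K q" for j
    proof (rule reg)
      have "(B ** jacm y) $ j $ l = (if j = l then jac y else 0)" for l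
        by (simp add: B Finite_Cartesian_Product.mat_def)
      then have "jac y * u j = (\<Sum>l\<in>UNIV. (B ** jacm y) $ j $ l * u l)"
        by (simp add: if_distrib[of "\<lambda>x. x * _"] cong: if_cong)
      also have "\<dots> = (\<Sum>i\<in>UNIV. B $ j $ i * (\<Sum>l\<in>UNIV. jacm y $ i $ l * u l))"
        unfolding matrix_matrix_mult_def
        by (simp add: sum_distrib_left sum_distrib_right mult.assoc) (rule sum.swap)
      also have "\<dots> \<in> ideal_add K q"
        by (intro is_ideal_sum[OF is_ideal_add[OF K]] DQ(3) J)
      finally show "jac y * u j \<in> ideal_add K q" .
    qed
    then show ?case using ideal_add_step[OF K u] by blast
  qed
  then have "s j - t j \<in> ideal_add K (q ^ k)" for k
    using ideal_add_power_mono[OF K, of k "Suc k"] by simp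
  then show ?thesis by (rule sep)
qed

text \<open>Newton's iteration with the Jacobian frozen at y. As every iterate agrees with y mod q,
  each step still gains one power of q; completeness supplies the limit.\<close>

lemma torus_factor_exists:
  fixes y :: "'a::comm_ring_1^'n^'n" and z :: "nat \<Rightarrow> 'a"
  assumes K: "is_ideal K"
    and complete: "\<And>f. (\<And>k. f (Suc k) - f k \<in> ideal_add K (q ^ k)) \<Longrightarrow> \<exists>l. \<forall>k. l - f k \<in> ideal_add K (q ^ k)"
    and sep: "\<And>a. (\<And>k. a \<in> ideal_add K (q ^ k)) \<Longrightarrow> a \<in> K"
    and unit: "v * jac y - 1 \<in> K"
    and z: "\<And>i. i \<in> {1..CARD('n)} \<Longrightarrow> z i - cp i y \<in> ideal_add K q"
  shows "\<exists>t. \<forall>i\<in>{1..CARD('n)}. cp i (\<chi> a b. y $ a $ b * (1 + q * t b)) - z i \<in> K"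
proof -
  note DK = is_idealD[OF K] and DQ = is_idealD[OF is_ideal_add[OF K, of q]]
  define Y where "Y t = (\<chi> a b. y $ a $ b * (1 + q * t b))" for t
  let ?A = "\<lambda>k t. \<forall>i::'n. cp (idx i) (Y t) - z (idx i) \<in> ideal_add K (q ^ Suc k)"
  have step: "\<exists>t'. ?A (Suc k) t' \<and> (\<forall>j. t' j - t j \<in> ideal_add K (q ^ k))" if A: "?A k t" for k t
  proof -
    obtain e where e: "\<And>i::'n. cp (idx i) (Y t) - z (idx i) - q ^ Suc k * e i \<in> K"
      using A unfolding ideal_add_iff by metis
    \<comment> \<open>This is minus the inverse Jacobian applied to the current error e, the inverse
      being v times the adjugate.\<close>
    define u where "u j = - v * (\<Sum>i\<in>UNIV. adjugate (jacm y) $ j $ i * e i)" for j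
    \<comment> \<open>The factor is s = 1 + q t, so a correction of t by q^k moves s by q^(k+1), the
      order of the current error.\<close>
    define t' where "t' j = t j + q ^ k * u j" for j
    have u: "(\<Sum>j\<in>UNIV. u j * dcp (idx i) y (colm y j)) + e i \<in> K" for i
    proof -
      have "(\<Sum>j\<in>UNIV. u j * dcp (idx i) y (colm y j))
          = - v * (\<Sum>j\<in>UNIV. \<Sum>l\<in>UNIV. jacm y $ i $ j * adjugate (jacm y) $ j $ l * e l)"
        by (simp add: u_def jacm_def sum_distrib_left sum_distrib_right mult_ac)
      also have "(\<Sum>j\<in>UNIV. \<Sum>l\<in>UNIV. jacm y $ i $ j * adjugate (jacm y) $ j $ l * e l)
          = (\<Sum>l\<in>UNIV. (jacm y ** adjugate (jacm y)) $ i $ l * e l)"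
        by (subst sum.swap) (simp add: matrix_matrix_mult_def sum_distrib_right)
      also have "\<dots> = jac y * e i"
        by (simp add: mult_adjugate jac_def Finite_Cartesian_Product.mat_def if_distrib[of "\<lambda>x. x * _"] cong: if_cong)
      finally have "(\<Sum>j\<in>UNIV. u j * dcp (idx i) y (colm y j)) + e i = - ((v * jac y - 1) * e i)"
        by (simp add: algebra_simps)
      then show ?thesis using DK(5)[OF DK(4)[OF unit]] by metis
    qed
    have Yy: "Y t $ a $ b - y $ a $ b \<in> ideal_add K q" for a b
      using ideal_addI[OF DK(1), of q "y $ a $ b * t b"] by (simp add: Y_def algebra_simps)
    have "?A (Suc k) t'"
    proof
      fix i :: 'n
      obtain e' where e': "e' \<in> ideal_add K q"
        "cp (idx i) (\<chi> a b. Y t $ a $ b + q ^ Suc k * (y $ a $ b * u b))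
          = cp (idx i) (Y t) + q ^ Suc k * (\<Sum>j\<in>UNIV. u j * dcp (idx i) y (colm y j)) + q ^ Suc k * e'"
        using cp_perturb[OF K Yy] by blast
      have "(\<chi> a b. Y t $ a $ b + q ^ Suc k * (y $ a $ b * u b)) = Y t'"
        by (rule matrix_eqI) (simp add: Y_def t'_def algebra_simps)
      then have "cp (idx i) (Y t') - z (idx i) - q ^ Suc k * e'
          = (cp (idx i) (Y t) - z (idx i) - q ^ Suc k * e i)
            + q ^ Suc k * ((\<Sum>j\<in>UNIV. u j * dcp (idx i) y (colm y j)) + e i)"
        using e'(2) by (simp add: algebra_simps)
      also have "\<dots> \<in> K" using DK(2)[OF e DK(3)[OF u]] .
      finally show "cp (idx i) (Y t') - z (idx i) \<in> ideal_add K (q ^ Suc (Suc k))"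
        by (rule ideal_add_step[OF K _ e'(1)])
    qed
    moreover have "t' j - t j \<in> ideal_add K (q ^ k)" for j
      using ideal_addI[OF DK(1), of "q ^ k" "u j"] by (simp add: t'_def)
    ultimately show ?thesis by blast
  qed
  have "\<exists>f. \<forall>k. ?A k (f k) \<and> (\<forall>j. f (Suc k) j - f k j \<in> ideal_add K (q ^ k))"
  proof (rule dependent_nat_choice)
    \<comment> \<open>The iteration starts at t = 0, where the error is that of y itself, assumed to
      be divisible by q.\<close>
    have "Y (\<lambda>_. 0) = y" by (rule matrix_eqI) (simp add: Y_def)
    then show "\<exists>t. ?A 0 t" using DQ(5)[OF z[OF idx_mem]] by (intro exI[of _ "\<lambda>_. 0"]) simp
  qed (use step in blast)
  then obtain f where f: "\<And>k. ?A k (f k)" "\<And>k j. f (Suc k) j - f k j \<in> ideal_add K (q ^ k)" by blast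
  then have "\<forall>j. \<exists>l. \<forall>k. l - f k j \<in> ideal_add K (q ^ k)" using complete[of "\<lambda>k. f k _"] by blast
  then obtain t where t: "\<And>j k. t j - f k j \<in> ideal_add K (q ^ k)" by metis
  have "cp (idx i) (Y t) - z (idx i) \<in> K" for i :: 'n
  proof (rule sep)
    fix k
    note Dk = is_idealD[OF is_ideal_add[OF K, of "q ^ k"]]
    interpret R: ring_rel "cong_mod (ideal_add K (q ^ k))" by (rule ring_rel_cong_mod[OF is_ideal_add[OF K]])
    have "cong_mod (ideal_add K (q ^ k)) (cp (idx i) (Y t)) (cp (idx i) (Y (f k)))"
    proof (rule R.cp)
      show "cong_mod (ideal_add K (q ^ k)) (Y t $ a $ b) (Y (f k) $ a $ b)" for a b
        using Dk(3)[OF t[of b k], of "y $ a $ b * q"] by (simp add: cong_mod_def Y_def algebra_simps)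
    qed
    moreover have "cp (idx i) (Y (f k)) - z (idx i) \<in> ideal_add K (q ^ k)"
      using ideal_add_power_mono[OF K, of k "Suc k"] f(1) by simp
    ultimately show "cp (idx i) (Y t) - z (idx i) \<in> ideal_add K (q ^ k)"
      using Dk(2) unfolding cong_mod_def by fastforce
  qed
  then show ?thesis unfolding ball_idx Y_def by blast
qed

subsection \<open>The Jacobian at diagonal matrices\<close>

definition diagm :: "('n::finite \<Rightarrow> 'a::comm_ring_1) \<Rightarrow> 'a^'n^'n" where
  "diagm x = (\<chi> i j. if i = j then x i else 0)"

lemma det_charmat_diagm: "Determinants.det (charmat (diagm x)) = (\<Prod>l\<in>UNIV. [:- x l, 1:])"
  by (subst det_diagonal) (auto simp: charmat_def diagm_def)

text \<open>For diagonal matrices the pencil is diagonal with factors s - x_l for l \<noteq> j and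
  (s - x_j) - t x_j, so the coefficient of t of its determinant replaces the j-th factor by
  -x_j.\<close>

lemma dcp_diagm: "dcp i (diagm x) (colm (diagm x) j)
    = (-1) ^ i * Polynomial.coeff ([:- x j:] * (\<Prod>l\<in>UNIV - {j}. [:- x l, 1:])) (CARD('n) - i)"
  for x :: "'n::finite \<Rightarrow> 'a::comm_ring_1"
proof -
  have "ddet (charmat (diagm x)) (cmat (- colm (diagm x) j))
      = Polynomial.coeff (\<Prod>l\<in>UNIV. [:[:- x l, 1:], if l = j then [:- x j:] else 0:]) 1"
    unfolding coeff_1_det_pencil[symmetric]
    by (subst det_diagonal) (auto simp: pencil_def charmat_def diagm_def cmat_def colm_def intro!: arg_cong[of _ _ "\<lambda>f. Polynomial.coeff f (Suc 0)"] prod.cong)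
  also have "\<dots> = (\<Sum>k\<in>UNIV. if k = j then [:- x j:] * (\<Prod>l\<in>UNIV - {j}. [:- x l, 1:]) else 0)"
    unfolding coeff_1_prod[OF finite] by (rule sum.cong) auto
  finally show ?thesis by (simp add: dcp_def)
qed

lemma degree_prod_linear: "Polynomial.degree (\<Prod>l\<in>L. [:- x l, 1:] :: 'a::comm_ring_1 poly) \<le> card L"
proof (induction L rule: infinite_finite_induct)
  case (insert a L)
  have "Polynomial.degree ([:- x a, 1:] * (\<Prod>l\<in>L. [:- x l, 1:])) \<le> 1 + Polynomial.degree (\<Prod>l\<in>L. [:- x l, 1:])"
    by (rule order.trans[OF degree_mult_le]) simp
  then show ?case using insert by simp
qed auto

lemma poly_eq_sum_lt:
  fixes f :: "'a::comm_ring_1 poly"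
  assumes "Polynomial.degree f < n"
  shows "Polynomial.poly f a = (\<Sum>k<n. Polynomial.coeff f k * a ^ k)"
proof -
  have "(\<Sum>k\<le>Polynomial.degree f. Polynomial.coeff f k * a ^ k) = (\<Sum>k<n. Polynomial.coeff f k * a ^ k)"
    by (rule sum.mono_neutral_left) (use assms in \<open>auto simp: coeff_eq_0\<close>)
  then show ?thesis by (simp add: poly_altdef)
qed

lemma sum_idx: "(\<Sum>i\<in>(UNIV :: 'n::finite set). f (CARD('n) - idx i)) = (\<Sum>k<CARD('n). f k)"
proof -
  have "(\<Sum>i\<in>(UNIV :: 'n set). f (CARD('n) - idx i)) = (\<Sum>i\<in>{1..CARD('n)}. f (CARD('n) - i))"
    by (rule sum.reindex_bij_betw[OF bij_idx])
  also have "\<dots> = (\<Sum>k<CARD('n). f k)"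
    by (rule sum.reindex_bij_witness[of _ "\<lambda>k. CARD('n) - k" "\<lambda>k. CARD('n) - k"]) auto
  finally show ?thesis .
qed

text \<open>A Vandermonde matrix adapted to \<open>cp\<close>: the signs and the exponents n - i are
  chosen so that row a, applied to the signed coefficients of a polynomial of degree below n,
  evaluates it at x_a.\<close>

definition vdm :: "('n::finite \<Rightarrow> 'a::comm_ring_1) \<Rightarrow> 'a^'n^'n" where
  "vdm x = (\<chi> a i. (-1) ^ idx i * x a ^ (CARD('n) - idx i))"

text \<open>Column j of the Jacobian holds the signed coefficients of g_j = -x_j times the product
  of s - x_l over l \<noteq> j. Evaluating at x_a gives 0 unless a = j, so the matrix product is
  diagonal. The Vandermonde factor is kept because it cannot be cancelled in a general ring.\<close>

lemma det_vdm_mult_jac_diagm: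
  "Determinants.det (vdm x) * jac (diagm x) = (\<Prod>j\<in>UNIV. - x j * (\<Prod>l\<in>UNIV - {j}. x j - x l))"
  for x :: "'n::finite \<Rightarrow> 'a::comm_ring_1"
proof -
  define g where "g j = [:- x j:] * (\<Prod>l\<in>UNIV - {j}. [:- x l, 1:])" for j
  have deg: "Polynomial.degree (g j) < CARD('n)" for j
  proof -
    have "Polynomial.degree (g j) \<le> 0 + (card (UNIV :: 'n set) - 1)"
      unfolding g_def by (rule order.trans[OF degree_mult_le] add_mono)+
        (use degree_prod_linear[of x "UNIV - {j}"] in simp_all)
    moreover have "0 < CARD('n)" by simp
    ultimately show ?thesis by linarith
  qed
  have pg: "Polynomial.poly (g j) (x a) = (if a = j then - x j * (\<Prod>l\<in>UNIV - {j}. x j - x l) else 0)" for a j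
  proof (cases "a = j")
    case False
    then have "(\<Prod>l\<in>UNIV - {j}. x a - x l) = 0" by (intro prod_zero) auto
    then show ?thesis using False by (simp add: g_def poly_prod algebra_simps)
  qed (simp add: g_def poly_prod algebra_simps)
  have "(vdm x ** jacm (diagm x)) $ a $ j = (if a = j then - x j * (\<Prod>l\<in>UNIV - {j}. x j - x l) else 0)" for a j
  proof -
    have "(vdm x ** jacm (diagm x)) $ a $ j
       = (\<Sum>i\<in>(UNIV :: 'n set). ((-1) ^ idx i * (-1) ^ idx i) * (Polynomial.coeff (g j) (CARD('n) - idx i) * x a ^ (CARD('n) - idx i)))"
      by (simp add: vdm_def jacm_def matrix_matrix_mult_def dcp_diagm g_def mult_ac)
    also have "\<dots> = (\<Sum>i\<in>(UNIV :: 'n set). Polynomial.coeff (g j) (CARD('n) - idx i) * x a ^ (CARD('n) - idx i))"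
      by (simp flip: power_mult_distrib)
    also have "\<dots> = Polynomial.poly (g j) (x a)"
      by (simp only: sum_idx[of "\<lambda>k. Polynomial.coeff (g j) k * x a ^ k"] poly_eq_sum_lt[OF deg])
    finally show ?thesis by (simp only: pg)
  qed
  then have "Determinants.det (vdm x ** jacm (diagm x)) = (\<Prod>j\<in>UNIV. - x j * (\<Prod>l\<in>UNIV - {j}. x j - x l))"
    by (subst det_diagonal) simp_all
  then show ?thesis by (simp add: det_mul jac_def)
qed

text \<open>The polynomials g_i and g_j coincide, so two columns of the Jacobian agree. The product
  formula cannot give this, since the Vandermonde factor vanishes too.\<close>

lemma jac_diagm_eq_0:
  assumes "i \<noteq> j" "x i = x j"
  shows "jac (diagm x) = 0"
  unfolding jac_def
proof (rule Determinants.det_identical_columns[OF assms(1)])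
  have "(\<Prod>l\<in>UNIV - {i}. [:- x l, 1:]) = (\<Prod>l\<in>UNIV - {j}. [:- x l, 1:])"
    by (rule prod.reindex_bij_witness[of _ "\<lambda>l. if l = i then j else l" "\<lambda>l. if l = j then i else l"])
      (use assms in \<open>auto split: if_splits\<close>)
  then show "Finite_Cartesian_Product.column i (jacm (diagm x)) = Finite_Cartesian_Product.column j (jacm (diagm x))"
    using assms by (simp add: Finite_Cartesian_Product.column_def jacm_def dcp_diagm Finite_Cartesian_Product.vec_eq_iff)
qed

section \<open>Evaluation of polynomials, and p as a prime element of polynomial rings\<close>

section \<open>Homomorphisms from the ring of a type\<close>

lemma typ_ring_simps [simp]:
  "carrier typ_ring = UNIV" "mult typ_ring = times" "one typ_ring = 1" "zero typ_ring = 0" "add typ_ring = (+)"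
  by (auto simp: ring_of_type_algebra_def)

lemma finsum_typ_ring: "finsum typ_ring f A = sum f A"
proof (induction A rule: infinite_finite_induct)
  interpret cring "typ_ring :: 'a ring" by (rule cring_from_type_algebra)
  case (infinite A)
  then show ?case by (simp add: finsum_infinite)
next
  interpret cring "typ_ring :: 'a ring" by (rule cring_from_type_algebra)
  case empty
  show ?case by simp
next
  interpret cring "typ_ring :: 'a ring" by (rule cring_from_type_algebra)
  case (insert x A)
  then show ?case by simp
qed

lemma finprod_typ_ring: "finprod typ_ring f A = prod f A"
proof (induction A rule: infinite_finite_induct)
  interpret cring "typ_ring :: 'a ring" by (rule cring_from_type_algebra)
  case (infinite A)
  then show ?case by simp
next
  interpret cring "typ_ring :: 'a ring" by (rule cring_from_type_algebra)
  case empty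
  show ?case by simp
next
  interpret cring "typ_ring :: 'a ring" by (rule cring_from_type_algebra)
  case (insert x A)
  then show ?case by simp
qed

lemma pow_typ_ring: "a [^]\<^bsub>typ_ring\<^esub> (n::nat) = a ^ n"
  by (induction n) (simp_all add: nat_pow_def mult.commute)

text \<open>The bridge between the two styles of rings: a homomorphism from the ring of a type to a
  ring with a carrier, together with the translation of all operations.\<close>

locale type_hom = S: cring S for S (structure) +
  fixes h :: "'r::comm_ring_1 \<Rightarrow> 'a"
  assumes hom: "h \<in> Ring.ring_hom typ_ring S"
begin

lemma closed [simp, intro]: "h a \<in> carrier S"
  and add: "h (a + b) = h a \<oplus> h b"
  and mult: "h (a * b) = h a \<otimes> h b"
  and one: "h 1 = \<one>"
  using Ring.ring_hom_memE[OF hom] by auto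

lemma zero: "h 0 = \<zero>"
proof -
  have "h 0 \<oplus> h 0 = h 0 \<oplus> \<zero>" using add[of 0 0] by simp
  then show ?thesis using S.add.l_cancel by blast
qed

lemma uminus: "h (- a) = \<ominus> h a"
proof -
  have "h (- a) \<oplus> h a = \<zero>" using add[of "- a" a] by (simp add: zero)
  then show ?thesis using S.minus_equality by auto
qed

lemma diff: "h (a - b) = h a \<ominus> h b"
  using add[of a "- b"] by (simp add: uminus a_minus_def)

lemma power: "h (a ^ n) = h a [^] n"
  by (induction n) (simp_all add: one mult S.m_comm)

lemma sum: "h (sum f A) = (\<Oplus>x\<in>A. h (f x))"
  by (induction A rule: infinite_finite_induct) (auto simp: zero add S.finsum_infinite)

lemma prod: "h (prod f A) = (\<Otimes>x\<in>A. h (f x))"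
  by (induction A rule: infinite_finite_induct) (auto simp: one mult)

lemma eq_iff: "h a = h b \<longleftrightarrow> h (a - b) = \<zero>"
  by (simp add: diff)

lemma of_nat: "h (of_nat n) = [n] \<cdot> \<one>"
  by (induction n) (simp_all add: zero add one S.a_comm)

lemma of_nat_mult: "h (of_nat n * a) = [n] \<cdot> h a"
  by (induction n) (simp_all add: zero add algebra_simps S.a_comm)

lemma is_ideal_ker: "is_ideal {a. h a = \<zero>}"
  by (auto simp: is_ideal_def zero add mult)

lemma comp: "type_hom S (\<lambda>x. h (g x))" if "g \<in> Ring.ring_hom typ_ring typ_ring"
proof
  show "(\<lambda>x. h (g x)) \<in> Ring.ring_hom typ_ring S"
    using Ring.ring_hom_memE[OF that] by (intro Ring.ring_hom_memI) (auto simp: add mult one)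
qed

end

lemma type_hom_compI:
  assumes "type_hom S g" "cring T" "f \<in> Ring.ring_hom S T"
  shows "type_hom T (\<lambda>x. f (g x))"
proof -
  interpret g: type_hom S g by fact
  show ?thesis using Ring.ring_hom_memE[OF assms(3)] Ring.ring_hom_memE[OF g.hom]
    by (intro type_hom.intro assms type_hom_axioms.intro Ring.ring_hom_memI) (auto simp: g.add g.mult g.one)
qed

section \<open>Evaluation of polynomials\<close>

lemma single_as_mult: "Poly_Mapping.single m c = Const c * Poly_Mapping.single m 1"
  by (simp add: Const_def mult_single)

lemma single_power: "Poly_Mapping.single (Poly_Mapping.single v k) 1 = Var v ^ k"
proof (induction k)
  case (Suc k)
  have "Poly_Mapping.single (Poly_Mapping.single v (Suc k)) (1::'b)
      = Poly_Mapping.single (Poly_Mapping.single v 1) 1 * Poly_Mapping.single (Poly_Mapping.single v k) 1"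
    by (simp add: mult_single flip: single_add)
  then show ?case using Suc by (simp add: Var_def)
qed (simp add: Var_def)

lemma update_eq_add: "a \<notin> Poly_Mapping.keys f \<Longrightarrow> Poly_Mapping.update a b f = f + Poly_Mapping.single a b"
  by (rule poly_mapping_eqI)
    (auto simp: lookup_update lookup_add lookup_single when_def not_in_keys_iff_lookup_eq_zero)

lemma mpoly_induct [case_names Const Var add mult]:
  fixes f :: "('v, 'r::comm_ring_1) mpoly"
  assumes C: "\<And>c. Q (Const c)" and V: "\<And>v. Q (Var v)"
    and A: "\<And>f g. Q f \<Longrightarrow> Q g \<Longrightarrow> Q (f + g)" and M: "\<And>f g. Q f \<Longrightarrow> Q g \<Longrightarrow> Q (f * g)"
  shows "Q f"
proof -
  have one: "Q 1" using C[of 1] by (simp add: Const_def)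
  have zero: "Q 0" using C[of 0] by (simp add: Const_def)
  have pow: "Q (Var v ^ k)" for v k by (induction k) (auto intro: one V M)
  have mon: "Q (Poly_Mapping.single m 1)" for m :: "'v \<Rightarrow>\<^sub>0 nat"
  proof (induction m rule: update_induct)
    case (update f a b)
    have "Poly_Mapping.single (Poly_Mapping.update a b f) (1::'r)
      = Poly_Mapping.single f 1 * Poly_Mapping.single (Poly_Mapping.single a b) 1"
      using update by (simp add: update_eq_add mult_single)
    then show ?case using update by (simp add: single_power M pow)
  qed (use one in simp)
  show ?thesis
  proof (induction f rule: update_induct)
    case (update f a b)
    then show ?case
      by (simp add: update_eq_add single_as_mult[of a b]) (intro A M C mon)
  qed (rule zero)
qed

lemma poly_mapping_sum_single: "f = (\<Sum>m\<in>Poly_Mapping.keys f. Poly_Mapping.single m (Poly_Mapping.lookup f m))"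
  by (rule poly_mapping_eqI)
    (auto simp: lookup_sum lookup_single when_def not_in_keys_iff_lookup_eq_zero)

text \<open>Evaluation at a point of a ring with a carrier; \<open>subst\<close> is the special case
  in which the target is the ring of a type.\<close>

definition ev :: "('s, 'm) ring_scheme \<Rightarrow> ('r \<Rightarrow> 's) \<Rightarrow> ('v \<Rightarrow> 's) \<Rightarrow> ('v, 'r::comm_ring_1) mpoly \<Rightarrow> 's" where
  "ev S \<kappa> y f = (\<Oplus>\<^bsub>S\<^esub>m\<in>Poly_Mapping.keys f. \<kappa> (Poly_Mapping.lookup f m) \<otimes>\<^bsub>S\<^esub>
     (\<Otimes>\<^bsub>S\<^esub>v\<in>Poly_Mapping.keys m. y v [^]\<^bsub>S\<^esub> Poly_Mapping.lookup m v))"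

lemma subst_eq_ev: "subst y f = ev typ_ring Const y f"
  by (simp add: subst_def ev_def finsum_typ_ring finprod_typ_ring pow_typ_ring)

context type_hom
begin

context
  fixes y :: "'v \<Rightarrow> 'a"
  assumes y: "\<And>v. y v \<in> carrier S"
begin

definition mono :: "('v \<Rightarrow>\<^sub>0 nat) \<Rightarrow> 'a" where
  "mono m = (\<Otimes>v\<in>Poly_Mapping.keys m. y v [^] Poly_Mapping.lookup m v)"

lemma mono_closed [simp]: "mono m \<in> carrier S"
  using y by (simp add: mono_def)

lemma mono_superset:
  assumes "finite L" "Poly_Mapping.keys m \<subseteq> L"
  shows "mono m = (\<Otimes>v\<in>L. y v [^] Poly_Mapping.lookup m v)"
  unfolding mono_def using assms y
  by (intro S.finprod_mono_neutral_cong_left) (auto simp: not_in_keys_iff_lookup_eq_zero)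

lemma mono_add: "mono (m + m') = mono m \<otimes> mono m'"
proof -
  let ?L = "Poly_Mapping.keys m \<union> Poly_Mapping.keys m'"
  have k: "Poly_Mapping.keys (m + m') \<subseteq> ?L" by (rule keys_add)
  show ?thesis
    using y by (simp add: mono_superset[of ?L] k lookup_add S.nat_pow_mult[symmetric] S.finprod_multf Pi_def)
qed

lemma mono_zero: "mono 0 = \<one>"
  by (simp add: mono_def)

lemma ev_superset:
  assumes "finite L" "Poly_Mapping.keys f \<subseteq> L"
  shows "ev S h y f = (\<Oplus>m\<in>L. h (Poly_Mapping.lookup f m) \<otimes> mono m)"
  unfolding ev_def mono_def[symmetric] using assms
  by (intro S.add.finprod_mono_neutral_cong_left) (auto simp: not_in_keys_iff_lookup_eq_zero zero)

lemma ev_closed [simp]: "ev S h y f \<in> carrier S"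
  unfolding ev_def mono_def[symmetric] by (rule S.finsum_closed) auto

lemma ev_add: "ev S h y (f + g) = ev S h y f \<oplus> ev S h y g"
proof -
  let ?L = "Poly_Mapping.keys f \<union> Poly_Mapping.keys g"
  have k: "Poly_Mapping.keys (f + g) \<subseteq> ?L" by (rule keys_add)
  show ?thesis
    by (simp add: ev_superset[of ?L] k lookup_add add S.l_distr S.finsum_addf Pi_def)
qed

lemma ev_single: "ev S h y (Poly_Mapping.single m c) = h c \<otimes> mono m"
  by (simp add: ev_superset[of "{m}"])

lemma ev_0: "ev S h y 0 = \<zero>"
  by (simp add: ev_def)

lemma ev_mult: "ev S h y (f * g) = ev S h y f \<otimes> ev S h y g"
proof (induction f rule: update_induct)
  case (update f a b)
  have "ev S h y (Poly_Mapping.single a b * g) = ev S h y (Poly_Mapping.single a b) \<otimes> ev S h y g"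
  proof (induction g rule: update_induct)
    case (update g c d)
    have 1: "ev S h y (Poly_Mapping.single a b * Poly_Mapping.single c d) =
        ev S h y (Poly_Mapping.single a b) \<otimes> ev S h y (Poly_Mapping.single c d)"
      by (simp add: mult_single ev_single mult mono_add S.m_ac)
    show ?case using update 1 by (simp add: update_eq_add ring_distribs ev_add S.r_distr)
  qed (simp add: ev_0)
  then show ?case using update by (simp add: update_eq_add ring_distribs ev_add S.l_distr)
qed (simp add: ev_0)

lemma ev_Const: "ev S h y (Const c) = h c"
  by (simp add: Const_def ev_single mono_zero)

lemma ev_Var: "ev S h y (Var v) = y v"
  using y by (simp add: Var_def ev_single one) (simp add: mono_def)

lemma type_hom_ev: "type_hom S (ev S h y)"
proof
  have "ev S h y 1 = \<one>" using ev_Const[of 1] by (simp add: Const_def one)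
  then show "ev S h y \<in> Ring.ring_hom typ_ring S"
    by (intro Ring.ring_hom_memI) (auto simp: ev_add ev_mult)
qed

end
end

lemma type_hom_eqI:
  assumes "type_hom S g" "type_hom S h"
    and C: "\<And>c. g (Const c) = h (Const c)" and V: "\<And>v. g (Var v) = h (Var v)"
  shows "g f = h f"
proof -
  interpret g: type_hom S g by fact
  interpret h: type_hom S h by fact
  show ?thesis
    by (induction f rule: mpoly_induct) (auto simp: C V g.add h.add g.mult h.mult)
qed

lemma type_hom_Const: "type_hom typ_ring (Const :: 'r::comm_ring_1 \<Rightarrow> ('v, 'r) mpoly)"
  by (intro type_hom.intro cring_from_type_algebra type_hom_axioms.intro Ring.ring_hom_memI)
    (auto simp: Const_def single_add mult_single)

lemma type_hom_subst: "type_hom typ_ring (subst y)"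
  using type_hom.type_hom_ev[OF type_hom_Const, of y] unfolding subst_eq_ev[abs_def] by simp

lemma subst_Const [simp]: "subst y (Const c) = Const c"
  by (simp add: subst_eq_ev type_hom.ev_Const[OF type_hom_Const])

lemma subst_Var [simp]: "subst y (Var v) = y v"
  by (simp add: subst_eq_ev type_hom.ev_Var[OF type_hom_Const])

lemma subst_simps:
  "subst y (f + g) = subst y f + subst y g" "subst y (f * g) = subst y f * subst y g"
  "subst y 0 = 0" "subst y 1 = 1" "subst y (- f) = - subst y f" "subst y (f - g) = subst y f - subst y g"
  "subst y (f ^ n) = subst y f ^ n" "subst y (of_nat n) = of_nat n"
  "subst y (sum F A) = (\<Sum>x\<in>A. subst y (F x))"
proof -
  interpret type_hom typ_ring "subst y" by (rule type_hom_subst)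
  have u: "subst y (- f) = - subst y f" for f
    using add[of "- f" f] zero by (simp add: eq_neg_iff_add_eq_0)
  show "subst y (- f) = - subst y f" by (rule u)
  show "subst y (f - g) = subst y f - subst y g" using add[of f "- g"] u by simp
  show "subst y (of_nat n) = of_nat n" by (induction n) (use add zero one in auto)
qed (use type_hom.add[OF type_hom_subst] type_hom.mult[OF type_hom_subst] type_hom.one[OF type_hom_subst]
    type_hom.zero[OF type_hom_subst] type_hom.power[OF type_hom_subst] type_hom.sum[OF type_hom_subst]
    in \<open>simp_all add: pow_typ_ring finsum_typ_ring\<close>)

section \<open>Primality of constants\<close>

lemma poly_mapping_mult_sum:
  "f * g = (\<Sum>k\<in>Poly_Mapping.keys f. \<Sum>l\<in>Poly_Mapping.keys g.
     Poly_Mapping.single (k + l) (Poly_Mapping.lookup f k * Poly_Mapping.lookup g l))"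
  by (subst poly_mapping_sum_single[of f], subst poly_mapping_sum_single[of g])
    (simp add: sum_product mult_single)

text \<open>Gauss' argument. Take the largest exponents k and l, for the order pulled back along
  \<iota>, whose coefficients in f and g lie outside Q. In the coefficient of the product at k + l
  every other term has a factor in Q. The additive injection \<iota> only serves to order the
  exponents.\<close>

lemma lookup_mult_notin_prime:
  fixes f g :: "'k::comm_monoid_add \<Rightarrow>\<^sub>0 'r::comm_ring_1"
    and \<iota> :: "'k \<Rightarrow> 'l::{linorder, ordered_cancel_comm_monoid_add}"
  assumes \<iota>: "inj \<iota>" "\<And>a b. \<iota> (a + b) = \<iota> a + \<iota> b"
    and Q: "is_ideal Q" "\<And>a b. a * b \<in> Q \<Longrightarrow> a \<in> Q \<or> b \<in> Q"
    and f: "Poly_Mapping.lookup f k0 \<notin> Q" and g: "Poly_Mapping.lookup g l0 \<notin> Q"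
  shows "\<exists>m. Poly_Mapping.lookup (f * g) m \<notin> Q"
proof -
  note D = is_idealD[OF Q(1)]
  have mx: "\<exists>k. Poly_Mapping.lookup f k \<notin> Q \<and> (\<forall>k'. Poly_Mapping.lookup f k' \<notin> Q \<longrightarrow> \<iota> k' \<le> \<iota> k)"
    if "Poly_Mapping.lookup f k0 \<notin> Q" for f :: "'k \<Rightarrow>\<^sub>0 'r" and k0
  proof -
    let ?A = "{k. Poly_Mapping.lookup f k \<notin> Q}"
    have "?A \<subseteq> Poly_Mapping.keys f" using D(1) by (auto simp: in_keys_iff)
    then have fin: "finite (\<iota> ` ?A)" using finite_subset finite_keys by blast
    have ne: "\<iota> ` ?A \<noteq> {}" using that by auto
    obtain k where "k \<in> ?A" "\<iota> k = Max (\<iota> ` ?A)" using Max_in[OF fin ne] by auto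
    then show ?thesis using Max_ge[OF fin] by (intro exI[of _ k]) auto
  qed
  obtain k where k: "Poly_Mapping.lookup f k \<notin> Q" "\<And>k'. Poly_Mapping.lookup f k' \<notin> Q \<Longrightarrow> \<iota> k' \<le> \<iota> k"
    using mx[OF f] by blast
  obtain l where l: "Poly_Mapping.lookup g l \<notin> Q" "\<And>l'. Poly_Mapping.lookup g l' \<notin> Q \<Longrightarrow> \<iota> l' \<le> \<iota> l"
    using mx[OF g] by blast
  let ?c = "\<lambda>k' l'. Poly_Mapping.lookup f k' * Poly_Mapping.lookup g l' when k' + l' = k + l"
  have kl: "k \<in> Poly_Mapping.keys f" "l \<in> Poly_Mapping.keys g" using k l D(1) by (auto simp: in_keys_iff)
  have in_Q: "?c k' l' \<in> Q" if "(k', l') \<noteq> (k, l)" for k' l'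
  proof (rule ccontr)
    assume c: "?c k' l' \<notin> Q"
    then have e: "k' + l' = k + l" using D(1) by (auto simp: when_def split: if_splits)
    with c have "Poly_Mapping.lookup f k' \<notin> Q" "Poly_Mapping.lookup g l' \<notin> Q"
      using D(3,4) by (auto simp: when_def)
    then have le: "\<iota> k' \<le> \<iota> k" "\<iota> l' \<le> \<iota> l" using k l by auto
    have "\<iota> k' + \<iota> l' = \<iota> k + \<iota> l" using e \<iota>(2) by metis
    \<comment> \<open>Two inequalities with equal sums are equalities, by cancellation in the
      ordered monoid.\<close>
    then have "\<iota> k' = \<iota> k" "\<iota> l' = \<iota> l"
      using le add_less_le_mono[of "\<iota> k'" "\<iota> k" "\<iota> l'" "\<iota> l"] add_le_less_mono[of "\<iota> k'" "\<iota> k" "\<iota> l'" "\<iota> l"]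
      by (metis order_less_le less_irrefl)+
    then show False using that \<iota>(1) by (auto dest: injD)
  qed
  have "Poly_Mapping.lookup (f * g) (k + l) = (\<Sum>(k', l')\<in>Poly_Mapping.keys f \<times> Poly_Mapping.keys g. ?c k' l')"
    unfolding poly_mapping_mult_sum[of f g] by (simp add: lookup_sum lookup_single sum.cartesian_product case_prod_unfold)
  also have "\<dots> = ?c k l + (\<Sum>(k', l')\<in>Poly_Mapping.keys f \<times> Poly_Mapping.keys g - {(k, l)}. ?c k' l')"
    using kl by (subst sum.remove[of _ "(k, l)"]) auto
  finally have e: "Poly_Mapping.lookup (f * g) (k + l) = Poly_Mapping.lookup f k * Poly_Mapping.lookup g l
      + (\<Sum>(k', l')\<in>Poly_Mapping.keys f \<times> Poly_Mapping.keys g - {(k, l)}. ?c k' l')" by simp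
  have r: "(\<Sum>(k', l')\<in>Poly_Mapping.keys f \<times> Poly_Mapping.keys g - {(k, l)}. ?c k' l') \<in> Q"
    by (rule is_ideal_sum[OF Q(1)]) (use in_Q in auto)
  have "Poly_Mapping.lookup (f * g) (k + l) \<notin> Q"
  proof
    assume "Poly_Mapping.lookup (f * g) (k + l) \<in> Q"
    from D(6)[OF this r] have "Poly_Mapping.lookup f k * Poly_Mapping.lookup g l \<in> Q" by (simp add: e)
    then show False using Q(2) k l by blast
  qed
  then show ?thesis by blast
qed

lemma lookup_of_nat_mult: "Poly_Mapping.lookup (of_nat p * f) m = of_nat p * Poly_Mapping.lookup f m"
  for f :: "'k::comm_monoid_add \<Rightarrow>\<^sub>0 'r::comm_ring_1"
  by (induction p) (simp_all add: algebra_simps lookup_add)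

lemma of_nat_dvd_poly_mapping_iff:
  fixes f :: "'k::comm_monoid_add \<Rightarrow>\<^sub>0 'r::comm_ring_1"
  shows "of_nat p dvd f \<longleftrightarrow> (\<forall>m. of_nat p dvd Poly_Mapping.lookup f m)"
proof
  assume "\<forall>m. of_nat p dvd Poly_Mapping.lookup f m"
  then obtain c where c: "\<And>m. Poly_Mapping.lookup f m = of_nat p * c m" unfolding dvd_def by metis
  have "Poly_Mapping.single m (of_nat p * c m) = of_nat p * Poly_Mapping.single m (c m)" for m
    by (rule poly_mapping_eqI) (simp add: lookup_of_nat_mult lookup_single when_def)
  then have "f = of_nat p * (\<Sum>m\<in>Poly_Mapping.keys f. Poly_Mapping.single m (c m))"
    by (subst poly_mapping_sum_single) (simp add: c sum_distrib_left)
  then show "of_nat p dvd f" by (metis dvd_triv_left)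
qed (auto simp: lookup_of_nat_mult)

lemma of_nat_cancel_poly_mapping:
  fixes f :: "'k::comm_monoid_add \<Rightarrow>\<^sub>0 'r::idom"
  assumes "of_nat p \<noteq> (0::'r)" "of_nat p * f = 0"
  shows "f = 0"
proof (rule poly_mapping_eqI)
  show "Poly_Mapping.lookup f k = Poly_Mapping.lookup 0 k" for k
    using assms lookup_of_nat_mult[of p f k] by simp
qed

text \<open>The constant p is a nonzero prime element of the coefficient ring.\<close>

definition prime_const :: "'r::comm_ring_1 itself \<Rightarrow> nat \<Rightarrow> bool" where
  "prime_const _ p \<longleftrightarrow> of_nat p \<noteq> (0::'r) \<and> \<not> of_nat p dvd (1::'r)
     \<and> (\<forall>a b :: 'r. of_nat p dvd a * b \<longrightarrow> of_nat p dvd a \<or> of_nat p dvd b)"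

text \<open>Exponents may be natural numbers or integers, so the statement serves for polynomials
  and for Laurent polynomials. Numbering the finitely many variables by natural numbers yields a
  linear order on exponents that is compatible with addition.\<close>

lemma prime_const_dvd_mult:
  fixes f g :: "('v::finite \<Rightarrow>\<^sub>0 'e::linordered_semidom) \<Rightarrow>\<^sub>0 'r::comm_ring_1"
  assumes p: "prime_const TYPE('r) p" and d: "of_nat p dvd f * g"
  shows "of_nat p dvd f \<or> of_nat p dvd g"
proof (rule ccontr)
  assume n: "\<not> ?thesis"
  obtain e :: "'v \<Rightarrow> nat" where e: "inj e" using finite_imp_inj_to_nat_seg[of "UNIV :: 'v set"] by auto
  define \<iota> :: "('v \<Rightarrow>\<^sub>0 'e) \<Rightarrow> (nat \<Rightarrow>\<^sub>0 'e)"
    where "\<iota> m = (\<Sum>v\<in>UNIV. Poly_Mapping.single (e v) (Poly_Mapping.lookup m v))" for m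
  have l: "Poly_Mapping.lookup (\<iota> m) (e v) = Poly_Mapping.lookup m v" for m v
  proof -
    have "Poly_Mapping.lookup (\<iota> m) (e v) = (\<Sum>w\<in>UNIV. if w = v then Poly_Mapping.lookup m w else 0)"
      unfolding \<iota>_def lookup_sum by (rule sum.cong) (use e in \<open>auto simp: lookup_single when_def dest: injD\<close>)
    then show ?thesis by simp
  qed
  have inj: "inj \<iota>" by (rule injI, rule poly_mapping_eqI) (metis l)
  have add: "\<iota> (a + b) = \<iota> a + \<iota> b" for a b
    by (simp add: \<iota>_def lookup_add single_add sum.distrib)
  let ?Q = "{a :: 'r. of_nat p dvd a}"
  have Q: "is_ideal ?Q" by (auto simp: is_ideal_def)
  have Q': "a \<in> ?Q \<or> b \<in> ?Q" if "a * b \<in> ?Q" for a b using p that by (auto simp: prime_const_def)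
  obtain k l where "Poly_Mapping.lookup f k \<notin> ?Q" "Poly_Mapping.lookup g l \<notin> ?Q"
    using n unfolding of_nat_dvd_poly_mapping_iff by auto
  from lookup_mult_notin_prime[of \<iota>, OF inj add Q Q' this] d show False
    unfolding of_nat_dvd_poly_mapping_iff by auto
qed

section \<open>Germs, sections and p-adic properties of the completed structure sheaf\<close>

section \<open>Ideals and primes of the ring of a type\<close>

lemma ideal_typ_ring_iff: "ideal I typ_ring \<longleftrightarrow> is_ideal I"
proof
  assume "ideal I typ_ring"
  then interpret ideal I "typ_ring :: 'a ring" .
  have "0 \<in> I" using additive_subgroup.zero_closed[OF is_additive_subgroup] by simp
  then show "is_ideal I"
    using additive_subgroup.a_closed[OF is_additive_subgroup] I_l_closed by (auto simp: is_ideal_def)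
next
  assume I: "is_ideal I"
  interpret cring "typ_ring :: 'a ring" by (rule cring_from_type_algebra)
  have "inv\<^bsub>add_monoid typ_ring\<^esub> a = - a" for a :: 'a
    using minus_equality[of "- a" a] by (simp add: a_inv_def)
  then have "subgroup I (add_monoid typ_ring)"
    using is_idealD[OF I] by (intro subgroup.intro) auto
  then show "ideal I typ_ring"
    using is_idealD[OF I] by (intro idealI ring_axioms) auto
qed

definition is_prime :: "'a::comm_ring_1 set \<Rightarrow> bool" where
  "is_prime P \<longleftrightarrow> is_ideal P \<and> 1 \<notin> P \<and> (\<forall>a b. a * b \<in> P \<longrightarrow> a \<in> P \<or> b \<in> P)"

lemma primeideal_typ_ring_iff: "primeideal P typ_ring \<longleftrightarrow> is_prime P"
proof
  assume "primeideal P typ_ring"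
  then interpret primeideal P "typ_ring :: 'a ring" .
  have i: "is_ideal P" using ideal_typ_ring_iff is_ideal by blast
  moreover have "1 \<notin> P" using I_notcarr is_idealD(3)[OF i, of 1] by auto
  ultimately show "is_prime P" using I_prime by (auto simp: is_prime_def)
next
  assume P: "is_prime P"
  then show "primeideal P typ_ring"
    by (intro primeidealI cring_from_type_algebra) (auto simp: ideal_typ_ring_iff is_prime_def)
qed

lemma Spec_iff: "P \<in> Spec \<longleftrightarrow> is_prime P"
  by (simp add: Spec_def primeideal_typ_ring_iff)

lemma is_primeD:
  assumes "is_prime P"
  shows "is_ideal P" "1 \<notin> P" "0 \<in> P" "a * b \<in> P \<longleftrightarrow> a \<in> P \<or> b \<in> P"
  using assms is_idealD[of P] by (auto simp: is_prime_def)

lemma is_prime_power: "is_prime P \<Longrightarrow> a ^ n \<in> P \<longleftrightarrow> n > 0 \<and> a \<in> P"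
  by (induction n) (auto simp: is_primeD)

lemma is_prime_prod:
  assumes "is_prime P" "finite A"
  shows "prod f A \<in> P \<longleftrightarrow> (\<exists>x\<in>A. f x \<in> P)"
  using assms(2) by (induction A rule: finite_induct) (auto simp: is_primeD[OF assms(1)])

lemma is_ideal_genideal: "is_ideal (genideal typ_ring S)"
proof -
  interpret cring "typ_ring :: 'a ring" by (rule cring_from_type_algebra)
  show ?thesis using genideal_ideal[of S] by (simp add: ideal_typ_ring_iff)
qed

lemma genideal_incl: "S \<subseteq> genideal typ_ring S"
proof -
  interpret cring "typ_ring :: 'a ring" by (rule cring_from_type_algebra)
  show ?thesis by (rule genideal_self) simp
qed

lemma genideal_least: "is_ideal I \<Longrightarrow> S \<subseteq> I \<Longrightarrow> genideal typ_ring S \<subseteq> I"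
proof -
  interpret cring "typ_ring :: 'a ring" by (rule cring_from_type_algebra)
  show "is_ideal I \<Longrightarrow> S \<subseteq> I \<Longrightarrow> genideal typ_ring S \<subseteq> I"
    by (rule genideal_minimal) (auto simp: ideal_typ_ring_iff)
qed

lemma thick_eq:
  assumes I: "is_ideal I"
  shows "thick p I m = ideal_add I (of_nat p ^ Suc m)"
proof
  show "thick p I m \<subseteq> ideal_add I (of_nat p ^ Suc m)"
    unfolding thick_def
  proof (rule genideal_least[OF is_ideal_add[OF I]])
    show "insert (of_nat p ^ Suc m) I \<subseteq> ideal_add I (of_nat p ^ Suc m)"
      using ideal_add_mono[OF I] ideal_addI[OF is_idealD(1)[OF I], of "of_nat p ^ Suc m" 1] by auto
  qed
  note D = is_idealD[OF is_ideal_genideal[of "insert (of_nat p ^ Suc m) I"]]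
  have "insert (of_nat p ^ Suc m) I \<subseteq> thick p I m" unfolding thick_def by (rule genideal_incl)
  then show "ideal_add I (of_nat p ^ Suc m) \<subseteq> thick p I m"
    unfolding ideal_add_def using D(2,4) by (auto simp: thick_def)
qed

section \<open>Germs\<close>

text \<open>The kernel of the map from the ring to the localization of its quotient by I at P.
  Equality of germs thereby becomes membership in an ideal.\<close>

definition loc :: "'a::comm_ring_1 set \<Rightarrow> 'a set \<Rightarrow> 'a set" where
  "loc I P = {f. \<exists>u. u \<notin> P \<and> u * f \<in> I}"

lemma frac_loc: "frac I P a s = {(b, t). t \<notin> P \<and> a * t - b * s \<in> loc I P}"
  by (simp add: frac_def loc_def)

locale local_frac =
  fixes I P :: "'a::comm_ring_1 set"
  assumes I: "is_ideal I" and P: "is_prime P"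
begin

lemma one_notin: "1 \<notin> P" and mult_notin: "s \<notin> P \<Longrightarrow> t \<notin> P \<Longrightarrow> s * t \<notin> P"
  using P by (auto simp: is_prime_def)

lemma locI: "f \<in> I \<Longrightarrow> f \<in> loc I P"
  unfolding loc_def using one_notin by (metis (mono_tags, lifting) mem_Collect_eq mult_1)

lemma is_ideal_loc: "is_ideal (loc I P)"
  unfolding is_ideal_def
proof (intro conjI ballI allI)
  show "0 \<in> loc I P" by (rule locI) (simp add: is_idealD[OF I])
  show "a + b \<in> loc I P" if ab: "a \<in> loc I P" "b \<in> loc I P" for a b
  proof -
    obtain u v where u: "u \<notin> P" "u * a \<in> I" and v: "v \<notin> P" "v * b \<in> I" using ab by (auto simp: loc_def)
    have "u * v * (a + b) = v * (u * a) + u * (v * b)" by (simp add: algebra_simps)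
    also have "\<dots> \<in> I" using is_idealD[OF I] u v by metis
    finally show ?thesis using mult_notin u v by (auto simp: loc_def)
  qed
  show "r * a \<in> loc I P" if "a \<in> loc I P" for a r
  proof -
    obtain u where u: "u \<notin> P" "u * a \<in> I" using \<open>a \<in> _\<close> by (auto simp: loc_def)
    have "u * (r * a) = r * (u * a)" by (simp add: algebra_simps)
    then have "u * (r * a) \<in> I" using is_idealD(3)[OF I u(2), of r] by (simp only:)
    then show ?thesis using u by (auto simp: loc_def)
  qed
qed

lemmas locD = is_idealD[OF is_ideal_loc]

lemma loc_cancel: "s \<notin> P \<Longrightarrow> s * f \<in> loc I P \<Longrightarrow> f \<in> loc I P"
  unfolding loc_def using mult_notin by (auto simp flip: mult.assoc)

lemma mem_frac_self: "s \<notin> P \<Longrightarrow> (a, s) \<in> frac I P a s"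
  by (simp add: frac_loc locD(1))

lemma frac_eq_iff:
  assumes "s \<notin> P" "t \<notin> P"
  shows "frac I P a s = frac I P b t \<longleftrightarrow> a * t - b * s \<in> loc I P"
proof
  assume "frac I P a s = frac I P b t"
  then have "(b, t) \<in> frac I P a s" using mem_frac_self[OF assms(2)] by simp
  then show "a * t - b * s \<in> loc I P" by (simp add: frac_loc)
next
  have sub: "frac I P a s \<subseteq> frac I P b t" if e: "a * t - b * s \<in> loc I P" and s: "s \<notin> P" for a b s t
  proof clarify
    fix c r assume c: "(c, r) \<in> frac I P a s"
    have "s * (b * r - c * t) = t * (a * r - c * s) - r * (a * t - b * s)" by (simp add: algebra_simps)
    also have "\<dots> \<in> loc I P" by (rule locD(6)[OF locD(3) locD(3)]) (use c e in \<open>auto simp: frac_loc\<close>)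
    finally show "(c, r) \<in> frac I P b t" using c loc_cancel[OF s] by (auto simp: frac_loc)
  qed
  assume e: "a * t - b * s \<in> loc I P"
  then have "b * s - a * t \<in> loc I P" using locD(5) by fastforce
  then show "frac I P a s = frac I P b t" using sub[OF e assms(1)] sub assms(2) by blast
qed

lemma frac_eqI: "s \<notin> P \<Longrightarrow> t \<notin> P \<Longrightarrow> a * t = b * s \<Longrightarrow> frac I P a s = frac I P b t"
  by (simp add: frac_eq_iff locD(1))

lemma frac_mem_iff: "s \<notin> P \<Longrightarrow> (b, t) \<in> frac I P a s \<longleftrightarrow> t \<notin> P \<and> frac I P a s = frac I P b t"
  using frac_eq_iff[of s t a b] by (auto simp: frac_loc)

lemma frac_0_iff: "s \<notin> P \<Longrightarrow> frac I P a s = frac I P 0 1 \<longleftrightarrow> a \<in> loc I P"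
  by (simp add: frac_eq_iff one_notin)

text \<open>The operations on stalks are unions over all pairs of representatives. Such a union
  collapses to one value as soon as the summand does not depend on the representatives.\<close>

lemma frac_Union2:
  assumes "s \<notin> P" "t \<notin> P"
    and "\<And>a' s' b' t'. s' \<notin> P \<Longrightarrow> t' \<notin> P \<Longrightarrow> a * s' - a' * s \<in> loc I P \<Longrightarrow> b * t' - b' * t \<in> loc I P
      \<Longrightarrow> G a' s' b' t' = G a s b t"
  shows "(\<Union>(a', s') \<in> frac I P a s. \<Union>(b', t') \<in> frac I P b t. G a' s' b' t') = G a s b t"
proof -
  have 1: "(\<Union>(b', t') \<in> frac I P b t. G a' s' b' t') = G a s b t" if "(a', s') \<in> frac I P a s" for a' s'
    using that assms(3)[of s' _ a'] mem_frac_self[OF assms(2), of b] unfolding frac_loc by blast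
  show ?thesis
  proof (intro subset_antisym subsetI)
    fix x assume "x \<in> (\<Union>(a', s') \<in> frac I P a s. \<Union>(b', t') \<in> frac I P b t. G a' s' b' t')"
    then obtain a' s' where "(a', s') \<in> frac I P a s" "x \<in> (\<Union>(b', t') \<in> frac I P b t. G a' s' b' t')" by blast
    then show "x \<in> G a s b t" using 1 by simp
  next
    fix x assume "x \<in> G a s b t"
    then show "x \<in> (\<Union>(a', s') \<in> frac I P a s. \<Union>(b', t') \<in> frac I P b t. G a' s' b' t')"
      using mem_frac_self[OF assms(1), of a] 1[OF mem_frac_self[OF assms(1)]] by blast
  qed
qed

lemma stalk_carrier_iff: "x \<in> carrier (stalk I P) \<longleftrightarrow> (\<exists>a s. s \<notin> P \<and> x = frac I P a s)"
  by (auto simp: stalk_def)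

lemma stalk_one: "\<one>\<^bsub>stalk I P\<^esub> = frac I P 1 1" and stalk_zero: "\<zero>\<^bsub>stalk I P\<^esub> = frac I P 0 1"
  by (auto simp: stalk_def)

lemma stalk_mult:
  assumes "s \<notin> P" "t \<notin> P"
  shows "frac I P a s \<otimes>\<^bsub>stalk I P\<^esub> frac I P b t = frac I P (a * b) (s * t)"
proof -
  have "(\<Union>(a', s') \<in> frac I P a s. \<Union>(b', t') \<in> frac I P b t. frac I P (a' * b') (s' * t')) = frac I P (a * b) (s * t)"
  proof (rule frac_Union2[OF assms])
    fix a' s' b' t'
    assume s: "s' \<notin> P" "t' \<notin> P" and e: "a * s' - a' * s \<in> loc I P" "b * t' - b' * t \<in> loc I P"
    have "a' * b' * (s * t) - a * b * (s' * t') = - ((b' * t) * (a * s' - a' * s) + (a * s') * (b * t' - b' * t))"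
      by (simp add: algebra_simps)
    also have "\<dots> \<in> loc I P" by (intro locD(5) locD(2) locD(3) e)
    finally show "frac I P (a' * b') (s' * t') = frac I P (a * b) (s * t)"
      using s assms mult_notin by (simp add: frac_eq_iff)
  qed
  then show ?thesis by (simp add: stalk_def)
qed

lemma stalk_add:
  assumes "s \<notin> P" "t \<notin> P"
  shows "frac I P a s \<oplus>\<^bsub>stalk I P\<^esub> frac I P b t = frac I P (a * t + b * s) (s * t)"
proof -
  have "(\<Union>(a', s') \<in> frac I P a s. \<Union>(b', t') \<in> frac I P b t. frac I P (a' * t' + b' * s') (s' * t'))
      = frac I P (a * t + b * s) (s * t)"
  proof (rule frac_Union2[OF assms])
    fix a' s' b' t'
    assume s: "s' \<notin> P" "t' \<notin> P" and e: "a * s' - a' * s \<in> loc I P" "b * t' - b' * t \<in> loc I P"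
    have "(a' * t' + b' * s') * (s * t) - (a * t + b * s) * (s' * t')
        = - ((t * t') * (a * s' - a' * s) + (s * s') * (b * t' - b' * t))"
      by (simp add: algebra_simps)
    also have "\<dots> \<in> loc I P" by (intro locD(5) locD(2) locD(3) e)
    finally show "frac I P (a' * t' + b' * s') (s' * t') = frac I P (a * t + b * s) (s * t)"
      using s assms mult_notin by (simp add: frac_eq_iff)
  qed
  then show ?thesis by (simp add: stalk_def)
qed

lemma frac_in_stalk: "s \<notin> P \<Longrightarrow> frac I P a s \<in> carrier (stalk I P)"
  by (auto simp: stalk_carrier_iff)

lemma stalkE:
  assumes "x \<in> carrier (stalk I P)"
  obtains a s where "s \<notin> P" "x = frac I P a s"
  using assms by (auto simp: stalk_carrier_iff)

lemma cring_stalk: "cring (stalk I P)"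
proof (intro cringI abelian_groupI comm_monoidI)
  note f = stalk_mult stalk_add stalk_one stalk_zero mult_notin one_notin
  fix x assume x: "x \<in> carrier (stalk I P)"
  obtain a s where a: "s \<notin> P" "x = frac I P a s" using x by (rule stalkE)
  show "\<exists>y\<in>carrier (stalk I P). y \<oplus>\<^bsub>stalk I P\<^esub> x = \<zero>\<^bsub>stalk I P\<^esub>"
  proof (rule bexI)
    show "frac I P (- a) s \<oplus>\<^bsub>stalk I P\<^esub> x = \<zero>\<^bsub>stalk I P\<^esub>"
      unfolding a(2) using a(1) by (simp add: f) (rule frac_eqI, simp_all add: f)
  qed (simp add: a frac_in_stalk)
  show "\<zero>\<^bsub>stalk I P\<^esub> \<oplus>\<^bsub>stalk I P\<^esub> x = x" "\<one>\<^bsub>stalk I P\<^esub> \<otimes>\<^bsub>stalk I P\<^esub> x = x"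
    using a by (simp_all add: f)
  fix y assume y: "y \<in> carrier (stalk I P)"
  obtain b t where b: "t \<notin> P" "y = frac I P b t" using y by (rule stalkE)
  show "x \<oplus>\<^bsub>stalk I P\<^esub> y \<in> carrier (stalk I P)" "x \<otimes>\<^bsub>stalk I P\<^esub> y \<in> carrier (stalk I P)"
    using a b by (simp_all add: f frac_in_stalk)
  show "x \<oplus>\<^bsub>stalk I P\<^esub> y = y \<oplus>\<^bsub>stalk I P\<^esub> x" "x \<otimes>\<^bsub>stalk I P\<^esub> y = y \<otimes>\<^bsub>stalk I P\<^esub> x"
    using a b by (simp_all add: f add.commute mult.commute)
  fix z assume z: "z \<in> carrier (stalk I P)"
  obtain c u where c: "u \<notin> P" "z = frac I P c u" using z by (rule stalkE)
  show "x \<oplus>\<^bsub>stalk I P\<^esub> y \<oplus>\<^bsub>stalk I P\<^esub> z = x \<oplus>\<^bsub>stalk I P\<^esub> (y \<oplus>\<^bsub>stalk I P\<^esub> z)"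
    unfolding a(2) b(2) c(2) using a(1) b(1) c(1)
    by (simp add: f) (rule frac_eqI, simp_all add: f algebra_simps)
  show "x \<otimes>\<^bsub>stalk I P\<^esub> y \<otimes>\<^bsub>stalk I P\<^esub> z = x \<otimes>\<^bsub>stalk I P\<^esub> (y \<otimes>\<^bsub>stalk I P\<^esub> z)"
    unfolding a(2) b(2) c(2) using a(1) b(1) c(1) by (simp add: f mult.assoc)
  show "(x \<oplus>\<^bsub>stalk I P\<^esub> y) \<otimes>\<^bsub>stalk I P\<^esub> z = x \<otimes>\<^bsub>stalk I P\<^esub> z \<oplus>\<^bsub>stalk I P\<^esub> y \<otimes>\<^bsub>stalk I P\<^esub> z"
    unfolding a(2) b(2) c(2) using a(1) b(1) c(1)
    by (simp add: f) (rule frac_eqI, simp_all add: f algebra_simps)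
qed (simp_all add: stalk_one stalk_zero frac_in_stalk one_notin)

sublocale stalk: cring "stalk I P" by (rule cring_stalk)

lemma stalk_pow: "s \<notin> P \<Longrightarrow> frac I P a s [^]\<^bsub>stalk I P\<^esub> (n::nat) = frac I P (a ^ n) (s ^ n)"
  by (induction n) (simp_all add: stalk_one stalk_mult is_prime_power[OF P] mult.commute)

end

lemma frac_mono: "I \<subseteq> I' \<Longrightarrow> frac I P a s \<subseteq> frac I' P a s"
  by (auto simp: frac_def)

section \<open>Sections\<close>

lemma zariski_open_Int:
  assumes "zariski_open V" "zariski_open V'"
  shows "zariski_open (V \<inter> V')"
proof -
  obtain S S' where V: "V = {P \<in> Spec. \<not> S \<subseteq> P}" "V' = {P \<in> Spec. \<not> S' \<subseteq> P}"
    using assms by (auto simp: zariski_open_def)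
  have "V \<inter> V' = {P \<in> Spec. \<not> {a * b | a b. a \<in> S \<and> b \<in> S'} \<subseteq> P}"
    using V is_primeD(4) by (auto simp: Spec_iff) blast+
  then show ?thesis by (auto simp: zariski_open_def)
qed

lemma zariski_open_basic: "zariski_open {P \<in> Spec. a \<notin> P}"
  unfolding zariski_open_def by (intro exI[of _ "{a}"]) auto

lemma zariski_open_Spec: "zariski_open Spec"
proof -
  have "Spec = {P \<in> Spec. (1::'a) \<notin> P}" by (auto simp: Spec_iff is_primeD)
  then show ?thesis using zariski_open_basic[of "1::'a"] by simp
qed

locale sheaf =
  fixes J :: "nat \<Rightarrow> 'a::comm_ring_1 set" and W :: "'a set set"
  assumes J: "\<And>m. is_ideal (J m)" and J_Suc: "\<And>m. J (Suc m) \<subseteq> J m"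
    and W: "\<And>Q. Q \<in> W \<Longrightarrow> is_prime Q" and J_W: "\<And>Q m. Q \<in> W \<Longrightarrow> J m \<subseteq> Q"
begin

abbreviation "S \<equiv> sections J W"

lemma local_fracI: "Q \<in> W \<Longrightarrow> local_frac (J m) Q"
  using J W by (simp add: local_frac_def)

lemma loc_subset: "Q \<in> W \<Longrightarrow> f \<in> loc (J m) Q \<Longrightarrow> f \<in> Q"
  using W J_W is_primeD(4) by (fastforce simp: loc_def)

lemma sect_localD:
  assumes "\<sigma> \<in> carrier S" "Q \<in> W"
  obtains V a s where "zariski_open V" "Q \<in> V" "\<forall>Q'\<in>V \<inter> W. s \<notin> Q' \<and> \<sigma> m Q' = frac (J m) Q' a s"
proof -
  have "\<forall>m. \<forall>P\<in>W. \<exists>V a s. zariski_open V \<and> P \<in> V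
     \<and> (\<forall>Q \<in> V \<inter> W. s \<notin> Q \<and> \<sigma> m Q = frac (J m) Q a s)"
    using assms(1) by (simp add: sections_def)
  then obtain V a s where "zariski_open V \<and> Q \<in> V
     \<and> (\<forall>Q \<in> V \<inter> W. s \<notin> Q \<and> \<sigma> m Q = frac (J m) Q a s)" using assms(2) by meson
  then show thesis using that[of V s a] by blast
qed

lemma germ:
  assumes "\<sigma> \<in> carrier S" "Q \<in> W"
  obtains a s where "s \<notin> Q" "\<sigma> m Q = frac (J m) Q a s"
proof -
  obtain V a s where "zariski_open V" "Q \<in> V" "\<forall>Q'\<in>V \<inter> W. s \<notin> Q' \<and> \<sigma> m Q' = frac (J m) Q' a s"
    by (rule sect_localD[OF assms, of m])
  then show thesis using assms(2) that[of s a] by blast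
qed

lemma germ_down:
  assumes s: "\<sigma> \<in> carrier S" "Q \<in> W" and e: "t \<notin> Q" "\<sigma> (Suc m) Q = frac (J (Suc m)) Q a t"
  shows "\<sigma> m Q = frac (J m) Q a t"
proof -
  interpret F: local_frac "J m" Q by (rule local_fracI[OF s(2)])
  interpret F': local_frac "J (Suc m)" Q by (rule local_fracI[OF s(2)])
  obtain b r where b: "r \<notin> Q" "\<sigma> m Q = frac (J m) Q b r" using germ[OF s] by metis
  have "(a, t) \<in> \<sigma> (Suc m) Q" using e F'.mem_frac_self by simp
  also have "\<sigma> (Suc m) Q \<subseteq> \<sigma> m Q" using s by (auto simp: sections_def)
  finally show ?thesis using F.frac_mem_iff[OF b(1)] b(2) by simp
qed

lemma germ_down_le:
  assumes "\<sigma> \<in> carrier S" "Q \<in> W" "m \<le> k" "t \<notin> Q" "\<sigma> k Q = frac (J k) Q a t"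
  shows "\<sigma> m Q = frac (J m) Q a t"
  using assms(3,5)
proof (induction k rule: dec_induct)
  case (step k)
  then show ?case using germ_down[OF assms(1,2,4)] by blast
qed (use assms in auto)

lemma sectionI:
  assumes out: "\<And>m Q. Q \<notin> W \<Longrightarrow> \<sigma> m Q = {}"
    and down: "\<And>m Q. Q \<in> W \<Longrightarrow> \<exists>a s. \<sigma> (Suc m) Q = frac (J (Suc m)) Q a s \<and> \<sigma> m Q = frac (J m) Q a s"
    and loc: "\<And>m Q. Q \<in> W \<Longrightarrow> \<exists>V a s. zariski_open V \<and> Q \<in> V
       \<and> (\<forall>Q'\<in>V \<inter> W. s \<notin> Q' \<and> \<sigma> m Q' = frac (J m) Q' a s)"
  shows "\<sigma> \<in> carrier S"
proof -
  have "\<sigma> (Suc m) Q \<subseteq> \<sigma> m Q" if "Q \<in> W" for m Q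
    using down[OF that, of m] frac_mono[OF J_Suc] by fastforce
  then show ?thesis using out loc by (simp add: sections_def)
qed

lemma section_eqI:
  assumes "\<sigma> \<in> carrier S" "\<tau> \<in> carrier S" "\<And>m Q. Q \<in> W \<Longrightarrow> \<sigma> m Q = \<tau> m Q"
  shows "\<sigma> = \<tau>"
proof (intro ext)
  show "\<sigma> m Q = \<tau> m Q" for m Q
    using assms by (cases "Q \<in> W") (auto simp: sections_def)
qed

text \<open>An operation on germs that is given by one formula in numerators and denominators keeps
  both conditions on a section: compatibility of the levels and being locally a fraction. Sums,
  products and quotients all arise in this way.\<close>

lemma section_op:
  assumes s: "\<sigma> \<in> carrier S" "\<tau> \<in> carrier S"
    and out: "\<And>m Q. Q \<notin> W \<Longrightarrow> \<rho> m Q = {}"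
    and op: "\<And>m Q a s b t. Q \<in> W \<Longrightarrow> s \<notin> Q \<Longrightarrow> t \<notin> Q \<Longrightarrow> \<sigma> m Q = frac (J m) Q a s
      \<Longrightarrow> \<tau> m Q = frac (J m) Q b t \<Longrightarrow> D a s b t \<notin> Q \<and> \<rho> m Q = frac (J m) Q (N a s b t) (D a s b t)"
  shows "\<rho> \<in> carrier S"
proof (rule sectionI[OF out])
  fix m Q assume Q: "Q \<in> W"
  obtain a r where a: "r \<notin> Q" "\<sigma> (Suc m) Q = frac (J (Suc m)) Q a r" using germ[OF s(1) Q] by metis
  obtain b t where b: "t \<notin> Q" "\<tau> (Suc m) Q = frac (J (Suc m)) Q b t" using germ[OF s(2) Q] by metis
  note a' = germ_down[OF s(1) Q a] and b' = germ_down[OF s(2) Q b]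
  show "\<exists>a s. \<rho> (Suc m) Q = frac (J (Suc m)) Q a s \<and> \<rho> m Q = frac (J m) Q a s"
    using op[OF Q a(1) b(1) a(2) b(2)] op[OF Q a(1) b(1) a' b'] by blast
next
  fix m Q assume Q: "Q \<in> W"
  obtain V a r where V: "zariski_open V" "Q \<in> V" "\<forall>Q'\<in>V \<inter> W. r \<notin> Q' \<and> \<sigma> m Q' = frac (J m) Q' a r" by (rule sect_localD[OF s(1) Q, of m])
  obtain V' b t where V': "zariski_open V'" "Q \<in> V'" "\<forall>Q'\<in>V' \<inter> W. t \<notin> Q' \<and> \<tau> m Q' = frac (J m) Q' b t" by (rule sect_localD[OF s(2) Q, of m])
  have "D a r b t \<notin> Q' \<and> \<rho> m Q' = frac (J m) Q' (N a r b t) (D a r b t)" if "Q' \<in> (V \<inter> V') \<inter> W" for Q'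
    using that V(3) V'(3) by (intro op) auto
  then show "\<exists>V a s. zariski_open V \<and> Q \<in> V \<and> (\<forall>Q'\<in>V \<inter> W. s \<notin> Q' \<and> \<rho> m Q' = frac (J m) Q' a s)"
    using V V' zariski_open_Int[of V V'] by blast
qed

lemma sect_of_closed [simp, intro]: "sect_of J W a \<in> carrier S"
proof (rule sectionI)
  show "\<exists>V b s. zariski_open V \<and> Q \<in> V \<and> (\<forall>Q'\<in>V \<inter> W. s \<notin> Q' \<and> sect_of J W a m Q' = frac (J m) Q' b s)"
    if "Q \<in> W" for m Q
    by (intro exI[of _ Spec] exI[of _ a] exI[of _ 1])
      (use that W zariski_open_Spec in \<open>simp add: sect_of_def Spec_iff is_primeD\<close>)
qed (auto simp: sect_of_def)

lemma sect_of_germ: "Q \<in> W \<Longrightarrow> sect_of J W a m Q = frac (J m) Q a 1"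
  by (simp add: sect_of_def)

lemma S_mult: "Q \<in> W \<Longrightarrow> (\<sigma> \<otimes>\<^bsub>S\<^esub> \<tau>) m Q = \<sigma> m Q \<otimes>\<^bsub>stalk (J m) Q\<^esub> \<tau> m Q"
  and S_add: "Q \<in> W \<Longrightarrow> (\<sigma> \<oplus>\<^bsub>S\<^esub> \<tau>) m Q = \<sigma> m Q \<oplus>\<^bsub>stalk (J m) Q\<^esub> \<tau> m Q"
  by (auto simp: sections_def)

lemma S_one: "\<one>\<^bsub>S\<^esub> = sect_of J W 1" and S_zero: "\<zero>\<^bsub>S\<^esub> = sect_of J W 0"
  by (auto simp: sections_def sect_of_def stalk_def fun_eq_iff)

lemma mult_closed: "\<sigma> \<in> carrier S \<Longrightarrow> \<tau> \<in> carrier S \<Longrightarrow> \<sigma> \<otimes>\<^bsub>S\<^esub> \<tau> \<in> carrier S"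
proof (rule section_op[where N = "\<lambda>a s b t. a * b" and D = "\<lambda>a s b t. s * t"])
  show "(\<sigma> \<otimes>\<^bsub>S\<^esub> \<tau>) m Q = {}" if "Q \<notin> W" for m Q using that by (simp add: sections_def)
  show "s * t \<notin> Q \<and> (\<sigma> \<otimes>\<^bsub>S\<^esub> \<tau>) m Q = frac (J m) Q (a * b) (s * t)"
    if "Q \<in> W" "s \<notin> Q" "t \<notin> Q" "\<sigma> m Q = frac (J m) Q a s" "\<tau> m Q = frac (J m) Q b t" for m Q a s b t
  proof -
    interpret F: local_frac "J m" Q by (rule local_fracI[OF that(1)])
    show ?thesis using that F.mult_notin by (simp add: S_mult F.stalk_mult)
  qed
qed

lemma add_closed: "\<sigma> \<in> carrier S \<Longrightarrow> \<tau> \<in> carrier S \<Longrightarrow> \<sigma> \<oplus>\<^bsub>S\<^esub> \<tau> \<in> carrier S"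
proof (rule section_op[where N = "\<lambda>a s b t. a * t + b * s" and D = "\<lambda>a s b t. s * t"])
  show "(\<sigma> \<oplus>\<^bsub>S\<^esub> \<tau>) m Q = {}" if "Q \<notin> W" for m Q using that by (simp add: sections_def)
  show "s * t \<notin> Q \<and> (\<sigma> \<oplus>\<^bsub>S\<^esub> \<tau>) m Q = frac (J m) Q (a * t + b * s) (s * t)"
    if "Q \<in> W" "s \<notin> Q" "t \<notin> Q" "\<sigma> m Q = frac (J m) Q a s" "\<tau> m Q = frac (J m) Q b t" for m Q a s b t
  proof -
    interpret F: local_frac "J m" Q by (rule local_fracI[OF that(1)])
    show ?thesis using that F.mult_notin by (simp add: S_add F.stalk_add)
  qed
qed

lemma germ_in_stalk: "\<sigma> \<in> carrier S \<Longrightarrow> Q \<in> W \<Longrightarrow> \<sigma> m Q \<in> carrier (stalk (J m) Q)"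
  by (metis germ local_frac.frac_in_stalk local_fracI)

lemma cring_S: "cring S"
proof -
  note R = cring.axioms(1)[OF local_frac.cring_stalk[OF local_fracI]]
  note A = abelian_groupE[OF ring.is_abelian_group[OF R]]
  note c = germ_in_stalk
  have one: "\<one>\<^bsub>S\<^esub> \<in> carrier S" "\<zero>\<^bsub>S\<^esub> \<in> carrier S" by (simp_all add: S_one S_zero)
  have z: "\<zero>\<^bsub>S\<^esub> m Q = \<zero>\<^bsub>stalk (J m) Q\<^esub>" "\<one>\<^bsub>S\<^esub> m Q = \<one>\<^bsub>stalk (J m) Q\<^esub>" if "Q \<in> W" for m Q
    using that by (simp_all add: sections_def)
  show ?thesis
  proof (intro cringI abelian_groupI comm_monoidI)
    show "\<exists>y\<in>carrier S. y \<oplus>\<^bsub>S\<^esub> x = \<zero>\<^bsub>S\<^esub>" if x: "x \<in> carrier S" for x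
    proof (rule bexI[of _ "sect_of J W (-1) \<otimes>\<^bsub>S\<^esub> x"])
      show "sect_of J W (-1) \<otimes>\<^bsub>S\<^esub> x \<oplus>\<^bsub>S\<^esub> x = \<zero>\<^bsub>S\<^esub>"
      proof (rule section_eqI)
        fix m Q assume Q: "Q \<in> W"
        interpret F: local_frac "J m" Q by (rule local_fracI[OF Q])
        obtain a s where "s \<notin> Q" "x m Q = frac (J m) Q a s" using germ[OF x Q] by metis
        then show "(sect_of J W (-1) \<otimes>\<^bsub>S\<^esub> x \<oplus>\<^bsub>S\<^esub> x) m Q = \<zero>\<^bsub>S\<^esub> m Q"
          using Q by (simp add: S_add S_mult sect_of_germ F.one_notin F.mult_notin F.stalk_mult F.stalk_add z F.stalk_zero)
            (intro F.frac_eqI, auto simp: F.one_notin F.mult_notin)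
      qed (use x one in \<open>auto intro: add_closed mult_closed\<close>)
    qed (use x in \<open>auto intro: mult_closed\<close>)
  next
    fix x y z assume xyz: "x \<in> carrier S" "y \<in> carrier S" "z \<in> carrier S"
    show "x \<oplus>\<^bsub>S\<^esub> y \<oplus>\<^bsub>S\<^esub> z = x \<oplus>\<^bsub>S\<^esub> (y \<oplus>\<^bsub>S\<^esub> z)"
      by (rule section_eqI) (use xyz A(3) c in \<open>auto simp: add_closed S_add\<close>)
    show "x \<otimes>\<^bsub>S\<^esub> y \<otimes>\<^bsub>S\<^esub> z = x \<otimes>\<^bsub>S\<^esub> (y \<otimes>\<^bsub>S\<^esub> z)"
      by (rule section_eqI) (use xyz ring.ring_simprules(11)[OF R] c in \<open>auto simp: mult_closed S_mult\<close>)
    show "(x \<oplus>\<^bsub>S\<^esub> y) \<otimes>\<^bsub>S\<^esub> z = x \<otimes>\<^bsub>S\<^esub> z \<oplus>\<^bsub>S\<^esub> y \<otimes>\<^bsub>S\<^esub> z"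
      by (rule section_eqI) (use xyz ring.ring_simprules(13)[OF R] c in \<open>auto simp: mult_closed add_closed S_mult S_add\<close>)
  next
    fix x y assume xyz: "x \<in> carrier S" "y \<in> carrier S"
    show "x \<oplus>\<^bsub>S\<^esub> y = y \<oplus>\<^bsub>S\<^esub> x"
      by (rule section_eqI) (use xyz A(4) c in \<open>auto simp: add_closed S_add\<close>)
    show "x \<otimes>\<^bsub>S\<^esub> y = y \<otimes>\<^bsub>S\<^esub> x"
      by (rule section_eqI) (use xyz cring.cring_simprules(14)[OF local_frac.cring_stalk[OF local_fracI]] c
        in \<open>auto simp: mult_closed S_mult\<close>)
  next
    fix x assume x: "x \<in> carrier S"
    show "\<zero>\<^bsub>S\<^esub> \<oplus>\<^bsub>S\<^esub> x = x"
      by (rule section_eqI) (use x A(5) c one in \<open>auto simp: add_closed S_add z\<close>)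
    show "\<one>\<^bsub>S\<^esub> \<otimes>\<^bsub>S\<^esub> x = x"
      by (rule section_eqI) (use x ring.ring_simprules(12)[OF R] c one in \<open>auto simp: mult_closed S_mult z\<close>)
  qed (use one in \<open>auto intro: add_closed mult_closed\<close>)
qed

sublocale S: cring S by (rule cring_S)

lemma type_hom_sect_of: "type_hom S (sect_of J W)"
proof -
  have m: "sect_of J W (a * b) = sect_of J W a \<otimes>\<^bsub>S\<^esub> sect_of J W b" for a b
  proof (rule section_eqI)
    fix m Q assume Q: "Q \<in> W"
    interpret F: local_frac "J m" Q by (rule local_fracI[OF Q])
    show "sect_of J W (a * b) m Q = (sect_of J W a \<otimes>\<^bsub>S\<^esub> sect_of J W b) m Q"
      using Q by (simp add: S_mult sect_of_germ F.stalk_mult F.one_notin)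
  qed (auto intro: mult_closed)
  have a: "sect_of J W (a + b) = sect_of J W a \<oplus>\<^bsub>S\<^esub> sect_of J W b" for a b
  proof (rule section_eqI)
    fix m Q assume Q: "Q \<in> W"
    interpret F: local_frac "J m" Q by (rule local_fracI[OF Q])
    show "sect_of J W (a + b) m Q = (sect_of J W a \<oplus>\<^bsub>S\<^esub> sect_of J W b) m Q"
      using Q by (simp add: S_add sect_of_germ F.stalk_add F.one_notin)
  qed (auto intro: add_closed)
  show ?thesis
    by (intro type_hom.intro cring_S type_hom_axioms.intro Ring.ring_hom_memI) (simp_all add: m a S_one)
qed

sublocale of: type_hom S "sect_of J W" by (rule type_hom_sect_of)

text \<open>The quotient x / y of two germs, computed on representatives. It makes sense when the
  numerator of y lies outside Q.\<close>

definition quot :: "nat \<Rightarrow> 'a set \<Rightarrow> ('a \<times> 'a) set \<Rightarrow> ('a \<times> 'a) set \<Rightarrow> ('a \<times> 'a) set" where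
  "quot m Q x y = (\<Union>(a, s)\<in>x. \<Union>(b, t)\<in>y. frac (J m) Q (a * t) (s * b))"

lemma loc_notin:
  assumes "Q \<in> W" "a * t - b * s \<in> loc (J m) Q" "t \<notin> Q" "s \<notin> Q"
  shows "a \<in> Q \<longleftrightarrow> b \<in> Q"
proof -
  have p: "is_prime Q" by (rule W[OF assms(1)])
  have d: "a * t - b * s \<in> Q" by (rule loc_subset[OF assms(1,2)])
  have "a * t \<in> Q \<longleftrightarrow> b * s \<in> Q"
    using is_primeD(1)[OF p] d by (intro cong_mod_mem) (auto simp: cong_mod_def)
  then show ?thesis using is_primeD(4)[OF p] assms by auto
qed

lemma quot_frac:
  assumes Q: "Q \<in> W" and st: "s \<notin> Q" "t \<notin> Q" and b: "b \<notin> Q"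
  shows "quot m Q (frac (J m) Q a s) (frac (J m) Q b t) = frac (J m) Q (a * t) (s * b)"
proof -
  interpret F: local_frac "J m" Q by (rule local_fracI[OF Q])
  show ?thesis unfolding quot_def
  proof (rule F.frac_Union2[OF st])
    fix a' s' b' t'
    assume s: "s' \<notin> Q" "t' \<notin> Q"
      and e: "a * s' - a' * s \<in> loc (J m) Q" "b * t' - b' * t \<in> loc (J m) Q"
    have b': "b' \<notin> Q" using loc_notin[OF Q e(2)] b s st by blast
    have "a' * t' * (s * b) - a * t * (s' * b') = (a' * s) * (b * t' - b' * t) - (t * b') * (a * s' - a' * s)"
      by (simp add: algebra_simps)
    also have "\<dots> \<in> loc (J m) Q" by (rule F.locD(6)[OF F.locD(3)[OF e(2)] F.locD(3)[OF e(1)]])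
    finally show "frac (J m) Q (a' * t') (s' * b') = frac (J m) Q (a * t) (s * b)"
      using s st b b' F.mult_notin by (simp add: F.frac_eq_iff)
  qed
qed

text \<open>All the ideals J m lie in Q, so membership of the numerator in Q depends neither on the
  level nor on the representative. Invertibility of a section can thus be tested at level 0.\<close>

lemma unit_germ_level:
  assumes s: "\<sigma> \<in> carrier S" and Q: "Q \<in> W" and t: "t \<notin> Q" "\<sigma> m Q = frac (J m) Q a t"
    and t': "t' \<notin> Q" "\<sigma> 0 Q = frac (J 0) Q a' t'"
  shows "a \<in> Q \<longleftrightarrow> a' \<in> Q"
proof -
  interpret F: local_frac "J 0" Q by (rule local_fracI[OF Q])
  have "\<sigma> 0 Q = frac (J 0) Q a t" using germ_down_le[OF s Q _ t] by simp
  then have "a * t' - a' * t \<in> loc (J 0) Q" using F.frac_eq_iff[OF t(1) t'(1), of a a'] t'(2) by simp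
  then show ?thesis using loc_notin[OF Q] t t' by blast
qed

lemma quot_closed:
  assumes s: "\<sigma> \<in> carrier S" "\<tau> \<in> carrier S"
    and u: "\<And>Q a s. Q \<in> W \<Longrightarrow> s \<notin> Q \<Longrightarrow> \<tau> 0 Q = frac (J 0) Q a s \<Longrightarrow> a \<notin> Q"
  shows "(\<lambda>m Q. if Q \<in> W then quot m Q (\<sigma> m Q) (\<tau> m Q) else {}) \<in> carrier S"
proof (rule section_op[OF s, where N = "\<lambda>a s b t. a * t" and D = "\<lambda>a s b t. s * b"])
  fix m Q a s' b t
  assume Q: "Q \<in> W" and st: "s' \<notin> Q" "t \<notin> Q" and e: "\<sigma> m Q = frac (J m) Q a s'" "\<tau> m Q = frac (J m) Q b t"
  interpret F: local_frac "J m" Q by (rule local_fracI[OF Q])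
  obtain a' t' where a': "t' \<notin> Q" "\<tau> 0 Q = frac (J 0) Q a' t'" using germ[OF s(2) Q] by metis
  then have "b \<notin> Q" using unit_germ_level[OF s(2) Q st(2) e(2) a'] u[OF Q a'] by blast
  then show "s' * b \<notin> Q \<and> (if Q \<in> W then quot m Q (\<sigma> m Q) (\<tau> m Q) else {}) = frac (J m) Q (a * t) (s' * b)"
    using Q st e F.mult_notin by (simp add: quot_frac)
qed auto

lemma unitI:
  assumes s: "\<tau> \<in> carrier S"
    and u: "\<And>Q a s. Q \<in> W \<Longrightarrow> s \<notin> Q \<Longrightarrow> \<tau> 0 Q = frac (J 0) Q a s \<Longrightarrow> a \<notin> Q"
  shows "\<exists>\<rho>\<in>carrier S. \<rho> \<otimes>\<^bsub>S\<^esub> \<tau> = \<one>\<^bsub>S\<^esub>"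
proof -
  define \<rho> where "\<rho> = (\<lambda>m Q. if Q \<in> W then quot m Q (sect_of J W 1 m Q) (\<tau> m Q) else {})"
  have \<rho>: "\<rho> \<in> carrier S" unfolding \<rho>_def by (rule quot_closed[OF _ s u]) auto
  have "\<rho> \<otimes>\<^bsub>S\<^esub> \<tau> = \<one>\<^bsub>S\<^esub>"
  proof (rule section_eqI)
    fix m Q assume Q: "Q \<in> W"
    interpret F: local_frac "J m" Q by (rule local_fracI[OF Q])
    obtain a t where a: "t \<notin> Q" "\<tau> m Q = frac (J m) Q a t" using germ[OF s Q] by metis
    obtain a' t' where a': "t' \<notin> Q" "\<tau> 0 Q = frac (J 0) Q a' t'" using germ[OF s Q] by metis
    have "a \<notin> Q" using unit_germ_level[OF s Q a a'] u[OF Q a'] by blast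
    then show "(\<rho> \<otimes>\<^bsub>S\<^esub> \<tau>) m Q = \<one>\<^bsub>S\<^esub> m Q"
      using Q a F.mult_notin F.one_notin
      by (simp add: S_mult \<rho>_def sect_of_germ quot_frac F.stalk_mult S_one)
        (intro F.frac_eqI, auto)
  qed (use s \<rho> in \<open>auto intro: mult_closed simp: S_one\<close>)
  then show ?thesis using \<rho> by blast
qed

end

section \<open>Formal completions along $p$\<close>

context sheaf
begin

lemma germ_hom: "Q \<in> W \<Longrightarrow> (\<lambda>\<sigma>. \<sigma> m Q) \<in> Ring.ring_hom S (stalk (J m) Q)"
  by (intro Ring.ring_hom_memI) (simp_all add: S_mult S_add germ_in_stalk S_one sect_of_germ local_frac.stalk_one[OF local_fracI])

lemma germ_minus:
  assumes Q: "Q \<in> W" and s: "\<sigma> \<in> carrier S" "\<tau> \<in> carrier S"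
  shows "(\<sigma> \<ominus>\<^bsub>S\<^esub> \<tau>) m Q = \<sigma> m Q \<ominus>\<^bsub>stalk (J m) Q\<^esub> \<tau> m Q"
proof -
  interpret F: local_frac "J m" Q by (rule local_fracI[OF Q])
  interpret h: ring_hom_cring S "stalk (J m) Q" "\<lambda>\<sigma>. \<sigma> m Q"
    by (intro ring_hom_cringI cring_S F.cring_stalk germ_hom Q)
  show ?thesis using s by (simp add: a_minus_def h.hom_add[OF s(1)] h.hom_a_inv)
qed

lemma stalk_cancel:
  assumes Q: "Q \<in> W" and y: "b \<notin> Q" "t \<notin> Q" "y = frac (J m) Q b t"
    and z: "z \<in> carrier (stalk (J m) Q)" "z' \<in> carrier (stalk (J m) Q)"
    and e: "z \<otimes>\<^bsub>stalk (J m) Q\<^esub> y = z' \<otimes>\<^bsub>stalk (J m) Q\<^esub> y"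
  shows "z = z'"
proof -
  interpret F: local_frac "J m" Q by (rule local_fracI[OF Q])
  have i: "y \<otimes>\<^bsub>stalk (J m) Q\<^esub> frac (J m) Q t b = \<one>\<^bsub>stalk (J m) Q\<^esub>"
    unfolding y(3) using y(1,2) by (simp add: F.stalk_mult F.stalk_one)
      (rule F.frac_eqI, simp_all add: F.mult_notin F.one_notin)
  have c: "y \<in> carrier (stalk (J m) Q)" "frac (J m) Q t b \<in> carrier (stalk (J m) Q)"
    using y by (auto intro: F.frac_in_stalk)
  have "z \<otimes>\<^bsub>stalk (J m) Q\<^esub> y \<otimes>\<^bsub>stalk (J m) Q\<^esub> frac (J m) Q t b
      = z' \<otimes>\<^bsub>stalk (J m) Q\<^esub> y \<otimes>\<^bsub>stalk (J m) Q\<^esub> frac (J m) Q t b" by (simp add: e)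
  then show ?thesis using z c by (simp add: F.stalk.m_assoc i)
qed

lemma quot_mult:
  assumes Q: "Q \<in> W" and y: "b \<notin> Q" "t \<notin> Q" "y = frac (J m) Q b t" and x: "x \<in> carrier (stalk (J m) Q)"
  shows "quot m Q x y \<in> carrier (stalk (J m) Q)" "quot m Q x y \<otimes>\<^bsub>stalk (J m) Q\<^esub> y = x"
proof -
  interpret F: local_frac "J m" Q by (rule local_fracI[OF Q])
  obtain a s where a: "s \<notin> Q" "x = frac (J m) Q a s" using x by (rule F.stalkE)
  have q: "quot m Q x y = frac (J m) Q (a * t) (s * b)"
    unfolding a y(3) using quot_frac[OF Q a(1) y(2,1)] .
  show "quot m Q x y \<in> carrier (stalk (J m) Q)"
    unfolding q by (rule F.frac_in_stalk) (use a y F.mult_notin in blast)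
  show "quot m Q x y \<otimes>\<^bsub>stalk (J m) Q\<^esub> y = x"
    unfolding q unfolding y(3) a(2) using a(1) y(1,2)
    by (simp add: F.stalk_mult F.mult_notin) (rule F.frac_eqI, simp_all add: F.mult_notin algebra_simps)
qed

end

text \<open>The completion along p of the closed subscheme given by I, over a set W of points of
  characteristic p. The last assumption says that the local rings at these points have no
  p-torsion.\<close>

locale formal =
  fixes p :: nat and I :: "'a::comm_ring_1 set" and W :: "'a set set"
  assumes I: "is_ideal I" and prime_W: "\<And>Q. Q \<in> W \<Longrightarrow> is_prime Q"
    and I_W: "\<And>Q. Q \<in> W \<Longrightarrow> I \<subseteq> Q" and p_W: "\<And>Q. Q \<in> W \<Longrightarrow> of_nat p \<in> Q"
    and flat: "\<And>Q f. Q \<in> W \<Longrightarrow> of_nat p * f \<in> loc I Q \<Longrightarrow> f \<in> loc I Q"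

sublocale formal \<subseteq> sheaf "thick p I" W
proof
  show "is_ideal (thick p I m)" for m by (simp add: thick_eq[OF I] is_ideal_add[OF I])
  show "thick p I (Suc m) \<subseteq> thick p I m" for m
    unfolding thick_eq[OF I] by (rule subsetI) (rule ideal_add_power_mono[OF I, of "Suc m" "Suc (Suc m)"], simp_all)
  show "thick p I m \<subseteq> Q" if "Q \<in> W" for m Q
  proof -
    note P = prime_W[OF that]
    show ?thesis unfolding thick_eq[OF I] ideal_add_def
      using is_idealD[OF is_primeD(1)[OF P]] I_W[OF that] p_W[OF that] by (auto simp: is_primeD[OF P])
  qed
qed (rule prime_W)

context formal
begin

abbreviation "J \<equiv> thick p I"

lemma thick_iff: "f \<in> J m \<longleftrightarrow> (\<exists>g. f - of_nat p ^ Suc m * g \<in> I)"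
  unfolding thick_eq[OF I] ideal_add_iff ..

lemma local_I: "Q \<in> W \<Longrightarrow> local_frac I Q"
  using I prime_W by (simp add: local_frac_def)

lemma loc_thick_iff: "f \<in> loc (J m) Q \<longleftrightarrow> (\<exists>u g. u \<notin> Q \<and> u * f - of_nat p ^ Suc m * g \<in> I)"
  by (auto simp: loc_def thick_iff)

lemma flat_pow: "Q \<in> W \<Longrightarrow> of_nat p ^ k * f \<in> loc I Q \<Longrightarrow> f \<in> loc I Q"
  by (induction k) (auto simp: mult.assoc dest: flat)

text \<open>Absence of p-torsion allows p^k to be divided out of a relation modulo I; the modulus
  p^(m+k+1) then drops to p^(m+1).\<close>

lemma loc_thick_cancel:
  assumes Q: "Q \<in> W"
  shows "of_nat p ^ k * f \<in> loc (J (m + k)) Q \<longleftrightarrow> f \<in> loc (J m) Q"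
proof -
  interpret L: local_frac I Q by (rule local_I[OF Q])
  have e: "u * (of_nat p ^ k * f) - of_nat p ^ Suc (m + k) * g = of_nat p ^ k * (u * f - of_nat p ^ Suc m * g)"
    for u g by (simp add: algebra_simps power_add)
  show ?thesis
  proof
    assume "of_nat p ^ k * f \<in> loc (J (m + k)) Q"
    then obtain u g where u: "u \<notin> Q" "of_nat p ^ k * (u * f - of_nat p ^ Suc m * g) \<in> I"
      unfolding loc_thick_iff e by blast
    then obtain v where v: "v \<notin> Q" "v * (u * f - of_nat p ^ Suc m * g) \<in> I"
      using flat_pow[OF Q L.locI] by (auto simp: loc_def)
    have "v * (u * f - of_nat p ^ Suc m * g) = (v * u) * f - of_nat p ^ Suc m * (v * g)"
      by (simp add: algebra_simps)
    then show "f \<in> loc (J m) Q" using v(2) L.mult_notin[OF v(1) u(1)] unfolding loc_thick_iff by metis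
  next
    assume "f \<in> loc (J m) Q"
    then obtain u g where u: "u \<notin> Q" "u * f - of_nat p ^ Suc m * g \<in> I" unfolding loc_thick_iff by blast
    then show "of_nat p ^ k * f \<in> loc (J (m + k)) Q"
      unfolding loc_thick_iff e using is_idealD(3)[OF I] by blast
  qed
qed

text \<open>A section that vanishes at level m has, at every higher level, numerators that are
  p^(m+1) times something up to a unit. The quotients are unique by flatness, hence glue to a
  section, and no affineness of W is involved.\<close>

lemma divisible:
  assumes s: "\<sigma> \<in> carrier S" and z: "\<And>Q. Q \<in> W \<Longrightarrow> \<sigma> m Q = frac (J m) Q 0 1"
  shows "\<exists>\<rho>\<in>carrier S. \<sigma> = sect_of J W (of_nat p ^ Suc m) \<otimes>\<^bsub>S\<^esub> \<rho>"
proof -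
  let ?q = "of_nat p ^ Suc m :: 'a"
  \<comment> \<open>Division by p^(m+1) costs m + 1 levels, so level k of the quotient is read off
    from level k + m + 1 of the section. Collecting all admissible fractions avoids choosing
    numerators.\<close>
  define \<rho> where "\<rho> = (\<lambda>k Q. if Q \<in> W then {(c, t). t \<notin> Q \<and> (?q * c, t) \<in> \<sigma> (k + Suc m) Q} else {})"
  have ex: "\<exists>u c. u \<notin> Q \<and> u * a - ?q * c \<in> I"
    if Q: "Q \<in> W" and a: "s \<notin> Q" "\<sigma> (k + Suc m) Q = frac (J (k + Suc m)) Q a s" for Q k a s
  proof -
    interpret F: local_frac "J m" Q by (rule local_fracI[OF Q])
    have "frac (J m) Q a s = frac (J m) Q 0 1"
      using germ_down_le[OF s Q _ a, of m] z[OF Q] by simp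
    then have "a \<in> loc (J m) Q" using F.frac_0_iff[OF a(1)] by simp
    then show ?thesis unfolding loc_thick_iff by blast
  qed
  have key: "\<rho> k Q = frac (J k) Q c (u * s)"
    if Q: "Q \<in> W" and a: "s \<notin> Q" "\<sigma> (k + Suc m) Q = frac (J (k + Suc m)) Q a s"
      and u: "u \<notin> Q" "u * a - ?q * c \<in> I" for Q k a s u c
  proof -
    interpret F: local_frac "J (k + Suc m)" Q by (rule local_fracI[OF Q])
    have sub: "I \<subseteq> J (k + Suc m)" unfolding thick_eq[OF I] by (rule ideal_add_mono[OF I])
    have "a * t - ?q * c' * s \<in> loc (J (k + Suc m)) Q \<longleftrightarrow> c * t - c' * (u * s) \<in> loc (J k) Q" for t c'
    proof -
      have i: "u * (a * t - ?q * c' * s) - ?q * (c * t - c' * (u * s)) \<in> loc (J (k + Suc m)) Q"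
      proof -
        have "u * (a * t - ?q * c' * s) - ?q * (c * t - c' * (u * s)) = (u * a - ?q * c) * t"
          by (simp add: algebra_simps)
        also have "\<dots> \<in> I" using is_idealD(4)[OF I u(2)] .
        finally show ?thesis using sub F.locI by blast
      qed
      have "a * t - ?q * c' * s \<in> loc (J (k + Suc m)) Q \<longleftrightarrow> u * (a * t - ?q * c' * s) \<in> loc (J (k + Suc m)) Q"
        using F.loc_cancel[OF u(1)] F.locD(3) by blast
      also have "\<dots> \<longleftrightarrow> ?q * (c * t - c' * (u * s)) \<in> loc (J (k + Suc m)) Q"
        by (rule cong_mod_mem[OF F.is_ideal_loc]) (use i in \<open>simp add: cong_mod_def\<close>)
      also have "\<dots> \<longleftrightarrow> c * t - c' * (u * s) \<in> loc (J k) Q" by (rule loc_thick_cancel[OF Q])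
      finally show ?thesis .
    qed
    then show ?thesis using Q a(2) by (auto simp: \<rho>_def frac_loc)
  qed
  have \<rho>: "\<rho> \<in> carrier S"
  proof (rule sectionI)
    show "\<rho> k Q = {}" if "Q \<notin> W" for k Q using that by (simp add: \<rho>_def)
  next
    fix k Q assume Q: "Q \<in> W"
    obtain a r where a: "r \<notin> Q" "\<sigma> (Suc k + Suc m) Q = frac (J (Suc k + Suc m)) Q a r"
      by (rule germ[OF s Q])
    then have a': "\<sigma> (k + Suc m) Q = frac (J (k + Suc m)) Q a r" using germ_down[OF s Q a(1), of "k + Suc m"] by simp
    obtain u c where u: "u \<notin> Q" "u * a - ?q * c \<in> I" using ex[OF Q a] by blast
    show "\<exists>a s. \<rho> (Suc k) Q = frac (J (Suc k)) Q a s \<and> \<rho> k Q = frac (J k) Q a s"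
      using key[OF Q a u] key[OF Q a(1) a' u] by blast
  next
    fix k Q assume Q: "Q \<in> W"
    obtain V a r where V: "zariski_open V" "Q \<in> V"
      "\<forall>Q'\<in>V \<inter> W. r \<notin> Q' \<and> \<sigma> (k + Suc m) Q' = frac (J (k + Suc m)) Q' a r"
      by (rule sect_localD[OF s Q])
    then have a: "r \<notin> Q" "\<sigma> (k + Suc m) Q = frac (J (k + Suc m)) Q a r" using Q by auto
    obtain u c where u: "u \<notin> Q" "u * a - ?q * c \<in> I" using ex[OF Q a] by blast
    have "u * r \<notin> Q' \<and> \<rho> k Q' = frac (J k) Q' c (u * r)" if Q': "Q' \<in> (V \<inter> {P \<in> Spec. u \<notin> P}) \<inter> W" for Q'
    proof -
      have b: "Q' \<in> W" "r \<notin> Q'" "\<sigma> (k + Suc m) Q' = frac (J (k + Suc m)) Q' a r" "u \<notin> Q'" using Q' V(3) by auto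
      then show ?thesis using key[OF b(1-4) u(2)] is_primeD(4)[OF prime_W[OF b(1)]] by blast
    qed
    moreover have "zariski_open (V \<inter> {P \<in> Spec. u \<notin> P})" "Q \<in> V \<inter> {P \<in> Spec. u \<notin> P}"
      using zariski_open_Int[OF V(1) zariski_open_basic[of u]] V(2) u(1) prime_W[OF Q]
      by (simp_all add: Spec_iff)
    ultimately show "\<exists>V a s. zariski_open V \<and> Q \<in> V \<and> (\<forall>Q'\<in>V \<inter> W. s \<notin> Q' \<and> \<rho> k Q' = frac (J k) Q' a s)"
      by blast
  qed
  have "\<sigma> = sect_of J W ?q \<otimes>\<^bsub>S\<^esub> \<rho>"
  proof (rule section_eqI[OF s])
    show "sect_of J W ?q \<otimes>\<^bsub>S\<^esub> \<rho> \<in> carrier S" using \<rho> by (intro mult_closed) auto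
    fix k Q assume Q: "Q \<in> W"
    interpret F: local_frac "J k" Q by (rule local_fracI[OF Q])
    obtain a r where a: "r \<notin> Q" "\<sigma> (k + Suc m) Q = frac (J (k + Suc m)) Q a r" by (rule germ[OF s Q])
    obtain u c where u: "u \<notin> Q" "u * a - ?q * c \<in> I" using ex[OF Q a] by blast
    have "\<sigma> k Q = frac (J k) Q a r" using germ_down_le[OF s Q _ a, of k] by simp
    also have "\<dots> = frac (J k) Q (?q * c) (u * r)"
    proof -
      have "a * (u * r) - ?q * c * r = (u * a - ?q * c) * r" by (simp add: algebra_simps)
      also have "\<dots> \<in> I" by (rule is_idealD(4)[OF I u(2)])
      finally have "a * (u * r) - ?q * c * r \<in> loc (J k) Q"
        using F.locI ideal_add_mono[OF I] unfolding thick_eq[OF I] by blast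
      then show ?thesis using F.frac_eq_iff[OF a(1) F.mult_notin[OF u(1) a(1)]] by simp
    qed
    finally show "\<sigma> k Q = (sect_of J W ?q \<otimes>\<^bsub>S\<^esub> \<rho>) k Q"
      using key[OF Q a u] Q F.mult_notin[OF u(1) a(1)]
      by (simp add: S_mult sect_of_germ F.stalk_mult F.one_notin)
  qed
  then show ?thesis using \<rho> by blast
qed

lemma level_p_power:
  assumes Q: "Q \<in> W" and \<rho>: "\<rho> \<in> carrier S" and "m < k"
  shows "(sect_of J W (of_nat p ^ k) \<otimes>\<^bsub>S\<^esub> \<rho>) m Q = \<zero>\<^bsub>stalk (J m) Q\<^esub>"
proof -
  interpret F: local_frac "J m" Q by (rule local_fracI[OF Q])
  have "of_nat p ^ k = of_nat p ^ Suc m * (of_nat p ^ (k - Suc m) :: 'a)"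
    using \<open>m < k\<close> by (simp flip: power_add power_Suc)
  then have "of_nat p ^ k \<in> J m" unfolding thick_iff using is_idealD(1)[OF I] by (metis diff_self)
  then have "frac (J m) Q (of_nat p ^ k) 1 = \<zero>\<^bsub>stalk (J m) Q\<^esub>"
    using F.locI by (simp add: F.stalk_zero F.frac_0_iff F.one_notin)
  then show ?thesis using Q germ_in_stalk[OF \<rho> Q] by (simp add: S_mult sect_of_germ)
qed

lemma level_eqD:
  assumes Q: "Q \<in> W" and c: "\<sigma> \<in> carrier S" "\<tau> \<in> carrier S" "\<rho> \<in> carrier S"
    and e: "\<sigma> \<ominus>\<^bsub>S\<^esub> \<tau> = sect_of J W (of_nat p ^ k) \<otimes>\<^bsub>S\<^esub> \<rho>" and "m < k"
  shows "\<sigma> m Q = \<tau> m Q"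
proof -
  interpret F: local_frac "J m" Q by (rule local_fracI[OF Q])
  have "\<sigma> m Q \<ominus>\<^bsub>stalk (J m) Q\<^esub> \<tau> m Q = \<zero>\<^bsub>stalk (J m) Q\<^esub>"
    using level_p_power[OF Q c(3) \<open>m < k\<close>] germ_minus[OF Q c(1,2), of m] e by simp
  then show ?thesis using germ_in_stalk[OF c(1) Q] germ_in_stalk[OF c(2) Q] by simp
qed

lemma level_eq_iff:
  assumes c: "\<sigma> \<in> carrier S" "\<tau> \<in> carrier S"
  shows "(\<forall>Q\<in>W. \<sigma> m Q = \<tau> m Q) \<longleftrightarrow> (\<exists>\<rho>\<in>carrier S. \<sigma> \<ominus>\<^bsub>S\<^esub> \<tau> = sect_of J W (of_nat p ^ Suc m) \<otimes>\<^bsub>S\<^esub> \<rho>)"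
proof
  assume a: "\<forall>Q\<in>W. \<sigma> m Q = \<tau> m Q"
  have "(\<sigma> \<ominus>\<^bsub>S\<^esub> \<tau>) m Q = frac (J m) Q 0 1" if Q: "Q \<in> W" for Q
  proof -
    interpret F: local_frac "J m" Q by (rule local_fracI[OF Q])
    show ?thesis unfolding germ_minus[OF Q c] F.stalk_zero[symmetric]
      using a Q germ_in_stalk[OF c(2) Q, of m] by simp
  qed
  then show "\<exists>\<rho>\<in>carrier S. \<sigma> \<ominus>\<^bsub>S\<^esub> \<tau> = sect_of J W (of_nat p ^ Suc m) \<otimes>\<^bsub>S\<^esub> \<rho>"
    using divisible[of "\<sigma> \<ominus>\<^bsub>S\<^esub> \<tau>" m] c by (simp add: S.minus_closed)
next
  assume "\<exists>\<rho>\<in>carrier S. \<sigma> \<ominus>\<^bsub>S\<^esub> \<tau> = sect_of J W (of_nat p ^ Suc m) \<otimes>\<^bsub>S\<^esub> \<rho>"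
  then show "\<forall>Q\<in>W. \<sigma> m Q = \<tau> m Q" using level_eqD[OF _ c] by blast
qed

text \<open>Multiplication by p loses one level: level m + 1 of p times the section determines level
  m of the section.\<close>

lemma torsion_free:
  assumes s: "\<sigma> \<in> carrier S" and z: "sect_of J W (of_nat p) \<otimes>\<^bsub>S\<^esub> \<sigma> = \<zero>\<^bsub>S\<^esub>"
  shows "\<sigma> = \<zero>\<^bsub>S\<^esub>"
proof (rule section_eqI[OF s])
  fix m Q assume Q: "Q \<in> W"
  interpret F: local_frac "J (Suc m)" Q by (rule local_fracI[OF Q])
  interpret F': local_frac "J m" Q by (rule local_fracI[OF Q])
  obtain a r where a: "r \<notin> Q" "\<sigma> (Suc m) Q = frac (J (Suc m)) Q a r" by (rule germ[OF s Q])
  have "(sect_of J W (of_nat p) \<otimes>\<^bsub>S\<^esub> \<sigma>) (Suc m) Q = frac (J (Suc m)) Q 0 1"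
    unfolding z S_zero sect_of_germ[OF Q] ..
  then have "of_nat p * a \<in> loc (J (Suc m)) Q"
    using a Q by (simp add: S_mult sect_of_germ F.stalk_mult F.one_notin F.frac_0_iff)
  then have "a \<in> loc (J m) Q" using loc_thick_cancel[OF Q, of 1 a m] by simp
  then show "\<sigma> m Q = \<zero>\<^bsub>S\<^esub> m Q"
    using germ_down[OF s Q a] F'.frac_0_iff[OF a(1)] by (simp add: S_zero sect_of_germ[OF Q])
qed simp

lemma separated:
  assumes s: "\<sigma> \<in> carrier S"
    and z: "\<And>k. \<exists>\<rho>\<in>carrier S. \<sigma> = sect_of J W (of_nat p ^ k) \<otimes>\<^bsub>S\<^esub> \<rho>"
  shows "\<sigma> = \<zero>\<^bsub>S\<^esub>"
proof (rule section_eqI[OF s])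
  fix m Q assume Q: "Q \<in> W"
  obtain \<rho> where "\<rho> \<in> carrier S" "\<sigma> = sect_of J W (of_nat p ^ Suc m) \<otimes>\<^bsub>S\<^esub> \<rho>" using z by blast
  then show "\<sigma> m Q = \<zero>\<^bsub>S\<^esub> m Q"
    using level_p_power[OF Q, of \<rho> m "Suc m"] Q by (simp add: sections_def)
qed simp

lemma complete:
  assumes f: "\<And>k. f k \<in> carrier S"
    and d: "\<And>k. \<exists>\<rho>\<in>carrier S. f (Suc k) \<ominus>\<^bsub>S\<^esub> f k = sect_of J W (of_nat p ^ k) \<otimes>\<^bsub>S\<^esub> \<rho>"
  shows "\<exists>l\<in>carrier S. \<forall>k. \<exists>\<rho>\<in>carrier S. l \<ominus>\<^bsub>S\<^esub> f k = sect_of J W (of_nat p ^ k) \<otimes>\<^bsub>S\<^esub> \<rho>"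
proof -
  \<comment> \<open>At level m the sequence is constant from index m + 1 on, because f(k+1) - f(k)
    is divisible by p^k and p^k vanishes at the levels below k.\<close>
  define l where "l = (\<lambda>m. f (Suc m) m)"
  have st: "f k m Q = l m Q" if Q: "Q \<in> W" and "Suc m \<le> k" for k m Q
    using \<open>Suc m \<le> k\<close>
  proof (induction k rule: dec_induct)
    case (step k)
    obtain \<rho> where "\<rho> \<in> carrier S" "f (Suc k) \<ominus>\<^bsub>S\<^esub> f k = sect_of J W (of_nat p ^ k) \<otimes>\<^bsub>S\<^esub> \<rho>" using d by blast
    then have "f (Suc k) m Q = f k m Q" using level_eqD[OF Q f f, of \<rho> "Suc k" k k m] step by simp
    then show ?case using step by simp
  qed (simp add: l_def)
  have l: "l \<in> carrier S"
  proof (rule sectionI)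
    show "l m Q = {}" if "Q \<notin> W" for m Q using f[of "Suc m"] that by (simp add: l_def sections_def)
  next
    fix m Q assume Q: "Q \<in> W"
    obtain a s where a: "s \<notin> Q" "f (Suc (Suc m)) (Suc m) Q = frac (J (Suc m)) Q a s" by (rule germ[OF f Q])
    then show "\<exists>a s. l (Suc m) Q = frac (J (Suc m)) Q a s \<and> l m Q = frac (J m) Q a s"
      using germ_down[OF f Q a] st[OF Q, of m "Suc (Suc m)"] by (auto simp: l_def)
  next
    fix m Q assume Q: "Q \<in> W"
    obtain V a s where "zariski_open V" "Q \<in> V"
      "\<forall>Q'\<in>V \<inter> W. s \<notin> Q' \<and> f (Suc m) m Q' = frac (J m) Q' a s"
      by (rule sect_localD[OF f Q])
    then show "\<exists>V a s. zariski_open V \<and> Q \<in> V \<and> (\<forall>Q'\<in>V \<inter> W. s \<notin> Q' \<and> l m Q' = frac (J m) Q' a s)"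
      unfolding l_def by blast
  qed
  have "\<exists>\<rho>\<in>carrier S. l \<ominus>\<^bsub>S\<^esub> f k = sect_of J W (of_nat p ^ k) \<otimes>\<^bsub>S\<^esub> \<rho>" for k
  proof (cases k)
    case 0
    then show ?thesis using l f of.one by (intro bexI[of _ "l \<ominus>\<^bsub>S\<^esub> f k"]) (auto intro: S.minus_closed)
  next
    case (Suc m)
    then show ?thesis using level_eq_iff[OF l f, of m k] st[of _ m k] by auto
  qed
  then show ?thesis using l by blast
qed

subsection \<open>A presentation of the ring of sections by polynomials\<close>

text \<open>Surjects a polynomial ring, which is the ring of a type, onto the ring of sections, so
  that matrix theory over types applies to sections modulo \<open>relations\<close>. Variables that
  are not sections are sent to zero only to make the evaluation total.\<close>

definition present :: "('a sect, 'a) mpoly \<Rightarrow> 'a sect" where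
  "present = ev S (sect_of J W) (\<lambda>\<sigma>. if \<sigma> \<in> carrier S then \<sigma> else \<zero>\<^bsub>S\<^esub>)"

lemma type_hom_present: "type_hom S present"
  unfolding present_def by (rule of.type_hom_ev) simp

sublocale present: type_hom S present by (rule type_hom_present)

lemma present_Var [simp]: "\<sigma> \<in> carrier S \<Longrightarrow> present (Var \<sigma>) = \<sigma>"
  unfolding present_def by (subst of.ev_Var) auto

lemma present_Const [simp]: "present (Const a) = sect_of J W a"
  unfolding present_def by (subst of.ev_Const) auto

definition relations :: "('a sect, 'a) mpoly set" where
  "relations = {f. present f = \<zero>\<^bsub>S\<^esub>}"

lemma is_ideal_relations: "is_ideal relations"
  unfolding relations_def by (rule present.is_ideal_ker)

lemma relations_diff_iff: "f - g \<in> relations \<longleftrightarrow> present f = present g"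
  by (simp add: relations_def present.eq_iff)

lemma present_p_power: "present (of_nat p ^ k) = sect_of J W (of_nat p ^ k)"
  by (simp add: present.of_nat of.of_nat flip: of_nat_power)

text \<open>The dictionary between congruences in the presenting ring and divisibility by p^k of
  differences of sections; surjectivity of \<open>present\<close> gives the direction from right to
  left.\<close>

lemma ideal_add_relations_iff:
  "f - g \<in> ideal_add relations (of_nat p ^ k) \<longleftrightarrow>
    (\<exists>\<rho>\<in>carrier S. present f \<ominus>\<^bsub>S\<^esub> present g = sect_of J W (of_nat p ^ k) \<otimes>\<^bsub>S\<^esub> \<rho>)"
proof -
  have "f - g \<in> ideal_add relations (of_nat p ^ k) \<longleftrightarrow> (\<exists>a. present (f - g) = present (of_nat p ^ k * a))"
    unfolding ideal_add_iff relations_diff_iff ..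
  also have "\<dots> \<longleftrightarrow> (\<exists>a. present f \<ominus>\<^bsub>S\<^esub> present g = sect_of J W (of_nat p ^ k) \<otimes>\<^bsub>S\<^esub> present a)"
    by (simp add: present.diff present.mult present_p_power)
  also have "\<dots> \<longleftrightarrow> (\<exists>\<rho>\<in>carrier S. present f \<ominus>\<^bsub>S\<^esub> present g = sect_of J W (of_nat p ^ k) \<otimes>\<^bsub>S\<^esub> \<rho>)"
  proof
    show "\<exists>a. present f \<ominus>\<^bsub>S\<^esub> present g = sect_of J W (of_nat p ^ k) \<otimes>\<^bsub>S\<^esub> present a"
      if r: "\<exists>\<rho>\<in>carrier S. present f \<ominus>\<^bsub>S\<^esub> present g = sect_of J W (of_nat p ^ k) \<otimes>\<^bsub>S\<^esub> \<rho>"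
    proof -
      obtain \<rho> where "\<rho> \<in> carrier S" "present f \<ominus>\<^bsub>S\<^esub> present g = sect_of J W (of_nat p ^ k) \<otimes>\<^bsub>S\<^esub> \<rho>"
        using r by blast
      then show ?thesis by (intro exI[of _ "Var \<rho>"]) simp
    qed
  qed blast
  finally show ?thesis .
qed

lemma ideal_add_relations_level:
  "f - g \<in> ideal_add relations (of_nat p ^ Suc m) \<longleftrightarrow> (\<forall>Q\<in>W. present f m Q = present g m Q)"
  unfolding ideal_add_relations_iff by (rule level_eq_iff[symmetric]) auto

lemma relations_flat: "of_nat p * f \<in> relations \<Longrightarrow> f \<in> relations"
  using torsion_free[of "present f"] present_p_power[of 1]
  by (simp add: relations_def present.mult)

lemma relations_separated:
  assumes "\<And>k. f \<in> ideal_add relations (of_nat p ^ k)"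
  shows "f \<in> relations"
proof -
  have "\<exists>\<rho>\<in>carrier S. present f = sect_of J W (of_nat p ^ k) \<otimes>\<^bsub>S\<^esub> \<rho>" for k
    using ideal_add_relations_iff[of f 0 k] assms[of k] by (simp add: present.zero a_minus_def)
  then show ?thesis using separated[of "present f"] by (simp add: relations_def)
qed

lemma relations_complete:
  assumes "\<And>k. f (Suc k) - f k \<in> ideal_add relations (of_nat p ^ k)"
  shows "\<exists>l. \<forall>k. l - f k \<in> ideal_add relations (of_nat p ^ k)"
proof -
  obtain l where l: "l \<in> carrier S"
    "\<forall>k. \<exists>\<rho>\<in>carrier S. l \<ominus>\<^bsub>S\<^esub> present (f k) = sect_of J W (of_nat p ^ k) \<otimes>\<^bsub>S\<^esub> \<rho>"
    using complete[of "\<lambda>k. present (f k)"] assms unfolding ideal_add_relations_iff by auto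
  then show ?thesis by (intro exI[of _ "Var l"]) (simp add: ideal_add_relations_iff)
qed

end

section \<open>Extension of ring homomorphisms to sections, and lifts of Frobenius\<close>

section \<open>Extending ring homomorphisms to sections\<close>

text \<open>A morphism of formal schemes is determined by a continuous map \<pi> on points and a
  homomorphism e on functions, provided e kills I and sends functions that do not vanish at \<pi> Q
  to units at Q. Lifts of Frobenius (\<pi> the identity) and pullbacks along maps of spectra are
  both of this kind.\<close>

locale push = src: formal p I W + tgt: formal p I' Y + E: type_hom "sections (thick p I') Y" e
  for p :: nat and I :: "'a::comm_ring_1 set" and W and I' :: "'b::comm_ring_1 set" and Y
    and e :: "'a \<Rightarrow> 'b sect" +
  fixes \<pi> :: "'b set \<Rightarrow> 'a set"
  assumes point: "\<And>Q. Q \<in> Y \<Longrightarrow> \<pi> Q \<in> W"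
    and cont: "\<And>V Q. zariski_open V \<Longrightarrow> Q \<in> Y \<Longrightarrow> \<pi> Q \<in> V
      \<Longrightarrow> \<exists>V'. zariski_open V' \<and> Q \<in> V' \<and> (\<forall>Q'\<in>V' \<inter> Y. \<pi> Q' \<in> V)"
    and rel: "\<And>a. a \<in> I \<Longrightarrow> e a = \<zero>\<^bsub>sections (thick p I') Y\<^esub>"
    and unit: "\<And>Q s b t. Q \<in> Y \<Longrightarrow> s \<notin> \<pi> Q \<Longrightarrow> t \<notin> Q \<Longrightarrow> e s 0 Q = frac (thick p I' 0) Q b t \<Longrightarrow> b \<notin> Q"
begin

lemma germ_type_hom: "Q \<in> Y \<Longrightarrow> type_hom (stalk (tgt.J m) Q) (\<lambda>a. e a m Q)"
  by (rule type_hom_compI[OF E.type_hom_axioms local_frac.cring_stalk[OF tgt.local_fracI] tgt.germ_hom])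

lemma e_J:
  assumes Q: "Q \<in> Y" and a: "a \<in> src.J m"
  shows "e a m Q = \<zero>\<^bsub>stalk (tgt.J m) Q\<^esub>"
proof -
  interpret F: local_frac "tgt.J m" Q by (rule tgt.local_fracI[OF Q])
  obtain c where c: "a - of_nat p ^ Suc m * c \<in> I" using a src.thick_iff by blast
  have "e (of_nat p ^ Suc m) = sect_of tgt.J Y (of_nat p ^ Suc m)"
    unfolding of_nat_power[symmetric] E.of_nat tgt.of.of_nat ..
  then have "e a = sect_of tgt.J Y (of_nat p ^ Suc m) \<otimes>\<^bsub>tgt.S\<^esub> e c"
    using rel[OF c] E.eq_iff[of a "of_nat p ^ Suc m * c"] by (simp add: E.mult)
  then show ?thesis using tgt.level_p_power[OF Q E.closed, of m "Suc m" c] by simp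
qed

lemma e_unit:
  assumes Q: "Q \<in> Y" and s: "s \<notin> \<pi> Q"
  obtains b t where "b \<notin> Q" "t \<notin> Q" "e s m Q = frac (tgt.J m) Q b t"
proof -
  obtain b t where b: "t \<notin> Q" "e s m Q = frac (tgt.J m) Q b t" by (rule tgt.germ[OF E.closed Q])
  obtain b' t' where b': "t' \<notin> Q" "e s 0 Q = frac (tgt.J 0) Q b' t'" by (rule tgt.germ[OF E.closed Q])
  have "b \<notin> Q" using tgt.unit_germ_level[OF E.closed Q b b'] unit[OF Q s b'] by blast
  then show thesis using that b by blast
qed

definition push :: "'a sect \<Rightarrow> 'b sect" where
  "push \<sigma> = (\<lambda>m Q. if Q \<in> Y then \<Union>(a, s)\<in>\<sigma> m (\<pi> Q). tgt.quot m Q (e a m Q) (e s m Q) else {})"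

lemma e_quot:
  assumes Q: "Q \<in> Y" and s: "s \<notin> \<pi> Q"
  shows "tgt.quot m Q (e a m Q) (e s m Q) \<in> carrier (stalk (tgt.J m) Q)"
    "tgt.quot m Q (e a m Q) (e s m Q) \<otimes>\<^bsub>stalk (tgt.J m) Q\<^esub> e s m Q = e a m Q"
proof -
  obtain b t where b: "b \<notin> Q" "t \<notin> Q" "e s m Q = frac (tgt.J m) Q b t" by (rule e_unit[OF assms])
  show "tgt.quot m Q (e a m Q) (e s m Q) \<in> carrier (stalk (tgt.J m) Q)"
    "tgt.quot m Q (e a m Q) (e s m Q) \<otimes>\<^bsub>stalk (tgt.J m) Q\<^esub> e s m Q = e a m Q"
    using tgt.quot_mult[OF Q b tgt.germ_in_stalk[OF E.closed Q]] by auto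
qed

lemma e_cancel:
  assumes Q: "Q \<in> Y" and s: "s \<notin> \<pi> Q"
    and "z \<in> carrier (stalk (tgt.J m) Q)" "z' \<in> carrier (stalk (tgt.J m) Q)"
    and "z \<otimes>\<^bsub>stalk (tgt.J m) Q\<^esub> e s m Q = z' \<otimes>\<^bsub>stalk (tgt.J m) Q\<^esub> e s m Q"
  shows "z = z'"
proof -
  obtain b t where b: "b \<notin> Q" "t \<notin> Q" "e s m Q = frac (tgt.J m) Q b t" by (rule e_unit[OF Q s])
  show ?thesis by (rule tgt.stalk_cancel[OF Q b assms(3-5)])
qed

text \<open>If a/s = a'/s', then u (a s' - a' s) lies in the ideal of the level for some u outside
  the point, and e sends it to zero. The two quotients agree after multiplication by e(u s s'),
  which is a unit.\<close>

lemma push_eq: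
  assumes Q: "Q \<in> Y" and s: "s \<notin> \<pi> Q" and e: "\<sigma> m (\<pi> Q) = frac (src.J m) (\<pi> Q) a s"
  shows "push \<sigma> m Q = tgt.quot m Q (e a m Q) (e s m Q)"
proof -
  interpret F: local_frac "tgt.J m" Q by (rule tgt.local_fracI[OF Q])
  interpret G: local_frac "src.J m" "\<pi> Q" by (rule src.local_fracI[OF point[OF Q]])
  interpret H: type_hom "stalk (tgt.J m) Q" "\<lambda>a. e a m Q" by (rule germ_type_hom[OF Q])
  let ?z = "tgt.quot m Q (e a m Q) (e s m Q)"
  have "tgt.quot m Q (e a' m Q) (e s' m Q) = ?z" if m: "(a', s') \<in> \<sigma> m (\<pi> Q)" for a' s'
  proof -
    let ?z' = "tgt.quot m Q (e a' m Q) (e s' m Q)"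
    have s': "s' \<notin> \<pi> Q" and "a * s' - a' * s \<in> loc (src.J m) (\<pi> Q)" using m e by (auto simp: frac_loc)
    then obtain u where u: "u \<notin> \<pi> Q" "u * (a * s' - a' * s) \<in> src.J m" by (auto simp: loc_def)
    note q = e_quot[OF Q s, of m a] and q' = e_quot[OF Q s', of m a']
    have "e (u * a * s') m Q = e (u * a' * s) m Q"
      using e_J[OF Q u(2)] H.eq_iff[of "u * a * s'" "u * a' * s"] by (simp add: algebra_simps)
    then have "?z \<otimes>\<^bsub>stalk (tgt.J m) Q\<^esub> e s m Q \<otimes>\<^bsub>stalk (tgt.J m) Q\<^esub> (e u m Q \<otimes>\<^bsub>stalk (tgt.J m) Q\<^esub> e s' m Q)
       = ?z' \<otimes>\<^bsub>stalk (tgt.J m) Q\<^esub> e s' m Q \<otimes>\<^bsub>stalk (tgt.J m) Q\<^esub> (e u m Q \<otimes>\<^bsub>stalk (tgt.J m) Q\<^esub> e s m Q)"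
      unfolding q(2) q'(2) by (simp add: H.mult F.stalk.m_ac)
    then have c: "?z' \<otimes>\<^bsub>stalk (tgt.J m) Q\<^esub> e (u * s * s') m Q = ?z \<otimes>\<^bsub>stalk (tgt.J m) Q\<^esub> e (u * s * s') m Q"
      using q(1) q'(1) by (simp add: H.mult F.stalk.m_ac)
    have "u * s * s' \<notin> \<pi> Q" by (intro G.mult_notin u(1) s s')
    from e_cancel[OF Q this q'(1) q(1) c] show ?thesis .
  qed
  then have "(case x of (a', s') \<Rightarrow> tgt.quot m Q (e a' m Q) (e s' m Q)) = ?z" if "x \<in> \<sigma> m (\<pi> Q)" for x
    using that by (cases x) auto
  moreover have "(a, s) \<in> \<sigma> m (\<pi> Q)" unfolding e by (rule G.mem_frac_self[OF s])
  ultimately show ?thesis unfolding push_def using Q by (simp only: if_True) blast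
qed

lemma push_unique:
  assumes Q: "Q \<in> Y" and s: "s \<notin> \<pi> Q" and e: "\<sigma> m (\<pi> Q) = frac (src.J m) (\<pi> Q) a s"
    and z: "z \<in> carrier (stalk (tgt.J m) Q)" "z \<otimes>\<^bsub>stalk (tgt.J m) Q\<^esub> e s m Q = e a m Q"
  shows "push \<sigma> m Q = z"
  using e_cancel[OF Q s e_quot(1)[OF Q s] z(1)] e_quot(2)[OF Q s, of m a] z(2)
    push_eq[where \<sigma> = \<sigma> and m = m and a = a, OF Q s e] by simp

lemma push_closed:
  assumes \<sigma>: "\<sigma> \<in> carrier src.S"
  shows "push \<sigma> \<in> carrier tgt.S"
proof (rule tgt.sectionI)
  show "push \<sigma> m Q = {}" if "Q \<notin> Y" for m Q using that by (simp add: push_def)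
next
  fix m Q assume Q: "Q \<in> Y"
  note P = point[OF Q]
  obtain a s where a: "s \<notin> \<pi> Q" "\<sigma> (Suc m) (\<pi> Q) = frac (src.J (Suc m)) (\<pi> Q) a s"
    by (rule src.germ[OF \<sigma> P])
  note a' = src.germ_down[OF \<sigma> P a]
  obtain b t where b: "t \<notin> Q" "e a (Suc m) Q = frac (tgt.J (Suc m)) Q b t" by (rule tgt.germ[OF E.closed Q])
  obtain c r where c: "c \<notin> Q" "r \<notin> Q" "e s (Suc m) Q = frac (tgt.J (Suc m)) Q c r" by (rule e_unit[OF Q a(1)])
  have "push \<sigma> (Suc m) Q = frac (tgt.J (Suc m)) Q (b * r) (t * c)"
    unfolding push_eq[OF Q a(1), of \<sigma>, OF a(2)] b(2) c(3) by (rule tgt.quot_frac[OF Q b(1) c(2,1)])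
  moreover have "push \<sigma> m Q = frac (tgt.J m) Q (b * r) (t * c)"
    unfolding push_eq[OF Q a(1), of \<sigma>, OF a'] tgt.germ_down[OF E.closed Q b] tgt.germ_down[OF E.closed Q c(2,3)]
    by (rule tgt.quot_frac[OF Q b(1) c(2,1)])
  ultimately show "\<exists>a s. push \<sigma> (Suc m) Q = frac (tgt.J (Suc m)) Q a s \<and> push \<sigma> m Q = frac (tgt.J m) Q a s"
    by blast
next
  fix m Q assume Q: "Q \<in> Y"
  note P = point[OF Q]
  obtain V a s where V: "zariski_open V" "\<pi> Q \<in> V"
    "\<forall>Q'\<in>V \<inter> W. s \<notin> Q' \<and> \<sigma> m Q' = frac (src.J m) Q' a s"
    by (rule src.sect_localD[OF \<sigma> P])
  obtain V' where V': "zariski_open V'" "Q \<in> V'" "\<forall>Q'\<in>V' \<inter> Y. \<pi> Q' \<in> V" using cont[OF V(1) Q V(2)] by blast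
  obtain V1 b t where V1: "zariski_open V1" "Q \<in> V1"
    "\<forall>Q'\<in>V1 \<inter> Y. t \<notin> Q' \<and> e a m Q' = frac (tgt.J m) Q' b t"
    by (rule tgt.sect_localD[OF E.closed Q])
  obtain V2 c r where V2: "zariski_open V2" "Q \<in> V2"
    "\<forall>Q'\<in>V2 \<inter> Y. r \<notin> Q' \<and> e s m Q' = frac (tgt.J m) Q' c r"
    by (rule tgt.sect_localD[OF E.closed Q])
  have k: "t * c \<notin> Q' \<and> push \<sigma> m Q' = frac (tgt.J m) Q' (b * r) (t * c)"
    if Q': "Q' \<in> Y" "Q' \<in> V'" "Q' \<in> V1" "Q' \<in> V2" for Q'
  proof -
    have s: "s \<notin> \<pi> Q'" "\<sigma> m (\<pi> Q') = frac (src.J m) (\<pi> Q') a s" using Q' V(3) V'(3) point by auto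
    have bt: "t \<notin> Q'" "e a m Q' = frac (tgt.J m) Q' b t" "r \<notin> Q'" "e s m Q' = frac (tgt.J m) Q' c r"
      using Q' V1(3) V2(3) by auto
    interpret F: local_frac "tgt.J m" Q' by (rule tgt.local_fracI[OF Q'(1)])
    obtain c' r' where c': "c' \<notin> Q'" "r' \<notin> Q'" "e s m Q' = frac (tgt.J m) Q' c' r'" by (rule e_unit[OF Q'(1) s(1)])
    \<comment> \<open>Near Q the numerator c represents e s on a whole neighbourhood, and e s is a
      unit at Q', so c avoids Q'.\<close>
    have c: "c \<notin> Q'"
      using tgt.loc_notin[OF Q'(1), of c r' c' r m] F.frac_eq_iff[OF bt(3) c'(2), of c c'] bt c' by simp
    show ?thesis
      unfolding push_eq[OF Q'(1) s(1), of \<sigma>, OF s(2)] bt(2,4)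
      using tgt.quot_frac[OF Q'(1) bt(1,3) c] F.mult_notin[OF bt(1) c] by blast
  qed
  have "zariski_open (V' \<inter> (V1 \<inter> V2))" using V' V1 V2 by (intro zariski_open_Int)
  then show "\<exists>V a s. zariski_open V \<and> Q \<in> V \<and> (\<forall>Q'\<in>V \<inter> Y. s \<notin> Q' \<and> push \<sigma> m Q' = frac (tgt.J m) Q' a s)"
    using k V'(2) V1(2) V2(2) by blast
qed

lemma push_sect_of: "push (sect_of src.J W a) = e a"
proof (rule tgt.section_eqI)
  fix m Q assume Q: "Q \<in> Y"
  interpret H: type_hom "stalk (tgt.J m) Q" "\<lambda>a. e a m Q" by (rule germ_type_hom[OF Q])
  interpret G: local_frac "src.J m" "\<pi> Q" by (rule src.local_fracI[OF point[OF Q]])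
  show "push (sect_of src.J W a) m Q = e a m Q"
    by (rule push_unique[OF Q G.one_notin, where a = a])
      (simp_all add: src.sect_of_germ[OF point[OF Q]] H.one)
qed (auto intro: push_closed)

lemma push_hom: "push \<in> Ring.ring_hom src.S tgt.S"
proof (intro Ring.ring_hom_memI)
  fix \<sigma> \<tau> assume \<sigma>: "\<sigma> \<in> carrier src.S" and \<tau>: "\<tau> \<in> carrier src.S"
  show "push (\<sigma> \<otimes>\<^bsub>src.S\<^esub> \<tau>) = push \<sigma> \<otimes>\<^bsub>tgt.S\<^esub> push \<tau>" (is "?m") and
    "push (\<sigma> \<oplus>\<^bsub>src.S\<^esub> \<tau>) = push \<sigma> \<oplus>\<^bsub>tgt.S\<^esub> push \<tau>" (is "?a")
  proof -
    have "push (\<sigma> \<otimes>\<^bsub>src.S\<^esub> \<tau>) m Q = (push \<sigma> \<otimes>\<^bsub>tgt.S\<^esub> push \<tau>) m Q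
        \<and> push (\<sigma> \<oplus>\<^bsub>src.S\<^esub> \<tau>) m Q = (push \<sigma> \<oplus>\<^bsub>tgt.S\<^esub> push \<tau>) m Q" if Q: "Q \<in> Y" for m Q
    proof -
      note P = point[OF Q]
      interpret F: local_frac "tgt.J m" Q by (rule tgt.local_fracI[OF Q])
      interpret G: local_frac "src.J m" "\<pi> Q" by (rule src.local_fracI[OF P])
      interpret H: type_hom "stalk (tgt.J m) Q" "\<lambda>a. e a m Q" by (rule germ_type_hom[OF Q])
      obtain a s where a: "s \<notin> \<pi> Q" "\<sigma> m (\<pi> Q) = frac (src.J m) (\<pi> Q) a s" by (rule src.germ[OF \<sigma> P])
      obtain b t where b: "t \<notin> \<pi> Q" "\<tau> m (\<pi> Q) = frac (src.J m) (\<pi> Q) b t" by (rule src.germ[OF \<tau> P])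
      define z where "z = push \<sigma> m Q"
      define z' where "z' = push \<tau> m Q"
      have z: "z \<in> carrier (stalk (tgt.J m) Q)" "e a m Q = z \<otimes>\<^bsub>stalk (tgt.J m) Q\<^esub> e s m Q"
        using e_quot[OF Q a(1), of m a] push_eq[OF Q a(1), of \<sigma>, OF a(2)] by (simp_all add: z_def)
      have z': "z' \<in> carrier (stalk (tgt.J m) Q)" "e b m Q = z' \<otimes>\<^bsub>stalk (tgt.J m) Q\<^esub> e t m Q"
        using e_quot[OF Q b(1), of m b] push_eq[OF Q b(1), of \<tau>, OF b(2)] by (simp_all add: z'_def)
      note st = G.mult_notin[OF a(1) b(1)]
      have "push (\<sigma> \<otimes>\<^bsub>src.S\<^esub> \<tau>) m Q = z \<otimes>\<^bsub>stalk (tgt.J m) Q\<^esub> z'"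
        by (rule push_unique[OF Q st, where a = "a * b"])
          (use z z' in \<open>simp_all add: src.S_mult[OF P] a b G.stalk_mult H.mult F.stalk.m_ac\<close>)
      moreover have "push (\<sigma> \<oplus>\<^bsub>src.S\<^esub> \<tau>) m Q = z \<oplus>\<^bsub>stalk (tgt.J m) Q\<^esub> z'"
      proof (rule push_unique[OF Q st, where a = "a * t + b * s"])
        have "(z \<oplus>\<^bsub>stalk (tgt.J m) Q\<^esub> z') \<otimes>\<^bsub>stalk (tgt.J m) Q\<^esub> e (s * t) m Q
          = z \<otimes>\<^bsub>stalk (tgt.J m) Q\<^esub> e (s * t) m Q \<oplus>\<^bsub>stalk (tgt.J m) Q\<^esub> z' \<otimes>\<^bsub>stalk (tgt.J m) Q\<^esub> e (s * t) m Q"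
          by (rule F.stalk.l_distr) (simp_all add: z(1) z'(1))
        then show "(z \<oplus>\<^bsub>stalk (tgt.J m) Q\<^esub> z') \<otimes>\<^bsub>stalk (tgt.J m) Q\<^esub> e (s * t) m Q = e (a * t + b * s) m Q"
          using z(1) z'(1) by (simp add: H.mult H.add z(2) z'(2) F.stalk.m_ac)
      qed (simp_all add: src.S_add[OF P] a b G.stalk_add z(1) z'(1))
      ultimately show ?thesis using Q by (simp add: tgt.S_mult tgt.S_add z_def z'_def)
    qed
    then show ?m ?a
      using \<sigma> \<tau> push_closed src.mult_closed src.add_closed tgt.mult_closed tgt.add_closed
      by (auto intro!: tgt.section_eqI)
  qed
qed (simp_all add: push_closed src.S_one push_sect_of E.one del: One_nat_def)

end

section \<open>Lifts of Frobenius\<close>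

lemma formal_subset: "formal p I Z \<Longrightarrow> W \<subseteq> Z \<Longrightarrow> formal p I W"
  unfolding formal_def by blast

lemma opens_subset: "W \<in> opens Z \<Longrightarrow> W \<subseteq> Z"
  by (auto simp: opens_def)

lemma opens_Int: "W \<in> opens Z \<Longrightarrow> zariski_open V \<Longrightarrow> V \<inter> W \<in> opens Z"
proof -
  assume "W \<in> opens Z" and V: "zariski_open V"
  then obtain V' where V': "W = V' \<inter> Z" "zariski_open V'" by (auto simp: opens_def)
  then have "V \<inter> W = (V \<inter> V') \<inter> Z" by blast
  then show ?thesis using zariski_open_Int[OF V V'(2)] by (auto simp: opens_def)
qed

context formal
begin

lemma restrict_closed:
  assumes "W' \<subseteq> W" "\<sigma> \<in> carrier S"
  shows "restrict_sect W' \<sigma> \<in> carrier (sections J W')"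
proof -
  interpret R: formal p I W' by (rule formal_subset[OF formal_axioms assms(1)])
  show ?thesis
  proof (rule R.sectionI)
    show "restrict_sect W' \<sigma> m Q = {}" if "Q \<notin> W'" for m Q using that by (simp add: restrict_sect_def)
  next
    fix m Q assume Q': "Q \<in> W'"
    then have Q: "Q \<in> W" using assms(1) by blast
    obtain a s where a: "s \<notin> Q" "\<sigma> (Suc m) Q = frac (J (Suc m)) Q a s" by (rule germ[OF assms(2) Q])
    then show "\<exists>a s. restrict_sect W' \<sigma> (Suc m) Q = frac (J (Suc m)) Q a s \<and> restrict_sect W' \<sigma> m Q = frac (J m) Q a s"
      using germ_down[OF assms(2) Q a] Q' by (auto simp: restrict_sect_def)
  next
    fix m Q assume Q': "Q \<in> W'"
    then have Q: "Q \<in> W" using assms(1) by blast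
    obtain V a s where "zariski_open V" "Q \<in> V" "\<forall>Q'\<in>V \<inter> W. s \<notin> Q' \<and> \<sigma> m Q' = frac (J m) Q' a s"
      by (rule sect_localD[OF assms(2) Q])
    then show "\<exists>V a s. zariski_open V \<and> Q \<in> V
        \<and> (\<forall>Q'\<in>V \<inter> W'. s \<notin> Q' \<and> restrict_sect W' \<sigma> m Q' = frac (J m) Q' a s)"
      using assms(1) by (intro exI[of _ V] exI[of _ a] exI[of _ s]) (auto simp: restrict_sect_def)
  qed
qed

lemma restrict_hom:
  assumes "W' \<subseteq> W"
  shows "restrict_sect W' \<in> Ring.ring_hom S (sections J W')"
proof -
  interpret R: formal p I W' by (rule formal_subset[OF formal_axioms assms(1)])
  show ?thesis
  proof (intro Ring.ring_hom_memI)
    fix \<sigma> \<tau> assume c: "\<sigma> \<in> carrier S" "\<tau> \<in> carrier S"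
    show "restrict_sect W' \<sigma> \<in> carrier (sections J W')" by (rule restrict_closed[OF assms c(1)])
    show "restrict_sect W' (\<sigma> \<otimes>\<^bsub>S\<^esub> \<tau>) = restrict_sect W' \<sigma> \<otimes>\<^bsub>sections J W'\<^esub> restrict_sect W' \<tau>"
      "restrict_sect W' (\<sigma> \<oplus>\<^bsub>S\<^esub> \<tau>) = restrict_sect W' \<sigma> \<oplus>\<^bsub>sections J W'\<^esub> restrict_sect W' \<tau>"
      using assms by (auto simp: sections_def restrict_sect_def fun_eq_iff)
  next
    show "restrict_sect W' \<one>\<^bsub>S\<^esub> = \<one>\<^bsub>sections J W'\<^esub>"
      using assms by (auto simp: sections_def restrict_sect_def fun_eq_iff)
  qed
qed

lemma restrict_sect_of: "W' \<subseteq> W \<Longrightarrow> restrict_sect W' (sect_of J W a) = sect_of J W' a"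
  by (auto simp: restrict_sect_def sect_of_def fun_eq_iff)

end

text \<open>At a fixed level a section is locally a fraction a/s. Both lifts agree on a and s, which
  are polynomials in constants and variables, and the image of s is invertible, so they agree on a/s
  modulo that power of p.\<close>

lemma frobenius_lift_unique:
  fixes \<phi> :: "'r::comm_ring_1 \<Rightarrow> 'r" and I :: "('v, 'r) mpoly set"
  assumes Z: "formal p I Z"
    and \<Phi>: "frobenius_lift p \<phi> (thick p I) Z \<Phi>" and \<Psi>: "frobenius_lift p \<phi> (thick p I) Z \<Psi>"
    and V: "\<And>v. \<Phi> Z (sect_of (thick p I) Z (Var v)) = \<Psi> Z (sect_of (thick p I) Z (Var v))"
  shows "same_morphism (thick p I) Z \<Phi> \<Psi>"
  unfolding same_morphism_def
proof (intro ballI)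
  interpret Z: formal p I Z by (rule Z)
  have ZZ: "Z \<in> opens Z"
    unfolding opens_def using zariski_open_Spec Z.prime_W by (auto simp: Spec_iff intro!: exI[of _ Spec])
  have agree: "\<Phi> W (sect_of Z.J W f) = \<Psi> W (sect_of Z.J W f)"
    and th: "type_hom (sections Z.J W) (\<lambda>f. \<Phi> W (sect_of Z.J W f))" "type_hom (sections Z.J W) (\<lambda>f. \<Psi> W (sect_of Z.J W f))"
    if W: "W \<in> opens Z" for W f
  proof -
    interpret W: formal p I W by (rule formal_subset[OF Z opens_subset[OF W]])
    show h: "type_hom (sections Z.J W) (\<lambda>f. \<Phi> W (sect_of Z.J W f))" "type_hom (sections Z.J W) (\<lambda>f. \<Psi> W (sect_of Z.J W f))"
      using \<Phi> \<Psi> W by (auto intro!: type_hom_compI[OF W.type_hom_sect_of W.cring_S] simp: frobenius_lift_def)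
    have r: "\<Theta> W (sect_of Z.J W (Var v)) = restrict_sect W (\<Theta> Z (sect_of Z.J Z (Var v)))"
      if "frobenius_lift p \<phi> Z.J Z \<Theta>" for \<Theta> v
    proof -
      have "restrict_sect W (\<Theta> Z \<sigma>) = \<Theta> W (restrict_sect W \<sigma>)" if "\<sigma> \<in> carrier Z.S" for \<sigma>
        using \<open>frobenius_lift p \<phi> Z.J Z \<Theta>\<close> W ZZ opens_subset[OF W] that unfolding frobenius_lift_def by blast
      then show ?thesis by (simp add: Z.restrict_sect_of[OF opens_subset[OF W]])
    qed
    show "\<Phi> W (sect_of Z.J W f) = \<Psi> W (sect_of Z.J W f)"
    proof (rule type_hom_eqI[OF h])
      show "\<Phi> W (sect_of Z.J W (Const c)) = \<Psi> W (sect_of Z.J W (Const c))" for c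
        using \<Phi> \<Psi> W by (simp add: frobenius_lift_def)
      show "\<Phi> W (sect_of Z.J W (Var v)) = \<Psi> W (sect_of Z.J W (Var v))" for v
        unfolding r[OF \<Phi>] r[OF \<Psi>] V ..
    qed
  qed
  fix W \<sigma> assume W: "W \<in> opens Z" and \<sigma>: "\<sigma> \<in> carrier (sections Z.J W)"
  interpret W: formal p I W by (rule formal_subset[OF Z opens_subset[OF W]])
  show "\<Phi> W \<sigma> = \<Psi> W \<sigma>"
  proof (rule W.section_eqI)
    show "\<Phi> W \<sigma> \<in> carrier W.S" "\<Psi> W \<sigma> \<in> carrier W.S"
    proof -
      have "\<Phi> W \<in> Ring.ring_hom W.S W.S" "\<Psi> W \<in> Ring.ring_hom W.S W.S"
        using \<Phi> \<Psi> W by (simp_all add: frobenius_lift_def)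
      then show "\<Phi> W \<sigma> \<in> carrier W.S" "\<Psi> W \<sigma> \<in> carrier W.S"
        using Ring.ring_hom_closed[OF _ \<sigma>] by auto
    qed
    fix m Q assume Q: "Q \<in> W"
    obtain V a s where V: "zariski_open V" "Q \<in> V" "\<forall>Q'\<in>V \<inter> W. s \<notin> Q' \<and> \<sigma> m Q' = frac (Z.J m) Q' a s"
      by (rule W.sect_localD[OF \<sigma> Q])
    \<comment> \<open>On this smaller open set one fraction represents the section at level m, and s
      becomes a unit there. Compatibility with restriction carries the comparison back to W.\<close>
    define W' where "W' = V \<inter> W"
    have W': "W' \<in> opens Z" "W' \<subseteq> W" "Q \<in> W'" using opens_Int[OF W V(1)] Q V(2) by (auto simp: W'_def)
    interpret W': formal p I W' by (rule formal_subset[OF Z opens_subset[OF W'(1)]])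
    define \<tau> where "\<tau> = restrict_sect W' \<sigma>"
    have \<tau>: "\<tau> \<in> carrier W'.S" unfolding \<tau>_def by (rule W.restrict_closed[OF W'(2) \<sigma>])
    have s: "s \<notin> Q'" "\<tau> m Q' = frac (Z.J m) Q' a s" if "Q' \<in> W'" for Q'
      using that V(3) by (auto simp: \<tau>_def W'_def restrict_sect_def)
    obtain \<rho> where \<rho>: "\<rho> \<in> carrier W'.S" "\<rho> \<otimes>\<^bsub>W'.S\<^esub> sect_of Z.J W' s = \<one>\<^bsub>W'.S\<^esub>"
    proof -
      have "b \<notin> Q'" if Q': "Q' \<in> W'" "t \<notin> Q'" "sect_of Z.J W' s 0 Q' = frac (Z.J 0) Q' b t" for Q' b t
      proof -
        interpret F: local_frac "Z.J 0" Q' by (rule W'.local_fracI[OF Q'(1)])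
        have "s * t - b * 1 \<in> loc (Z.J 0) Q'"
          using Q' F.frac_eq_iff[OF F.one_notin Q'(2), of s b] by (simp add: W'.sect_of_germ)
        then show ?thesis using W'.loc_notin[OF Q'(1)] Q'(2) F.one_notin s(1)[OF Q'(1)] by blast
      qed
      then show thesis using W'.unitI[OF W'.sect_of_closed, of s] that by blast
    qed
    have "\<forall>Q'\<in>W'. (\<tau> \<otimes>\<^bsub>W'.S\<^esub> sect_of Z.J W' s) m Q' = sect_of Z.J W' a m Q'"
    proof
      fix Q' assume Q': "Q' \<in> W'"
      interpret F: local_frac "Z.J m" Q' by (rule W'.local_fracI[OF Q'])
      show "(\<tau> \<otimes>\<^bsub>W'.S\<^esub> sect_of Z.J W' s) m Q' = sect_of Z.J W' a m Q'"
        unfolding W'.S_mult[OF Q'] W'.sect_of_germ[OF Q'] s(2)[OF Q'] F.stalk_mult[OF s(1)[OF Q'] F.one_notin]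
        by (rule F.frac_eqI) (use s(1)[OF Q'] F.one_notin in simp_all)
    qed
    \<comment> \<open>A lift is a homomorphism of the whole ring of sections and need not act on a
      single level. Equality at level m is therefore rewritten as divisibility by p^(m+1), which
      every homomorphism preserves.\<close>
    then obtain \<xi> where \<xi>: "\<xi> \<in> carrier W'.S"
      "\<tau> \<otimes>\<^bsub>W'.S\<^esub> sect_of Z.J W' s \<ominus>\<^bsub>W'.S\<^esub> sect_of Z.J W' a = sect_of Z.J W' (of_nat p ^ Suc m) \<otimes>\<^bsub>W'.S\<^esub> \<xi>"
      using W'.level_eq_iff[OF W'.mult_closed[OF \<tau> W'.sect_of_closed] W'.sect_of_closed] by blast
    have main: "\<Theta> W' \<tau> \<in> carrier W'.S \<and> (\<Theta> W' \<tau> \<otimes>\<^bsub>W'.S\<^esub> \<Theta> W' (sect_of Z.J W' s)) m Q = \<Theta> W' (sect_of Z.J W' a) m Q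
        \<and> \<Theta> W' \<rho> \<otimes>\<^bsub>W'.S\<^esub> \<Theta> W' (sect_of Z.J W' s) = \<one>\<^bsub>W'.S\<^esub> \<and> \<Theta> W' \<rho> \<in> carrier W'.S
        \<and> \<Theta> W \<sigma> m Q = \<Theta> W' \<tau> m Q"
      if \<Theta>: "frobenius_lift p \<phi> Z.J Z \<Theta>" and hom: "type_hom W'.S (\<lambda>f. \<Theta> W' (sect_of Z.J W' f))" for \<Theta>
    proof -
      interpret h: type_hom W'.S "\<lambda>f. \<Theta> W' (sect_of Z.J W' f)" by (rule hom)
      interpret t: ring_hom_cring W'.S W'.S "\<Theta> W'"
        by (intro ring_hom_cringI W'.cring_S) (use \<Theta> W'(1) in \<open>simp add: frobenius_lift_def\<close>)
      have "\<Theta> W' (sect_of Z.J W' (of_nat p ^ Suc m)) = sect_of Z.J W' (of_nat p ^ Suc m)"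
        unfolding of_nat_power[symmetric] by (rule trans[OF h.of_nat W'.of.of_nat[symmetric]])
      then have e1: "\<Theta> W' \<tau> \<otimes>\<^bsub>W'.S\<^esub> \<Theta> W' (sect_of Z.J W' s) \<ominus>\<^bsub>W'.S\<^esub> \<Theta> W' (sect_of Z.J W' a)
          = sect_of Z.J W' (of_nat p ^ Suc m) \<otimes>\<^bsub>W'.S\<^esub> \<Theta> W' \<xi>"
        using arg_cong[OF \<xi>(2), of "\<Theta> W'"] \<tau> \<xi>(1)
        by (simp add: a_minus_def)
      have "(\<Theta> W' \<tau> \<otimes>\<^bsub>W'.S\<^esub> \<Theta> W' (sect_of Z.J W' s)) m Q = \<Theta> W' (sect_of Z.J W' a) m Q"
        by (rule W'.level_eqD[OF W'(3) _ _ _ e1]) (use \<tau> \<xi>(1) in simp_all)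
      moreover have "\<Theta> W \<sigma> m Q = \<Theta> W' \<tau> m Q"
      proof -
        have "restrict_sect W' (\<Theta> W \<sigma>) = \<Theta> W' \<tau>"
          using \<Theta> W W' \<sigma> unfolding frobenius_lift_def \<tau>_def by blast
        from arg_cong[OF this, of "\<lambda>x. x m Q"] show ?thesis using W'(3) by (simp add: restrict_sect_def)
      qed
      moreover have "\<Theta> W' \<rho> \<otimes>\<^bsub>W'.S\<^esub> \<Theta> W' (sect_of Z.J W' s) = \<one>\<^bsub>W'.S\<^esub>"
        using arg_cong[OF \<rho>(2), of "\<Theta> W'"] \<rho>(1) by simp
      ultimately show ?thesis using \<tau> \<rho>(1) by simp
    qed
    interpret F: local_frac "Z.J m" Q by (rule W'.local_fracI[OF W'(3)])
    note th' = th[OF W'(1)]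
    let ?m = "mult (stalk (Z.J m) Q)"
    define y where "y = \<Phi> W' (sect_of Z.J W' s) m Q"
    define w where "w = \<Phi> W' \<rho> m Q"
    have y: "y \<in> carrier (stalk (Z.J m) Q)" unfolding y_def
      by (rule W'.germ_in_stalk[OF type_hom.closed[OF th'(1)] W'(3)])
    have w: "w \<in> carrier (stalk (Z.J m) Q)" unfolding w_def
      using main[OF \<Phi> th'(1)] W'.germ_in_stalk[OF _ W'(3)] by blast
    have wy: "?m w y = \<one>\<^bsub>stalk (Z.J m) Q\<^esub>"
    proof -
      have "\<Phi> W' \<rho> \<otimes>\<^bsub>W'.S\<^esub> \<Phi> W' (sect_of Z.J W' s) = \<one>\<^bsub>W'.S\<^esub>" using main[OF \<Phi> th'(1)] by blast
      from arg_cong[OF this, of "\<lambda>x. x m Q"] show ?thesis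
        using W'(3) by (simp add: W'.S_mult y_def w_def W'.S_one W'.sect_of_germ F.stalk_one)
    qed
    have z: "\<Phi> W' \<tau> m Q \<in> carrier (stalk (Z.J m) Q)" "\<Psi> W' \<tau> m Q \<in> carrier (stalk (Z.J m) Q)"
      using main[OF \<Phi> th'(1)] main[OF \<Psi> th'(2)] W'.germ_in_stalk[OF _ W'(3)] by blast+
    have "?m (\<Phi> W' \<tau> m Q) y = ?m (\<Psi> W' \<tau> m Q) y"
      using main[OF \<Phi> th'(1)] main[OF \<Psi> th'(2)] agree[OF W'(1)] by (simp add: W'.S_mult[OF W'(3)] y_def)
    then have "?m (?m (\<Phi> W' \<tau> m Q) y) w = ?m (?m (\<Psi> W' \<tau> m Q) y) w" by simp
    then have "\<Phi> W' \<tau> m Q = \<Psi> W' \<tau> m Q"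
      using z y w wy by (simp add: F.stalk.m_assoc F.stalk.m_comm[of y w])
    then show "\<Phi> W \<sigma> m Q = \<Psi> W \<sigma> m Q" using main[OF \<Phi> th'(1)] main[OF \<Psi> th'(2)] by simp
  qed
qed

lemma freshman_dream:
  fixes a b :: "'a::comm_ring_1"
  assumes p: "prime p"
  shows "of_nat p dvd (a + b) ^ p - (a ^ p + b ^ p)"
proof -
  have p1: "1 \<le> p" using prime_gt_0_nat[OF p] by simp
  have "(a + b) ^ p = (\<Sum>k\<in>{0..p}. of_nat (p choose k) * a ^ k * b ^ (p - k))"
    by (simp add: binomial_ring atMost_atLeast0)
  also have "{0..p} = insert 0 (insert p {1..<p})" using p1 by auto
  also have "(\<Sum>k\<in>insert 0 (insert p {1..<p}). of_nat (p choose k) * a ^ k * b ^ (p - k))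
      = b ^ p + (a ^ p + (\<Sum>k\<in>{1..<p}. of_nat (p choose k) * a ^ k * b ^ (p - k)))"
    using p1 by simp
  finally have e: "(a + b) ^ p - (a ^ p + b ^ p) = (\<Sum>k\<in>{1..<p}. of_nat (p choose k) * a ^ k * b ^ (p - k))"
    by (simp add: algebra_simps)
  have d: "of_nat p dvd (of_nat (p choose k) * a ^ k * b ^ (p - k) :: 'a)" if "k \<in> {1..<p}" for k
  proof -
    have "p dvd (p choose k)" using that p by (intro dvd_choose_prime) auto
    then obtain c where "p choose k = p * c" by (auto elim: dvdE)
    then show ?thesis by (simp add: mult.assoc)
  qed
  show ?thesis unfolding e by (rule dvd_sum) (rule d)
qed

text \<open>The prescribed values on variables, together with \<phi> on constants, define e on
  polynomials. Modulo p it is the p-th power map, so it sends functions that do not vanish at a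
  point to units there and extends to sections by \<open>push\<close> with the identity on
  points.\<close>

lemma frobenius_lift_exists:
  fixes \<phi> :: "'r::idom \<Rightarrow> 'r" and Z :: "('v, 'r) mpoly set set"
  assumes p: "prime p" and \<phi>: "frobenius_lift_base p \<phi>" and Z: "formal p {0} Z"
    and y: "\<And>v. y v \<in> carrier (sections (thick p {0}) Z)"
    and yp: "\<And>v Q. Q \<in> Z \<Longrightarrow> y v 0 Q = frac (thick p {0} 0) Q (Var v ^ p) 1"
  shows "\<exists>\<Phi>. frobenius_lift p \<phi> (thick p {0}) Z \<Phi> \<and> (\<forall>v. \<Phi> Z (sect_of (thick p {0}) Z (Var v)) = y v)"
proof -
  interpret Z: formal p "{0}" Z by (rule Z)
  have \<phi>1: "\<phi> \<in> Ring.ring_hom typ_ring typ_ring" and \<phi>2: "of_nat p dvd \<phi> a - a ^ p" for a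
    using \<phi> by (auto simp: frobenius_lift_base_def)
  have dvd_J: "f \<in> Z.J 0 \<longleftrightarrow> of_nat p dvd f" for f by (auto simp: Z.thick_iff dvd_def)
  interpret CC: type_hom "typ_ring :: ('v, 'r) mpoly ring" "\<lambda>c. Const (\<phi> c)"
    by (rule type_hom.comp[OF type_hom_Const \<phi>1])
  define \<kappa> where "\<kappa> c = sect_of Z.J Z (Const (\<phi> c))" for c
  have \<kappa>h: "type_hom Z.S \<kappa>"
    unfolding \<kappa>_def[abs_def] by (rule type_hom_compI[OF CC.type_hom_axioms Z.cring_S Z.of.hom])
  interpret \<kappa>: type_hom Z.S \<kappa> by (rule \<kappa>h)
  define e where "e = ev Z.S \<kappa> y"
  interpret e: type_hom Z.S e unfolding e_def by (rule \<kappa>.type_hom_ev[OF y])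
  have eV: "e (Var v) = y v" for v unfolding e_def by (rule \<kappa>.ev_Var[OF y])
  have eC: "e (Const c) = sect_of Z.J Z (Const (\<phi> c))" for c
    unfolding e_def using \<kappa>.ev_Const[OF y] by (simp add: \<kappa>_def)
  \<comment> \<open>Modulo p both sides are ring homomorphisms in f, the right one by the binomial
    congruence, so constants and variables suffice.\<close>
  have e0: "e f 0 Q = frac (Z.J 0) Q (f ^ p) 1" if Q: "Q \<in> Z" for f Q
  proof -
    interpret F: local_frac "Z.J 0" Q by (rule Z.local_fracI[OF Q])
    have h1: "type_hom (stalk (Z.J 0) Q) (\<lambda>f. e f 0 Q)"
      by (rule type_hom_compI[OF e.type_hom_axioms F.cring_stalk Z.germ_hom[OF Q]])
    have h2: "type_hom (stalk (Z.J 0) Q) (\<lambda>f. frac (Z.J 0) Q (f ^ p) 1)"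
    proof (intro type_hom.intro F.cring_stalk type_hom_axioms.intro Ring.ring_hom_memI)
      fix f g :: "('v, 'r) mpoly"
      have "frac (Z.J 0) Q ((f + g) ^ p) 1 = frac (Z.J 0) Q (f ^ p + g ^ p) 1"
        using freshman_dream[OF p, of f g] by (simp add: F.frac_eq_iff F.one_notin F.locI dvd_J)
      then show "frac (Z.J 0) Q ((f \<oplus>\<^bsub>typ_ring\<^esub> g) ^ p) 1
          = frac (Z.J 0) Q (f ^ p) 1 \<oplus>\<^bsub>stalk (Z.J 0) Q\<^esub> frac (Z.J 0) Q (g ^ p) 1"
        by (simp add: F.stalk_add F.one_notin)
    qed (simp_all add: F.stalk_mult F.one_notin F.frac_in_stalk F.stalk_one power_mult_distrib)
    show ?thesis
    proof (rule type_hom_eqI[OF h1 h2])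
      show "e (Const c) 0 Q = frac (Z.J 0) Q (Const c ^ p) 1" for c
      proof -
        have "Const c ^ p = (Const (c ^ p) :: ('v, 'r) mpoly)"
          by (induction p) (simp_all add: Const_def mult_single)
        moreover have "of_nat p dvd (Const (\<phi> c) - Const (c ^ p) :: ('v, 'r) mpoly)"
        proof -
          have "Const (\<phi> c) - Const (c ^ p) = (Const (\<phi> c - c ^ p) :: ('v, 'r) mpoly)"
            by (simp add: Const_def single_diff)
          then show ?thesis using \<phi>2[of c]
            by (simp add: of_nat_dvd_poly_mapping_iff Const_def lookup_single when_def)
        qed
        ultimately show ?thesis
          by (simp add: eC Z.sect_of_germ[OF Q] F.frac_eq_iff F.one_notin F.locI dvd_J)
      qed
      show "e (Var v) 0 Q = frac (Z.J 0) Q (Var v ^ p) 1" for v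
        by (simp add: eV yp[OF Q])
    qed
  qed
  have eu: "b \<notin> Q" if Q: "Q \<in> Z" and s: "s \<notin> Q" and t: "t \<notin> Q" and eq: "e s 0 Q = frac (Z.J 0) Q b t" for Q s b t
  proof -
    interpret F: local_frac "Z.J 0" Q by (rule Z.local_fracI[OF Q])
    have "s ^ p * t - b * 1 \<in> loc (Z.J 0) Q"
      unfolding F.frac_eq_iff[OF F.one_notin t, symmetric] using e0[OF Q, of s] eq by simp
    moreover have "s ^ p \<notin> Q" using s is_prime_power[OF Z.prime_W[OF Q]] by simp
    ultimately show ?thesis using Z.loc_notin[OF Q _ t F.one_notin] by blast
  qed
  have psh: "push p {0} W {0} W (\<lambda>f. restrict_sect W (e f)) (\<lambda>Q. Q)" if W: "W \<subseteq> Z" for W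
  proof -
    interpret W: formal p "{0}" W by (rule formal_subset[OF Z W])
    interpret E: type_hom W.S "\<lambda>f. restrict_sect W (e f)"
      by (rule type_hom_compI[OF e.type_hom_axioms W.cring_S Z.restrict_hom[OF W]])
    show ?thesis
    proof
      show "b \<notin> Q" if "Q \<in> W" "s \<notin> Q" "t \<notin> Q" "restrict_sect W (e s) 0 Q = frac (W.J 0) Q b t" for Q s b t
        using that W eu[of Q s t b] by (auto simp: restrict_sect_def)
      show "restrict_sect W (e a) = \<zero>\<^bsub>W.S\<^esub>" if "a \<in> {0}" for a using that E.zero by simp
    qed auto
  qed
  define \<Phi> where "\<Phi> W = push.push p {0} W (\<lambda>f. restrict_sect W (e f)) (\<lambda>Q. Q)" for W
  have \<Phi>_eq: "\<Phi> W \<sigma> m Q = (if Q \<in> W then \<Union>(a, s)\<in>\<sigma> m Q. sheaf.quot Z.J m Q (e a m Q) (e s m Q) else {})"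
    if W: "W \<subseteq> Z" for W \<sigma> m Q
  proof -
    interpret Psh: push p "{0}" W "{0}" W "\<lambda>f. restrict_sect W (e f)" "\<lambda>Q. Q" by (rule psh[OF W])
    show ?thesis unfolding \<Phi>_def Psh.push_def by (simp add: restrict_sect_def)
  qed
  have "frobenius_lift p \<phi> Z.J Z \<Phi>"
    unfolding frobenius_lift_def
  proof (intro conjI ballI allI impI)
    fix W assume "W \<in> opens Z"
    then have W: "W \<subseteq> Z" by (rule opens_subset)
    interpret Psh: push p "{0}" W "{0}" W "\<lambda>f. restrict_sect W (e f)" "\<lambda>Q. Q" by (rule psh[OF W])
    show "\<Phi> W \<in> Ring.ring_hom (sections Z.J W) (sections Z.J W)"
      unfolding \<Phi>_def by (rule Psh.push_hom)
    show "\<Phi> W (sect_of Z.J W (Const c)) = sect_of Z.J W (Const (\<phi> c))" for c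
      unfolding \<Phi>_def Psh.push_sect_of eC by (rule Z.restrict_sect_of[OF W])
    show "restrict_sect W' (\<Phi> W \<sigma>) = \<Phi> W' (restrict_sect W' \<sigma>)"
      if "W' \<in> opens Z" "W' \<subseteq> W" "\<sigma> \<in> carrier (sections Z.J W)" for W' \<sigma>
    proof (intro ext)
      fix m Q
      have W': "W' \<subseteq> Z" using that(2) W by blast
      show "restrict_sect W' (\<Phi> W \<sigma>) m Q = \<Phi> W' (restrict_sect W' \<sigma>) m Q"
        using that(2) by (auto simp: \<Phi>_eq[OF W] \<Phi>_eq[OF W'] restrict_sect_def)
    qed
    show "\<Phi> W \<sigma> 0 Q = \<sigma> 0 Q [^]\<^bsub>stalk (Z.J 0) Q\<^esub> p"
      if \<sigma>: "\<sigma> \<in> carrier (sections Z.J W)" and Q: "Q \<in> W" for \<sigma> Q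
    proof -
      interpret F: local_frac "Z.J 0" Q by (rule Psh.src.local_fracI[OF Q])
      have QZ: "Q \<in> Z" using Q W by blast
      obtain a s where a: "s \<notin> Q" "\<sigma> 0 Q = frac (Z.J 0) Q a s" by (rule Psh.src.germ[OF \<sigma> Q])
      have sp: "s ^ p \<notin> Q" using a(1) is_prime_power[OF Z.prime_W[OF QZ]] by simp
      show ?thesis unfolding \<Phi>_def
      proof (rule Psh.push_unique[OF Q a(1), where a = a])
        show "\<sigma> 0 Q [^]\<^bsub>stalk (Z.J 0) Q\<^esub> p \<in> carrier (stalk (Z.J 0) Q)"
          by (simp add: a(2) F.stalk_pow[OF a(1)] F.frac_in_stalk[OF sp])
        have "frac (Z.J 0) Q (a ^ p) (s ^ p) \<otimes>\<^bsub>stalk (Z.J 0) Q\<^esub> frac (Z.J 0) Q (s ^ p) 1 = frac (Z.J 0) Q (a ^ p) 1"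
          unfolding F.stalk_mult[OF sp F.one_notin] by (rule F.frac_eqI) (use sp F.one_notin in simp_all)
        then show "\<sigma> 0 Q [^]\<^bsub>stalk (Z.J 0) Q\<^esub> p \<otimes>\<^bsub>stalk (Z.J 0) Q\<^esub> restrict_sect W (e s) 0 Q = restrict_sect W (e a) 0 Q"
          using Q by (simp add: a(2) F.stalk_pow[OF a(1)] restrict_sect_def e0[OF QZ])
      qed (rule a(2))
    qed
  qed
  moreover have "\<Phi> Z (sect_of Z.J Z (Var v)) = y v" for v
  proof -
    interpret Psh: push p "{0}" Z "{0}" Z "\<lambda>f. restrict_sect Z (e f)" "\<lambda>Q. Q" by (rule psh) simp
    have "restrict_sect Z (e (Var v)) = e (Var v)"
      using e.closed[of "Var v"] by (auto simp: restrict_sect_def sections_def fun_eq_iff)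
    then show ?thesis unfolding \<Phi>_def Psh.push_sect_of by (simp add: eV)
  qed
  ultimately show ?thesis by blast
qed

section \<open>Matrices of sections and their factorization by diagonal matrices\<close>

section \<open>Matrices over rings of sections\<close>

context formal
begin

definition present_mat :: "('a sect, 'a) mpoly^'n^'n \<Rightarrow> ('n::finite, 'a sect) fmat" where
  "present_mat M = (\<lambda>i j. present (M $ i $ j))"

definition lift_mat :: "('n::finite, 'a sect) fmat \<Rightarrow> ('a sect, 'a) mpoly^'n^'n" where
  "lift_mat A = (\<chi> i j. Var (A i j))"

lemma present_mat_closed [simp]: "present_mat M \<in> mat_carrier S"
  by (simp add: present_mat_def mat_carrier_def)

lemma present_mat_lift_mat [simp]: "A \<in> mat_carrier S \<Longrightarrow> present_mat (lift_mat A) = A"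
  by (simp add: present_mat_def lift_mat_def mat_carrier_def fun_eq_iff)

lemma mat_carrier_obtain:
  assumes "A \<in> mat_carrier S"
  obtains M where "A = present_mat M"
  using assms present_mat_lift_mat by metis

lemma present_mat_mult: "mat_mult S (present_mat M) (present_mat N) = present_mat (M ** N)"
  by (simp add: mat_mult_def present_mat_def matrix_matrix_mult_def present.sum present.mult)

lemma present_mat_one: "mat_one S = present_mat (Finite_Cartesian_Product.mat 1)"
  by (simp add: mat_one_def present_mat_def Finite_Cartesian_Product.mat_def present.one present.zero fun_eq_iff)

lemma mat_mult_closed: "A \<in> mat_carrier S \<Longrightarrow> B \<in> mat_carrier S \<Longrightarrow> mat_mult S A B \<in> mat_carrier S"
  by (elim mat_carrier_obtain) (simp add: present_mat_mult)

lemma mat_mult_assoc: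
  "A \<in> mat_carrier S \<Longrightarrow> B \<in> mat_carrier S \<Longrightarrow> C \<in> mat_carrier S \<Longrightarrow>
    mat_mult S (mat_mult S A B) C = mat_mult S A (mat_mult S B C)"
  by (elim mat_carrier_obtain) (simp add: present_mat_mult matrix_mul_assoc)

lemma mat_mult_one: "A \<in> mat_carrier S \<Longrightarrow> mat_mult S A (mat_one S) = A"
  "A \<in> mat_carrier S \<Longrightarrow> mat_mult S (mat_one S) A = A"
  by (elim mat_carrier_obtain, simp add: present_mat_mult present_mat_one)+

lemma mat_inverse_eqI:
  assumes A: "A \<in> mat_carrier S" and B: "B \<in> mat_carrier S"
    and AB: "mat_mult S A B = mat_one S" and BA: "mat_mult S B A = mat_one S"
  shows "mat_inverse S A = B"
  unfolding mat_inverse_def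
proof (rule the_equality)
  fix C assume C: "C \<in> mat_carrier S \<and> mat_mult S A C = mat_one S \<and> mat_mult S C A = mat_one S"
  have "mat_mult S (mat_mult S C A) B = mat_mult S C (mat_mult S A B)" using A B C by (intro mat_mult_assoc) auto
  then show "C = B" using B C by (simp add: AB mat_mult_one)
qed (use assms in auto)

text \<open>The inverse v of the determinant, times a right and a left adjugate, gives a right and a
  left inverse; these coincide by associativity.\<close>

lemma ex_inverse:
  assumes v: "v \<in> carrier S" "v \<otimes>\<^bsub>S\<^esub> present (Determinants.det M) = \<one>\<^bsub>S\<^esub>"
  shows "\<exists>B\<in>mat_carrier S. mat_mult S (present_mat M) B = mat_one S \<and> mat_mult S B (present_mat M) = mat_one S"
proof -
  obtain L where L: "L ** M = Finite_Cartesian_Product.mat (Determinants.det M)" using ex_adjugate_left by blast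
  define B C where "B = present_mat (\<chi> i j. Var v * adjugate M $ i $ j)" and "C = present_mat (\<chi> i j. Var v * L $ i $ j)"
  have d: "present (Var v * Determinants.det M) = \<one>\<^bsub>S\<^esub>" using v by (simp add: present.mult)
  have B: "mat_mult S (present_mat M) B = mat_one S"
  proof -
    have "(M ** (\<chi> i j. Var v * adjugate M $ i $ j)) $ i $ j = Var v * (M ** adjugate M) $ i $ j" for i j
      by (simp add: matrix_matrix_mult_def sum_distrib_left mult_ac)
    then show ?thesis unfolding B_def present_mat_mult mult_adjugate
      by (auto simp: present_mat_def Finite_Cartesian_Product.mat_def mat_one_def d present.zero fun_eq_iff)
  qed
  have C: "mat_mult S C (present_mat M) = mat_one S"
  proof -
    have "((\<chi> i j. Var v * L $ i $ j) ** M) $ i $ j = Var v * (L ** M) $ i $ j" for i j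
      by (simp add: matrix_matrix_mult_def sum_distrib_left mult_ac)
    then show ?thesis unfolding C_def present_mat_mult L
      by (auto simp: present_mat_def Finite_Cartesian_Product.mat_def mat_one_def d present.zero fun_eq_iff)
  qed
  have c: "B \<in> mat_carrier S" "C \<in> mat_carrier S" by (simp_all add: B_def C_def)
  have "C = mat_mult S (mat_mult S C (present_mat M)) B" using c by (simp add: mat_mult_assoc B mat_mult_one)
  then have "C = B" using c by (simp add: C mat_mult_one)
  then show ?thesis using B C c by blast
qed

text \<open>Characteristic coefficients of a matrix of sections, computed on a lift to the
  presenting ring; by \<open>cpS_present_mat\<close> the choice of lift is immaterial.\<close>

definition cpS :: "nat \<Rightarrow> ('n::finite, 'a sect) fmat \<Rightarrow> 'a sect" where
  "cpS i A = present (cp i (lift_mat A))"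

lemma ring_rel_present:
  assumes "type_hom S h"
  shows "ring_rel (\<lambda>a f. h a = present f)"
proof -
  interpret h: type_hom S h by fact
  show ?thesis
    by unfold_locales
      (simp_all add: h.zero h.one h.add h.mult h.uminus present.zero present.one present.add present.mult present.uminus)
qed

lemma cp_present:
  assumes h: "type_hom S h" and e: "\<And>i j. h (M $ i $ j) = present (N $ i $ j)"
  shows "h (cp i M) = present (cp i N)"
  by (rule ring_rel.cp[OF ring_rel_present[OF h]]) (rule e)

lemma cpS_present_mat: "cpS i (present_mat M) = present (cp i M)"
  unfolding cpS_def by (rule cp_present[OF type_hom_present]) (simp add: lift_mat_def present_mat_def)

lemma cpS_hom: "type_hom S h \<Longrightarrow> h (cp i M) = cpS i (\<lambda>i j. h (M $ i $ j))"
  unfolding cpS_def by (rule cp_present) (simp_all add: lift_mat_def type_hom.closed)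

lemma cpS_conj:
  assumes A: "A \<in> mat_carrier S" and E: "E \<in> mat_carrier S" "E' \<in> mat_carrier S"
    and e: "mat_mult S E E' = mat_one S"
  shows "cpS i (mat_mult S (mat_mult S E A) E') = cpS i A"
proof -
  obtain a e1 e2 where o: "A = present_mat a" "E = present_mat e1" "E' = present_mat e2" using assms mat_carrier_obtain by metis
  have "present_mat (e1 ** e2) = present_mat (Finite_Cartesian_Product.mat 1)" using e by (simp add: o present_mat_mult present_mat_one)
  then have "cong_mod relations ((e1 ** e2) $ i $ j) (Finite_Cartesian_Product.mat 1 $ i $ j)" for i j
    unfolding cong_mod_def relations_diff_iff present_mat_def by metis
  from cp_conj[OF is_ideal_relations this, of i a] show ?thesis
    by (simp add: o present_mat_mult cpS_present_mat cong_mod_def relations_diff_iff)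
qed

end

lemma P_fun_eq_cp: "P_fun i = cp i (\<chi> i j. Var (i, j))"
  by (simp add: P_fun_def cp_def char_pol_def charmat_def)

section \<open>Primality of $p$\<close>

text \<open>The ideal generated by p is maximal, hence prime, and it is not zero because R is not a
  field.\<close>

lemma prime_const_complete_dvr:
  assumes "complete_dvr_Fp_closure TYPE('r::idom) p"
  shows "prime_const TYPE('r) p"
proof -
  interpret cring "typ_ring :: 'r ring" by (rule cring_from_type_algebra)
  define M where "M = PIdl\<^bsub>(typ_ring :: 'r ring)\<^esub> (of_nat p)"
  have nf: "\<not> Ring.field (typ_ring :: 'r ring)" and mx: "maximalideal M (typ_ring :: 'r ring)"
    using assms by (auto simp: complete_dvr_Fp_closure_def Let_def M_def)
  have M: "M = {x. of_nat p dvd x}"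
    unfolding M_def cgenideal_def by (auto simp: dvd_def mult.commute)
  have "is_prime M" using maximalideal_prime[OF mx] by (simp add: primeideal_typ_ring_iff)
  moreover have "of_nat p \<noteq> (0::'r)"
  proof
    assume "of_nat p = (0::'r)"
    then have "M = {\<zero>\<^bsub>typ_ring\<^esub>}" by (auto simp: M)
    then show False using zeromaximalideal_fieldI mx nf by simp
  qed
  ultimately show ?thesis unfolding prime_const_def is_prime_def M by auto
qed

lemma prime_const_dvd_prod:
  fixes f :: "'i \<Rightarrow> ('v::finite \<Rightarrow>\<^sub>0 'e::linordered_semidom) \<Rightarrow>\<^sub>0 'r::comm_ring_1"
  assumes p: "prime_const TYPE('r) p" and fin: "finite A" and d: "of_nat p dvd prod f A"
  shows "\<exists>x\<in>A. of_nat p dvd f x"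
  using fin d
proof (induction A rule: finite_induct)
  case empty
  have "of_nat p dvd Poly_Mapping.lookup (1 :: ('v \<Rightarrow>\<^sub>0 'e) \<Rightarrow>\<^sub>0 'r) 0"
    using empty unfolding prod.empty of_nat_dvd_poly_mapping_iff by blast
  then show ?case using p by (simp add: prime_const_def)
next
  case (insert x A)
  then show ?case using prime_const_dvd_mult[OF p, of "f x" "prod f A"] by auto
qed

lemma not_dvd_Var_power:
  assumes "prime_const TYPE('r::comm_ring_1) p"
  shows "\<not> of_nat p dvd (Var v ^ k :: ('v, 'r) mpoly)"
proof
  assume "of_nat p dvd (Var v ^ k :: ('v, 'r) mpoly)"
  then have "of_nat p dvd Poly_Mapping.lookup (Var v ^ k :: ('v, 'r) mpoly) (Poly_Mapping.single v k)"
    unfolding of_nat_dvd_poly_mapping_iff by blast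
  then show False using assms by (simp add: prime_const_def flip: single_power)
qed

lemma not_dvd_Var_power_diff:
  assumes "prime_const TYPE('r::comm_ring_1) p" "k > 0" "v \<noteq> w"
  shows "\<not> of_nat p dvd (Var v ^ k - Var w ^ k :: ('v, 'r) mpoly)"
proof
  have ne: "Poly_Mapping.single w k \<noteq> Poly_Mapping.single v k"
  proof
    assume "Poly_Mapping.single w k = Poly_Mapping.single v k"
    then have "Poly_Mapping.lookup (Poly_Mapping.single w k) v = Poly_Mapping.lookup (Poly_Mapping.single v k) v" by simp
    then show False using assms by (simp add: lookup_single when_def)
  qed
  assume "of_nat p dvd (Var v ^ k - Var w ^ k :: ('v, 'r) mpoly)"
  then have "of_nat p dvd Poly_Mapping.lookup (Var v ^ k - Var w ^ k :: ('v, 'r) mpoly) (Poly_Mapping.single v k)"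
    unfolding of_nat_dvd_poly_mapping_iff by blast
  then show False using assms ne by (simp add: prime_const_def lookup_minus lookup_single when_def flip: single_power)
qed

lemma ring_rel_subst: "ring_rel (\<lambda>f g. subst h f = g)"
  by unfold_locales (simp_all add: subst_simps)

text \<open>Consequently any expression F with integer coefficients satisfies F(x^(p)) = F(x)^p mod
  p; it is applied to the determinant, the characteristic coefficients and the Jacobian.\<close>

lemma ring_rel_frobenius:
  assumes "prime p"
  shows "ring_rel (\<lambda>f g :: 'a::comm_ring_1. of_nat p dvd g - f ^ p)"
proof
  have p0: "p \<noteq> 0" using assms by auto
  note fd = freshman_dream[OF assms]
  show add: "of_nat p dvd b + d - (a + c) ^ p" if "of_nat p dvd b - a ^ p" "of_nat p dvd d - c ^ p" for a b c d :: 'a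
  proof -
    have "b + d - (a + c) ^ p = (b - a ^ p) + (d - c ^ p) - ((a + c) ^ p - (a ^ p + c ^ p))" by simp
    then show ?thesis using that fd[of a c] by (metis dvd_add dvd_diff)
  qed
  show "of_nat p dvd - b - (- a) ^ p" if "of_nat p dvd b - a ^ p" for a b :: 'a
  proof -
    \<comment> \<open>The sign is obtained from the binomial congruence for a + (-a), without a case
      distinction on the parity of p.\<close>
    have "- b - (- a) ^ p = (0 ^ p - (a ^ p + (- a) ^ p)) - (b - a ^ p)" using p0 by (simp add: power_0_left)
    then show ?thesis using that fd[of a "- a"] by (metis add.right_inverse dvd_diff)
  qed
  show "of_nat p dvd b * d - (a * c) ^ p" if "of_nat p dvd b - a ^ p" "of_nat p dvd d - c ^ p" for a b c d :: 'a
  proof -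
    have "b * d - (a * c) ^ p = (b - a ^ p) * d + a ^ p * (d - c ^ p)" by (simp add: algebra_simps power_mult_distrib)
    then show ?thesis using that by (metis dvd_add dvd_mult dvd_mult2)
  qed
qed (use assms in \<open>auto simp: power_0_left\<close>)

definition xmat :: "('n::finite, 'r::comm_ring_1) GL_fun^'n^'n" where
  "xmat = (\<chi> i j. Var (i, j))"

definition xpow :: "nat \<Rightarrow> ('n::finite, 'r::comm_ring_1) GL_fun^'n^'n" where
  "xpow k = (\<chi> i j. Var (i, j) ^ k)"

lemma det_fun_eq: "det_fun = Determinants.det xmat"
  by (simp add: det_fun_def xmat_def)

lemma P_fun_eq: "P_fun i = cp i xmat"
  by (simp add: P_fun_eq_cp xmat_def)

lemma xpow_cong:
  assumes "prime p"
  shows "of_nat p dvd Determinants.det (xpow p) - (det_fun :: ('n::finite, 'r::comm_ring_1) GL_fun) ^ p"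
    "of_nat p dvd cp i (xpow p) - (P_fun i :: ('n, 'r) GL_fun) ^ p"
    "of_nat p dvd jac (xpow p) - jac (xmat :: ('n, 'r) GL_fun^'n^'n) ^ p"
proof -
  interpret R: ring_rel "\<lambda>f g :: ('n, 'r) GL_fun. of_nat p dvd g - f ^ p" by (rule ring_rel_frobenius[OF assms])
  have x: "of_nat p dvd xpow p $ i $ j - (xmat $ i $ j :: ('n, 'r) GL_fun) ^ p" for i j
    by (simp add: xpow_def xmat_def)
  show "of_nat p dvd Determinants.det (xpow p) - (det_fun :: ('n, 'r) GL_fun) ^ p"
    unfolding det_fun_eq by (rule R.det) (rule x)
  show "of_nat p dvd cp i (xpow p) - (P_fun i :: ('n, 'r) GL_fun) ^ p"
    unfolding P_fun_eq by (rule R.cp) (rule x)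
  show "of_nat p dvd jac (xpow p) - jac (xmat :: ('n, 'r) GL_fun^'n^'n) ^ p"
    by (rule R.jac) (rule x)
qed

text \<open>Setting the off-diagonal variables to zero and multiplying by the Vandermonde
  determinant turns a multiple of p into a product of factors -x_j^k and x_j^k - x_l^k. As p is
  prime, it would divide one of these, but each has a coefficient 1 or -1.\<close>

lemma jac_xpow_not_dvd:
  assumes p: "prime_const TYPE('r::comm_ring_1) p" and k: "k > 0"
  shows "\<not> of_nat p dvd (jac (xpow k) :: ('n::finite, 'r) GL_fun)"
proof
  assume "of_nat p dvd (jac (xpow k) :: ('n, 'r) GL_fun)"
  then obtain g where g: "jac (xpow k) = of_nat p * (g :: ('n, 'r) GL_fun)" by (auto elim: dvdE)
  let ?h = "\<lambda>(i, j). if i = j then Var (i, i) else (0 :: ('n, 'r) GL_fun)"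
  let ?x = "\<lambda>i. Var (i, i) ^ k :: ('n, 'r) GL_fun"
  interpret R: ring_rel "\<lambda>f g. subst ?h f = g" by (rule ring_rel_subst)
  have "subst ?h (jac (xpow k)) = jac (diagm ?x)"
    by (rule R.jac) (use k in \<open>simp add: xpow_def diagm_def subst_simps power_0_left\<close>)
  then have "jac (diagm ?x) = of_nat p * subst ?h g"
    unfolding g by (simp add: subst_simps)
  then have "of_nat p dvd jac (diagm ?x)" by (simp only: dvd_triv_left)
  then have "of_nat p dvd (\<Prod>j\<in>UNIV. - ?x j * (\<Prod>l\<in>UNIV - {j}. ?x j - ?x l))"
    unfolding det_vdm_mult_jac_diagm[symmetric] by (rule dvd_mult)
  from prime_const_dvd_prod[OF p finite this]
  obtain j where "of_nat p dvd - ?x j * (\<Prod>l\<in>UNIV - {j}. ?x j - ?x l)" by blast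
  from prime_const_dvd_mult[OF p this]
  have "of_nat p dvd (\<Prod>l\<in>UNIV - {j}. ?x j - ?x l)"
    using not_dvd_Var_power[OF p, of "(j, j)" k] by simp
  from prime_const_dvd_prod[OF p _ this] obtain l where "l \<noteq> j" "of_nat p dvd ?x j - ?x l" by auto
  then show False using not_dvd_Var_power_diff[OF p k, of "(j, j)" "(l, l)"] by simp
qed

section \<open>Matrices with a diagonal factor\<close>

context formal
begin

text \<open>The function j is a nonzerodivisor on the structure sheaf modulo p, at every point of W.
  This is weaker than invertibility and holds where j has zeros.\<close>

definition reg :: "'a \<Rightarrow> bool" where
  "reg j \<longleftrightarrow> (\<forall>Q\<in>W. \<forall>c. j * c \<in> loc (J 0) Q \<longrightarrow> c \<in> loc (J 0) Q)"

lemma ideal_add_relations_0: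
  "f \<in> ideal_add relations (of_nat p) \<longleftrightarrow> (\<forall>Q\<in>W. present f 0 Q = frac (J 0) Q 0 1)"
  using ideal_add_relations_level[of f 0 0]
  by (auto simp: present.zero S_zero sect_of_germ)

lemma ideal_add_relations_0_diff:
  "f - g \<in> ideal_add relations (of_nat p) \<longleftrightarrow> (\<forall>Q\<in>W. present f 0 Q = present g 0 Q)"
  using ideal_add_relations_level[of f g 0] by simp

lemma reg_relations:
  assumes "reg j" and m: "Const j * f \<in> ideal_add relations (of_nat p)"
  shows "f \<in> ideal_add relations (of_nat p)"
  unfolding ideal_add_relations_0
proof
  fix Q assume Q: "Q \<in> W"
  interpret F: local_frac "J 0" Q by (rule local_fracI[OF Q])
  obtain c t where c: "t \<notin> Q" "present f 0 Q = frac (J 0) Q c t" by (rule germ[OF present.closed Q])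
  have "present (Const j * f) 0 Q = frac (J 0) Q (j * c) t"
    using Q c by (simp add: present.mult S_mult sect_of_germ F.stalk_mult F.one_notin)
  then have "j * c \<in> loc (J 0) Q"
    using m Q F.frac_0_iff[OF c(1)] unfolding ideal_add_relations_0 by auto
  then have "c \<in> loc (J 0) Q" using assms(1) Q by (auto simp: reg_def)
  then show "present f 0 Q = frac (J 0) Q 0 1" using c F.frac_0_iff by simp
qed

lemma ring_rel_Const: "ring_rel (\<lambda>a f. Const a = f)"
  by unfold_locales (auto simp: Const_def single_add mult_single single_uminus)

definition diag_mult :: "'a^'n^'n \<Rightarrow> ('n::finite \<Rightarrow> 'a sect) \<Rightarrow> ('n, 'a sect) fmat" where
  "diag_mult y s = (\<lambda>a b. sect_of J W (y $ a $ b) \<otimes>\<^bsub>S\<^esub> s b)"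

definition const_mat :: "'a^'n^'n \<Rightarrow> ('a sect, 'a) mpoly^'n^'n" where
  "const_mat y = (\<chi> a b. Const (y $ a $ b))"

lemma jac_const_mat: "jac (const_mat y) = Const (jac y)"
  by (rule ring_rel.jac[OF ring_rel_Const, symmetric]) (simp add: const_mat_def)

lemma det_const_mat: "Determinants.det (const_mat y) = Const (Determinants.det y)"
  by (rule ring_rel.det[OF ring_rel_Const, symmetric]) (simp add: const_mat_def)

lemma cp_const_mat: "cp i (const_mat y) = Const (cp i y)"
  by (rule ring_rel.cp[OF ring_rel_Const, symmetric]) (simp add: const_mat_def)

lemma diag_mult_present_mat:
  "(\<And>j. s j \<in> carrier S) \<Longrightarrow> diag_mult y s = present_mat (\<chi> a b. const_mat y $ a $ b * Var (s b))"
  by (simp add: diag_mult_def present_mat_def const_mat_def present.mult fun_eq_iff)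

text \<open>The uniqueness half of Hensel's lemma, read modulo \<open>relations\<close> with q =
  p.\<close>

lemma diag_mult_unique:
  fixes y :: "'a^'n^'n"
  assumes reg: "reg (jac y)"
    and c: "\<And>j. s j \<in> carrier S" "\<And>j. t j \<in> carrier S"
    and s: "\<And>j Q. Q \<in> W \<Longrightarrow> s j 0 Q = \<one>\<^bsub>S\<^esub> 0 Q" and t: "\<And>j Q. Q \<in> W \<Longrightarrow> t j 0 Q = \<one>\<^bsub>S\<^esub> 0 Q"
    and eq: "\<And>i. i \<in> {1..CARD('n)} \<Longrightarrow> cpS i (diag_mult y s) = cpS i (diag_mult y t)"
  shows "s j = t j"
proof -
  have "Var (s j) - Var (t j) \<in> relations"
  proof (rule torus_factor_unique[where y = "const_mat y", OF is_ideal_relations relations_flat relations_separated])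
    show "Var (s j) - 1 \<in> ideal_add relations (of_nat p)" "Var (t j) - 1 \<in> ideal_add relations (of_nat p)" for j
      unfolding ideal_add_relations_0_diff using s t c by (simp_all add: present.one)
    show "f \<in> ideal_add relations (of_nat p)" if "jac (const_mat y) * f \<in> ideal_add relations (of_nat p)" for f
      using reg_relations[OF reg] that by (simp add: jac_const_mat)
    show "cp i (\<chi> a b. const_mat y $ a $ b * Var (s b)) - cp i (\<chi> a b. const_mat y $ a $ b * Var (t b)) \<in> relations"
      if "i \<in> {1..CARD('n)}" for i
      using eq[OF that] unfolding relations_diff_iff by (simp add: diag_mult_present_mat c cpS_present_mat)
  qed auto
  then show ?thesis using c by (simp add: relations_diff_iff)
qed

lemma diag_mult_exists:
  fixes y :: "'a^'n^'n"
  assumes v: "v \<in> carrier S" "v \<otimes>\<^bsub>S\<^esub> sect_of J W (jac y) = \<one>\<^bsub>S\<^esub>"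
    and w: "\<And>i. of_nat p dvd w i - cp i y"
  shows "\<exists>t. (\<forall>j. t j \<in> carrier S) \<and> (\<forall>j. \<forall>Q\<in>W. t j 0 Q = \<one>\<^bsub>S\<^esub> 0 Q)
    \<and> (\<forall>i\<in>{1..CARD('n)}. cpS i (diag_mult y t) = sect_of J W (w i))"
proof -
  have "\<exists>t. \<forall>i\<in>{1..CARD('n)}. cp i (\<chi> a b. const_mat y $ a $ b * (1 + of_nat p * t b)) - Const (w i) \<in> relations"
  proof (rule torus_factor_exists[OF is_ideal_relations relations_complete relations_separated])
    show "Var v * jac (const_mat y) - 1 \<in> relations"
      using v by (simp add: relations_diff_iff jac_const_mat present.mult present.one)
    show "Const (w i) - cp i (const_mat y) \<in> ideal_add relations (of_nat p)" for i
    proof -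
      obtain c where "w i = cp i y + of_nat p * c" using w[of i] by (auto elim!: dvdE simp: algebra_simps)
      then have "sect_of J W (w i) \<ominus>\<^bsub>S\<^esub> sect_of J W (cp i y) = sect_of J W (of_nat p) \<otimes>\<^bsub>S\<^esub> sect_of J W c"
        by (simp flip: of.diff of.mult)
      then show ?thesis using ideal_add_relations_iff[of "Const (w i)" "Const (cp i y)" 1] by (auto simp: cp_const_mat)
    qed
  qed auto
  then obtain t where t: "\<And>i. i \<in> {1..CARD('n)} \<Longrightarrow>
      cp i (\<chi> a b. const_mat y $ a $ b * (1 + of_nat p * t b)) - Const (w i) \<in> relations" by blast
  define t' where "t' b = present (1 + of_nat p * t b)" for b
  show ?thesis
  proof (intro exI[of _ t'] conjI allI ballI)
    show c: "t' j \<in> carrier S" for j by (simp add: t'_def)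
    show "t' j 0 Q = \<one>\<^bsub>S\<^esub> 0 Q" if "Q \<in> W" for j Q
    proof -
      have "(1 + of_nat p * t j) - 1 \<in> ideal_add relations (of_nat p)"
        using ideal_addI[OF is_idealD(1)[OF is_ideal_relations], of "of_nat p" "t j"] by simp
      then show ?thesis unfolding ideal_add_relations_0_diff using that by (simp add: t'_def present.one)
    qed
    show "cpS i (diag_mult y t') = sect_of J W (w i)" if "i \<in> {1..CARD('n)}" for i
    proof -
      have "diag_mult y t' = present_mat (\<chi> a b. const_mat y $ a $ b * (1 + of_nat p * t b))"
        by (simp add: diag_mult_def present_mat_def const_mat_def t'_def present.mult fun_eq_iff)
      then show ?thesis using t[OF that] by (simp add: cpS_present_mat relations_diff_iff)
    qed
  qed
qed

text \<open>Both parts come from diag(s) = y^(-1) A. The first translates the vanishing of the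
  off-diagonal entries; for the second, y^(-1) A is congruent to y^(-1) y = 1 mod p.\<close>

lemma diagonal_factor:
  fixes y :: "'a^'n^'n"
  assumes det: "\<And>Q. Q \<in> W \<Longrightarrow> Determinants.det y \<notin> Q"
    and A: "A \<in> mat_carrier S"
  defines "B \<equiv> mat_inverse S (\<lambda>i j. sect_of J W (y $ i $ j))"
  shows "(\<forall>i j. i \<noteq> j \<longrightarrow> mat_mult S B A i j = \<zero>\<^bsub>S\<^esub>) \<longleftrightarrow> (\<exists>s. (\<forall>j. s j \<in> carrier S) \<and> A = diag_mult y s)"
    and "(\<And>i j Q. Q \<in> W \<Longrightarrow> A i j 0 Q = sect_of J W (y $ i $ j) 0 Q) \<Longrightarrow> (\<And>j. s j \<in> carrier S)
      \<Longrightarrow> A = diag_mult y s \<Longrightarrow> Q \<in> W \<Longrightarrow> s j 0 Q = \<one>\<^bsub>S\<^esub> 0 Q"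
proof -
  have X0: "(\<lambda>i j. sect_of J W (y $ i $ j)) = present_mat (const_mat y)" by (simp add: present_mat_def const_mat_def fun_eq_iff)
  have "b \<notin> Q" if Q: "Q \<in> W" "t \<notin> Q" "sect_of J W (Determinants.det y) 0 Q = frac (J 0) Q b t" for Q b t
  proof -
    interpret F: local_frac "J 0" Q by (rule local_fracI[OF Q(1)])
    have "Determinants.det y * t - b * 1 \<in> loc (J 0) Q"
      unfolding F.frac_eq_iff[OF F.one_notin Q(2), symmetric] using Q by (simp add: sect_of_germ)
    then show ?thesis using loc_notin[OF Q(1)] Q(2) F.one_notin det[OF Q(1)] by blast
  qed
  then obtain v where v: "v \<in> carrier S" "v \<otimes>\<^bsub>S\<^esub> present (Determinants.det (const_mat y)) = \<one>\<^bsub>S\<^esub>"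
    using unitI[OF sect_of_closed, of "Determinants.det y"] by (auto simp: det_const_mat)
  obtain C where C: "C \<in> mat_carrier S" "mat_mult S (present_mat (const_mat y)) C = mat_one S" "mat_mult S C (present_mat (const_mat y)) = mat_one S"
    using ex_inverse[OF v] by blast
  have B: "B = C" unfolding B_def X0 by (rule mat_inverse_eqI) (use C in auto)
  have dm: "diag_mult y s = mat_mult S (present_mat (const_mat y)) (present_mat (diagm (\<lambda>j. Var (s j))))" if "\<And>j. s j \<in> carrier S" for s
    using that by (simp add: diag_mult_present_mat present_mat_mult matrix_matrix_mult_def diagm_def if_distrib[of "\<lambda>x. _ * x"] cong: if_cong)
  have BA: "mat_mult S B A = present_mat (diagm (\<lambda>j. Var (s j)))" if "\<And>j. s j \<in> carrier S" "A = diag_mult y s" for s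
    unfolding that(2) dm[OF that(1)] B using C by (simp flip: mat_mult_assoc add: mat_mult_one)
  show "(\<forall>i j. i \<noteq> j \<longrightarrow> mat_mult S B A i j = \<zero>\<^bsub>S\<^esub>) \<longleftrightarrow> (\<exists>s. (\<forall>j. s j \<in> carrier S) \<and> A = diag_mult y s)"
  proof
    assume d: "\<forall>i j. i \<noteq> j \<longrightarrow> mat_mult S B A i j = \<zero>\<^bsub>S\<^esub>"
    define D where "D = mat_mult S B A"
    have Dc: "D \<in> mat_carrier S" unfolding D_def B by (intro mat_mult_closed C A)
    define s where "s j = D j j" for j
    have s: "s j \<in> carrier S" for j using Dc by (simp add: s_def mat_carrier_def)
    have "D = present_mat (diagm (\<lambda>j. Var (s j)))"
    proof (rule ext, rule ext)
      show "D i j = present_mat (diagm (\<lambda>j. Var (s j))) i j" for i j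
        using d s by (auto simp: present_mat_def diagm_def present.zero D_def s_def)
    qed
    then have "diag_mult y s = mat_mult S (present_mat (const_mat y)) D" using dm[OF s] by simp
    also have "\<dots> = A" unfolding D_def B using C A by (simp flip: mat_mult_assoc add: mat_mult_one)
    finally show "\<exists>s. (\<forall>j. s j \<in> carrier S) \<and> A = diag_mult y s" using s by metis
  next
    assume "\<exists>s. (\<forall>j. s j \<in> carrier S) \<and> A = diag_mult y s"
    then show "\<forall>i j. i \<noteq> j \<longrightarrow> mat_mult S B A i j = \<zero>\<^bsub>S\<^esub>"
      using BA by (auto simp: present_mat_def diagm_def present.zero)
  qed
  show "s j 0 Q = \<one>\<^bsub>S\<^esub> 0 Q" if l: "\<And>i j Q. Q \<in> W \<Longrightarrow> A i j 0 Q = sect_of J W (y $ i $ j) 0 Q"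
    and s: "\<And>j. s j \<in> carrier S" and As: "A = diag_mult y s" and Q: "Q \<in> W"
  proof -
    obtain c where c: "C = present_mat c" using C(1) by (rule mat_carrier_obtain)
    interpret R: ring_rel "cong_mod (ideal_add relations (of_nat p))"
      by (rule ring_rel_cong_mod[OF is_ideal_add[OF is_ideal_relations]])
    have AA: "A i j \<in> carrier S" for i j using A by (simp add: mat_carrier_def)
    have "cong_mod (ideal_add relations (of_nat p)) ((c ** lift_mat A) $ j $ j) ((c ** const_mat y) $ j $ j)"
    proof (rule R.matrix_mult)
      show "cong_mod (ideal_add relations (of_nat p)) (c $ i $ j) (c $ i $ j)" for i j
        by (rule cong_mod_refl[OF is_ideal_add[OF is_ideal_relations]])
      show "cong_mod (ideal_add relations (of_nat p)) (lift_mat A $ i $ j) (const_mat y $ i $ j)" for i j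
        unfolding cong_mod_def ideal_add_relations_0_diff using l AA by (simp add: lift_mat_def const_mat_def)
    qed
    then have "present ((c ** lift_mat A) $ j $ j) 0 Q = present ((c ** const_mat y) $ j $ j) 0 Q"
      unfolding cong_mod_def ideal_add_relations_0_diff using Q by blast
    moreover have "mat_mult S C A j j = present ((c ** lift_mat A) $ j $ j)"
      using A present_mat_mult[of c "lift_mat A"] by (simp add: c present_mat_def[of "c ** lift_mat A"])
    moreover have "\<one>\<^bsub>S\<^esub> = present ((c ** const_mat y) $ j $ j)"
    proof -
      have "mat_one S j j = present_mat (c ** const_mat y) j j" using C(3) by (simp add: c present_mat_mult)
      then show ?thesis by (simp add: mat_one_def present_mat_def)
    qed
    moreover have "mat_mult S C A j j = s j"
      using BA[OF s As] s by (simp add: B present_mat_def diagm_def)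
    ultimately show ?thesis by simp
  qed
qed

end

section \<open>The discriminant compared with the Jacobian on the torus\<close>

section \<open>The Sylvester determinant of a product of linear factors\<close>

lemma poly_linear_prod: "Polynomial.poly (\<Prod>l\<in>L. [:- x l, 1:]) a = (\<Prod>l\<in>L. a - x l)"
  for a :: "'a::comm_ring_1"
  by (simp add: poly_prod)

lemma sum_powers_rev:
  fixes f :: "'a::comm_ring_1 poly"
  assumes "Polynomial.degree f < n"
  shows "(\<Sum>j\<in>{0..<n}. Polynomial.coeff f (n - 1 - j) * a ^ (n - 1 - j)) = Polynomial.poly f a"
proof -
  have "(\<Sum>j\<in>{0..<n}. Polynomial.coeff f (n - 1 - j) * a ^ (n - 1 - j)) = (\<Sum>k<n. Polynomial.coeff f k * a ^ k)"
    by (rule sum.reindex_bij_witness[of _ "\<lambda>k. n - 1 - k" "\<lambda>k. n - 1 - k"]) auto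
  then show ?thesis using poly_eq_sum_lt[OF assms] by simp
qed

text \<open>Row k of G consists of the coefficients of the product of s - x_l over l \<noteq> k.
  Hence G V is diagonal with entries the products of x_k - x_l, which are nonzero in a
  domain.\<close>

lemma det_vandermonde_nonzero:
  fixes x :: "nat \<Rightarrow> 'a::idom"
  assumes inj: "inj_on x {..<n}"
  shows "Determinant.det (Matrix.mat n n (\<lambda>(i, l). x l ^ (n - 1 - i))) \<noteq> 0"
proof -
  define V where "V = Matrix.mat n n (\<lambda>(i, l). x l ^ (n - 1 - i))"
  define g where "g k = (\<Prod>l\<in>{..<n} - {k}. [:- x l, 1:])" for k
  define G where "G = Matrix.mat n n (\<lambda>(k, i). Polynomial.coeff (g k) (n - 1 - i))"
  define d where "d k = (\<Prod>l\<in>{..<n} - {k}. x k - x l)" for k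
  have VG: "V \<in> carrier_mat n n" "G \<in> carrier_mat n n" by (auto simp: V_def G_def)
  have deg: "Polynomial.degree (g k) < n" if "k < n" for k
    using degree_prod_linear[of x "{..<n} - {k}"] that by (simp add: g_def)
  have GV: "(G * V) $$ (k, l) = (if k = l then d k else 0)" if "k < n" "l < n" for k l
  proof -
    have "(G * V) $$ (k, l) = (\<Sum>j\<in>{0..<n}. Polynomial.coeff (g k) (n - 1 - j) * x l ^ (n - 1 - j))"
      using that by (simp add: G_def V_def scalar_prod_def)
    also have "\<dots> = Polynomial.poly (g k) (x l)" by (rule sum_powers_rev[OF deg[OF that(1)]])
    also have "\<dots> = (if k = l then d k else 0)"
    proof (cases "k = l")
      case False
      then have "(\<Prod>i\<in>{..<n} - {k}. x l - x i) = 0" using that by (intro prod_zero) auto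
      then show ?thesis using False by (simp add: g_def poly_linear_prod)
    qed (simp add: g_def poly_linear_prod d_def)
    finally show ?thesis .
  qed
  have "Determinant.det (G * V) = prod_list (diag_mat (G * V))"
    by (rule det_lower_triangular[of n]) (use GV VG in auto)
  also have "\<dots> \<noteq> 0"
  proof
    assume "prod_list (diag_mat (G * V)) = 0"
    then have "0 \<in> set (diag_mat (G * V))" by (simp add: prod_list_zero_iff)
    then obtain k where k: "k < n" "(G * V) $$ (k, k) = 0" using VG by (auto simp: diag_mat_def)
    then have "d k = 0" using GV by simp
    then show False using inj k(1) by (auto simp: d_def inj_on_def)
  qed
  finally show ?thesis using det_mult[OF VG(2,1)] by (auto simp: V_def)
qed

text \<open>Rows are coefficient vectors of shifts of f and g, so multiplying them by a column of
  powers of a evaluates these shifts at a.\<close>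

lemma sylvester_rows:
  fixes f g :: "'a::comm_ring_1 poly"
  assumes "Polynomial.degree f \<le> n" "Polynomial.degree g \<le> m" "i < n + m" "j < n + m"
  shows "sylvester_mat_sub n m f g $$ (i, j)
    = Polynomial.coeff (if i < m then Polynomial.monom 1 (m - 1 - i) * f else Polynomial.monom 1 (n + m - 1 - i) * g) (n + m - 1 - j)"
proof (cases "i < m")
  case True
  show ?thesis
  proof (cases "i \<le> j \<and> j - i \<le> n")
    case t: True
    then have "m - 1 - i \<le> n + m - 1 - j" "n + m - 1 - j - (m - 1 - i) = n + i - j" using True by auto
    then show ?thesis using True t assms(3,4) by (simp add: sylvester_mat_sub_index coeff_monom_mult)
  next
    case False
    then have "n + m - 1 - j < m - 1 - i \<or> Polynomial.degree f < n + m - 1 - j - (m - 1 - i)" using True assms by auto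
    then show ?thesis using True False assms(3,4) by (auto simp: sylvester_mat_sub_index coeff_monom_mult coeff_eq_0)
  qed
next
  case False
  show ?thesis
  proof (cases "i - m \<le> j \<and> j \<le> i")
    case t: True
    then have "n + m - 1 - i \<le> n + m - 1 - j" "n + m - 1 - j - (n + m - 1 - i) = i - j" using False assms by auto
    then show ?thesis using False t assms(3,4) by (simp add: sylvester_mat_sub_index coeff_monom_mult)
  next
    case f: False
    then have "n + m - 1 - j < n + m - 1 - i \<or> Polynomial.degree g < n + m - 1 - j - (n + m - 1 - i)" using False assms by auto
    then show ?thesis using f False assms(3,4) by (auto simp: sylvester_mat_sub_index coeff_monom_mult coeff_eq_0)
  qed
qed

text \<open>The matrix E has m unit vectors and then n columns of powers of the roots. In S E the
  shifts of f vanish at the roots, which leaves a block triangular matrix: a unitriangular block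
  from the leading coefficient of f, and a Vandermonde matrix times the diagonal matrix of the
  values g(x_l). The determinant of E is the same Vandermonde determinant and cancels in a
  domain.\<close>

lemma det_sylvester_linear_prod_idom:
  fixes x :: "nat \<Rightarrow> 'a::idom"
  assumes inj: "inj_on x {..<n}" and g: "Polynomial.degree g \<le> m"
  shows "Determinant.det (sylvester_mat_sub n m (\<Prod>l<n. [:- x l, 1:]) g) = (\<Prod>l<n. Polynomial.poly g (x l))"
proof -
  define f where "f = (\<Prod>l<n. [:- x l, 1:])"
  define N where "N = n + m"
  define r where "r i = (if i < m then Polynomial.monom 1 (m - 1 - i) * f else Polynomial.monom 1 (N - 1 - i) * g)" for i
  define S where "S = sylvester_mat_sub n m f g"
  define V where "V = Matrix.mat n n (\<lambda>(i, l). x l ^ (n - 1 - i))"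
  define E where "E = four_block_mat (1\<^sub>m m) (Matrix.mat m n (\<lambda>(j, l). x l ^ (N - 1 - j))) (0\<^sub>m n m) V"
  have degf: "Polynomial.degree f \<le> n" unfolding f_def using degree_prod_linear[of x "{..<n}"] by simp
  have coeff_f: "Polynomial.coeff f n = 1"
  proof -
    have "Polynomial.coeff (\<Prod>l<k. [:- x l, 1:]) k = 1" for k
    proof (induction k)
      case (Suc k)
      have "Polynomial.coeff (\<Prod>l<k. [:- x l, 1:]) (Suc k) = 0"
        using degree_prod_linear[of x "{..<k}"] by (intro coeff_eq_0) simp
      then show ?case using Suc by simp
    qed simp
    then show ?thesis by (simp add: f_def)
  qed
  have S: "S \<in> carrier_mat N N" by (simp add: S_def N_def sylvester_mat_sub_carrier)
  have V: "V \<in> carrier_mat n n" by (simp add: V_def)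
  have E: "E \<in> carrier_mat N N"
    unfolding E_def N_def using four_block_carrier_mat[of "1\<^sub>m m" m m V n n] V by (simp add: add.commute)
  have Sij: "S $$ (i, j) = Polynomial.coeff (r i) (N - 1 - j)" if "i < N" "j < N" for i j
    using sylvester_rows[OF degf g] that by (simp add: S_def r_def N_def)
  have degr: "Polynomial.degree (r i) < N" if "i < N" for i
  proof (cases "i < m")
    case True
    have "Polynomial.degree (Polynomial.monom 1 (m - 1 - i) * f) \<le> (m - 1 - i) + n"
      by (rule order.trans[OF degree_mult_le]) (use degf in \<open>simp add: degree_monom_le add_mono\<close>)
    then show ?thesis using True by (simp add: r_def N_def)
  next
    case False
    have "Polynomial.degree (Polynomial.monom 1 (N - 1 - i) * g) \<le> (N - 1 - i) + m"
      by (rule order.trans[OF degree_mult_le]) (use g in \<open>simp add: degree_monom_le add_mono\<close>)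
    then show ?thesis using False that by (simp add: r_def N_def)
  qed
  have Ec: "E $$ (j, c) = (if c < m then (if j = c then 1 else 0) else x (c - m) ^ (N - 1 - j))"
    if "j < N" "c < N" for j c
    using that unfolding E_def N_def by (auto simp: V_def intro!: arg_cong[of _ _ "(^) _"])
  have SE: "(S * E) $$ (i, c) = (if c < m then S $$ (i, c) else if i < m then 0 else x (c - m) ^ (N - 1 - i) * Polynomial.poly g (x (c - m)))"
    if ic: "i < N" "c < N" for i c
  proof -
    have e: "(S * E) $$ (i, c) = (\<Sum>j\<in>{0..<N}. S $$ (i, j) * E $$ (j, c))"
      using ic S E by (simp add: scalar_prod_def)
    show ?thesis
    proof (cases "c < m")
      case True
      then show ?thesis unfolding e using ic by (simp add: Ec if_distrib[of "\<lambda>y. _ * y"] cong: if_cong)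
    next
      case False
      have "(S * E) $$ (i, c) = (\<Sum>j\<in>{0..<N}. Polynomial.coeff (r i) (N - 1 - j) * x (c - m) ^ (N - 1 - j))"
        unfolding e using ic False by (simp add: Ec Sij)
      also have "\<dots> = Polynomial.poly (r i) (x (c - m))" by (rule sum_powers_rev[OF degr[OF ic(1)]])
      also have "\<dots> = (if i < m then 0 else x (c - m) ^ (N - 1 - i) * Polynomial.poly g (x (c - m)))"
      proof -
        have "Polynomial.poly f (x (c - m)) = 0"
          unfolding f_def poly_linear_prod using False ic by (intro prod_zero) (auto simp: N_def)
        then show ?thesis by (simp add: r_def poly_monom)
      qed
      finally show ?thesis using False by simp
    qed
  qed
  define A1 where "A1 = Matrix.mat m m (\<lambda>(i, c). S $$ (i, c))"
  define A3 where "A3 = Matrix.mat n m (\<lambda>(i, c). S $$ (i + m, c))"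
  define A4 where "A4 = V * Matrix.mat n n (\<lambda>(l, c). if l = c then Polynomial.poly g (x l) else 0)"
  have A4: "A4 \<in> carrier_mat n n" unfolding A4_def by (rule mult_carrier_mat[OF V]) simp
  have A4c: "A4 $$ (i, c) = x c ^ (n - 1 - i) * Polynomial.poly g (x c)" if "i < n" "c < n" for i c
    using that by (simp add: A4_def V_def scalar_prod_def if_distrib[of "\<lambda>y. _ * y"] cong: if_cong)
  have "S * E = four_block_mat A1 (0\<^sub>m m n) A3 A4"
  proof (rule eq_matI)
    show "dim_row (S * E) = dim_row (four_block_mat A1 (0\<^sub>m m n) A3 A4)"
      "dim_col (S * E) = dim_col (four_block_mat A1 (0\<^sub>m m n) A3 A4)"
      using S E A4 by (simp_all add: A1_def N_def)
    fix i c assume "i < dim_row (four_block_mat A1 (0\<^sub>m m n) A3 A4)" "c < dim_col (four_block_mat A1 (0\<^sub>m m n) A3 A4)"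
    then have ic: "i < N" "c < N" using A4 by (simp_all add: A1_def N_def)
    show "(S * E) $$ (i, c) = four_block_mat A1 (0\<^sub>m m n) A3 A4 $$ (i, c)"
      unfolding SE[OF ic] using ic A4 A4c[of "i - m" "c - m"] by (auto simp: A1_def A3_def N_def)
  qed
  then have "Determinant.det (S * E) = Determinant.det A1 * Determinant.det A4"
    using det_four_block_mat_upper_right_zero[of A1 m "0\<^sub>m m n" n A3 A4] A4 by (simp add: A1_def A3_def)
  moreover have "Determinant.det A1 = 1"
  proof -
    have A1ic: "A1 $$ (i, c) = Polynomial.coeff f (n + i - c)" if "c \<le> i" "i < m" for i c
      using that by (simp add: A1_def Sij N_def r_def coeff_monom_mult)
    have "Determinant.det A1 = prod_list (diag_mat A1)"
    proof (rule det_upper_triangular[of _ m])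
      show "upper_triangular A1"
        by (rule upper_triangularI) (use degf in \<open>auto simp: A1ic coeff_eq_0 A1_def[THEN arg_cong[of _ _ dim_row]]\<close>)
    qed (simp add: A1_def)
    also have "diag_mat A1 = map (\<lambda>_. 1) [0..<m]"
      unfolding diag_mat_def using A1ic coeff_f by (auto simp: A1_def[THEN arg_cong[of _ _ dim_row]])
    finally show ?thesis by (simp add: map_replicate_const)
  qed
  moreover have "Determinant.det A4 = Determinant.det V * (\<Prod>l<n. Polynomial.poly g (x l))"
  proof -
    define D where "D = Matrix.mat n n (\<lambda>(l, c). if l = c then Polynomial.poly g (x l) else 0)"
    have D: "D \<in> carrier_mat n n" by (simp add: D_def)
    have "Determinant.det D = prod_list (diag_mat D)"
      by (rule det_lower_triangular[of n]) (auto simp: D_def)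
    also have "diag_mat D = map (\<lambda>l. Polynomial.poly g (x l)) [0..<n]"
      by (auto simp: diag_mat_def D_def)
    also have "prod_list \<dots> = (\<Prod>l<n. Polynomial.poly g (x l))"
      by (simp add: prod.list_conv_set_nth atLeast0LessThan)
    finally show ?thesis unfolding A4_def D_def[symmetric] using det_mult[OF V D] by simp
  qed
  moreover have "Determinant.det E = Determinant.det V"
    unfolding E_def using det_four_block_mat_lower_left_zero[of "1\<^sub>m m" m _ n "0\<^sub>m n m" V] V by simp
  moreover have "Determinant.det (S * E) = Determinant.det S * Determinant.det E" by (rule det_mult[OF S E])
  moreover have "Determinant.det V \<noteq> 0" unfolding V_def by (rule det_vandermonde_nonzero[OF inj])
  ultimately show ?thesis by (simp add: S_def f_def)
qed

text \<open>The identity holds in every ring because it holds for indeterminate roots and coefficients.\<close>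

lemma det_sylvester_linear_prod:
  fixes x :: "nat \<Rightarrow> 'a::comm_ring_1"
  assumes g: "Polynomial.degree g \<le> m"
  shows "Determinant.det (sylvester_mat_sub n m (\<Prod>l<n. [:- x l, 1:]) g) = (\<Prod>l<n. Polynomial.poly g (x l))"
proof -
  have oi: "type_hom (typ_ring :: 'a ring) (of_int :: int \<Rightarrow> 'a)"
    by (intro type_hom.intro cring_from_type_algebra type_hom_axioms.intro Ring.ring_hom_memI) auto
  \<comment> \<open>Variables with even index stand for the roots and those with odd index for the
    coefficients of g.\<close>
  define y where "y k = (if even k then x (k div 2) else Polynomial.coeff g (k div 2))" for k :: nat
  define h where "h = ev typ_ring of_int y"
  have "type_hom typ_ring h" unfolding h_def by (rule type_hom.type_hom_ev[OF oi]) simp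
  then interpret h: type_hom typ_ring h .
  have hV: "h (Var k) = y k" for k unfolding h_def by (rule type_hom.ev_Var[OF oi]) simp
  interpret H: comm_ring_hom h
  proof
    show "h 0 = 0" "h 1 = 1" using h.zero h.one by simp_all
    show "h (a + b) = h a + h b" "h (a * b) = h a * h b" for a b using h.add h.mult by simp_all
  qed
  interpret HP: map_poly_comm_ring_hom h ..
  define x0 :: "nat \<Rightarrow> (nat, int) mpoly" where "x0 l = Var (2 * l)" for l
  define g0 :: "(nat, int) mpoly poly" where "g0 = (\<Sum>k\<le>m. Polynomial.monom (Var (2 * k + 1)) k)"
  have x0: "h (x0 l) = x l" for l by (simp add: x0_def hV y_def)
  have cg: "Polynomial.coeff g0 k = (if k \<le> m then Var (2 * k + 1) else 0)" for k
    unfolding g0_def by (simp add: coeff_sum)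
  have g0: "map_poly h g0 = g"
  proof (rule poly_eqI)
    show "Polynomial.coeff (map_poly h g0) k = Polynomial.coeff g k" for k
      using g by (auto simp: coeff_map_poly cg hV y_def coeff_eq_0)
  qed
  have "inj_on x0 {..<n}"
  proof (rule inj_onI)
    fix k l assume "x0 k = x0 l"
    then have "Poly_Mapping.lookup (x0 k) (Poly_Mapping.single (2 * k) 1) = Poly_Mapping.lookup (x0 l) (Poly_Mapping.single (2 * k) 1)" by simp
    then have "Poly_Mapping.single (2 * l) (1::nat) = Poly_Mapping.single (2 * k) 1"
      by (simp add: x0_def Var_def lookup_single when_def split: if_splits)
    then have "Poly_Mapping.lookup (Poly_Mapping.single (2 * l) (1::nat)) (2 * l) = Poly_Mapping.lookup (Poly_Mapping.single (2 * k) 1) (2 * l)" by simp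
    then show "k = l" by (simp add: lookup_single when_def split: if_splits)
  qed
  moreover have "Polynomial.degree g0 \<le> m" by (rule degree_le) (simp add: cg)
  ultimately have e: "Determinant.det (sylvester_mat_sub n m (\<Prod>l<n. [:- x0 l, 1:]) g0) = (\<Prod>l<n. Polynomial.poly g0 (x0 l))"
    by (rule det_sylvester_linear_prod_idom)
  have "map_mat h (sylvester_mat_sub n m (\<Prod>l<n. [:- x0 l, 1:]) g0) = sylvester_mat_sub n m (\<Prod>l<n. [:- x l, 1:]) g"
    by (simp add: sylvester_mat_sub_map g0 HP.hom_prod x0 H.hom_uminus)
  moreover have "h (\<Prod>l<n. Polynomial.poly g0 (x0 l)) = (\<Prod>l<n. Polynomial.poly g (x l))"
  proof -
    have "h (Polynomial.poly g0 (x0 l)) = Polynomial.poly g (x l)" for l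
      using H.poly_map_poly[of g0 "x0 l"] by (simp add: g0 x0)
    then show ?thesis by (simp add: H.hom_prod)
  qed
  ultimately show ?thesis using arg_cong[OF e, of h] by (metis H.hom_det)
qed

section \<open>The discriminant and the Jacobian on the torus\<close>

lemma coeff_formal_deriv: "Polynomial.coeff (formal_deriv f) j = of_nat (Suc j) * Polynomial.coeff f (Suc j)"
proof -
  have "Polynomial.coeff (formal_deriv f) j
      = (\<Sum>k\<le>Polynomial.degree f. if k = Suc j then of_nat k * Polynomial.coeff f k else 0)"
    unfolding formal_deriv_def coeff_sum
  proof (rule sum.cong[OF refl])
    fix k
    show "Polynomial.coeff (Polynomial.monom (of_nat k * Polynomial.coeff f k) (k - 1)) j
        = (if k = Suc j then of_nat k * Polynomial.coeff f k else 0)" by (cases k) auto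
  qed
  then show ?thesis by (simp add: coeff_eq_0)
qed

lemma formal_deriv_linear_mult: "formal_deriv ([:- a, 1:] * h) = h + [:- a, 1:] * formal_deriv h"
proof (rule poly_eqI)
  fix j
  show "Polynomial.coeff (formal_deriv ([:- a, 1:] * h)) j = Polynomial.coeff (h + [:- a, 1:] * formal_deriv h) j"
    by (cases j) (simp_all add: coeff_formal_deriv algebra_simps)
qed

context
  fixes P :: "('n::finite, 'r::comm_ring_1) GL_fun set"
  assumes P: "is_prime P" and off: "\<And>i j. i \<noteq> j \<Longrightarrow> Var (i, j) \<in> P"
begin

interpretation R: ring_rel "cong_mod P" by (rule ring_rel_cong_mod[OF is_primeD(1)[OF P]])
interpretation RP: ring_rel "pcong P" by (rule ring_rel_pcong[OF is_primeD(1)[OF P]])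

abbreviation (input) diag_var :: "'n \<Rightarrow> ('n, 'r) GL_fun" where "diag_var i \<equiv> Var (i, i)"

lemma xmat_cong: "cong_mod P (xmat $ i $ j) (diagm diag_var $ i $ j)"
  using off[of i j] is_primeD(3)[OF P] by (auto simp: xmat_def diagm_def cong_mod_def)

lemma char_pol_cong: "pcong P char_pol (\<Prod>l\<in>UNIV. [:- diag_var l, 1:])"
proof -
  have "pcong P (Determinants.det (charmat xmat)) (Determinants.det (charmat (diagm diag_var)))"
    by (rule RP.det) (auto simp: pcong_def intro: R.charmat xmat_cong)
  moreover have "char_pol = Determinants.det (charmat (xmat :: ('n, 'r) GL_fun^'n^'n))"
    by (simp add: char_pol_def charmat_def xmat_def)
  ultimately show ?thesis by (simp add: det_charmat_diagm)
qed

lemma poly_cong: "pcong P f g \<Longrightarrow> Polynomial.degree f \<le> d \<Longrightarrow> Polynomial.degree g \<le> d \<Longrightarrow>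
    cong_mod P (Polynomial.poly f a) (Polynomial.poly g a)"
proof -
  assume fg: "pcong P f g" "Polynomial.degree f \<le> d" "Polynomial.degree g \<le> d"
  have "cong_mod P (\<Sum>k<Suc d. Polynomial.coeff f k * a ^ k) (\<Sum>k<Suc d. Polynomial.coeff g k * a ^ k)"
    by (intro R.sum R.mult pcongD[OF fg(1)] cong_mod_refl is_primeD(1)[OF P])
  then show ?thesis using poly_eq_sum_lt[of f "Suc d" a] poly_eq_sum_lt[of g "Suc d" a] fg(2,3) by simp
qed

text \<open>The size of a Sylvester matrix is fixed by the actual degrees, so the degree must be
  known exactly. A prime ideal excludes the zero ring, where it would drop.\<close>

lemma degree_char_pol: "Polynomial.degree (char_pol :: ('n, 'r) GL_fun poly) = CARD('n)"
proof (cases "(1 :: ('n, 'r) GL_fun) = 0")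
  case True
  then show ?thesis using is_primeD(2,3)[OF P] by simp
next
  case False
  let ?c = "\<lambda>i j. charmat (xmat :: ('n, 'r) GL_fun^'n^'n) $ i $ j"
  have d1: "Polynomial.degree (?c i j) \<le> 1" for i j
    by (auto simp: charmat_def degree_diff_le)
  have lead: "Polynomial.degree (\<Prod>i\<in>L. f i) \<le> card L \<and> Polynomial.coeff (\<Prod>i\<in>L. f i) (card L) = (\<Prod>i\<in>L. Polynomial.coeff (f i) 1)"
    if "finite L" "\<And>i. Polynomial.degree (f i) \<le> 1" for f :: "'n \<Rightarrow> ('n, 'r) GL_fun poly" and L
    using that(1)
  proof (induction L rule: finite_induct)
    case (insert a L)
    have fa: "f a = [:Polynomial.coeff (f a) 0, Polynomial.coeff (f a) 1:]"
    proof (rule poly_eqI)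
      show "Polynomial.coeff (f a) k = Polynomial.coeff [:Polynomial.coeff (f a) 0, Polynomial.coeff (f a) 1:] k" for k
        using that(2)[of a] by (cases k; cases "k - 1") (auto simp: coeff_eq_0)
    qed
    have z: "Polynomial.coeff (\<Prod>i\<in>L. f i) (Suc (card L)) = 0" using insert.IH by (intro coeff_eq_0) simp
    have "Polynomial.degree (f a * (\<Prod>i\<in>L. f i)) \<le> 1 + card L"
      by (rule order.trans[OF degree_mult_le]) (use that(2)[of a] insert.IH in simp)
    moreover have "Polynomial.coeff (f a * (\<Prod>i\<in>L. f i)) (Suc (card L)) = Polynomial.coeff (f a) 1 * Polynomial.coeff (\<Prod>i\<in>L. f i) (card L)"
      by (subst fa) (simp add: z)
    ultimately show ?case using insert by simp
  qed simp
  have cp: "char_pol = Determinants.det (charmat (xmat :: ('n, 'r) GL_fun^'n^'n))" by (simp add: char_pol_def charmat_def xmat_def)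
  have "Polynomial.coeff (Determinants.det (charmat (xmat :: ('n, 'r) GL_fun^'n^'n))) CARD('n)
      = Determinants.det (\<chi> i j. Polynomial.coeff (?c i j) 1)"
    unfolding Determinants.det_def coeff_sum of_int_sign_poly
    using lead[OF finite d1] by (simp add: Determinants.det_def)
  also have "(\<chi> i j. Polynomial.coeff (?c i j) 1) = Finite_Cartesian_Product.mat 1"
    by (rule matrix_eqI) (simp add: charmat_def Finite_Cartesian_Product.mat_def)
  finally have c1: "Polynomial.coeff (char_pol :: ('n, 'r) GL_fun poly) CARD('n) = 1" by (simp add: cp)
  have "Polynomial.degree (char_pol :: ('n, 'r) GL_fun poly) \<le> CARD('n)"
    unfolding cp Determinants.det_def of_int_sign_poly
    using lead[OF finite d1] by (intro degree_sum_le) (auto intro: order.trans[OF degree_smult_le])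
  then show ?thesis using le_degree[of "char_pol :: ('n, 'r) GL_fun poly" "CARD('n)"] c1 False by simp
qed

text \<open>Modulo P the characteristic polynomial is the product of s - x_l, and the resultant with
  its derivative becomes the product of the values of the derivative at the roots, that is of all
  differences x_l - x_k with k \<noteq> l.\<close>

lemma discriminant_mem_iff:
  "discriminant char_pol \<in> P \<longleftrightarrow> (\<exists>i j. i \<noteq> j \<and> diag_var i - diag_var j \<in> P)"
proof -
  let ?n = "CARD('n)"
  let ?f = "char_pol :: ('n, 'r) GL_fun poly"
  let ?g = "formal_deriv ?f"
  let ?m = "Polynomial.degree ?g"
  let ?lin = "\<Prod>l\<in>UNIV. [:- diag_var l, 1:]"
  obtain e :: "nat \<Rightarrow> 'n" where e: "bij_betw e {..<?n} UNIV"
    using ex_bij_betw_nat_finite[of "UNIV :: 'n set"] by (auto simp: atLeast0LessThan)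
  have f0: "?lin = (\<Prod>l<?n. [:- diag_var (e l), 1:])"
    by (rule prod.reindex_bij_betw[OF e, symmetric])
  \<comment> \<open>Only the first polynomial is replaced modulo P. The derivative is kept, so both
    Sylvester matrices have the same size even if degrees drop modulo P.\<close>
  have "cong_mod P (Determinant.det (sylvester_mat_sub ?n ?m ?f ?g)) (Determinant.det (sylvester_mat_sub ?n ?m ?lin ?g))"
  proof -
    have "cong_mod P (sylvester_mat_sub ?n ?m ?f ?g $$ (i, j)) (sylvester_mat_sub ?n ?m ?lin ?g $$ (i, j))"
      if "i < ?n + ?m" "j < ?n + ?m" for i j
      using that pcongD[OF char_pol_cong] cong_mod_refl[OF is_primeD(1)[OF P]] by (simp add: sylvester_mat_sub_index)
    then have "cong_mod P (\<Prod>i\<in>{0..<?n + ?m}. sylvester_mat_sub ?n ?m ?f ?g $$ (i, \<pi> i))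
        (\<Prod>i\<in>{0..<?n + ?m}. sylvester_mat_sub ?n ?m ?lin ?g $$ (i, \<pi> i))" if "\<pi> permutes {0..<?n + ?m}" for \<pi>
      using permutes_in_image[OF that] by (intro R.prod) auto
    then show ?thesis
      unfolding det_def'[OF sylvester_mat_sub_carrier]
      by (intro R.sum R.mult[OF cong_mod_refl[OF is_primeD(1)[OF P]]]) simp
  qed
  then have res: "cong_mod P (resultant ?f ?g) (\<Prod>l<?n. Polynomial.poly ?g (diag_var (e l)))"
    unfolding f0 det_sylvester_linear_prod[OF order.refl] by (simp add: resultant_sub resultant_sub_def degree_char_pol)
  have gl: "cong_mod P (Polynomial.poly ?g (diag_var l)) (\<Prod>k\<in>UNIV - {l}. diag_var l - diag_var k)" for l
  proof -
    have "pcong P ?g (formal_deriv ?lin)"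
      unfolding pcong_def coeff_formal_deriv using pcongD[OF char_pol_cong]
      by (intro allI R.mult cong_mod_refl[OF is_primeD(1)[OF P]])
    then have "cong_mod P (Polynomial.poly ?g (diag_var l)) (Polynomial.poly (formal_deriv ?lin) (diag_var l))"
      by (rule poly_cong[OF _ max.cobounded1 max.cobounded2])
    moreover have "?lin = [:- diag_var l, 1:] * (\<Prod>k\<in>UNIV - {l}. [:- diag_var k, 1:])"
      by (rule prod.remove) auto
    then have "Polynomial.poly (formal_deriv ?lin) (diag_var l) = (\<Prod>k\<in>UNIV - {l}. diag_var l - diag_var k)"
      by (simp only: formal_deriv_linear_mult) (simp add: poly_linear_prod)
    ultimately show ?thesis by simp
  qed
  have "discriminant ?f \<in> P \<longleftrightarrow> resultant ?f ?g \<in> P"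
  proof -
    have "(-1) ^ k \<notin> P" for k :: nat
      using is_prime_power[OF P, of "-1" k] is_idealD(5)[OF is_primeD(1)[OF P], of "-1"] is_primeD(2)[OF P] by auto
    then show ?thesis by (simp add: discriminant_def is_primeD(4)[OF P])
  qed
  also have "\<dots> \<longleftrightarrow> (\<exists>l<?n. Polynomial.poly ?g (diag_var (e l)) \<in> P)"
    using cong_mod_mem[OF is_primeD(1)[OF P] res] by (auto simp: is_prime_prod[OF P])
  also have "\<dots> \<longleftrightarrow> (\<exists>l. Polynomial.poly ?g (diag_var l) \<in> P)"
    using e unfolding bij_betw_def by (metis UNIV_I imageE lessThan_iff)
  also have "\<dots> \<longleftrightarrow> (\<exists>l k. l \<noteq> k \<and> diag_var l - diag_var k \<in> P)"
  proof -
    have m: "Polynomial.poly ?g (diag_var l) \<in> P \<longleftrightarrow> (\<exists>k\<in>UNIV - {l}. diag_var l - diag_var k \<in> P)" for l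
    proof -
      have "(\<Prod>k\<in>UNIV - {l}. diag_var l - diag_var k) \<in> P \<longleftrightarrow> (\<exists>k\<in>UNIV - {l}. diag_var l - diag_var k \<in> P)"
        using is_prime_prod[OF P, of "UNIV - {l}" "\<lambda>k. diag_var l - diag_var k"] by simp
      then show ?thesis using cong_mod_mem[OF is_primeD(1)[OF P] gl[of l]] by (rule trans[rotated])
    qed
    show ?thesis unfolding m
    proof (rule ex_cong1)
      fix l
      show "(\<exists>k\<in>UNIV - {l}. diag_var l - diag_var k \<in> P) \<longleftrightarrow> (\<exists>k. l \<noteq> k \<and> diag_var l - diag_var k \<in> P)"
        unfolding Bex_def by (rule ex_cong1) (simp add: eq_commute)
    qed
  qed
  finally show ?thesis .
qed

text \<open>On the group the diagonal entries lie outside P, so the product formula turns vanishing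
  of \<open>jac\<close> into vanishing of a difference. For the converse two diagonal entries may be
  taken equal modulo P, and then two columns of the Jacobian agree.\<close>

lemma jac_mem_iff:
  assumes det: "det_fun \<notin> P"
  shows "jac xmat \<in> P \<longleftrightarrow> (\<exists>i j. i \<noteq> j \<and> diag_var i - diag_var j \<in> P)"
proof -
  note I = is_primeD(1)[OF P]
  have d: "cong_mod P det_fun (Determinants.det (diagm diag_var))"
    unfolding det_fun_eq by (rule R.det) (rule xmat_cong)
  have "Determinants.det (diagm diag_var) = (\<Prod>i\<in>UNIV. diag_var i)" by (subst det_diagonal) (auto simp: diagm_def)
  then have "(\<Prod>i\<in>UNIV. diag_var i) \<notin> P" using cong_mod_mem[OF I d] det by simp
  then have diag_var: "diag_var i \<notin> P" for i unfolding is_prime_prod[OF P finite] by blast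
  have j: "jac xmat \<in> P \<longleftrightarrow> jac (diagm diag_var) \<in> P"
    by (rule cong_mod_mem[OF I R.jac]) (rule xmat_cong)
  show ?thesis
  proof
    assume "jac xmat \<in> P"
    then have "(\<Prod>j\<in>UNIV. - diag_var j * (\<Prod>l\<in>UNIV - {j}. diag_var j - diag_var l)) \<in> P"
      unfolding j det_vdm_mult_jac_diagm[symmetric] using is_idealD(3)[OF I] by blast
    then obtain j where "- diag_var j \<in> P \<or> (\<Prod>l\<in>UNIV - {j}. diag_var j - diag_var l) \<in> P"
      unfolding is_prime_prod[OF P finite] is_primeD(4)[OF P] by blast
    then have "(\<Prod>l\<in>UNIV - {j}. diag_var j - diag_var l) \<in> P" using diag_var is_idealD(5)[OF I, of "- diag_var j"] by auto
    then obtain l where "l \<in> UNIV - {j}" "diag_var j - diag_var l \<in> P" by (auto simp: is_prime_prod[OF P])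
    then show "\<exists>i j. i \<noteq> j \<and> diag_var i - diag_var j \<in> P" by (intro exI[of _ j] exI[of _ l]) simp
  next
    assume "\<exists>i j. i \<noteq> j \<and> diag_var i - diag_var j \<in> P"
    then obtain i j where ij: "i \<noteq> j" "diag_var i - diag_var j \<in> P" by blast
    define z where "z = diag_var(j := diag_var i)"
    have "cong_mod P (jac (diagm diag_var)) (jac (diagm z))"
    proof (rule R.jac)
      show "cong_mod P (diagm diag_var $ a $ b) (diagm z $ a $ b)" for a b
        using is_idealD(5)[OF I ij(2)] is_idealD(1)[OF I] by (auto simp: diagm_def z_def cong_mod_def)
    qed
    moreover have "jac (diagm z) = 0" by (rule jac_diagm_eq_0[OF ij(1)]) (use ij(1) in \<open>simp add: z_def\<close>)
    ultimately show "jac xmat \<in> P" unfolding j by (simp add: cong_mod_0_iff)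
  qed
qed

end

definition U_jac :: "('n::finite, 'r::comm_ring_1) GL_fun set set" where
  "U_jac = {P \<in> GL. jac xmat \<notin> P}"

lemma U_jac_Int_torus: "U_jac \<inter> torus = torus_star"
proof -
  have "jac xmat \<in> P \<longleftrightarrow> discriminant char_pol \<in> P" if "P \<in> torus" for P :: "('n::finite, 'r::comm_ring_1) GL_fun set"
    using that discriminant_mem_iff[of P] jac_mem_iff[of P] by (auto simp: torus_def GL_def Spec_iff)
  then show ?thesis by (auto simp: U_jac_def torus_star_def torus_def)
qed

lemma U_jac_eq: "U_jac = {P \<in> Spec. det_fun * jac xmat \<notin> P}"
  by (auto simp: U_jac_def GL_def Spec_iff is_primeD)

lemma zariski_open_U_jac: "zariski_open U_jac"
  unfolding U_jac_eq by (rule zariski_open_basic)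

section \<open>The normalizer of the torus: monomial matrices and flatness\<close>

section \<open>Monomial matrices modulo an ideal\<close>

text \<open>The equations of the normalizer for b and c = b^(-1), modulo an arbitrary ideal. The
  generality is needed because entrywise powers satisfy the same equations, as do the images in the
  presenting ring of sections.\<close>

definition monomial_pair :: "'a::comm_ring_1 set \<Rightarrow> 'a^'n^'n \<Rightarrow> 'a^'n^'n \<Rightarrow> bool" where
  "monomial_pair I b c \<longleftrightarrow>
     (\<forall>i j. cong_mod I ((b ** c) $ i $ j) (Finite_Cartesian_Product.mat 1 $ i $ j)) \<and>
     (\<forall>i j. cong_mod I ((c ** b) $ i $ j) (Finite_Cartesian_Product.mat 1 $ i $ j)) \<and>
     (\<forall>i j k. i \<noteq> k \<longrightarrow> b $ i $ j * c $ j $ k \<in> I) \<and> (\<forall>i j k. i \<noteq> k \<longrightarrow> c $ i $ j * b $ j $ k \<in> I)"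

lemma monomial_pair_swap: "monomial_pair I b c \<Longrightarrow> monomial_pair I c b"
  by (auto simp: monomial_pair_def)

definition matrix_pow :: "nat \<Rightarrow> 'a::comm_ring_1^'n^'n \<Rightarrow> 'a^'n^'n" where
  "matrix_pow k y = (\<chi> i j. y $ i $ j ^ k)"

text \<open>All cross terms lie in I. It is used for sums of orthogonal idempotents and for the sums
  that express the entries of c x b.\<close>

lemma sum_orthogonal_power:
  assumes I: "is_ideal I" and fin: "finite A"
    and o: "\<And>x y. x \<in> A \<Longrightarrow> y \<in> A \<Longrightarrow> x \<noteq> y \<Longrightarrow> a x * a y \<in> I"
  shows "cong_mod I ((\<Sum>x\<in>A. a x) ^ Suc k) (\<Sum>x\<in>A. a x ^ Suc k)"
proof (induction k)
  case 0
  show ?case by (simp add: cong_mod_refl[OF I])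
next
  case (Suc k)
  interpret R: ring_rel "cong_mod I" by (rule ring_rel_cong_mod[OF I])
  have "cong_mod I ((\<Sum>x\<in>A. a x) * (\<Sum>x\<in>A. a x) ^ Suc k) ((\<Sum>x\<in>A. a x) * (\<Sum>x\<in>A. a x ^ Suc k))"
    by (rule R.mult[OF cong_mod_refl[OF I] Suc])
  moreover have "(\<Sum>x\<in>A. a x) * (\<Sum>x\<in>A. a x ^ Suc k) = (\<Sum>x\<in>A. \<Sum>y\<in>A. a x * a y ^ Suc k)"
    by (simp add: sum_product)
  moreover have "cong_mod I (\<Sum>x\<in>A. \<Sum>y\<in>A. a x * a y ^ Suc k) (\<Sum>x\<in>A. \<Sum>y\<in>A. if y = x then a x ^ Suc (Suc k) else 0)"
  proof (intro R.sum)
    fix x y assume xy: "x \<in> A" "y \<in> A"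
    have "a x * a y ^ Suc k \<in> I" if "x \<noteq> y"
      using is_idealD(4)[OF I o[OF xy that], of "a y ^ k"] by (simp add: mult.assoc)
    then show "cong_mod I (a x * a y ^ Suc k) (if y = x then a x ^ Suc (Suc k) else 0)"
      by (auto simp: cong_mod_refl[OF I] cong_mod_0_iff)
  qed
  moreover have "(\<Sum>x\<in>A. \<Sum>y\<in>A. if y = x then a x ^ Suc (Suc k) else 0) = (\<Sum>x\<in>A. a x ^ Suc (Suc k))"
    using fin by simp
  ultimately show ?case using cong_mod_trans[OF I] by (simp only: power_Suc[of _ "Suc k"])
qed

context
  fixes I :: "'a::comm_ring_1 set" and b c :: "'a^'n^'n"
  assumes I: "is_ideal I" and bc: "monomial_pair I b c"
begin

interpretation R: ring_rel "cong_mod I" by (rule ring_rel_cong_mod[OF I])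

lemma mp_bc: "cong_mod I (\<Sum>l\<in>UNIV. b $ i $ l * c $ l $ i) 1"
  and mp_cb: "cong_mod I (\<Sum>l\<in>UNIV. c $ i $ l * b $ l $ i) 1"
proof -
  have "cong_mod I ((b ** c) $ i $ i) (Finite_Cartesian_Product.mat 1 $ i $ i)"
    "cong_mod I ((c ** b) $ i $ i) (Finite_Cartesian_Product.mat 1 $ i $ i)"
    using bc by (auto simp: monomial_pair_def)
  then show "cong_mod I (\<Sum>l\<in>UNIV. b $ i $ l * c $ l $ i) 1" "cong_mod I (\<Sum>l\<in>UNIV. c $ i $ l * b $ l $ i) 1"
    by (simp_all add: matrix_matrix_mult_def Finite_Cartesian_Product.mat_def)
qed

lemma mp_off: "i \<noteq> k \<Longrightarrow> b $ i $ j * c $ j $ k \<in> I" "i \<noteq> k \<Longrightarrow> c $ i $ j * b $ j $ k \<in> I"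
  using bc by (auto simp: monomial_pair_def)

lemma absorb:
  assumes "cong_mod I s 1" "z * s \<in> I"
  shows "z \<in> I"
  using cong_mod_mem[OF I R.mult[OF cong_mod_refl[OF I] assms(1)], of z] assms(2) by simp

text \<open>Multiply by 1 = \<Sum> c_jl b_lj. The term l = i contains c_ji b_ik with j \<noteq> k,
  every other term contains b_ij c_jl with i \<noteq> l, and both lie in I.\<close>

lemma mp_row:
  assumes "j \<noteq> k"
  shows "b $ i $ j * b $ i $ k \<in> I"
proof (rule absorb[OF mp_cb[of j]])
  have "b $ i $ j * b $ i $ k * (c $ j $ l * b $ l $ j) \<in> I" for l
  proof (cases "l = i")
    case True
    have "b $ i $ j * b $ i $ k * (c $ j $ l * b $ l $ j) = (b $ i $ j * b $ l $ j) * (c $ j $ i * b $ i $ k)"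
      using True by (simp add: mult_ac)
    then show ?thesis using is_idealD(3)[OF I mp_off(2)[OF assms]] by metis
  next
    case False
    have "b $ i $ j * b $ i $ k * (c $ j $ l * b $ l $ j) = (b $ i $ k * b $ l $ j) * (b $ i $ j * c $ j $ l)"
      by (simp add: mult_ac)
    then show ?thesis using is_idealD(3)[OF I mp_off(1)[of i l j]] False by metis
  qed
  then show "b $ i $ j * b $ i $ k * (\<Sum>l\<in>UNIV. c $ j $ l * b $ l $ j) \<in> I"
    unfolding sum_distrib_left by (rule is_ideal_sum[OF I])
qed

text \<open>Multiply again by 1 = \<Sum> c_jl b_lj: the term l = i contains b_kj c_ji, the others
  contain b_ij c_jl with l \<noteq> i.\<close>

lemma mp_col:
  assumes "i \<noteq> k"
  shows "b $ i $ j * b $ k $ j \<in> I"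
proof (rule absorb[OF mp_cb[of j]])
  have "b $ i $ j * b $ k $ j * (c $ j $ l * b $ l $ j) \<in> I" for l
  proof (cases "l = i")
    case True
    have "b $ i $ j * b $ k $ j * (c $ j $ l * b $ l $ j) = (b $ i $ j * b $ l $ j) * (b $ k $ j * c $ j $ l)"
      by (simp add: mult_ac)
    then show ?thesis using is_idealD(3)[OF I mp_off(1)[of k l j]] assms True by metis
  next
    case False
    have "b $ i $ j * b $ k $ j * (c $ j $ l * b $ l $ j) = (b $ k $ j * b $ l $ j) * (b $ i $ j * c $ j $ l)"
      by (simp add: mult_ac)
    then show ?thesis using is_idealD(3)[OF I mp_off(1)[of i l j]] False by metis
  qed
  then show "b $ i $ j * b $ k $ j * (\<Sum>l\<in>UNIV. c $ j $ l * b $ l $ j) \<in> I"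
    unfolding sum_distrib_left by (rule is_ideal_sum[OF I])
qed

text \<open>For fixed i the elements b_ij c_ji have sum 1, so their orthogonality makes them
  idempotents modulo I; they mark the column in which row i of b is supported.\<close>

lemma mp_idem:
  assumes "j \<noteq> k"
  shows "(b $ i $ j * c $ j $ i) * (b $ i $ k * c $ k $ i) \<in> I"
proof -
  have "(b $ i $ j * c $ j $ i) * (b $ i $ k * c $ k $ i) = (b $ i $ j * c $ k $ i) * (c $ j $ i * b $ i $ k)"
    by (simp add: mult_ac)
  then show ?thesis using is_idealD(3)[OF I mp_off(2)[OF assms]] by metis
qed

text \<open>The k-th powers of orthogonal elements with sum 1 again have sum 1.\<close>

lemma mp_pow_half:
  assumes "k > 0"
  shows "cong_mod I ((matrix_pow k b ** matrix_pow k c) $ i $ j) (Finite_Cartesian_Product.mat 1 $ i $ j)"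
    and "i \<noteq> m \<Longrightarrow> matrix_pow k b $ i $ j * matrix_pow k c $ j $ m \<in> I"
proof -
  obtain k' where k: "k = Suc k'" using assms by (cases k) auto
  show o: "matrix_pow k b $ i $ j * matrix_pow k c $ j $ m \<in> I" if "i \<noteq> m" for i j m
    using is_idealD(4)[OF I mp_off(1)[OF that], of j "(b $ i $ j * c $ j $ m) ^ k'"]
    by (simp add: matrix_pow_def k power_mult_distrib mult_ac)
  show "cong_mod I ((matrix_pow k b ** matrix_pow k c) $ i $ j) (Finite_Cartesian_Product.mat 1 $ i $ j)"
  proof (cases "i = j")
    case True
    have "cong_mod I (\<Sum>l\<in>UNIV. (b $ i $ l * c $ l $ i) ^ Suc k') ((\<Sum>l\<in>UNIV. b $ i $ l * c $ l $ i) ^ Suc k')"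
      by (rule cong_mod_sym[OF I sum_orthogonal_power[OF I]]) (auto intro: mp_idem)
    moreover have "cong_mod I ((\<Sum>l\<in>UNIV. b $ i $ l * c $ l $ i) ^ Suc k') (1 ^ Suc k')" by (rule R.power[OF mp_bc])
    ultimately have "cong_mod I (\<Sum>l\<in>UNIV. (b $ i $ l * c $ l $ i) ^ Suc k') (1 ^ Suc k')" by (rule cong_mod_trans[OF I])
    then show ?thesis using True
      by (simp add: matrix_matrix_mult_def matrix_pow_def Finite_Cartesian_Product.mat_def k flip: power_mult_distrib del: power_Suc)
  next
    case False
    then have "(\<Sum>l\<in>UNIV. matrix_pow k b $ i $ l * matrix_pow k c $ l $ j) \<in> I"
      by (intro is_ideal_sum[OF I] o)
    then show ?thesis using False
      by (simp add: matrix_matrix_mult_def Finite_Cartesian_Product.mat_def cong_mod_0_iff)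
  qed
qed

text \<open>M is locally a permutation matrix: its entries are the idempotents of the support, and M
  times its transpose is 1 modulo I. So det M squares to 1.\<close>

lemma det_idem_matrix:
  defines "M \<equiv> \<chi> l j. b $ l $ j * c $ j $ l"
  shows "cong_mod I (Determinants.det M * Determinants.det M) 1"
proof -
  have e: "cong_mod I ((M ** transpose M) $ i $ k) (Finite_Cartesian_Product.mat 1 $ i $ k)" for i k
  proof (cases "i = k")
    case True
    have "cong_mod I (\<Sum>l\<in>UNIV. (b $ i $ l * c $ l $ i) ^ Suc 1) ((\<Sum>l\<in>UNIV. b $ i $ l * c $ l $ i) ^ Suc 1)"
      by (rule cong_mod_sym[OF I sum_orthogonal_power[OF I]]) (auto intro: mp_idem)
    moreover have "cong_mod I ((\<Sum>l\<in>UNIV. b $ i $ l * c $ l $ i) ^ Suc 1) (1 ^ Suc 1)" by (rule R.power[OF mp_bc])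
    ultimately have "cong_mod I (\<Sum>l\<in>UNIV. (b $ i $ l * c $ l $ i) ^ Suc 1) (1 ^ Suc 1)" by (rule cong_mod_trans[OF I])
    then show ?thesis using True
      by (simp add: matrix_matrix_mult_def M_def transpose_def Finite_Cartesian_Product.mat_def)
  next
    case False
    have "b $ i $ j * c $ j $ i * (b $ k $ j * c $ j $ k) \<in> I" for j
    proof -
      have "b $ i $ j * c $ j $ i * (b $ k $ j * c $ j $ k) = (c $ j $ i * b $ k $ j) * (b $ i $ j * c $ j $ k)"
        by (simp add: mult_ac)
      then show ?thesis using is_idealD(3)[OF I mp_off(1)[OF False, of j]] by metis
    qed
    then have "(\<Sum>j\<in>UNIV. b $ i $ j * c $ j $ i * (b $ k $ j * c $ j $ k)) \<in> I" by (intro is_ideal_sum[OF I])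
    then show ?thesis using False
      by (simp add: matrix_matrix_mult_def M_def transpose_def Finite_Cartesian_Product.mat_def cong_mod_0_iff)
  qed
  have "cong_mod I (Determinants.det (M ** transpose M)) (Determinants.det (Finite_Cartesian_Product.mat 1 :: 'a^'n^'n))"
    by (rule R.det) (rule e)
  then show ?thesis by (simp add: det_mul)
qed

end

context
  fixes I :: "'a::comm_ring_1 set" and b c :: "'a^'n^'n"
  assumes I: "is_ideal I" and bc: "monomial_pair I b c"
begin

lemma monomial_pair_pow: "k > 0 \<Longrightarrow> monomial_pair I (matrix_pow k b) (matrix_pow k c)"
  unfolding monomial_pair_def
  by (intro conjI allI impI mp_pow_half[OF I bc] mp_pow_half[OF I monomial_pair_swap[OF bc]])

text \<open>The (i, j) entry of c x b is the sum of c_iq x_ql b_lj over pairs (l, q). Two different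
  pairs differ in q or in l, and then orthogonality in row i of c or in column j of b kills the
  product of the two terms, so the power can be taken termwise.\<close>

lemma conj_pow:
  assumes k: "k > 0"
  shows "cong_mod I (matrix_pow k (c ** x ** b) $ i $ j) ((matrix_pow k c ** matrix_pow k x ** matrix_pow k b) $ i $ j)"
proof -
  obtain k' where k': "k = Suc k'" using k by (cases k) auto
  let ?a = "\<lambda>(l, q). c $ i $ q * x $ q $ l * b $ l $ j"
  have e: "(c ** x ** b) $ i $ j = (\<Sum>(l, q)\<in>UNIV. c $ i $ q * x $ q $ l * b $ l $ j)" for c x b :: "'a^'n^'n" and i j
    by (simp add: matrix_matrix_mult_def sum_distrib_right sum.cartesian_product)
  have "cong_mod I ((\<Sum>z\<in>UNIV. ?a z) ^ Suc k') (\<Sum>z\<in>UNIV. ?a z ^ Suc k')"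
  proof (rule sum_orthogonal_power[OF I])
    fix z z' :: "'n \<times> 'n" assume "z \<noteq> z'"
    obtain l q l' q' where z: "z = (l, q)" "z' = (l', q')" by (cases z, cases z')
    consider "q \<noteq> q'" | "l \<noteq> l'" using \<open>z \<noteq> z'\<close> z by auto
    then show "?a z * ?a z' \<in> I"
    proof cases
      case 1
      have "?a z * ?a z' = (x $ q $ l * b $ l $ j * x $ q' $ l' * b $ l' $ j) * (c $ i $ q * c $ i $ q')"
        by (simp add: z mult_ac)
      then show ?thesis using is_idealD(3)[OF I mp_row[OF I monomial_pair_swap[OF bc] 1]] by metis
    next
      case 2
      have "?a z * ?a z' = (c $ i $ q * x $ q $ l * c $ i $ q' * x $ q' $ l') * (b $ l $ j * b $ l' $ j)"
        by (simp add: z mult_ac)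
      then show ?thesis using is_idealD(3)[OF I mp_col[OF I bc 2]] by metis
    qed
  qed simp
  then show ?thesis
    unfolding e by (simp add: matrix_pow_def e k' power_mult_distrib case_prod_unfold del: power_Suc)
qed

end

section \<open>The normalizer of the torus\<close>

definition bmatN :: "('n::finite, 'r::comm_ring_1) conj_fun^'n^'n" where "bmatN = (\<chi> i j. Var (BV i j))"
definition cmatN :: "('n::finite, 'r::comm_ring_1) conj_fun^'n^'n" where "cmatN = (\<chi> i j. Var (CV i j))"
definition xmatN :: "('n::finite, 'r::comm_ring_1) conj_fun^'n^'n" where "xmatN = (\<chi> i j. Var (XV i j))"

lemma is_ideal_N: "is_ideal normalizer_ideal"
  unfolding normalizer_ideal_def by (rule is_ideal_genideal)

lemma monomial_pair_N: "monomial_pair normalizer_ideal bmatN cmatN"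
proof -
  note s = genideal_incl[THEN subsetD]
  show ?thesis
    unfolding monomial_pair_def normalizer_ideal_def cong_mod_def
    by (intro conjI allI impI; rule s;
        auto simp: bmatN_def cmatN_def matrix_matrix_mult_def Finite_Cartesian_Product.mat_def)
qed

lemma proj_G_xmat: "proj_G (xmat $ i $ j) = xmatN $ i $ j"
  by (simp add: proj_G_def xmat_def xmatN_def)

lemma conj_map_xmat: "conj_map (xmat $ i $ j) = (cmatN ** xmatN ** bmatN) $ i $ j"
  unfolding conj_map_def
  by (simp add: xmat_def xmatN_def cmatN_def bmatN_def matrix_matrix_mult_def sum_distrib_right)
    (rule sum.swap)

lemma ring_rel_proj_G: "ring_rel (\<lambda>f g. proj_G f = g)" and ring_rel_conj_map: "ring_rel (\<lambda>f g. conj_map f = g)"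
  unfolding proj_G_def conj_map_def by (rule ring_rel_subst)+

lemma Spec_vimage_subst: "Q \<in> Spec \<Longrightarrow> subst h -` Q \<in> Spec"
  unfolding Spec_iff by (auto simp: is_prime_def is_ideal_def subst_simps)

lemma jac_conj_N:
  assumes k: "k > 0"
  defines "b \<equiv> matrix_pow k (bmatN :: ('n::finite, 'r::comm_ring_1) conj_fun^'n^'n)" and "c \<equiv> matrix_pow k (cmatN :: ('n, 'r) conj_fun^'n^'n)"
  shows "\<exists>d. cong_mod normalizer_ideal (d * d) 1 \<and> cong_mod normalizer_ideal (jac (c ** x ** b)) (jac x * d)"
proof -
  have mp: "monomial_pair normalizer_ideal b c"
    unfolding b_def c_def by (rule monomial_pair_pow[OF is_ideal_N monomial_pair_N k])
  have "cong_mod normalizer_ideal (jac (c ** x ** b)) (jac x * Determinants.det (\<chi> l j. b $ l $ j * c $ j $ l))"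
    by (rule jac_conj[OF is_ideal_N]) (use mp in \<open>simp_all add: monomial_pair_def\<close>)
  then show ?thesis
    by (intro exI[of _ "Determinants.det (\<chi> l j. b $ l $ j * c $ j $ l)"] conjI det_idem_matrix[OF is_ideal_N mp])
qed

lemma matrix_pow_1: "matrix_pow 1 y = y"
  by (rule matrix_eqI) (simp add: matrix_pow_def)

text \<open>Conjugation multiplies \<open>jac\<close> by an element of square 1 and does not change
  the determinant up to a unit, modulo the ideal of the normalizer.\<close>

lemma N_invariant_U_jac: "N_invariant (U_jac :: ('n::finite, 'r::comm_ring_1) GL_fun set set)"
  unfolding N_invariant_def
proof
  fix Q :: "('n, 'r) conj_fun set"
  assume "Q \<in> times_N U_jac"
  then have Q: "is_prime Q" "normalizer_ideal \<subseteq> Q" and U: "det_fun \<notin> proj_G -` Q" "jac xmat \<notin> proj_G -` Q"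
    by (auto simp: times_N_def Spec_iff U_jac_def GL_def)
  interpret P: ring_rel "\<lambda>f g. proj_G f = (g :: ('n, 'r) conj_fun)" by (rule ring_rel_proj_G)
  interpret C: ring_rel "\<lambda>f g. conj_map f = (g :: ('n, 'r) conj_fun)" by (rule ring_rel_conj_map)
  interpret N: ring_rel "cong_mod (normalizer_ideal :: ('n, 'r) conj_fun set)" by (rule ring_rel_cong_mod[OF is_ideal_N])
  have p: "proj_G det_fun = (Determinants.det xmatN :: ('n, 'r) conj_fun)" "proj_G (jac xmat) = (jac xmatN :: ('n, 'r) conj_fun)"
    unfolding det_fun_eq by (intro P.det P.jac proj_G_xmat)+
  have c: "conj_map det_fun = (Determinants.det (cmatN ** xmatN ** bmatN) :: ('n, 'r) conj_fun)"
    "conj_map (jac xmat) = (jac (cmatN ** xmatN ** bmatN) :: ('n, 'r) conj_fun)"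
    unfolding det_fun_eq by (intro C.det C.jac conj_map_xmat)+
  have mem: "x \<in> Q \<longleftrightarrow> y \<in> Q" if "cong_mod normalizer_ideal x y" for x y
    by (rule cong_mod_mem[OF is_primeD(1)[OF Q(1)] cong_mod_mono[OF Q(2) that]])
  obtain d :: "('n, 'r) conj_fun" where d: "cong_mod normalizer_ideal (d * d) 1"
    "cong_mod normalizer_ideal (jac (cmatN ** xmatN ** bmatN)) (jac xmatN * d)"
    using jac_conj_N[of 1 "xmatN :: ('n, 'r) conj_fun^'n^'n"] unfolding matrix_pow_1 by auto
  have "d \<notin> Q" using mem[OF d(1)] is_primeD[OF Q(1)] by auto
  then have 1: "jac xmat \<notin> conj_map -` Q" using mem[OF d(2)] U(2) is_primeD(4)[OF Q(1)] by (simp add: p c)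
  have mp: "monomial_pair normalizer_ideal (bmatN :: ('n, 'r) conj_fun^'n^'n) cmatN" by (rule monomial_pair_N)
  have "cong_mod normalizer_ideal (Determinants.det (cmatN ** bmatN :: ('n, 'r) conj_fun^'n^'n))
      (Determinants.det (Finite_Cartesian_Product.mat 1 :: ('n, 'r) conj_fun^'n^'n))"
    by (rule N.det) (use mp in \<open>simp add: monomial_pair_def\<close>)
  then have "Determinants.det (cmatN :: ('n, 'r) conj_fun^'n^'n) * Determinants.det (bmatN :: ('n, 'r) conj_fun^'n^'n) \<notin> Q"
    using mem is_primeD(2)[OF Q(1)] by (simp add: det_mul)
  then have 2: "det_fun \<notin> conj_map -` Q" using U(1) is_primeD(4)[OF Q(1)] by (simp add: p c det_mul)
  have "conj_map -` Q \<in> Spec" using Spec_vimage_subst Q(1) unfolding conj_map_def Spec_iff by blast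
  then show "conj_map -` Q \<in> U_jac" using 1 2 by (simp add: U_jac_def GL_def)
qed

subsection \<open>Flatness\<close>

text \<open>Near a prime at which the entries $b_{i,w(i)}$ are invertible, the other entries of $b$ vanish and
  the coordinate ring becomes the ring of Laurent polynomials in the $b_{i,w(i)}$ over $R[x]$.\<close>

instance conj_var :: (finite) finite
proof
  have "UNIV = (\<lambda>(i, j). XV i j) ` (UNIV :: ('a \<times> 'a) set) \<union> (\<lambda>(i, j). BV i j) ` UNIV \<union> (\<lambda>(i, j). CV i j) ` UNIV"
    by (auto simp: image_iff) (metis conj_var.exhaust)
  then show "finite (UNIV :: 'a conj_var set)" by (metis finite_Un finite_imageI finite_class.finite_UNIV)
qed

lemma type_hom_single: "type_hom typ_ring (Poly_Mapping.single 0 :: 'r::comm_ring_1 \<Rightarrow> 'k::comm_monoid_add \<Rightarrow>\<^sub>0 'r)"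
  by (intro type_hom.intro cring_from_type_algebra type_hom_axioms.intro Ring.ring_hom_memI)
    (auto simp: single_add mult_single)

abbreviation laurent_var :: "'w \<Rightarrow> int \<Rightarrow> ('w \<Rightarrow>\<^sub>0 int) \<Rightarrow>\<^sub>0 'r::comm_ring_1" where
  "laurent_var v k \<equiv> Poly_Mapping.single (Poly_Mapping.single v k) 1"

text \<open>The map \<theta> relabels monomials injectively and leaves coefficients alone, so
  vanishing and divisibility by constants can be read off from coefficients.\<close>

lemma laurent_embedding_dvd:
  fixes g :: "'v::finite \<Rightarrow> 'w" and F :: "('v, 'r::comm_ring_1) mpoly"
  assumes g: "inj g"
  defines "\<theta> \<equiv> ev typ_ring (Poly_Mapping.single 0) (\<lambda>v. laurent_var (g v) 1 :: ('w \<Rightarrow>\<^sub>0 int) \<Rightarrow>\<^sub>0 'r)"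
  shows "of_nat p dvd \<theta> F \<longleftrightarrow> of_nat p dvd F" and "\<theta> F = 0 \<Longrightarrow> F = 0"
proof -
  define tz :: "('v \<Rightarrow>\<^sub>0 nat) \<Rightarrow> ('w \<Rightarrow>\<^sub>0 int)"
    where "tz m = (\<Sum>v\<in>UNIV. Poly_Mapping.single (g v) (int (Poly_Mapping.lookup m v)))" for m
  have pw: "(laurent_var w 1 :: ('w \<Rightarrow>\<^sub>0 int) \<Rightarrow>\<^sub>0 'r) ^ k = laurent_var w (int k)" for w k
    by (induction k) (simp_all add: mult_single flip: single_add)
  have prod_single: "(\<Prod>v\<in>A. Poly_Mapping.single (q v) (1::'r)) = Poly_Mapping.single (\<Sum>v\<in>A. q v) 1"
    for A and q :: "'v \<Rightarrow> 'w \<Rightarrow>\<^sub>0 int"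
    by (induction A rule: infinite_finite_induct) (auto simp: mult_single)
  have \<theta>: "\<theta> F = (\<Sum>m\<in>Poly_Mapping.keys F. Poly_Mapping.single (tz m) (Poly_Mapping.lookup F m))" for F
  proof -
    have "(\<Sum>v\<in>Poly_Mapping.keys m. Poly_Mapping.single (g v) (int (Poly_Mapping.lookup m v))) = tz m" for m
      unfolding tz_def by (rule sum.mono_neutral_left) (auto simp: not_in_keys_iff_lookup_eq_zero)
    then show ?thesis
      unfolding \<theta>_def ev_def
      by (simp add: finsum_typ_ring finprod_typ_ring pow_typ_ring pw prod_single mult_single)
  qed
  have "Poly_Mapping.lookup (tz m) (g v) = int (Poly_Mapping.lookup m v)" for m v
  proof -
    have "Poly_Mapping.lookup (tz m) (g v) = (\<Sum>u\<in>UNIV. if u = v then int (Poly_Mapping.lookup m u) else 0)"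
      unfolding tz_def lookup_sum by (rule sum.cong) (use g in \<open>auto simp: lookup_single when_def dest: injD\<close>)
    then show ?thesis by simp
  qed
  then have tz: "tz m = tz m' \<Longrightarrow> m = m'" for m m' by (intro poly_mapping_eqI) (metis of_nat_eq_iff)
  have l: "Poly_Mapping.lookup (\<theta> F) (tz m) = Poly_Mapping.lookup F m" for F m
  proof -
    have "Poly_Mapping.lookup (\<theta> F) (tz m) = (\<Sum>k\<in>Poly_Mapping.keys F. if k = m then Poly_Mapping.lookup F k else 0)"
      unfolding \<theta> lookup_sum by (rule sum.cong) (auto simp: lookup_single when_def dest: tz)
    then show ?thesis by (simp add: not_in_keys_iff_lookup_eq_zero)
  qed
  show "\<theta> F = 0 \<Longrightarrow> F = 0" by (rule poly_mapping_eqI) (metis l lookup_zero)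
  show "of_nat p dvd \<theta> F \<longleftrightarrow> of_nat p dvd F"
  proof
    assume "of_nat p dvd \<theta> F"
    then show "of_nat p dvd F" unfolding of_nat_dvd_poly_mapping_iff using l by metis
  next
    assume d: "of_nat p dvd F"
    show "of_nat p dvd \<theta> F"
      unfolding \<theta> by (rule dvd_sum) (use d in \<open>simp add: of_nat_dvd_poly_mapping_iff lookup_single when_def\<close>)
  qed
qed

context
  fixes Q :: "('n::finite, 'r::idom) conj_fun set"
  assumes Q: "is_prime Q" and NQ: "normalizer_ideal \<subseteq> Q"
begin

text \<open>Each row has an entry outside Q because \<Sum> b_il c_li = 1. Two rows cannot share such
  a column, since products of distinct entries of a column lie in Q.\<close>

lemma ex_monomial_support: "\<exists>w. bij w \<and> (\<forall>i. Var (BV i (w i)) \<notin> Q)"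
proof -
  have "\<exists>j. Var (BV i j) \<notin> Q" for i
  proof (rule ccontr)
    assume "\<not> ?thesis"
    then have "(\<Sum>l\<in>UNIV. bmatN $ i $ l * cmatN $ l $ i) \<in> Q"
      by (intro is_ideal_sum[OF is_primeD(1)[OF Q]] is_idealD(4)[OF is_primeD(1)[OF Q]]) (simp add: bmatN_def)
    then show False
      using cong_mod_mem[OF is_primeD(1)[OF Q] cong_mod_mono[OF NQ mp_bc[OF is_ideal_N monomial_pair_N]], of i]
        is_primeD(2)[OF Q] by simp
  qed
  then obtain w where w: "\<And>i. Var (BV i (w i)) \<notin> Q" by metis
  have "inj w"
  proof (rule injI, rule ccontr)
    fix i k assume e: "w i = w k" and "i \<noteq> k"
    have "Var (BV i (w i)) * Var (BV k (w i)) \<in> Q"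
      using mp_col[OF is_ideal_N monomial_pair_N \<open>i \<noteq> k\<close>, of "w i"] NQ by (auto simp: bmatN_def)
    then show False using is_primeD(4)[OF Q] w[of i] w[of k] e by simp
  qed
  then have "bij w" by (simp add: bij_def finite_UNIV_inj_surj)
  then show ?thesis using w by blast
qed

text \<open>The chart \<psi> sends b_{i,w(i)} to an invertible variable, c_{w(i),i} to its inverse
  and the other entries of b and c to zero. Up to a factor outside Q and modulo the ideal, every f
  comes from the polynomial ring in x and the b_{i,w(i)}; F is this representative, and \<psi> is
  injective on such elements.\<close>

lemma laurent_chart:
  "\<exists>\<psi> :: ('n, 'r) conj_fun \<Rightarrow> ('n \<times> 'n + 'n \<Rightarrow>\<^sub>0 int) \<Rightarrow>\<^sub>0 'r. type_hom typ_ring \<psi>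
    \<and> (\<forall>f \<in> normalizer_ideal. \<psi> f = 0)
    \<and> (\<forall>f. \<exists>v F. v \<notin> Q \<and> v * f - F \<in> normalizer_ideal
          \<and> (\<forall>p. of_nat p dvd \<psi> F \<longrightarrow> of_nat p dvd F) \<and> (\<psi> F = 0 \<longrightarrow> F = 0))
    \<and> (\<forall>j p. of_nat p dvd \<psi> (proj_G j) \<longleftrightarrow> of_nat p dvd j)"
proof -
  obtain w where w: "bij w" and wQ: "\<And>i. Var (BV i (w i)) \<notin> Q" using ex_monomial_support by blast
  have winj: "w i = w k \<longleftrightarrow> i = k" for i k using w by (auto dest: bij_is_inj injD)
  let ?K = "Poly_Mapping.single 0 :: 'r \<Rightarrow> ('n \<times> 'n + 'n \<Rightarrow>\<^sub>0 int) \<Rightarrow>\<^sub>0 'r"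
  define yv where "yv v = (case v of XV i j \<Rightarrow> laurent_var (Inl (i, j)) 1
      | BV i j \<Rightarrow> if j = w i then laurent_var (Inr i) 1 else 0
      | CV j i \<Rightarrow> if j = w i then laurent_var (Inr i) (-1) else (0 :: ('n \<times> 'n + 'n \<Rightarrow>\<^sub>0 int) \<Rightarrow>\<^sub>0 'r))" for v
  define \<psi> where "\<psi> = ev typ_ring ?K yv"
  have yc: "yv v \<in> carrier typ_ring" for v by simp
  have h\<psi>: "type_hom typ_ring \<psi>" unfolding \<psi>_def by (rule type_hom.type_hom_ev[OF type_hom_single yc])
  interpret \<psi>: type_hom typ_ring \<psi> by (rule h\<psi>)
  have \<psi>V: "\<psi> (Var v) = yv v" for v unfolding \<psi>_def by (rule type_hom.ev_Var[OF type_hom_single yc])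
  have \<psi>C: "\<psi> (Const a) = ?K a" for a unfolding \<psi>_def by (rule type_hom.ev_Const[OF type_hom_single yc])
  have \<psi>s: "\<psi> (f + g) = \<psi> f + \<psi> g" "\<psi> (f * g) = \<psi> f * \<psi> g" "\<psi> 0 = 0" "\<psi> 1 = 1" for f g
    using \<psi>.add \<psi>.mult \<psi>.zero \<psi>.one by simp_all
  have \<psi>m: "\<psi> (f - g) = \<psi> f - \<psi> g" for f g using \<psi>s(1)[of "f - g" g] by (simp add: eq_diff_eq)
  have \<psi>sum: "\<psi> (sum f A) = (\<Sum>x\<in>A. \<psi> (f x))" for f :: "'n \<Rightarrow> _" and A
    using \<psi>.sum[of f A] by (simp add: finsum_typ_ring)
  have inv: "laurent_var (Inr i) 1 * laurent_var (Inr i) (-1) = (1 :: ('n \<times> 'n + 'n \<Rightarrow>\<^sub>0 int) \<Rightarrow>\<^sub>0 'r)" for i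
    by (simp add: mult_single flip: single_add)
  have N0: "\<psi> f = 0" if "f \<in> normalizer_ideal" for f
  proof -
    have "normalizer_ideal \<subseteq> {f. \<psi> f = 0}"
      unfolding normalizer_ideal_def
    proof (rule genideal_least)
      show "is_ideal {f. \<psi> f = 0}" by (auto simp: is_ideal_def \<psi>s)
      have 1: "\<psi> ((\<Sum>j\<in>UNIV. Var (BV i j) * Var (CV j k)) - (if i = k then 1 else 0)) = 0" for i k
      proof -
        have "(\<Sum>j\<in>UNIV. yv (BV i j) * yv (CV j k)) = (\<Sum>j\<in>UNIV. if j = w i then (if i = k then 1 else 0) else 0)"
          by (rule sum.cong) (auto simp: yv_def winj inv)
        then show ?thesis by (auto simp: \<psi>m \<psi>s \<psi>sum \<psi>V)
      qed
      have 2: "\<psi> ((\<Sum>j\<in>UNIV. Var (CV i j) * Var (BV j k)) - (if i = k then 1 else 0)) = 0" for i k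
      proof -
        obtain i0 where i0: "i = w i0" using w by (meson bij_pointE)
        have "(\<Sum>j\<in>UNIV. yv (CV i j) * yv (BV j k)) = (\<Sum>j\<in>UNIV. if j = i0 then (if i = k then 1 else 0) else 0)"
          by (rule sum.cong) (auto simp: yv_def winj inv i0 mult.commute)
        then show ?thesis by (auto simp: \<psi>m \<psi>s \<psi>sum \<psi>V)
      qed
      have 3: "\<psi> (Var (BV i j) * Var (CV j k)) = 0" "\<psi> (Var (CV i j) * Var (BV j k)) = 0" if "i \<noteq> k" for i j k
        using that by (auto simp: \<psi>s \<psi>V yv_def winj)
      show "{(\<Sum>j\<in>UNIV. Var (BV i j) * Var (CV j k)) - (if i = k then 1 else 0) | i k. True}
      \<union> {(\<Sum>j\<in>UNIV. Var (CV i j) * Var (BV j k)) - (if i = k then 1 else 0) | i k. True}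
      \<union> {Var (BV i j) * Var (CV j k) | i j k. i \<noteq> k}
      \<union> {Var (CV i j) * Var (BV j k) | i j k. i \<noteq> k} \<subseteq> {f. \<psi> f = 0}"
        by (intro Un_least subsetI CollectI; elim CollectE exE conjE; simp only: 1 2 3 simp_thms)
    qed
    then show ?thesis using that by blast
  qed
  \<comment> \<open>On the image of this polynomial ring the chart is the inclusion of polynomials
    into Laurent polynomials, which detects divisibility by p.\<close>
  define \<iota> where "\<iota> = subst (\<lambda>v :: 'n \<times> 'n + 'n. case v of Inl (i, j) \<Rightarrow> Var (XV i j) | Inr i \<Rightarrow> (Var (BV i (w i)) :: ('n, 'r) conj_fun))"
  have \<iota>s: "\<iota> (f + g) = \<iota> f + \<iota> g" "\<iota> (f * g) = \<iota> f * \<iota> g" "\<iota> 0 = 0" "\<iota> 1 = 1" "\<iota> (of_nat k) = of_nat k" for f g k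
    by (simp_all add: \<iota>_def subst_simps)
  have \<iota>V: "\<iota> (Const a) = Const a" "\<iota> (Var (Inl (i, j))) = Var (XV i j)" "\<iota> (Var (Inr i)) = Var (BV i (w i))" for a i j
    by (simp_all add: \<iota>_def)
  note D = is_idealD[OF is_ideal_N]
  have red: "\<exists>V F. \<iota> V \<notin> Q \<and> \<iota> V * f - \<iota> F \<in> normalizer_ideal" for f
  proof (induction f rule: mpoly_induct)
    case (Const a)
    show ?case by (rule exI[of _ 1], rule exI[of _ "Const a"]) (simp add: \<iota>s \<iota>V D(1) is_primeD(2)[OF Q])
  next
    case (Var v)
    show ?case
    proof (cases v)
      case (XV i j)
      show ?thesis by (rule exI[of _ 1], rule exI[of _ "Var (Inl (i, j))"]) (simp add: XV \<iota>s \<iota>V D(1) is_primeD(2)[OF Q])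
    next
      case (BV i j)
      show ?thesis
      proof (cases "j = w i")
        case True
        show ?thesis by (rule exI[of _ 1], rule exI[of _ "Var (Inr i)"]) (simp add: BV True \<iota>s \<iota>V D(1) is_primeD(2)[OF Q])
      next
        case False
        show ?thesis
          using mp_row[OF is_ideal_N monomial_pair_N, of "w i" j i] False
          by (intro exI[of _ "Var (Inr i)"] exI[of _ 0]) (simp add: BV \<iota>s \<iota>V wQ bmatN_def)
      qed
    next
      case (CV i j)
      show ?thesis
      proof (cases "i = w j")
        case True
        let ?b = "Var (BV j (w j)) :: ('n, 'r) conj_fun"
        \<comment> \<open>Multiplying row j of b c = 1 by the chosen entry b removes all other terms
          by orthogonality in the row, so b^2 c = b: the entry of c becomes polynomial after
          multiplication by b^2, which is outside Q.\<close>
        have "?b * ?b * Var (CV (w j) j) - ?b \<in> normalizer_ideal"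
        proof -
          have 1: "?b * ((\<Sum>l\<in>UNIV. bmatN $ j $ l * cmatN $ l $ j) - 1) \<in> normalizer_ideal"
            using D(3) mp_bc[OF is_ideal_N monomial_pair_N, of j] by (simp add: cong_mod_def)
          have 2: "(\<Sum>l\<in>UNIV - {w j}. ?b * (bmatN $ j $ l * cmatN $ l $ j)) \<in> normalizer_ideal"
          proof (rule is_ideal_sum[OF is_ideal_N])
            fix l assume "l \<in> UNIV - {w j}"
            then have "?b * bmatN $ j $ l \<in> normalizer_ideal"
              using mp_row[OF is_ideal_N monomial_pair_N, of "w j" l j] by (simp add: bmatN_def)
            from D(4)[OF this, of "cmatN $ l $ j"] show "?b * (bmatN $ j $ l * cmatN $ l $ j) \<in> normalizer_ideal"
              by (simp add: mult.assoc)
          qed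
          have "(\<Sum>l\<in>UNIV. bmatN $ j $ l * cmatN $ l $ j)
              = bmatN $ j $ (w j) * cmatN $ (w j) $ j + (\<Sum>l\<in>UNIV - {w j}. bmatN $ j $ l * cmatN $ l $ j :: ('n, 'r) conj_fun)"
            by (rule sum.remove) auto
          then have "?b * ?b * Var (CV (w j) j) - ?b = ?b * ((\<Sum>l\<in>UNIV. bmatN $ j $ l * cmatN $ l $ j) - 1)
              - (\<Sum>l\<in>UNIV - {w j}. ?b * (bmatN $ j $ l * cmatN $ l $ j))"
            by (simp add: bmatN_def cmatN_def algebra_simps sum_distrib_left)
          then show ?thesis using D(6)[OF 1 2] by (simp only:)
        qed
        then show ?thesis
          by (intro exI[of _ "Var (Inr j) * Var (Inr j)"] exI[of _ "Var (Inr j)"])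
            (simp add: CV True \<iota>s \<iota>V wQ is_primeD(4)[OF Q])
      next
        case False
        then show ?thesis
          using mp_off(2)[OF is_ideal_N monomial_pair_N, of i "w j" j]
          by (intro exI[of _ "Var (Inr j)"] exI[of _ 0]) (simp add: CV \<iota>s \<iota>V wQ bmatN_def cmatN_def mult.commute)
      qed
    qed
  next
    case (add f g)
    then obtain V F V' G where h: "\<iota> V \<notin> Q" "\<iota> V * f - \<iota> F \<in> normalizer_ideal"
      "\<iota> V' \<notin> Q" "\<iota> V' * g - \<iota> G \<in> normalizer_ideal" by blast
    have "\<iota> (V * V') * (f + g) - \<iota> (V' * F + V * G) = \<iota> V' * (\<iota> V * f - \<iota> F) + \<iota> V * (\<iota> V' * g - \<iota> G)"
      by (simp add: \<iota>s algebra_simps)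
    also have "\<dots> \<in> normalizer_ideal" by (rule D(2)[OF D(3)[OF h(2)] D(3)[OF h(4)]])
    finally show ?case using h(1,3) is_primeD(4)[OF Q] by (intro exI[of _ "V * V'"] exI[of _ "V' * F + V * G"]) (simp add: \<iota>s)
  next
    case (mult f g)
    then obtain V F V' G where h: "\<iota> V \<notin> Q" "\<iota> V * f - \<iota> F \<in> normalizer_ideal"
      "\<iota> V' \<notin> Q" "\<iota> V' * g - \<iota> G \<in> normalizer_ideal" by blast
    have "\<iota> (V * V') * (f * g) - \<iota> (F * G) = (\<iota> V * f) * (\<iota> V' * g - \<iota> G) + \<iota> G * (\<iota> V * f - \<iota> F)"
      by (simp add: \<iota>s algebra_simps)
    also have "\<dots> \<in> normalizer_ideal" by (rule D(2)[OF D(3)[OF h(4)] D(3)[OF h(2)]])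
    finally show ?case using h(1,3) is_primeD(4)[OF Q] by (intro exI[of _ "V * V'"] exI[of _ "F * G"]) (simp add: \<iota>s)
  qed
  have emb: "\<psi> (\<iota> F) = ev typ_ring ?K (\<lambda>v. laurent_var (id v) 1) F" for F
  proof (rule type_hom_eqI)
    show "type_hom typ_ring (\<lambda>F. \<psi> (\<iota> F))"
      by (rule \<psi>.comp) (use type_hom.hom[OF type_hom_subst] in \<open>simp add: \<iota>_def\<close>)
    show "type_hom typ_ring (ev typ_ring ?K (\<lambda>v. laurent_var (id v) 1))"
      by (rule type_hom.type_hom_ev[OF type_hom_single]) simp
    show "\<psi> (\<iota> (Const a)) = ev typ_ring ?K (\<lambda>v. laurent_var (id v) 1) (Const a)" for a
      by (simp add: \<iota>V \<psi>C type_hom.ev_Const[OF type_hom_single])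
    show "\<psi> (\<iota> (Var v)) = ev typ_ring ?K (\<lambda>v. laurent_var (id v) 1) (Var v)" for v
      by (cases v) (auto simp: \<iota>V \<psi>V yv_def type_hom.ev_Var[OF type_hom_single])
  qed
  have embG: "\<psi> (proj_G j) = ev typ_ring ?K (\<lambda>v. laurent_var (Inl v) 1) j" for j
  proof (rule type_hom_eqI)
    show "type_hom typ_ring (\<lambda>F. \<psi> (proj_G F))"
      by (rule \<psi>.comp) (use type_hom.hom[OF type_hom_subst] in \<open>simp add: proj_G_def\<close>)
    show "type_hom typ_ring (ev typ_ring ?K (\<lambda>v. laurent_var (Inl v) 1))"
      by (rule type_hom.type_hom_ev[OF type_hom_single]) simp
    show "\<psi> (proj_G (Const a)) = ev typ_ring ?K (\<lambda>v. laurent_var (Inl v) 1) (Const a)" for a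
      by (simp add: proj_G_def \<psi>C type_hom.ev_Const[OF type_hom_single])
    show "\<psi> (proj_G (Var v)) = ev typ_ring ?K (\<lambda>v. laurent_var (Inl v) 1) (Var v)" for v
      by (cases v) (auto simp: proj_G_def \<psi>V yv_def type_hom.ev_Var[OF type_hom_single])
  qed
  have dv: "of_nat p dvd \<iota> F" if pF: "of_nat p dvd F" for p F
  proof -
    obtain G where "F = of_nat p * G" using pF by (auto elim: dvdE)
    then have "\<iota> F = of_nat p * \<iota> G" by (simp only: \<iota>s)
    then show ?thesis by simp
  qed
  have 3: "\<exists>v F. v \<notin> Q \<and> v * f - F \<in> normalizer_ideal \<and> (\<forall>p. of_nat p dvd \<psi> F \<longrightarrow> of_nat p dvd F) \<and> (\<psi> F = 0 \<longrightarrow> F = 0)" for f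
    proof -
      obtain V F where "\<iota> V \<notin> Q" "\<iota> V * f - \<iota> F \<in> normalizer_ideal" using red[of f] by (elim exE conjE)
      moreover have "of_nat p dvd \<iota> F" if "of_nat p dvd \<psi> (\<iota> F)" for p
        by (rule dv[OF iffD1[OF laurent_embedding_dvd(1)[OF inj_on_id] that[unfolded emb]]])
      moreover have "\<iota> F = 0" if "\<psi> (\<iota> F) = 0"
        using laurent_embedding_dvd(2)[OF inj_on_id that[unfolded emb]] \<iota>s(3) by simp
      ultimately show ?thesis by (intro exI[of _ "\<iota> V"] exI[of _ "\<iota> F"]) simp
    qed
  have 4: "of_nat p dvd \<psi> (proj_G j) \<longleftrightarrow> of_nat p dvd j" for j p
    unfolding embG by (rule laurent_embedding_dvd(1)[OF inj_Inl])
  show ?thesis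
    by (intro exI[of _ \<psi>] conjI ballI allI h\<psi> N0 3 4)
qed

text \<open>The ring of Laurent polynomials has no p-torsion, so the chart kills u f; its polynomial
  representative F is then zero, which puts a multiple of f by an element outside Q into the
  ideal.\<close>

lemma normalizer_flat:
  assumes p: "prime_const TYPE('r) p" and f: "of_nat p * f \<in> loc normalizer_ideal Q"
  shows "f \<in> loc normalizer_ideal Q"
proof -
  obtain \<psi> :: "('n, 'r) conj_fun \<Rightarrow> ('n \<times> 'n + 'n \<Rightarrow>\<^sub>0 int) \<Rightarrow>\<^sub>0 'r" where \<psi>: "type_hom typ_ring \<psi>"
    "\<forall>f \<in> normalizer_ideal. \<psi> f = 0"
    "\<forall>f. \<exists>v F. v \<notin> Q \<and> v * f - F \<in> normalizer_ideal
          \<and> (\<forall>p. of_nat p dvd \<psi> F \<longrightarrow> of_nat p dvd F) \<and> (\<psi> F = 0 \<longrightarrow> F = 0)"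
    "\<forall>j p. of_nat p dvd \<psi> (proj_G j) \<longleftrightarrow> of_nat p dvd j"
    using laurent_chart by (elim exE conjE)
  interpret \<psi>: type_hom typ_ring \<psi> by (rule \<psi>(1))
  obtain u where u: "u \<notin> Q" "u * (of_nat p * f) \<in> normalizer_ideal" using f by (auto simp: loc_def)
  have e: "u * (of_nat p * f) = of_nat p * (u * f)" by (simp add: mult_ac)
  have "\<psi> (of_nat p * (u * f)) = of_nat p * \<psi> (u * f)"
  proof -
    have "\<psi> (of_nat k) = of_nat k" for k by (induction k) (use \<psi>.add \<psi>.one \<psi>.zero in simp_all)
    then show ?thesis using \<psi>.mult by simp
  qed
  then have "of_nat p * \<psi> (u * f) = 0" using bspec[OF \<psi>(2) u(2)] by (simp add: e)
  then have z: "\<psi> (u * f) = 0" using of_nat_cancel_poly_mapping[of p "\<psi> (u * f)"] p by (auto simp: prime_const_def)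
  obtain v F where F: "v \<notin> Q" "v * (u * f) - F \<in> normalizer_ideal" "\<psi> F = 0 \<longrightarrow> F = 0" using spec[OF \<psi>(3), of "u * f"] by (elim exE conjE)
  have "\<psi> (v * (u * f)) = \<psi> F" using bspec[OF \<psi>(2) F(2)] \<psi>.eq_iff[of "v * (u * f)" F] by simp
  then have "F = 0" using F(3) z \<psi>.mult[of v "u * f"] by simp
  then have "v * u * f \<in> normalizer_ideal" using F(2) by (simp add: mult.assoc)
  then show ?thesis using F(1) u(1) is_primeD(4)[OF Q] by (auto simp: loc_def)
qed

text \<open>In the chart, p is a prime element that does not divide the image of j, so it divides
  the image of u f and hence the polynomial representative of f.\<close>

lemma normalizer_regular:
  assumes p: "prime_const TYPE('r) p" and j: "\<not> of_nat p dvd j"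
    and f: "proj_G j * f \<in> loc (ideal_add normalizer_ideal (of_nat p)) Q"
  shows "f \<in> loc (ideal_add normalizer_ideal (of_nat p)) Q"
proof -
  obtain \<psi> :: "('n, 'r) conj_fun \<Rightarrow> ('n \<times> 'n + 'n \<Rightarrow>\<^sub>0 int) \<Rightarrow>\<^sub>0 'r" where \<psi>: "type_hom typ_ring \<psi>"
    "\<forall>f \<in> normalizer_ideal. \<psi> f = 0"
    "\<forall>f. \<exists>v F. v \<notin> Q \<and> v * f - F \<in> normalizer_ideal
          \<and> (\<forall>p. of_nat p dvd \<psi> F \<longrightarrow> of_nat p dvd F) \<and> (\<psi> F = 0 \<longrightarrow> F = 0)"
    "\<forall>j p. of_nat p dvd \<psi> (proj_G j) \<longleftrightarrow> of_nat p dvd j"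
    using laurent_chart by (elim exE conjE)
  interpret \<psi>: type_hom typ_ring \<psi> by (rule \<psi>(1))
  obtain u g where u: "u \<notin> Q" "u * (proj_G j * f) - of_nat p * g \<in> normalizer_ideal"
    using f by (auto simp: loc_def ideal_add_iff)
  have pn: "\<psi> (of_nat k) = of_nat k" for k by (induction k) (use \<psi>.add \<psi>.one \<psi>.zero in simp_all)
  have "\<psi> (u * (proj_G j * f)) = \<psi> (of_nat p * g)"
    using bspec[OF \<psi>(2) u(2)] \<psi>.eq_iff[of "u * (proj_G j * f)" "of_nat p * g"] by simp
  then have "\<psi> (proj_G j) * \<psi> (u * f) = of_nat p * \<psi> g" using \<psi>.mult pn by (simp add: mult_ac)
  then have "of_nat p dvd \<psi> (proj_G j) * \<psi> (u * f)" by simp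
  then have d: "of_nat p dvd \<psi> (u * f)" using prime_const_dvd_mult[OF p, of "\<psi> (proj_G j)" "\<psi> (u * f)"] \<psi>(4) j by simp
  obtain v F where F: "v \<notin> Q" "v * (u * f) - F \<in> normalizer_ideal" "of_nat p dvd \<psi> F \<longrightarrow> of_nat p dvd F"
    using spec[OF \<psi>(3), of "u * f"] by (elim exE conjE allE[of _ p])
  have "\<psi> (v * (u * f)) = \<psi> F" using bspec[OF \<psi>(2) F(2)] \<psi>.eq_iff[of "v * (u * f)" F] by simp
  then have "of_nat p dvd F" using F(3) dvd_mult[OF d, of "\<psi> v"] \<psi>.mult[of v "u * f"] by simp
  then obtain G where "F = of_nat p * G" by (auto elim: dvdE)
  then have "v * u * f \<in> ideal_add normalizer_ideal (of_nat p)" using F(2) by (auto simp: ideal_add_iff mult.assoc)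
  then show ?thesis using F(1) u(1) is_primeD(4)[OF Q] by (auto simp: loc_def)
qed

end

section \<open>The three assertions for open subsets of the general linear group\<close>

section \<open>Lifts of Frobenius on open subschemes of the general linear group\<close>

locale GL_frobenius =
  fixes p :: nat and \<phi> :: "'r::idom \<Rightarrow> 'r" and U :: "('n::finite, 'r) GL_fun set set"
  assumes p: "prime p" and pc: "prime_const TYPE('r) p" and \<phi>: "frobenius_lift_base p \<phi>"
    and U: "zariski_open U" "U \<subseteq> GL"
begin

lemma formal_G: "formal p {0} (special_fibre p U)"
proof
  show "is_ideal {0 :: ('n, 'r) GL_fun}" by (rule is_ideal_0)
  fix Q assume Q: "Q \<in> special_fibre p U"
  show P: "is_prime Q" using Q U(2) by (auto simp: special_fibre_def GL_def Spec_iff)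
  show "{0} \<subseteq> Q" using is_primeD(3)[OF P] by simp
  show "of_nat p \<in> Q" using Q by (simp add: special_fibre_def)
  show "f \<in> loc {0} Q" if f: "of_nat p * f \<in> loc {0} Q" for f
  proof -
    obtain u where u: "u \<notin> Q" "u * (of_nat p * f) = 0" using f by (auto simp: loc_def)
    then have "of_nat p * (u * f) = 0" by (simp add: mult_ac)
    then have "u * f = 0" using of_nat_cancel_poly_mapping pc by (auto simp: prime_const_def)
    then show ?thesis using u(1) by (auto simp: loc_def)
  qed
qed

end

sublocale GL_frobenius \<subseteq> F: formal p "{0} :: ('n, 'r) GL_fun set" "special_fibre p U"
  by (rule formal_G)

context GL_frobenius
begin

lemma special_fibre_opens: "special_fibre p U \<in> opens (special_fibre p U)"
proof -
  have "special_fibre p U = Spec \<inter> special_fibre p U" using U(2) by (auto simp: special_fibre_def GL_def)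
  then show ?thesis unfolding opens_def using zariski_open_Spec by blast
qed

text \<open>A localization argument on R[x], where p is prime and does not divide jac(x^(p)). It
  applies at points where jac(x^(p)) vanishes as well, hence on every open set.\<close>

lemma reg_jac_xpow: "F.reg (jac (xpow p))"
  unfolding F.reg_def
proof (intro ballI allI impI)
  fix Q and c :: "('n, 'r) GL_fun" assume "Q \<in> special_fibre p U" and "jac (xpow p) * c \<in> loc (F.J 0) Q"
  then obtain u g where u: "u \<notin> Q" "u * (jac (xpow p) * c) - of_nat p ^ Suc 0 * g \<in> {0 :: ('n, 'r) GL_fun}"
    using F.loc_thick_iff by blast
  then have "jac (xpow p) * (u * c) = of_nat p * g" by (simp add: mult_ac)
  then have "of_nat p dvd jac (xpow p) * (u * c)" by simp
  then have "of_nat p dvd u * c"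
    using prime_const_dvd_mult[OF pc, of "jac (xpow p)" "u * c"] jac_xpow_not_dvd[OF pc prime_gt_0_nat[OF p]] by auto
  then obtain d where "u * c = of_nat p * d" by (auto elim: dvdE)
  then show "c \<in> loc (F.J 0) Q" using u(1) F.loc_thick_iff[of c 0 Q] by auto
qed

lemma mem_prime_cong:
  assumes Q: "Q \<in> special_fibre p U" and d: "of_nat p dvd a - b ^ p"
  shows "a \<in> Q \<longleftrightarrow> b \<in> Q"
proof -
  note P = F.prime_W[OF Q]
  have "cong_mod Q a (b ^ p)"
    using d is_idealD(4)[OF is_primeD(1)[OF P] F.p_W[OF Q]] by (auto simp: cong_mod_def elim!: dvdE)
  then show ?thesis
    using cong_mod_mem[OF is_primeD(1)[OF P]] is_prime_power[OF P, of b p] prime_gt_0_nat[OF p] by auto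
qed

lemma det_xpow_notin: "Q \<in> special_fibre p U \<Longrightarrow> Determinants.det (xpow p) \<notin> Q"
  using mem_prime_cong[OF _ xpow_cong(1)[OF p]] U(2) by (auto simp: special_fibre_def GL_def)

lemma frob0_at_x_eq: "frob0_at_x p U = (\<lambda>i j. glob p U (xpow p $ i $ j))"
  by (simp add: frob0_at_x_def xpow_def)

context
  fixes \<Phi> :: "('n, 'r) G_mor"
  assumes \<Phi>: "G_frobenius_lift p \<phi> U \<Phi>"
begin

lemma frobenius_lift_hom: "\<Phi> (special_fibre p U) \<in> Ring.ring_hom (O_hat p U) (O_hat p U)"
  using \<Phi> special_fibre_opens by (simp add: frobenius_lift_def)

lemma frobenius_lift_type_hom: "type_hom (O_hat p U) (\<lambda>f. \<Phi> (special_fibre p U) (glob p U f))"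
  by (rule type_hom_compI[OF F.type_hom_sect_of F.cring_S frobenius_lift_hom])

interpretation \<Phi>: type_hom "O_hat p U" "\<lambda>f. \<Phi> (special_fibre p U) (glob p U f)"
  by (rule frobenius_lift_type_hom)

lemma at_x_closed: "at_x p U \<Phi> \<in> mat_carrier (O_hat p U)"
  by (simp add: at_x_def mat_carrier_def)

lemma frobenius_lift_level_0:
  assumes Q: "Q \<in> special_fibre p U"
  shows "\<Phi> (special_fibre p U) (glob p U f) 0 Q = glob p U (f ^ p) 0 Q"
proof -
  interpret L: local_frac "F.J 0" Q by (rule F.local_fracI[OF Q])
  have "\<Phi> (special_fibre p U) (glob p U f) 0 Q = glob p U f 0 Q [^]\<^bsub>stalk (JG p 0) Q\<^esub> p"
    using \<Phi> special_fibre_opens Q F.sect_of_closed[of f] unfolding frobenius_lift_def by blast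
  then show ?thesis using Q L.stalk_pow[OF L.one_notin, of f p] by (simp add: F.sect_of_germ)
qed

lemma at_x_level_0: "Q \<in> special_fibre p U \<Longrightarrow> at_x p U \<Phi> i j 0 Q = glob p U (xpow p $ i $ j) 0 Q"
  by (simp add: at_x_def frobenius_lift_level_0 xpow_def)

lemma frobenius_lift_P_fun: "\<Phi> (special_fibre p U) (glob p U (P_fun i)) = F.cpS i (at_x p U \<Phi>)"
  unfolding P_fun_eq F.cpS_hom[OF frobenius_lift_type_hom] at_x_def by (simp add: xmat_def)

lemma P_horizontal_iff:
  "P_horizontal p U \<Phi> \<longleftrightarrow> (\<forall>i\<in>{1..CARD('n)}. F.cpS i (at_x p U \<Phi>) = glob p U (P_fun i ^ p))"
  by (simp add: P_horizontal_def frobenius_lift_P_fun)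

lemma T_deformation_iff:
  "T_deformation p U \<Phi> \<longleftrightarrow> (\<exists>s. (\<forall>j. s j \<in> carrier (O_hat p U)) \<and> at_x p U \<Phi> = F.diag_mult (xpow p) s)"
  unfolding T_deformation_def frob0_at_x_eq
  by (rule F.diagonal_factor(1)[OF det_xpow_notin at_x_closed])

text \<open>The factors are congruent to 1 mod p because a lift of Frobenius and x^(p) agree mod p;
  this is what places both solutions in the range of Hensel uniqueness.\<close>

lemma T_deformationE:
  assumes "T_deformation p U \<Phi>"
  shows "\<exists>s. (\<forall>j. s j \<in> carrier (O_hat p U)) \<and> (\<forall>j. \<forall>Q\<in>special_fibre p U. s j 0 Q = \<one>\<^bsub>O_hat p U\<^esub> 0 Q)
    \<and> at_x p U \<Phi> = F.diag_mult (xpow p) s"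
proof -
  obtain s where s: "\<forall>j. s j \<in> carrier (O_hat p U)" "at_x p U \<Phi> = F.diag_mult (xpow p) s"
    using assms T_deformation_iff by blast
  have "s j 0 Q = \<one>\<^bsub>O_hat p U\<^esub> 0 Q" if "Q \<in> special_fibre p U" for j Q
    by (rule F.diagonal_factor(2)[OF det_xpow_notin at_x_closed at_x_level_0 _ s(2) that])
      (use s(1) in auto)
  then show ?thesis using s by blast
qed

end

lemma G_same_if_at_x_eq:
  assumes "G_frobenius_lift p \<phi> U \<Phi>" "G_frobenius_lift p \<phi> U \<Psi>" and e: "at_x p U \<Phi> = at_x p U \<Psi>"
  shows "G_same p U \<Phi> \<Psi>"
proof (rule frobenius_lift_unique[OF formal_G assms(1,2)])
  show "\<Phi> (special_fibre p U) (glob p U (Var v)) = \<Psi> (special_fibre p U) (glob p U (Var v))" for v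
    using e by (cases v) (simp add: at_x_def fun_eq_iff)
qed

lemma horizontal_T_deformation_unique:
  assumes \<Phi>: "G_frobenius_lift p \<phi> U \<Phi>" "P_horizontal p U \<Phi>" "T_deformation p U \<Phi>"
    and \<Psi>: "G_frobenius_lift p \<phi> U \<Psi>" "P_horizontal p U \<Psi>" "T_deformation p U \<Psi>"
  shows "G_same p U \<Phi> \<Psi>"
proof (rule G_same_if_at_x_eq[OF \<Phi>(1) \<Psi>(1)])
  obtain s where s: "\<forall>j. s j \<in> carrier (O_hat p U)" "\<forall>j. \<forall>Q\<in>special_fibre p U. s j 0 Q = \<one>\<^bsub>O_hat p U\<^esub> 0 Q"
    "at_x p U \<Phi> = F.diag_mult (xpow p) s" using T_deformationE[OF \<Phi>(1,3)] by (elim exE conjE)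
  obtain t where t: "\<forall>j. t j \<in> carrier (O_hat p U)" "\<forall>j. \<forall>Q\<in>special_fibre p U. t j 0 Q = \<one>\<^bsub>O_hat p U\<^esub> 0 Q"
    "at_x p U \<Psi> = F.diag_mult (xpow p) t" using T_deformationE[OF \<Psi>(1,3)] by (elim exE conjE)
  have "s j = t j" for j
  proof (rule F.diag_mult_unique[OF reg_jac_xpow])
    show "F.cpS i (F.diag_mult (xpow p) s) = F.cpS i (F.diag_mult (xpow p) t)" if "i \<in> {1..CARD('n)}" for i
      using P_horizontal_iff[OF \<Phi>(1)] P_horizontal_iff[OF \<Psi>(1)] \<Phi>(2) \<Psi>(2) that s(3) t(3) by simp
  qed (use s(1,2) t(1,2) in auto)
  then have "s = t" by (rule ext)
  then show "at_x p U \<Phi> = at_x p U \<Psi>" using s(3) t(3) by simp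
qed

lemma frobenius_lift_with_at_x:
  assumes A: "A \<in> mat_carrier (O_hat p U)"
    and l: "\<And>i j Q. Q \<in> special_fibre p U \<Longrightarrow> A i j 0 Q = glob p U (xpow p $ i $ j) 0 Q"
  shows "\<exists>\<Phi>. G_frobenius_lift p \<phi> U \<Phi> \<and> at_x p U \<Phi> = A"
proof -
  define y where "y v = A (fst v) (snd v)" for v
  have "\<exists>\<Phi>. frobenius_lift p \<phi> (thick p {0}) (special_fibre p U) \<Phi>
      \<and> (\<forall>v. \<Phi> (special_fibre p U) (sect_of (thick p {0}) (special_fibre p U) (Var v)) = y v)"
  proof (rule frobenius_lift_exists[OF p \<phi> formal_G])
    show "y v \<in> carrier (sections (thick p {0}) (special_fibre p U))" for v
      using A by (simp add: y_def mat_carrier_def)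
    show "y v 0 Q = frac (thick p {0} 0) Q (Var v ^ p) 1" if "Q \<in> special_fibre p U" for v Q
      using l[OF that, of "fst v" "snd v"] by (simp add: y_def xpow_def F.sect_of_germ[OF that])
  qed
  then obtain \<Phi> where \<Phi>: "G_frobenius_lift p \<phi> U \<Phi>" "\<forall>v. \<Phi> (special_fibre p U) (glob p U (Var v)) = y v"
    by (elim exE conjE)
  have "at_x p U \<Phi> = A" using \<Phi>(2) by (simp add: at_x_def y_def fun_eq_iff)
  then show ?thesis using \<Phi>(1) by (intro exI[of _ \<Phi>] conjI)
qed

lemma horizontal_T_deformation_exists:
  assumes j: "\<And>Q. Q \<in> U \<Longrightarrow> jac xmat \<notin> Q"
  shows "\<exists>\<Phi>. G_frobenius_lift p \<phi> U \<Phi> \<and> P_horizontal p U \<Phi> \<and> T_deformation p U \<Phi>"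
proof -
  have jn: "jac (xpow p) \<notin> Q" if "Q \<in> special_fibre p U" for Q
    using mem_prime_cong[OF that xpow_cong(3)[OF p]] j that by (auto simp: special_fibre_def)
  have "\<exists>\<rho>\<in>carrier (O_hat p U). \<rho> \<otimes>\<^bsub>O_hat p U\<^esub> glob p U (jac (xpow p)) = \<one>\<^bsub>O_hat p U\<^esub>"
  proof (rule F.unitI[OF F.sect_of_closed])
    fix Q b t assume Q: "Q \<in> special_fibre p U" "t \<notin> Q" "glob p U (jac (xpow p)) 0 Q = frac (JG p 0) Q b t"
    interpret L: local_frac "F.J 0" Q by (rule F.local_fracI[OF Q(1)])
    have "jac (xpow p) * t - b * 1 \<in> loc (JG p 0) Q"
      unfolding L.frac_eq_iff[OF L.one_notin Q(2), symmetric] using Q by (simp add: F.sect_of_germ)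
    then show "b \<notin> Q" using F.loc_notin[OF Q(1)] Q(2) L.one_notin jn[OF Q(1)] by blast
  qed
  then obtain v where v: "v \<in> carrier (O_hat p U)" "v \<otimes>\<^bsub>O_hat p U\<^esub> glob p U (jac (xpow p)) = \<one>\<^bsub>O_hat p U\<^esub>"
    by (elim bexE)
  have w: "of_nat p dvd P_fun i ^ p - cp i (xpow p :: ('n, 'r) GL_fun^'n^'n)" for i
    using iffD2[OF dvd_minus_iff xpow_cong(2)[OF p, of i]] by (simp only: minus_diff_eq)
  obtain t where t: "\<forall>j. t j \<in> carrier (O_hat p U)" "\<forall>j. \<forall>Q\<in>special_fibre p U. t j 0 Q = \<one>\<^bsub>O_hat p U\<^esub> 0 Q"
    "\<forall>i\<in>{1..CARD('n)}. F.cpS i (F.diag_mult (xpow p) t) = glob p U (P_fun i ^ p)"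
    using F.diag_mult_exists[OF v w] by (elim exE conjE)
  have "\<exists>\<Phi>. G_frobenius_lift p \<phi> U \<Phi> \<and> at_x p U \<Phi> = F.diag_mult (xpow p) t"
  proof (rule frobenius_lift_with_at_x)
    show "F.diag_mult (xpow p) t \<in> mat_carrier (O_hat p U)"
      using t(1) by (auto simp: mat_carrier_def F.diag_mult_def intro!: F.mult_closed)
    show "F.diag_mult (xpow p) t i j 0 Q = glob p U (xpow p $ i $ j) 0 Q" if Q: "Q \<in> special_fibre p U" for i j Q
    proof -
      interpret L: local_frac "F.J 0" Q by (rule F.local_fracI[OF Q])
      show ?thesis
        using Q t(2) by (simp add: F.diag_mult_def F.S_mult F.S_one F.sect_of_germ L.stalk_mult L.one_notin)
    qed
  qed
  then obtain \<Phi> where \<Phi>: "G_frobenius_lift p \<phi> U \<Phi>" "at_x p U \<Phi> = F.diag_mult (xpow p) t" by (elim exE conjE)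
  have "P_horizontal p U \<Phi>" using P_horizontal_iff[OF \<Phi>(1)] \<Phi>(2) t(3) by simp
  moreover have "T_deformation p U \<Phi>" unfolding T_deformation_iff[OF \<Phi>(1)] using \<Phi>(2) t(1) by (intro exI[of _ t] conjI)
  ultimately show ?thesis using \<Phi>(1) by (intro exI[of _ \<Phi>] conjI)
qed

end

section \<open>Conjugation by matrices congruent to one\<close>

context formal
begin

lemma relations_le_p: "f \<in> relations \<Longrightarrow> f \<in> ideal_add relations (of_nat p)"
  using ideal_add_mono[OF is_ideal_relations] by blast

lemma present_nat_mult: "present (of_nat p * f) = [p] \<cdot>\<^bsub>S\<^esub> present f"
  by (rule present.of_nat_mult)

lemma nat_torsion_free:
  assumes g: "g \<in> carrier S" and z: "[p] \<cdot>\<^bsub>S\<^esub> g = \<zero>\<^bsub>S\<^esub>"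
  shows "g = \<zero>\<^bsub>S\<^esub>"
proof (rule torsion_free[OF g])
  have "sect_of J W (of_nat p) \<otimes>\<^bsub>S\<^esub> g = present (of_nat p * Var g)"
    using g present_p_power[of 1] by (simp add: present.mult)
  then show "sect_of J W (of_nat p) \<otimes>\<^bsub>S\<^esub> g = \<zero>\<^bsub>S\<^esub>" using g z by (simp add: present_nat_mult)
qed

text \<open>Zero solves the defining equation, and it is the only solution since the ring of
  sections has no p-torsion; this evaluates the definite description.\<close>

lemma p_derivation_eq_zero:
  assumes "\<psi> f = f [^]\<^bsub>S\<^esub> p" and f: "f \<in> carrier S"
  shows "p_derivation S p \<psi> f = \<zero>\<^bsub>S\<^esub>"
proof -
  interpret S: cring S by (rule cring_S)
  have "\<psi> f \<ominus>\<^bsub>S\<^esub> f [^]\<^bsub>S\<^esub> p = \<zero>\<^bsub>S\<^esub>" using assms by (simp add: S.r_right_minus_eq)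
  then show ?thesis
    unfolding p_derivation_def by (intro the_equality) (auto intro: nat_torsion_free)
qed

text \<open>The determinant of \<epsilon> is congruent to 1 mod p, hence a unit. Conjugation by
  \<epsilon> preserves characteristic coefficients and is trivial mod p, so the conjugated matrix
  still defines a lift of Frobenius.\<close>

lemma conj_one_plus_p:
  fixes \<alpha> A :: "('n::finite, 'a sect) fmat"
  assumes \<alpha>: "\<alpha> \<in> mat_carrier S" and A: "A \<in> mat_carrier S"
  defines "\<epsilon> \<equiv> \<lambda>i j. mat_one S i j \<oplus>\<^bsub>S\<^esub> [p] \<cdot>\<^bsub>S\<^esub> \<alpha> i j"
  defines "B \<equiv> mat_mult S (mat_mult S \<epsilon> A) (mat_inverse S \<epsilon>)"
  shows "B \<in> mat_carrier S" "cpS i B = cpS i A" "Q \<in> W \<Longrightarrow> B k l 0 Q = A k l 0 Q"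
proof -
  let ?D = "ideal_add relations (of_nat p)"
  note D = is_ideal_add[OF is_ideal_relations, of "of_nat p"]
  interpret R: ring_rel "cong_mod ?D" by (rule ring_rel_cong_mod[OF D])
  obtain a where a: "\<alpha> = present_mat a" using \<alpha> by (rule mat_carrier_obtain)
  obtain m where m: "A = present_mat m" using A by (rule mat_carrier_obtain)
  define e where "e = (\<chi> i j. Finite_Cartesian_Product.mat 1 $ i $ j + of_nat p * a $ i $ j)"
  have \<epsilon>: "\<epsilon> = present_mat e"
    by (rule ext, rule ext) (simp add: \<epsilon>_def e_def a mat_one_def present_mat_def present.add present_nat_mult
        Finite_Cartesian_Product.mat_def present.one present.zero)
  have e1: "cong_mod ?D (e $ i $ j) (Finite_Cartesian_Product.mat 1 $ i $ j)" for i j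
    using ideal_addI[OF is_idealD(1)[OF is_ideal_relations], of "of_nat p" "a $ i $ j"] by (simp add: e_def cong_mod_def)
  have "cong_mod ?D (Determinants.det e) (Determinants.det (Finite_Cartesian_Product.mat 1 :: ('a sect, 'a) mpoly^'n^'n))"
    by (rule R.det) (rule e1)
  then have d: "present (Determinants.det e) 0 Q = sect_of J W 1 0 Q" if "Q \<in> W" for Q
    using that unfolding cong_mod_def ideal_add_relations_0_diff by (simp add: present.one S_one)
  have "\<exists>\<rho>\<in>carrier S. \<rho> \<otimes>\<^bsub>S\<^esub> present (Determinants.det e) = \<one>\<^bsub>S\<^esub>"
  proof (rule unitI[OF present.closed])
    fix Q b t assume Q: "Q \<in> W" "t \<notin> Q" "present (Determinants.det e) 0 Q = frac (J 0) Q b t"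
    interpret L: local_frac "J 0" Q by (rule local_fracI[OF Q(1)])
    have "1 * t - b * 1 \<in> loc (J 0) Q"
      unfolding L.frac_eq_iff[OF L.one_notin Q(2), symmetric] using Q d[OF Q(1)] by (simp add: sect_of_germ)
    then show "b \<notin> Q" using loc_notin[OF Q(1)] Q(2) L.one_notin by blast
  qed
  then obtain v where v: "v \<in> carrier S" "v \<otimes>\<^bsub>S\<^esub> present (Determinants.det e) = \<one>\<^bsub>S\<^esub>" by (elim bexE)
  obtain C where C: "C \<in> mat_carrier S" "mat_mult S (present_mat e) C = mat_one S" "mat_mult S C (present_mat e) = mat_one S"
    using ex_inverse[OF v] by (elim bexE conjE)
  have inv: "mat_inverse S \<epsilon> = C" unfolding \<epsilon> by (rule mat_inverse_eqI) (use C in auto)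
  obtain c where c: "C = present_mat c" using C(1) by (rule mat_carrier_obtain)
  have B: "B = present_mat (e ** m ** c)" by (simp add: B_def \<epsilon> inv[unfolded \<epsilon>] c m present_mat_mult)
  show "B \<in> mat_carrier S" by (simp add: B)
  show "cpS i B = cpS i A"
    unfolding B_def inv by (rule cpS_conj) (use A C in \<open>simp_all add: \<epsilon>\<close>)
  have refl: "cong_mod ?D f f" for f by (rule cong_mod_refl[OF D])
  have ec: "cong_mod ?D ((e ** c) $ i $ j) (Finite_Cartesian_Product.mat 1 $ i $ j)" for i j
  proof -
    have "present_mat (e ** c) = present_mat (Finite_Cartesian_Product.mat 1)" using C(2) by (simp add: c present_mat_mult present_mat_one)
    then have "(e ** c) $ i $ j - Finite_Cartesian_Product.mat 1 $ i $ j \<in> relations"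
      unfolding relations_diff_iff present_mat_def by metis
    then show ?thesis unfolding cong_mod_def by (rule relations_le_p)
  qed
  \<comment> \<open>The inverse c is congruent to 1 because c = 1 c, which is congruent to e c =
    1.\<close>
  have c1: "cong_mod ?D (c $ i $ j) (Finite_Cartesian_Product.mat 1 $ i $ j)" for i j
  proof (rule cong_mod_trans[OF D cong_mod_sym[OF D] ec])
    show "cong_mod ?D ((e ** c) $ i $ j) (c $ i $ j)"
      using R.matrix_mult[of e "Finite_Cartesian_Product.mat 1" c c, OF e1 refl] by simp
  qed
  have "cong_mod ?D ((e ** m ** c) $ k $ l) (((Finite_Cartesian_Product.mat 1) ** m ** Finite_Cartesian_Product.mat 1) $ k $ l)"
    by (rule R.matrix_mult[OF R.matrix_mult[OF e1 refl] c1])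
  then show "Q \<in> W \<Longrightarrow> B k l 0 Q = A k l 0 Q"
    unfolding cong_mod_def ideal_add_relations_0_diff by (simp add: B m present_mat_def)
qed

end

context GL_frobenius
begin

context
  fixes \<Phi> :: "('n, 'r) G_mor" and \<alpha> :: "('n, ('n, 'r) GL_fun sect) fmat"
  assumes \<Phi>: "G_frobenius_lift p \<phi> U \<Phi>" "P_horizontal p U \<Phi>" and \<alpha>: "\<alpha> \<in> mat_carrier (O_hat p U)"
begin

lemma twist_exists: "\<exists>\<Psi>. G_frobenius_lift p \<phi> U \<Psi> \<and> at_x p U \<Psi> = twist_at_x p U \<Phi> \<alpha>"
proof (rule frobenius_lift_with_at_x)
  note t = F.conj_one_plus_p[OF \<alpha> at_x_closed[OF \<Phi>(1)]]
  show "twist_at_x p U \<Phi> \<alpha> \<in> mat_carrier (O_hat p U)" using t(1) by (simp add: twist_at_x_def Let_def)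
  show "twist_at_x p U \<Phi> \<alpha> i j 0 Q = glob p U (xpow p $ i $ j) 0 Q" if "Q \<in> special_fibre p U" for i j Q
    using t(3)[OF that] at_x_level_0[OF \<Phi>(1) that] by (simp add: twist_at_x_def Let_def)
qed

lemma twist_P_horizontal:
  assumes \<Psi>: "G_frobenius_lift p \<phi> U \<Psi>" "at_x p U \<Psi> = twist_at_x p U \<Phi> \<alpha>"
  shows "P_horizontal p U \<Psi>"
  using F.conj_one_plus_p(2)[OF \<alpha> at_x_closed[OF \<Phi>(1)]] \<Phi>(2)
  unfolding P_horizontal_iff[OF \<Phi>(1)] P_horizontal_iff[OF \<Psi>(1)] \<Psi>(2) by (simp add: twist_at_x_def Let_def)

end

lemma p_derivation_P_fun:
  assumes "P_horizontal p U \<Psi>" "i \<in> {1..CARD('n)}"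
  shows "p_derivation (O_hat p U) p (\<Psi> (special_fibre p U)) (glob p U (P_fun i)) = \<zero>\<^bsub>O_hat p U\<^esub>"
proof (rule F.p_derivation_eq_zero[OF _ F.sect_of_closed])
  show "\<Psi> (special_fibre p U) (glob p U (P_fun i)) = glob p U (P_fun i) [^]\<^bsub>O_hat p U\<^esub> p"
    using assms F.of.power[of "P_fun i" p] by (simp add: P_horizontal_def)
qed

end

section \<open>Compatibility with conjugation by the normalizer\<close>

context formal
begin

lemma sect_of_cong: "cong_mod I a b \<Longrightarrow> sect_of J W a = sect_of J W b"
proof (rule section_eqI[OF sect_of_closed sect_of_closed])
  fix m Q assume ab: "cong_mod I a b" and Q: "Q \<in> W"
  interpret L: local_frac "J m" Q by (rule local_fracI[OF Q])
  have "a * 1 - b * 1 \<in> J m"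
    using ab ideal_add_mono[OF I] unfolding thick_eq[OF I] by (auto simp: cong_mod_def)
  then show "sect_of J W a m Q = sect_of J W b m Q"
    using Q L.frac_eq_iff[OF L.one_notin L.one_notin] L.locI by (simp add: sect_of_germ)
qed

lemma Const_relations: "a \<in> I \<Longrightarrow> Const a \<in> relations"
  using sect_of_cong[of a 0] relations_diff_iff[of "Const a" 0]
  by (simp add: cong_mod_0_iff present.zero S_zero)

lemma monomial_pair_const_mat:
  fixes b c :: "'a^'n^'n"
  assumes "monomial_pair I b c"
  shows "monomial_pair relations (const_mat b) (const_mat c)"
proof -
  interpret C: ring_rel "\<lambda>(a :: 'a) (f :: ('a sect, 'a) mpoly). Const a = f" by (rule ring_rel_Const)
  have m: "(const_mat y ** const_mat z) $ i $ j = Const ((y ** z) $ i $ j)" for y z :: "'a^'n^'n" and i j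
    by (rule C.matrix_mult[symmetric]) (simp_all add: const_mat_def)
  have one: "Finite_Cartesian_Product.mat 1 $ i $ j = (Const ((Finite_Cartesian_Product.mat 1 :: 'a^'n^'n) $ i $ j) :: ('a sect, 'a) mpoly)" for i j :: 'n
    using C.one C.zero by (simp add: Finite_Cartesian_Product.mat_def)
  have d: "(Const a :: ('a sect, 'a) mpoly) - Const b = Const (a - b)" for a b
    using C.diff[OF refl refl, of a b] by simp
  have e: "(Const a :: ('a sect, 'a) mpoly) * Const b = Const (a * b)" for a b
    using C.mult[OF refl refl, of a b] by simp
  show ?thesis
    using assms unfolding monomial_pair_def m one cong_mod_def d
    by (auto simp: const_mat_def e intro!: Const_relations)
qed

end

text \<open>Conjugating by a monomial matrix sends diagonal matrices to diagonal matrices, so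
  \<open>c x d b = (c x b) (c d b)\<close> expresses \<open>b\<inverse> (x d) b\<close> as a diagonal multiple of \<open>b\<inverse> x b\<close>.\<close>

lemma monomial_conj_diagm:
  fixes b c x :: "'a::comm_ring_1^'n^'n"
  assumes I: "is_ideal I" and bc: "monomial_pair I b c"
  shows "cong_mod I ((c ** (x ** diagm v) ** b) $ i $ j)
    ((c ** x ** b ** diagm (\<lambda>m. (c ** diagm v ** b) $ m $ m)) $ i $ j)"
proof -
  interpret R: ring_rel "cong_mod I" by (rule ring_rel_cong_mod[OF I])
  let ?E = "c ** diagm v ** b"
  have rf: "cong_mod I f f" for f by (rule cong_mod_refl[OF I])
  have E: "cong_mod I (?E $ k $ l) (diagm (\<lambda>m. ?E $ m $ m) $ k $ l)" for k l
  proof (cases "k = l")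
    case False
    have "?E $ k $ l = (\<Sum>m\<in>UNIV. c $ k $ m * v m * b $ m $ l)"
      by (simp add: matrix_matrix_mult_def diagm_def if_distrib[of "\<lambda>x. _ * x"] cong: if_cong)
    also have "\<dots> \<in> I"
    proof (rule is_ideal_sum[OF I])
      show "c $ k $ m * v m * b $ m $ l \<in> I" for m
        using is_idealD(4)[OF I mp_off(2)[OF I bc False], of m "v m"] by (simp add: mult_ac)
    qed
    finally show ?thesis using False by (simp add: diagm_def cong_mod_0_iff)
  qed (simp add: diagm_def rf)
  have bc1: "cong_mod I ((b ** c) $ k $ l) (Finite_Cartesian_Product.mat 1 $ k $ l)" for k l
    using bc by (simp add: monomial_pair_def)
  have 1: "cong_mod I ((c ** x ** b ** ?E) $ i $ j) ((c ** x ** b ** diagm (\<lambda>m. ?E $ m $ m)) $ i $ j)"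
    by (rule R.matrix_mult[OF rf E])
  have 2: "c ** x ** b ** ?E = c ** x ** (b ** c) ** (diagm v ** b)"
    by (simp only: matrix_mul_assoc)
  have "cong_mod I ((c ** x ** (b ** c) ** (diagm v ** b)) $ i $ j)
      ((c ** x ** Finite_Cartesian_Product.mat 1 ** (diagm v ** b)) $ i $ j)"
    by (rule R.matrix_mult[OF R.matrix_mult[OF rf bc1] rf])
  moreover have "c ** x ** Finite_Cartesian_Product.mat 1 ** (diagm v ** b) = c ** (x ** diagm v) ** b"
    by (simp only: matrix_mul_assoc matrix_mul_rid)
  ultimately have 3: "cong_mod I ((c ** x ** b ** ?E) $ i $ j) ((c ** (x ** diagm v) ** b) $ i $ j)"
    by (simp only: 2)
  show ?thesis by (rule cong_mod_trans[OF I cong_mod_sym[OF I 3] 1])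
qed

context formal
begin

text \<open>The new factors t are the diagonal entries of c diag(s) b. They stay congruent to 1 mod
  p, because s is, and c b = 1.\<close>

lemma conj_diag_mult:
  fixes b c x :: "'a^'n^'n"
  assumes bc: "monomial_pair I b c" and s: "\<And>j. s j \<in> carrier S"
    and s1: "\<And>j Q. Q \<in> W \<Longrightarrow> s j 0 Q = \<one>\<^bsub>S\<^esub> 0 Q"
  shows "\<exists>t. (\<forall>j. t j \<in> carrier S) \<and> (\<forall>j. \<forall>Q\<in>W. t j 0 Q = \<one>\<^bsub>S\<^esub> 0 Q)
    \<and> mat_mult S (mat_mult S (present_mat (const_mat c)) (diag_mult x s)) (present_mat (const_mat b)) = diag_mult (c ** x ** b) t"
proof -
  let ?D = "ideal_add relations (of_nat p)"
  note D = is_ideal_add[OF is_ideal_relations, of "of_nat p"]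
  interpret R: ring_rel "cong_mod ?D" by (rule ring_rel_cong_mod[OF D])
  interpret C: ring_rel "\<lambda>(a :: 'a) (f :: ('a sect, 'a) mpoly). Const a = f" by (rule ring_rel_Const)
  note BC = monomial_pair_const_mat[OF bc]
  define E where "E = const_mat c ** diagm (\<lambda>j. Var (s j)) ** const_mat b"
  define t where "t j = present (E $ j $ j)" for j
  have rf: "cong_mod ?D f f" for f by (rule cong_mod_refl[OF D])
  have dv: "cong_mod ?D (diagm (\<lambda>j. Var (s j)) $ k $ l) ((Finite_Cartesian_Product.mat 1 :: ('a sect, 'a) mpoly^'n^'n) $ k $ l)" for k l
  proof -
    have "Var (s l) - 1 \<in> ?D" unfolding ideal_add_relations_0_diff using s s1 by (simp add: present.one)
    then show ?thesis using rf by (simp add: diagm_def Finite_Cartesian_Product.mat_def cong_mod_def is_idealD(1)[OF D])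
  qed
  have Ec: "cong_mod ?D (E $ j $ j) (((const_mat c ** Finite_Cartesian_Product.mat 1) ** const_mat b) $ j $ j)" for j
    unfolding E_def by (rule R.matrix_mult[OF R.matrix_mult[OF rf dv] rf])
  have cb: "cong_mod ?D ((const_mat c ** const_mat b) $ j $ j) 1" for j
  proof (rule cong_mod_mono[OF ideal_add_mono[OF is_ideal_relations]])
    have "cong_mod relations ((const_mat c ** const_mat b) $ j $ j) ((Finite_Cartesian_Product.mat 1 :: ('a sect, 'a) mpoly^'n^'n) $ j $ j)"
      using BC by (simp only: monomial_pair_def)
    then show "cong_mod relations ((const_mat c ** const_mat b) $ j $ j) 1" by (simp add: Finite_Cartesian_Product.mat_def)
  qed
  have E1: "cong_mod ?D (E $ j $ j) 1" for j
    by (rule cong_mod_trans[OF D Ec[unfolded matrix_mul_rid] cb])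
  have t1: "t j 0 Q = \<one>\<^bsub>S\<^esub> 0 Q" if "Q \<in> W" for j Q
    using E1[of j] that unfolding cong_mod_def ideal_add_relations_0_diff by (simp add: t_def present.one)
  have cc: "const_mat (c ** x ** b) = const_mat c ** const_mat x ** const_mat b"
  proof (rule matrix_eqI)
    have "Const ((c ** x ** b) $ i $ j) = (const_mat c ** const_mat x ** const_mat b) $ i $ j" for i j
      by (intro C.matrix_mult) (simp_all add: const_mat_def)
    then show "const_mat (c ** x ** b) $ i $ j = (const_mat c ** const_mat x ** const_mat b) $ i $ j" for i j
      by (simp add: const_mat_def)
  qed
  have dm: "diag_mult y u = present_mat (const_mat y ** diagm f)" if "\<And>j. present (f j) = u j" for y :: "'a^'n^'n" and u f
    by (rule ext, rule ext)
      (simp add: diag_mult_def present_mat_def const_mat_def matrix_matrix_mult_def diagm_def present.mult that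
        if_distrib[of "\<lambda>x. _ * x"] cong: if_cong)
  have "mat_mult S (mat_mult S (present_mat (const_mat c)) (diag_mult x s)) (present_mat (const_mat b))
      = present_mat (const_mat c ** (const_mat x ** diagm (\<lambda>j. Var (s j))) ** const_mat b)"
    using dm[of "\<lambda>j. Var (s j)" s x] s by (simp add: present_mat_mult)
  also have "\<dots> = present_mat (const_mat c ** const_mat x ** const_mat b ** diagm (\<lambda>j. E $ j $ j))"
    using monomial_conj_diagm[OF is_ideal_relations BC, of "const_mat x" "\<lambda>j. Var (s j)"]
    unfolding cong_mod_def relations_diff_iff E_def[symmetric] by (simp add: present_mat_def fun_eq_iff)
  also have "\<dots> = diag_mult (c ** x ** b) t" unfolding cc[symmetric] by (rule dm[symmetric]) (simp add: t_def)
  finally show ?thesis using t1 by (intro exI[of _ t] conjI allI ballI) (simp_all add: t_def)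
qed

lemma mat_inverse_const_mat:
  fixes b c :: "'a^'n^'n"
  assumes bc: "monomial_pair I b c"
  shows "mat_mult S (present_mat (const_mat c)) (present_mat (const_mat b)) = mat_one S" "mat_inverse S (present_mat (const_mat b)) = present_mat (const_mat c)"
proof -
  note BC = monomial_pair_const_mat[OF bc]
  have 1: "present_mat (const_mat b ** const_mat c) = present_mat (Finite_Cartesian_Product.mat 1)" "present_mat (const_mat c ** const_mat b) = present_mat (Finite_Cartesian_Product.mat 1)"
    using BC unfolding monomial_pair_def cong_mod_def relations_diff_iff by (simp_all add: present_mat_def fun_eq_iff)
  show "mat_mult S (present_mat (const_mat c)) (present_mat (const_mat b)) = mat_one S" by (simp add: present_mat_mult present_mat_one 1)
  show "mat_inverse S (present_mat (const_mat b)) = present_mat (const_mat c)" by (rule mat_inverse_eqI) (simp_all add: present_mat_mult present_mat_one 1)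
qed

lemma present_mat_const_mat: "present_mat (const_mat y) = (\<lambda>i j. sect_of J W (y $ i $ j))"
  by (simp add: present_mat_def const_mat_def fun_eq_iff)

end

section \<open>Pullback of sections\<close>

lemma push_pullback:
  fixes h :: "'a::comm_ring_1 \<Rightarrow> 'b::comm_ring_1"
  assumes src: "formal p {0} W" and tgt: "formal p I' Y" and h: "type_hom typ_ring h"
    and pt: "\<And>Q. Q \<in> Y \<Longrightarrow> h -` Q \<in> W"
  shows "push p {0} W I' Y (\<lambda>a. sect_of (thick p I') Y (h a)) (\<lambda>Q. h -` Q)"
proof -
  interpret src: formal p "{0}" W by (rule src)
  interpret tgt: formal p I' Y by (rule tgt)
  interpret h: type_hom typ_ring h by (rule h)
  interpret E: type_hom "sections (thick p I') Y" "\<lambda>a. sect_of (thick p I') Y (h a)"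
    by (rule tgt.of.comp[OF h.hom])
  show ?thesis
  proof unfold_locales
    show "h -` Q \<in> W" if "Q \<in> Y" for Q using pt that .
    show "\<exists>V'. zariski_open V' \<and> Q \<in> V' \<and> (\<forall>Q'\<in>V' \<inter> Y. h -` Q' \<in> V)"
      if V: "zariski_open V" and Q: "Q \<in> Y" "h -` Q \<in> V" for V Q
    proof -
      obtain T where T: "V = {P \<in> Spec. \<not> T \<subseteq> P}" using V by (auto simp: zariski_open_def)
      have "zariski_open {P \<in> Spec. \<not> h ` T \<subseteq> P}" unfolding zariski_open_def by (rule exI, rule refl)
      moreover have "Q \<in> Spec" using tgt.prime_W[OF Q(1)] by (simp add: Spec_iff)
      moreover have "h -` Q' \<in> Spec" if "Q' \<in> Y" for Q' using src.prime_W[OF pt[OF that]] by (simp add: Spec_iff)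
      ultimately show ?thesis using Q(2) unfolding T
        by (intro exI[of _ "{P \<in> Spec. \<not> h ` T \<subseteq> P}"]) auto
    qed
    show "sect_of (thick p I') Y (h a) = \<zero>\<^bsub>sections (thick p I') Y\<^esub>" if "a \<in> {0}" for a
      using that h.zero by (simp add: tgt.S_zero)
    show "b \<notin> Q" if Q: "Q \<in> Y" and s: "s \<notin> h -` Q" "t \<notin> Q" "sect_of (thick p I') Y (h s) 0 Q = frac (thick p I' 0) Q b t"
      for Q s b t
    proof -
      interpret L: local_frac "thick p I' 0" Q by (rule tgt.local_fracI[OF Q])
      have "h s * t - b * 1 \<in> loc (thick p I' 0) Q"
        unfolding L.frac_eq_iff[OF L.one_notin s(2), symmetric] using Q s by (simp add: tgt.sect_of_germ)
      then show ?thesis using tgt.loc_notin[OF Q] s L.one_notin by blast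
    qed
  qed
qed

text \<open>Pulling back a/s to h a / h s is the quotient of the germs of h a and h s, so the
  general results on extensions of homomorphisms apply to pullbacks.\<close>

lemma pullback_eq_push:
  fixes h :: "'a::comm_ring_1 \<Rightarrow> 'b::comm_ring_1"
  assumes src: "formal p {0} W" and tgt: "formal p I' Y" and h: "type_hom typ_ring h"
    and pt: "\<And>Q. Q \<in> Y \<Longrightarrow> h -` Q \<in> W" and \<sigma>: "\<sigma> \<in> carrier (sections (thick p {0}) W)"
  shows "pullback h (thick p I') Y \<sigma> = push.push p I' Y (\<lambda>a. sect_of (thick p I') Y (h a)) (\<lambda>Q. h -` Q) \<sigma>"
proof -
  interpret E: push p "{0}" W I' Y "\<lambda>a. sect_of (thick p I') Y (h a)" "\<lambda>Q. h -` Q"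
    by (rule push_pullback[OF src tgt h pt])
  have "pullback h (thick p I') Y \<sigma> m Q = E.push \<sigma> m Q" for m Q
  proof (cases "Q \<in> Y")
    case Q: True
    interpret L: local_frac "thick p I' m" Q by (rule E.tgt.local_fracI[OF Q])
    have "frac (thick p I' m) Q (h a) (h s) = E.tgt.quot m Q (sect_of (thick p I') Y (h a) m Q) (sect_of (thick p I') Y (h s) m Q)"
      if "(a, s) \<in> \<sigma> m (h -` Q)" for a s
    proof -
      obtain a' s' where "\<sigma> m (h -` Q) = frac (thick p {0} m) (h -` Q) a' s'"
        using E.src.germ[OF \<sigma> pt[OF Q]] by metis
      then have "h s \<notin> Q" using that by (auto simp: frac_def)
      then show ?thesis using Q E.tgt.quot_frac[OF Q L.one_notin L.one_notin] by (simp add: E.tgt.sect_of_germ)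
    qed
    then show ?thesis using Q by (auto simp: pullback_def E.push_def)
  qed (simp add: pullback_def E.push_def)
  then show ?thesis by (intro ext)
qed

context
  fixes h :: "'a::comm_ring_1 \<Rightarrow> 'b::comm_ring_1" and p W I' Y
  assumes src: "formal p {0} W" and tgt: "formal p I' Y" and h: "type_hom typ_ring h"
    and pt: "\<And>Q. Q \<in> Y \<Longrightarrow> h -` Q \<in> W"
begin

interpretation E: push p "{0}" W I' Y "\<lambda>a. sect_of (thick p I') Y (h a)" "\<lambda>Q. h -` Q"
  by (rule push_pullback[OF src tgt h pt])

lemma pullback_hom:
  "pullback h (thick p I') Y \<in> Ring.ring_hom (sections (thick p {0}) W) (sections (thick p I') Y)"
proof -
  interpret S: cring "sections (thick p {0}) W" by (rule E.src.cring_S)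
  note e = pullback_eq_push[OF src tgt h pt]
  show ?thesis
    by (rule Ring.ring_hom_memI)
      (simp_all add: e Ring.ring_hom_closed[OF E.push_hom] Ring.ring_hom_mult[OF E.push_hom]
        Ring.ring_hom_add[OF E.push_hom] Ring.ring_hom_one[OF E.push_hom])
qed

lemma pullback_sect_of: "pullback h (thick p I') Y (sect_of (thick p {0}) W a) = sect_of (thick p I') Y (h a)"
  using pullback_eq_push[OF src tgt h pt E.src.sect_of_closed] E.push_sect_of by simp

lemma pullback_level_0_one:
  assumes s: "\<And>Q. Q \<in> W \<Longrightarrow> s 0 Q = \<one>\<^bsub>sections (thick p {0}) W\<^esub> 0 Q" and Q: "Q \<in> Y"
  shows "pullback h (thick p I') Y s 0 Q = \<one>\<^bsub>sections (thick p I') Y\<^esub> 0 Q"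
proof -
  interpret h: type_hom typ_ring h by (rule h)
  have "pullback h (thick p I') Y s 0 Q = pullback h (thick p I') Y (sect_of (thick p {0}) W 1) 0 Q"
    using Q s[OF pt[OF Q]] by (simp add: pullback_def E.src.S_one)
  then show ?thesis using h.one by (simp add: pullback_sect_of E.tgt.S_one)
qed

end

lemma type_hom_proj_G: "type_hom typ_ring proj_G" and type_hom_conj_map: "type_hom typ_ring conj_map"
  by (simp_all add: proj_G_def conj_map_def type_hom_subst)

lemma proj_G_xpow: "proj_G (xpow k $ i $ j) = matrix_pow k xmatN $ i $ j"
  by (simp add: proj_G_def xpow_def xmatN_def matrix_pow_def subst_simps)

lemma conj_map_xpow:
  "conj_map (xpow k $ i $ j) = (matrix_pow k (cmatN ** xmatN ** bmatN) $ i $ j :: ('n::finite, 'r::comm_ring_1) conj_fun)"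
proof -
  have "conj_map (xpow k $ i $ j) = (conj_map (xmat $ i $ j) ^ k :: ('n, 'r) conj_fun)"
    by (simp add: conj_map_def xpow_def xmat_def subst_simps)
  then show ?thesis by (simp only: conj_map_xmat) (simp add: matrix_pow_def)
qed

lemma conj_map_P_fun:
  "cong_mod normalizer_ideal (conj_map (P_fun i)) (proj_G (P_fun i) :: ('n::finite, 'r::comm_ring_1) conj_fun)"
proof -
  interpret G: ring_rel "\<lambda>f (g :: ('n, 'r) conj_fun). proj_G f = g" by (rule ring_rel_proj_G)
  interpret C: ring_rel "\<lambda>f (g :: ('n, 'r) conj_fun). conj_map f = g" by (rule ring_rel_conj_map)
  have 1: "proj_G (P_fun i) = cp i (xmatN :: ('n, 'r) conj_fun^'n^'n)" unfolding P_fun_eq by (rule G.cp) (rule proj_G_xmat)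
  have 2: "conj_map (P_fun i) = cp i (cmatN ** xmatN ** bmatN :: ('n, 'r) conj_fun^'n^'n)"
    unfolding P_fun_eq by (rule C.cp) (rule conj_map_xmat)
  have "monomial_pair normalizer_ideal (bmatN :: ('n, 'r) conj_fun^'n^'n) cmatN" by (rule monomial_pair_N)
  then show ?thesis unfolding 1 2 by (intro cp_conj[OF is_ideal_N]) (simp add: monomial_pair_def)
qed

context GL_frobenius
begin

lemma formal_N: "formal p normalizer_ideal (special_fibre p (times_N U))"
proof
  show "is_ideal (normalizer_ideal :: ('n, 'r) conj_fun set)" by (rule is_ideal_N)
  fix Q :: "('n, 'r) conj_fun set" assume Q: "Q \<in> special_fibre p (times_N U)"
  show P: "is_prime Q" and N: "normalizer_ideal \<subseteq> Q" and "of_nat p \<in> Q"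
    using Q by (simp_all add: special_fibre_def times_N_def Spec_iff)
  show "f \<in> loc normalizer_ideal Q" if "of_nat p * f \<in> loc normalizer_ideal Q" for f
    by (rule normalizer_flat[OF P N pc that])
qed

interpretation N: formal p "normalizer_ideal :: ('n, 'r) conj_fun set" "special_fibre p (times_N U)"
  by (rule formal_N)

lemma proj_G_point: "\<forall>Q\<in>special_fibre p (times_N U). proj_G -` Q \<in> special_fibre p U"
  by (simp add: special_fibre_def times_N_def proj_G_def subst_simps)

lemma conj_map_point: "N_invariant U \<Longrightarrow> \<forall>Q\<in>special_fibre p (times_N U). conj_map -` Q \<in> special_fibre p U"
  by (auto simp: special_fibre_def N_invariant_def conj_map_def subst_simps)

text \<open>Stated for a general h because it is used twice, for the projection and for conjugation.
  Both pullbacks of \<Phi>(x) keep their prescribed characteristic coefficients and their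
  factorization with factors congruent to 1 mod p.\<close>

lemma pullback_at_x:
  fixes h :: "('n, 'r) GL_fun \<Rightarrow> ('n, 'r) conj_fun"
  assumes \<Phi>: "G_frobenius_lift p \<phi> U \<Phi>" "P_horizontal p U \<Phi>" "T_deformation p U \<Phi>"
    and h: "type_hom typ_ring h" and pt: "\<forall>Q\<in>special_fibre p (times_N U). h -` Q \<in> special_fibre p U"
  defines "A \<equiv> \<lambda>i j. pullback h (thick p normalizer_ideal) (special_fibre p (times_N U)) (at_x p U \<Phi> i j)"
  shows "A \<in> mat_carrier N.S"
    and "i \<in> {1..CARD('n)} \<Longrightarrow> N.cpS i A = sect_of N.J (special_fibre p (times_N U)) (h (P_fun i) ^ p)"
    and "\<exists>t. (\<forall>j. t j \<in> carrier N.S) \<and> (\<forall>j. \<forall>Q\<in>special_fibre p (times_N U). t j 0 Q = \<one>\<^bsub>N.S\<^esub> 0 Q)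
      \<and> A = N.diag_mult (\<chi> i j. h (xpow p $ i $ j)) t"
proof -
  interpret h: type_hom typ_ring h by (rule h)
  let ?P = "pullback h (thick p normalizer_ideal) (special_fibre p (times_N U))"
  note ph = pullback_hom[OF formal_G formal_N h bspec[OF pt]] and ps = pullback_sect_of[OF formal_G formal_N h bspec[OF pt]]
    and p1 = pullback_level_0_one[OF formal_G formal_N h bspec[OF pt]]
  have th: "type_hom N.S (\<lambda>f. ?P (\<Phi> (special_fibre p U) (glob p U f)))"
    by (rule type_hom_compI[OF frobenius_lift_type_hom[OF \<Phi>(1)] N.cring_S ph])
  have Ac: "A i j = ?P (\<Phi> (special_fibre p U) (glob p U (xmat $ i $ j)))" for i j
    by (simp add: A_def at_x_def xmat_def)
  show "A \<in> mat_carrier N.S" using type_hom.closed[OF th] by (simp add: mat_carrier_def Ac)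
  show "N.cpS i A = sect_of N.J (special_fibre p (times_N U)) (h (P_fun i) ^ p)" if "i \<in> {1..CARD('n)}"
  proof -
    have "N.cpS i A = ?P (\<Phi> (special_fibre p U) (glob p U (P_fun i)))"
      unfolding P_fun_eq N.cpS_hom[OF th] Ac[abs_def] ..
    also have "\<dots> = ?P (glob p U (P_fun i ^ p))" using \<Phi>(2) that by (simp add: P_horizontal_def)
    finally show ?thesis using h.power[of "P_fun i" p] by (simp add: ps pow_typ_ring)
  qed
  obtain s where s: "\<forall>j. s j \<in> carrier (O_hat p U)" "\<forall>j. \<forall>Q\<in>special_fibre p U. s j 0 Q = \<one>\<^bsub>O_hat p U\<^esub> 0 Q"
    "at_x p U \<Phi> = F.diag_mult (xpow p) s" using T_deformationE[OF \<Phi>(1,3)] by (elim exE conjE)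
  show "\<exists>t. (\<forall>j. t j \<in> carrier N.S) \<and> (\<forall>j. \<forall>Q\<in>special_fibre p (times_N U). t j 0 Q = \<one>\<^bsub>N.S\<^esub> 0 Q)
      \<and> A = N.diag_mult (\<chi> i j. h (xpow p $ i $ j)) t"
  proof (intro exI[of _ "\<lambda>j. ?P (s j)"] conjI allI ballI)
    show "?P (s j) \<in> carrier N.S" for j by (rule Ring.ring_hom_closed[OF ph]) (use s(1) in auto)
    show "?P (s j) 0 Q = \<one>\<^bsub>N.S\<^esub> 0 Q" if "Q \<in> special_fibre p (times_N U)" for j Q
      by (rule p1[OF _ _ that]) (use s(2) in auto)
    have e: "A i j = N.diag_mult (\<chi> i j. h (xpow p $ i $ j)) (\<lambda>j. ?P (s j)) i j" for i j
      using Ring.ring_hom_mult[OF ph, of "glob p U (xpow p $ i $ j)" "s j"] s(1)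
      by (simp add: A_def s(3) F.diag_mult_def N.diag_mult_def ps)
    show "A = N.diag_mult (\<chi> i j. h (xpow p $ i $ j)) (\<lambda>j. ?P (s j))" by (rule ext, rule ext, rule e)
  qed
qed

text \<open>The Jacobian is jac(x^(p)) d with d^2 = 1 modulo the ideal of the normalizer; jac(x^(p))
  is regular mod p on the product because it is pulled back from the first factor.\<close>

lemma reg_jac_conj:
  "N.reg (jac (matrix_pow p cmatN ** matrix_pow p xmatN ** matrix_pow p bmatN))"
  unfolding N.reg_def
proof (intro ballI allI impI)
  let ?y = "matrix_pow p cmatN ** matrix_pow p xmatN ** matrix_pow p bmatN :: ('n, 'r) conj_fun^'n^'n"
  fix Q and f :: "('n, 'r) conj_fun" assume Q: "Q \<in> special_fibre p (times_N U)" and f: "jac ?y * f \<in> loc (N.J 0) Q"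
  interpret L: local_frac "N.J 0" Q by (rule N.local_fracI[OF Q])
  interpret G: ring_rel "\<lambda>f (g :: ('n, 'r) conj_fun). proj_G f = g" by (rule ring_rel_proj_G)
  have th: "N.J 0 = ideal_add normalizer_ideal (of_nat p)" using thick_eq[OF is_ideal_N, of p 0] by simp
  have sub: "a \<in> normalizer_ideal \<Longrightarrow> a \<in> loc (N.J 0) Q" for a
    using ideal_add_mono[OF is_ideal_N] L.locI unfolding th by blast
  obtain d where d: "cong_mod normalizer_ideal (d * d) 1"
    "cong_mod normalizer_ideal (jac ?y) (jac (matrix_pow p xmatN) * d)"
    using jac_conj_N[OF prime_gt_0_nat[OF p], of "matrix_pow p xmatN"] by (elim exE conjE)
  have j: "proj_G (jac (xpow p)) = jac (matrix_pow p xmatN :: ('n, 'r) conj_fun^'n^'n)"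
    by (rule G.jac) (rule proj_G_xpow)
  note D = is_idealD[OF L.is_ideal_loc]
  have "jac ?y * f - (jac ?y - jac (matrix_pow p xmatN) * d) * f \<in> loc (N.J 0) Q"
    using d(2) by (intro D(6) f D(4) sub) (simp add: cong_mod_def)
  then have "proj_G (jac (xpow p)) * (d * f) \<in> loc (ideal_add normalizer_ideal (of_nat p)) Q"
    unfolding j th by (simp add: algebra_simps)
  then have "d * f \<in> loc (N.J 0) Q"
    unfolding th by (rule normalizer_regular[OF N.prime_W[OF Q] N.I_W[OF Q] pc
          jac_xpow_not_dvd[OF pc prime_gt_0_nat[OF p]]])
  moreover have "(d * d - 1) * f \<in> loc (N.J 0) Q" using d(1) by (intro D(4) sub) (simp add: cong_mod_def)
  \<comment> \<open>This difference equals f, so invertibility of d recovers f from d f.\<close>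
  ultimately have "d * (d * f) - (d * d - 1) * f \<in> loc (N.J 0) Q" by (rule D(6)[OF D(3)])
  then show "f \<in> loc (N.J 0) Q" by (simp add: algebra_simps)
qed

lemma C_compatible:
  assumes \<Phi>: "G_frobenius_lift p \<phi> U \<Phi>" "P_horizontal p U \<Phi>" "T_deformation p U \<Phi>" and inv: "N_invariant U"
  shows "C_compatible p U \<Phi>"
proof -
  let ?Y = "special_fibre p (times_N U)"
  define b c x :: "('n, 'r) conj_fun^'n^'n" where "b = matrix_pow p bmatN" and "c = matrix_pow p cmatN" and "x = matrix_pow p xmatN"
  define A1 where "A1 = (\<lambda>i j. pullback proj_G N.J ?Y (at_x p U \<Phi> i j))"
  define A2 where "A2 = (\<lambda>i j. pullback conj_map N.J ?Y (at_x p U \<Phi> i j))"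
  note pa1 = pullback_at_x[OF \<Phi> type_hom_proj_G proj_G_point, folded A1_def]
  note pa2 = pullback_at_x[OF \<Phi> type_hom_conj_map conj_map_point[OF inv], folded A2_def]
  have bc: "monomial_pair normalizer_ideal b c"
    unfolding b_def c_def by (rule monomial_pair_pow[OF is_ideal_N monomial_pair_N prime_gt_0_nat[OF p]])
  have x: "(\<chi> i j. proj_G (xpow p $ i $ j)) = x" by (rule matrix_eqI) (simp add: proj_G_xpow x_def)
  obtain s1 where s1: "\<forall>j. s1 j \<in> carrier N.S" "\<forall>j. \<forall>Q\<in>?Y. s1 j 0 Q = \<one>\<^bsub>N.S\<^esub> 0 Q"
    "A1 = N.diag_mult x s1" using pa1(3) unfolding x by (elim exE conjE)
  obtain s2 where s2: "\<forall>j. s2 j \<in> carrier N.S" "\<forall>j. \<forall>Q\<in>?Y. s2 j 0 Q = \<one>\<^bsub>N.S\<^esub> 0 Q"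
    "A2 = N.diag_mult (\<chi> i j. conj_map (xpow p $ i $ j)) s2" using pa2(3) by (elim exE conjE)
  \<comment> \<open>The right-hand side is naturally a diagonal multiple of (b^(-1) x b)^(p). On the
    normalizer this is the conjugate of x^(p) by b^(p), the matrix that also underlies the left-hand
    side.\<close>
  have A2: "A2 = N.diag_mult (c ** x ** b) s2"
  proof -
    have "sect_of N.J ?Y (conj_map (xpow p $ i $ j)) = sect_of N.J ?Y ((c ** x ** b) $ i $ j)" for i j
      unfolding conj_map_xpow b_def c_def x_def
      by (rule N.sect_of_cong) (rule conj_pow[OF is_ideal_N monomial_pair_N prime_gt_0_nat[OF p]])
    then show ?thesis unfolding s2(3) N.diag_mult_def by simp
  qed
  define L where "L = mat_mult N.S (mat_mult N.S (N.present_mat (N.const_mat c)) A1) (N.present_mat (N.const_mat b))"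
  have "\<exists>t. (\<forall>j. t j \<in> carrier N.S) \<and> (\<forall>j. \<forall>Q\<in>?Y. t j 0 Q = \<one>\<^bsub>N.S\<^esub> 0 Q)
      \<and> L = N.diag_mult (c ** x ** b) t"
    unfolding L_def s1(3) by (rule N.conj_diag_mult[OF bc]) (use s1(1,2) in auto)
  then obtain t where t: "\<forall>j. t j \<in> carrier N.S" "\<forall>j. \<forall>Q\<in>?Y. t j 0 Q = \<one>\<^bsub>N.S\<^esub> 0 Q"
    "L = N.diag_mult (c ** x ** b) t"
    by (elim exE conjE)
  have "t j = s2 j" for j
  proof (rule N.diag_mult_unique)
    show "N.reg (jac (c ** x ** b))" unfolding b_def c_def x_def by (rule reg_jac_conj)
    show "N.cpS i (N.diag_mult (c ** x ** b) t) = N.cpS i (N.diag_mult (c ** x ** b) s2)" if i: "i \<in> {1..CARD('n)}" for i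
    proof -
      \<comment> \<open>Both sides have the p-th powers of the characteristic coefficients: the left
        one is conjugate to the pullback along the projection, and the functions P_i are invariant
        under conjugation.\<close>
      have "N.cpS i L = N.cpS i A1"
        unfolding L_def by (rule N.cpS_conj[OF pa1(1) N.present_mat_closed N.present_mat_closed N.mat_inverse_const_mat(1)[OF bc]])
      also have "\<dots> = N.cpS i A2"
        unfolding pa1(2)[OF i] pa2(2)[OF i]
        by (rule N.sect_of_cong[OF ring_rel.power[OF ring_rel_cong_mod[OF is_ideal_N]
                cong_mod_sym[OF is_ideal_N conj_map_P_fun]]])
      finally show ?thesis by (simp only: t(3) A2)
    qed
  qed (use t(1,2) s2(1,2) in auto)
  then have "t = s2" by (rule ext)
  then have "L = A2" using t(3) A2 by simp
  moreover have "(\<lambda>i j. sect_of N.J ?Y (Var (BV i j) ^ p)) = N.present_mat (N.const_mat b)"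
    by (simp add: N.present_mat_const_mat b_def matrix_pow_def bmatN_def)
  ultimately show ?thesis
    unfolding C_compatible_def Let_def by (simp only: N.mat_inverse_const_mat(2)[OF bc] L_def A1_def A2_def)
qed

end

lemma GL_frobenius_U_jac:
  assumes "prime p" "prime_const TYPE('r::idom) p" "frobenius_lift_base p \<phi>"
  shows "GL_frobenius p \<phi> (U_jac :: ('n::finite, 'r) GL_fun set set)"
  by unfold_locales (use assms zariski_open_U_jac in \<open>auto simp: U_jac_def\<close>)

theorem proposition6p8:
  fixes p :: nat and \<phi> :: "'r::idom \<Rightarrow> 'r"
  assumes "prime p" and "odd p"
    and "complete_dvr_Fp_closure TYPE('r) p"
    and "frobenius_lift_base p \<phi>"
  shows
    "(\<exists>(U :: ('n::finite, 'r) GL_fun set set) \<Phi>. good_pair p \<phi> U \<Phi>)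
     \<and> (\<forall>(U :: ('n, 'r) GL_fun set set) \<Phi>. good_pair p \<phi> U \<Phi> \<longrightarrow>
          (\<forall>\<Psi>. G_frobenius_lift p \<phi> U \<Psi> \<and> P_horizontal p U \<Psi> \<and> T_deformation p U \<Psi>
                \<longrightarrow> G_same p U \<Psi> \<Phi>)
          \<and> C_compatible p U \<Phi>)
     \<and> (\<forall>(U :: ('n, 'r) GL_fun set set) \<Phi>. good_pair p \<phi> U \<Phi> \<longrightarrow>
          (\<forall>\<alpha> \<in> mat_carrier (O_hat p U).
             (\<exists>\<Psi>. G_frobenius_lift p \<phi> U \<Psi> \<and> at_x p U \<Psi> = twist_at_x p U \<Phi> \<alpha>)
             \<and> (\<forall>\<Psi>. G_frobenius_lift p \<phi> U \<Psi> \<and> at_x p U \<Psi> = twist_at_x p U \<Phi> \<alpha> \<longrightarrow>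
                  (\<forall>\<Psi>'. G_frobenius_lift p \<phi> U \<Psi>' \<and> at_x p U \<Psi>' = twist_at_x p U \<Phi> \<alpha>
                         \<longrightarrow> G_same p U \<Psi>' \<Psi>)
                  \<and> P_horizontal p U \<Psi>
                  \<and> (\<forall>i \<in> {1..CARD('n)}.
                       p_derivation (O_hat p U) p (\<Psi> (special_fibre p U)) (glob p U (P_fun i))
                         = \<zero>\<^bsub>O_hat p U\<^esub>))))"
proof (intro conjI allI impI ballI)
  have pc: "prime_const TYPE('r) p" by (rule prime_const_complete_dvr[OF assms(3)])
  interpret J: GL_frobenius p \<phi> "U_jac :: ('n, 'r) GL_fun set set"
    by (rule GL_frobenius_U_jac[OF assms(1) pc assms(4)])
  obtain \<Phi> :: "('n, 'r) G_mor" where "G_frobenius_lift p \<phi> U_jac \<Phi> \<and> P_horizontal p U_jac \<Phi> \<and> T_deformation p U_jac \<Phi>"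
    using J.horizontal_T_deformation_exists by (auto simp: U_jac_def)
  then show "\<exists>(U :: ('n, 'r) GL_fun set set) \<Phi>. good_pair p \<phi> U \<Phi>"
    using J.U N_invariant_U_jac U_jac_Int_torus unfolding good_pair_def
    by (intro exI[of _ U_jac] exI[of _ \<Phi>]) simp
next
  fix U :: "('n, 'r) GL_fun set set" and \<Phi> \<Psi> assume g: "good_pair p \<phi> U \<Phi>"
    and \<Psi>: "G_frobenius_lift p \<phi> U \<Psi> \<and> P_horizontal p U \<Psi> \<and> T_deformation p U \<Psi>"
  have pc: "prime_const TYPE('r) p" by (rule prime_const_complete_dvr[OF assms(3)])
  interpret GL_frobenius p \<phi> U by unfold_locales (use assms pc g in \<open>simp_all add: good_pair_def\<close>)
  show "G_same p U \<Psi> \<Phi>"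
    by (rule horizontal_T_deformation_unique) (use g \<Psi> in \<open>simp_all add: good_pair_def\<close>)
next
  fix U :: "('n, 'r) GL_fun set set" and \<Phi> assume g: "good_pair p \<phi> U \<Phi>"
  have pc: "prime_const TYPE('r) p" by (rule prime_const_complete_dvr[OF assms(3)])
  interpret GL_frobenius p \<phi> U by unfold_locales (use assms pc g in \<open>simp_all add: good_pair_def\<close>)
  show "C_compatible p U \<Phi>" by (rule C_compatible) (use g in \<open>simp_all add: good_pair_def\<close>)
next
  fix U :: "('n, 'r) GL_fun set set" and \<Phi> and \<alpha> :: "('n, ('n, 'r) GL_fun sect) fmat" assume g: "good_pair p \<phi> U \<Phi>" and \<alpha>: "\<alpha> \<in> mat_carrier (O_hat p U)"
  have pc: "prime_const TYPE('r) p" by (rule prime_const_complete_dvr[OF assms(3)])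
  interpret GL_frobenius p \<phi> U by unfold_locales (use assms pc g in \<open>simp_all add: good_pair_def\<close>)
  have \<Phi>: "G_frobenius_lift p \<phi> U \<Phi>" "P_horizontal p U \<Phi>" using g by (simp_all add: good_pair_def)
  show "\<exists>\<Psi>. G_frobenius_lift p \<phi> U \<Psi> \<and> at_x p U \<Psi> = twist_at_x p U \<Phi> \<alpha>" by (rule twist_exists[OF \<Phi> \<alpha>])
  fix \<Psi> assume \<Psi>: "G_frobenius_lift p \<phi> U \<Psi> \<and> at_x p U \<Psi> = twist_at_x p U \<Phi> \<alpha>"
  show P: "P_horizontal p U \<Psi>" using twist_P_horizontal[OF \<Phi> \<alpha>] \<Psi> by simp
  show "p_derivation (O_hat p U) p (\<Psi> (special_fibre p U)) (glob p U (P_fun i)) = \<zero>\<^bsub>O_hat p U\<^esub>"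
    if "i \<in> {1..CARD('n)}" for i by (rule p_derivation_P_fun[OF P that])
  show "G_same p U \<Psi>' \<Psi>" if "G_frobenius_lift p \<phi> U \<Psi>' \<and> at_x p U \<Psi>' = twist_at_x p U \<Phi> \<alpha>" for \<Psi>'
    by (rule G_same_if_at_x_eq) (use that \<Psi> in simp_all)
qed

end
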